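(* Let $d\ge 2$, $\alpha>0$, and let $\mathcal G:H^1(B_1)\to\mathbb R$ and $\mathcal F:H^1(\partial B_1)\to\mathbb R$ be functionals such that: (1) $\mathcal F$ is differentiable: there is $\nabla\mathcal F:H^2(\partial B_1)\to L^2(\partial B_1)$ with $\mathcal F(u+v)=\mathcal F(u)+v\cdot\nabla\mathcal F(u)+o(\|v\|_{H^1(\partial B_1)})$ for all $u\in H^2(\partial B_1)$, $v\in H^1(\partial B_1)$; (2) (slicing) there is $C_{SL}>0$ such that for every $u=u(r,\theta)\in H^1([0,1]\times\partial B_1)$, $$\mathcal G(r^\alpha u(r,\theta))\le\int_0^1\mathcal F(u(r,\cdot))\,r^{2\alpha+d-3}\,dr+C_{SL}\int_0^1\!\!\int_{\partial B_1}|\partial_ru|^2\,r^{2\alpha+d-1}\,d\mathcal H^{d-1}\,dr,$$ with equality if $u$ does not depend on $r$, in which case $\mathcal G(r^\alpha u(\theta))=\frac{1}{2\alpha+d-2}\mathcal F(u)$; (3) there is a compact set $\mathcal S\subset H^2(\partial B_1)$ with $\nabla\mathcal F(Q)=0$ for all $Q\in\mathcal S$ and $\mathcal F$ constant on $\mathcal S$, with value denoted $\mathcal F(\mathcal S)$. Let $T_{\max}>0$ and let $\psi:[0,T_{\max}]\to H^2(\partial B_1)$ belong either to $L^2([0,T_{\max}];H^2(\partial B_1))\cap H^1((0,T_{\max});L^2(\partial B_1))$ or to $L^2([0,T_{\max}];H^1(\partial B_1))\cap H^1((0,T_{\max});H^1(\partial B_1))$, such that $t\mapsto\mathcal F(\psi(t))$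 is weakly differentiable with $\frac{d}{dt}\mathcal F(\psi(t))=\psi'(t)\cdot\nabla\mathcal F(\psi(t))$ and $t\mapsto\psi'(t)\cdot\nabla\mathcal F(\psi(t))$ integrable on $(0,T_{\max})$ (here the dot is the $L^2(\partial B_1)$ scalar product or the $H^1$–dual pairing). Assume moreover: (ED) there are $C_{ED}>0$ and $p\ge2$ with $C_{ED}\min\{\|\psi'(t)\|^2_{L^2(\partial B_1)},\|\psi'(t)\|^p_{L^2(\partial B_1)}\}\le-\psi'(t)\cdot\nabla\mathcal F(\psi(t))$ for almost every $t$; (LS) there are $C_{LS}>0$ and $\beta\in[0,1)$ with $C_{LS}(\mathcal F(\psi(t))-\mathcal F(\mathcal S))^{1+\beta}\le-\psi'(t)\cdot\nabla\mathcal F(\psi(t))$ for almost every $t>0$; and $(1+\beta)(1-\tfrac1p)<1$. Then there are constants $\delta_0>0$, $E>0$, $\gamma\in[0,1)$ and $\varepsilon>0$, depending on $d,\alpha,p,\beta,T_{\max},C_{SL},C_{LS},C_{ED}$, such that: if $c\in H^1(\partial B_1)$ satisfies $c=\psi(0)$ and $\mathcal F(c)-\mathcal F(\mathcal S)\le E$, then there exists $h=h(r,\theta)\in H^1(B_1)$ with $h(1,\cdot)=c$ on $\partial B_1$ and $$\mathcal G(h)-\mathcal G(\mathcal S)\le\big(1-\varepsilon|\mathcal G(z)-\mathcal G(\mathcal S)|^\gamma\big)\big(\mathcal G(z)-\mathcal G(\mathcal S)\big),$$ where $\gamma=(1+\beta)(2-\tfrac2p)-1$, $z(r,\theta)=r^\alpha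 c(\theta)$ and $\mathcal G(\mathcal S)=\frac{1}{2\alpha+d-2}\mathcal F(\mathcal S)$.
   Context: $B_1\subset\mathbb R^d$ is the unit ball, functions on $B_1$ are written in polar coordinates $(r,\theta)\in(0,1]\times\partial B_1$. $\psi'$ denotes the time derivative of $\psi$. *)

theory Defs
  imports "HOL-Analysis.Analysis"
begin

text \<open>C^1 test functions with compact support in an open set U (for weak derivatives,
  C^1_c test functions are equivalent to C^infinity_c ones).\<close>
definition test_fun :: "'a::euclidean_space set \<Rightarrow> ('a \<Rightarrow> real) \<Rightarrow> bool" where
  "test_fun U \<phi> \<longleftrightarrow>
     (\<forall>x. \<phi> differentiable (at x)) \<and>
     (\<forall>b\<in>Basis. continuous_on UNIV (\<lambda>x. frechet_derivative \<phi> (at x) b)) \<and>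
     (\<exists>K. compact K \<and> K \<subseteq> U \<and> (\<forall>x. x \<notin> K \<longrightarrow> \<phi> x = 0))"

definition L2_on :: "'a::euclidean_space set \<Rightarrow> ('a \<Rightarrow> real) \<Rightarrow> bool" where
  "L2_on U u \<longleftrightarrow> set_borel_measurable lborel U u \<and> set_integrable lborel U (\<lambda>x. (u x)\<^sup>2)"

definition has_weak_deriv :: "'a::euclidean_space set \<Rightarrow> ('a \<Rightarrow> real) \<Rightarrow> 'a \<Rightarrow> ('a \<Rightarrow> real) \<Rightarrow> bool" where
  "has_weak_deriv U u b g \<longleftrightarrow> L2_on U g \<and>
     (\<forall>\<phi>. test_fun U \<phi> \<longrightarrow>
        set_lebesgue_integral lborel U (\<lambda>x. u x * frechet_derivative \<phi> (at x) b)
        = - set_lebesgue_integral lborel U (\<lambda>x. g x * \<phi> x))"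

definition wderiv :: "'a::euclidean_space set \<Rightarrow> ('a \<Rightarrow> real) \<Rightarrow> 'a \<Rightarrow> ('a \<Rightarrow> real)" where
  "wderiv U u b = (SOME g. has_weak_deriv U u b g)"

definition H1_on :: "'a::euclidean_space set \<Rightarrow> ('a \<Rightarrow> real) \<Rightarrow> bool" where
  "H1_on U u \<longleftrightarrow> L2_on U u \<and> (\<forall>b\<in>Basis. \<exists>g. has_weak_deriv U u b g)"

definition H1_norm :: "'a::euclidean_space set \<Rightarrow> ('a \<Rightarrow> real) \<Rightarrow> real" where
  "H1_norm U u = sqrt (set_lebesgue_integral lborel U (\<lambda>x. (u x)\<^sup>2)
      + (\<Sum>b\<in>Basis. set_lebesgue_integral lborel U (\<lambda>x. (wderiv U u b x)\<^sup>2)))"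

definition H2_on :: "'a::euclidean_space set \<Rightarrow> ('a \<Rightarrow> real) \<Rightarrow> bool" where
  "H2_on U u \<longleftrightarrow> H1_on U u \<and> (\<forall>b\<in>Basis. H1_on U (wderiv U u b))"

definition H2_norm :: "'a::euclidean_space set \<Rightarrow> ('a \<Rightarrow> real) \<Rightarrow> real" where
  "H2_norm U u = sqrt ((H1_norm U u)\<^sup>2 + (\<Sum>b\<in>Basis. (H1_norm U (wderiv U u b))\<^sup>2))"

text \<open>A function on the sphere is represented by a function vanishing off the sphere.\<close>
definition sfun :: "('a::euclidean_space \<Rightarrow> real) \<Rightarrow> bool" where
  "sfun u \<longleftrightarrow> (\<forall>x. x \<notin> sphere 0 1 \<longrightarrow> u x = 0)"

text \<open>Surface integral over the unit sphere (H^{d-1} measure), via the polar-coordinate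
  identity  int_{B_1} f(x/|x|) dx = (1/d) int_{dB_1} f dH^{d-1}.\<close>
definition sph_int :: "('a::euclidean_space \<Rightarrow> real) \<Rightarrow> real" where
  "sph_int f = real DIM('a) * set_lebesgue_integral lborel (ball 0 1) (\<lambda>x. f (x /\<^sub>R norm x))"

definition L2S :: "('a::euclidean_space \<Rightarrow> real) \<Rightarrow> bool" where
  "L2S u \<longleftrightarrow> sfun u \<and> L2_on (ball 0 1) (\<lambda>x. u (x /\<^sub>R norm x))"

definition sph_inner :: "('a::euclidean_space \<Rightarrow> real) \<Rightarrow> ('a \<Rightarrow> real) \<Rightarrow> real" where
  "sph_inner u v = sph_int (\<lambda>x. u x * v x)"

definition L2S_norm :: "('a::euclidean_space \<Rightarrow> real) \<Rightarrow> real" where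
  "L2S_norm u = sqrt (sph_int (\<lambda>x. (u x)\<^sup>2))"

text \<open>Sobolev spaces on the sphere via the 0-homogeneous extension to an annulus
  (gives the standard spaces with an equivalent norm).\<close>
definition annulus :: "'a::euclidean_space set" where
  "annulus = {x. 1/2 < norm x \<and> norm x < 2}"

definition hom_ext :: "('a::euclidean_space \<Rightarrow> real) \<Rightarrow> 'a \<Rightarrow> real" where
  "hom_ext u x = u (x /\<^sub>R norm x)"

definition H1S :: "('a::euclidean_space \<Rightarrow> real) \<Rightarrow> bool" where
  "H1S u \<longleftrightarrow> sfun u \<and> H1_on annulus (hom_ext u)"

definition H1S_norm :: "('a::euclidean_space \<Rightarrow> real) \<Rightarrow> real" where
  "H1S_norm u = H1_norm annulus (hom_ext u)"

definition H2S :: "('a::euclidean_space \<Rightarrow> real) \<Rightarrow> bool" where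
  "H2S u \<longleftrightarrow> sfun u \<and> H2_on annulus (hom_ext u)"

definition H2S_norm :: "('a::euclidean_space \<Rightarrow> real) \<Rightarrow> real" where
  "H2S_norm u = H2_norm annulus (hom_ext u)"

definition H2S_compact :: "('a::euclidean_space \<Rightarrow> real) set \<Rightarrow> bool" where
  "H2S_compact S \<longleftrightarrow> S \<subseteq> {u. H2S u} \<and>
     (\<forall>q::nat \<Rightarrow> 'a \<Rightarrow> real. (\<forall>n. q n \<in> S) \<longrightarrow> (\<exists>Q\<in>S. \<exists>f. strict_mono f \<and>
        (\<lambda>n. H2S_norm (\<lambda>x. q (f n) x - Q x)) \<longlonglongrightarrow> 0))"

text \<open>H^1(B_1); functions on B_1 are represented by functions vanishing off B_1.\<close>
definition H1B :: "('a::euclidean_space \<Rightarrow> real) \<Rightarrow> bool" where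
  "H1B h \<longleftrightarrow> (\<forall>x. x \<notin> ball 0 1 \<longrightarrow> h x = 0) \<and> H1_on (ball 0 1) h"

text \<open>Trace condition h(1,.) = c: the spherical slices converge in L^2(dB_1) to c as r -> 1
  (along all radii outside a null set; pointwise values of a representative on single
  spheres are only meaningful for a.e. r).\<close>
definition trace_eq :: "('a::euclidean_space \<Rightarrow> real) \<Rightarrow> ('a \<Rightarrow> real) \<Rightarrow> bool" where
  "trace_eq h c \<longleftrightarrow> (\<exists>N. N \<in> null_sets lborel \<and>
     ((\<lambda>r. L2S_norm (\<lambda>\<theta>. h (r *\<^sub>R \<theta>) - c \<theta>)) \<longlongrightarrow> 0) (at 1 within ({0<..<1} - N)))"

definition polar_fun :: "real \<Rightarrow> (real \<Rightarrow> 'a::euclidean_space \<Rightarrow> real) \<Rightarrow> 'a \<Rightarrow> real" where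
  "polar_fun \<alpha> u x = (if norm x < 1 then norm x powr \<alpha> * u (norm x) (x /\<^sub>R norm x) else 0)"

text \<open>H^1([0,1] x dB_1): transported to the shell 1<|x|<2 via x |-> (|x|-1, x/|x|).\<close>
definition shell :: "'a::euclidean_space set" where
  "shell = {x. 1 < norm x \<and> norm x < 2}"

definition shell_lift :: "(real \<Rightarrow> 'a::euclidean_space \<Rightarrow> real) \<Rightarrow> 'a \<Rightarrow> real" where
  "shell_lift u x = u (norm x - 1) (x /\<^sub>R norm x)"

definition H1_prod :: "(real \<Rightarrow> 'a::euclidean_space \<Rightarrow> real) \<Rightarrow> bool" where
  "H1_prod u \<longleftrightarrow> (\<forall>r. sfun (u r)) \<and> H1_on shell (shell_lift u)"

definition rad_deriv :: "(real \<Rightarrow> 'a::euclidean_space \<Rightarrow> real) \<Rightarrow> real \<Rightarrow> 'a \<Rightarrow> real" where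
  "rad_deriv u r \<theta> = (\<Sum>b\<in>Basis. (\<theta> \<bullet> b) * wderiv shell (shell_lift u) b ((1 + r) *\<^sub>R \<theta>))"

text \<open>Membership in L^2(0,T;X), X one of L^2, H^1, H^2 of the sphere, given by its norm nX.
  (Strong measurability: joint measurability in (t,theta).)\<close>
definition L2T :: "real \<Rightarrow> (('a::euclidean_space \<Rightarrow> real) \<Rightarrow> real) \<Rightarrow> (real \<Rightarrow> 'a \<Rightarrow> real) \<Rightarrow> bool" where
  "L2T T nX \<psi> \<longleftrightarrow>
     (\<lambda>(t,x). indicator {0..T} t * \<psi> t (x /\<^sub>R norm x)) \<in> borel_measurable (lborel \<Otimes>\<^sub>M lborel) \<and>
     set_integrable lborel {0..T} (\<lambda>t. (nX (\<psi> t))\<^sup>2)"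

definition time_deriv :: "real \<Rightarrow> (real \<Rightarrow> 'a::euclidean_space \<Rightarrow> real) \<Rightarrow> (real \<Rightarrow> 'a \<Rightarrow> real) \<Rightarrow> bool" where
  "time_deriv T \<psi> d\<psi> \<longleftrightarrow> (\<forall>\<eta> \<phi>. L2S \<eta> \<longrightarrow> test_fun {0<..<T} \<phi> \<longrightarrow>
     set_lebesgue_integral lborel {0<..<T} (\<lambda>t. sph_inner (\<psi> t) \<eta> * frechet_derivative \<phi> (at t) 1)
     = - set_lebesgue_integral lborel {0<..<T} (\<lambda>t. sph_inner (d\<psi> t) \<eta> * \<phi> t))"

definition scalar_weak_deriv :: "real \<Rightarrow> (real \<Rightarrow> real) \<Rightarrow> (real \<Rightarrow> real) \<Rightarrow> bool" where
  "scalar_weak_deriv T f g \<longleftrightarrow>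
     (\<forall>a b. 0 < a \<longrightarrow> b < T \<longrightarrow> set_integrable lborel {a..b} f) \<and>
     (\<forall>a b. 0 < a \<longrightarrow> b < T \<longrightarrow> set_integrable lborel {a..b} g) \<and>
     (\<forall>\<phi>. test_fun {0<..<T} \<phi> \<longrightarrow>
        set_lebesgue_integral lborel {0<..<T} (\<lambda>t. f t * frechet_derivative \<phi> (at t) 1)
        = - set_lebesgue_integral lborel {0<..<T} (\<lambda>t. g t * \<phi> t))"

end

theory Submission
  imports Defs "HOL-Analysis.Analysis"
begin

text \<open>
  Put \<open>f t = F (\<psi> t) - FS\<close> and \<open>K = 2\<alpha> + d - 2\<close>. The competitor slides along the curve: its slices run through
  \<open>\<psi>\<close> from \<open>\<psi> 0 = c\<close> to \<open>\<psi> \<tau>\<close> while \<open>r\<close> decreases from 1 to 1/2, and stay at \<open>\<psi> \<tau>\<close> for \<open>r \<le> 1/2\<close>. By slicing,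
  compared with the homogeneous extension of \<open>c\<close> it gains \<open>(1/2)\<^sup>K/K \<cdot> (f 0 - f \<tau>)\<close> and costs a multiple of
  \<open>\<tau> \<integral>\<^sub>0\<^sup>\<tau> \<parallel>\<psi>'\<parallel>\<^sup>2\<close>. Stop at the time \<open>\<tau>\<close> at which the energy \<open>f\<close> is halved, but not later than at a small multiple
  of \<open>f(0)\<close> to the power \<open>(1 + \<beta>)(1 - 2/p)\<close>. Up to then (LS) bounds the dissipation from below, so (ED) bounds
  \<open>\<parallel>\<psi>'\<parallel>\<^sup>2\<close> by a multiple of the dissipation, the cost is at most half of the gain, and the gain is at least of
  order \<open>f(0)\<close> to the power \<open>1 + \<gamma>\<close>.

  The curve is only Sobolev in time, so the competitor follows it along a fine chain of points
  \<open>\<psi> (t\<^sub>i)\<close> joined by smooth steps; it is then a finite sum of \<open>C\<^sup>1\<close> functions of \<open>r\<close> times fixed functions on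
  the sphere. For the mesh to control \<open>F\<close> between the points, \<open>\<psi>\<close> must be continuous into \<open>H\<^sup>1\<close>. In the
  parabolic case this follows from \<open>|B(\<psi> t, \<psi> t) - B(\<psi> s, \<psi> s)| \<le> C \<parallel>\<psi> t - \<psi> s\<parallel>\<^bsub>L\<^sup>2\<^esub> (\<parallel>\<psi> t\<parallel>\<^bsub>H\<^sup>2\<^esub> + \<parallel>\<psi> s\<parallel>\<^bsub>H\<^sup>2\<^esub>)\<close> for the
  Dirichlet form \<open>B\<close>.
\<close>

subsection \<open>Square integrable functions\<close>

text \<open>Why the stopping rule has this exponent: while f \<ge> f(0)/2, (LS) keeps the
  dissipation D above a multiple of f(0)^(1+\<beta>). Where the p-th power is the smaller term in
  (ED), the squared speed is only bounded by D^(2/p); the lower bound on D turns this into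
  f(0)^(-\<sigma>) D with \<sigma> = (1+\<beta>)(1-2/p). The cost carries an extra factor \<tau>,
  and \<tau> of order f(0)^\<sigma> cancels exactly this loss, while running for that long
  dissipates f(0)^(\<sigma>+1+\<beta>) = f(0)^(1+\<gamma>). Function spaces on the sphere are
  encoded by 0-homogeneous extensions and integrals over the ball, so tangential calculus is done
  without charts, by homogeneity in the ambient space, polar coordinates and difference quotients.
  Weak derivatives are arbitrary representatives: a gradient has to be made exactly homogeneous
  before it can be continued to the origin. F is continuous only at individual points of H^2, with a
  modulus depending on the point, so the mesh of the chain comes from a compactness
  argument.\<close>

definition sq_int :: "'a measure \<Rightarrow> ('a \<Rightarrow> real) \<Rightarrow> bool" where
  "sq_int M f \<longleftrightarrow> f \<in> borel_measurable M \<and> integrable M (\<lambda>x. (f x)\<^sup>2)"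

definition l2 :: "'a measure \<Rightarrow> ('a \<Rightarrow> real) \<Rightarrow> real" where
  "l2 M f = sqrt (\<integral>x. (f x)\<^sup>2 \<partial>M)"

lemma sq_int_measurable: "sq_int M f \<Longrightarrow> f \<in> borel_measurable M"
  and sq_int_integrable: "sq_int M f \<Longrightarrow> integrable M (\<lambda>x. (f x)\<^sup>2)"
  by (auto simp: sq_int_def)

lemma abs_mult_le_squares: "\<bar>a * b\<bar> \<le> a\<^sup>2 + (b::real)\<^sup>2"
proof -
  have "0 \<le> (\<bar>a\<bar> - \<bar>b\<bar>)\<^sup>2" by simp
  then have "2 * \<bar>a * b\<bar> \<le> a\<^sup>2 + b\<^sup>2" by (simp add: power2_diff abs_mult)
  then show ?thesis using zero_le_power2[of a] zero_le_power2[of b] by linarith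
qed

lemma sq_int_mult:
  assumes "sq_int M f" "sq_int M g"
  shows "integrable M (\<lambda>x. f x * g x)"
proof (rule Bochner_Integration.integrable_bound)
  show "integrable M (\<lambda>x. (f x)\<^sup>2 + (g x)\<^sup>2)" using assms by (auto simp: sq_int_def)
  show "(\<lambda>x. f x * g x) \<in> borel_measurable M"
    using assms by (auto simp: sq_int_def)
  show "AE x in M. norm (f x * g x) \<le> norm ((f x)\<^sup>2 + (g x)\<^sup>2)"
    using abs_mult_le_squares by (auto intro!: AE_I2)
qed

lemma sq_int_cmult: "sq_int M f \<Longrightarrow> sq_int M (\<lambda>x. c * f x)"
  by (auto simp: sq_int_def power_mult_distrib)

lemma sq_int_minus: "sq_int M f \<Longrightarrow> sq_int M (\<lambda>x. - f x)"
  by (auto simp: sq_int_def)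

lemma sq_int_add:
  assumes "sq_int M f" "sq_int M g"
  shows "sq_int M (\<lambda>x. f x + g x)"
  using assms sq_int_mult[OF assms] unfolding sq_int_def power2_sum
  by (auto simp: mult.assoc)

lemma sq_int_diff:
  assumes "sq_int M f" "sq_int M g"
  shows "sq_int M (\<lambda>x. f x - g x)"
  using sq_int_add[OF assms(1) sq_int_minus[OF assms(2)]] by simp

lemma sq_int_zero [simp]: "sq_int M (\<lambda>x. 0)"
  by (auto simp: sq_int_def)

lemma sq_int_sum: "(\<And>i. i \<in> I \<Longrightarrow> sq_int M (f i)) \<Longrightarrow> sq_int M (\<lambda>x. \<Sum>i\<in>I. f i x)"
  by (induction I rule: infinite_finite_induct) (auto intro: sq_int_add)

lemma sq_int_bound:
  assumes "sq_int M f" "g \<in> borel_measurable M" "AE x in M. \<bar>g x\<bar> \<le> C * \<bar>f x\<bar>"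
  shows "sq_int M g"
proof -
  have "integrable M (\<lambda>x. (g x)\<^sup>2)"
  proof (rule Bochner_Integration.integrable_bound)
  show "integrable M (\<lambda>x. C\<^sup>2 * (f x)\<^sup>2)" using assms by (auto simp: sq_int_def)
  show "(\<lambda>x. (g x)\<^sup>2) \<in> borel_measurable M" using assms by auto
  show "AE x in M. norm ((g x)\<^sup>2) \<le> norm (C\<^sup>2 * (f x)\<^sup>2)"
    using assms(3)
  proof eventually_elim
    case (elim x)
    then have "(\<bar>g x\<bar>)\<^sup>2 \<le> (C * \<bar>f x\<bar>)\<^sup>2" by (intro power_mono) auto
    then show ?case by (simp add: power_mult_distrib)
  qed
  qed
  then show ?thesis using assms(2) by (simp add: sq_int_def)
qed

lemma sq_int_bounded_mult:
  assumes "sq_int M f" "m \<in> borel_measurable M" "\<And>x. \<bar>m x\<bar> \<le> C"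
  shows "sq_int M (\<lambda>x. m x * f x)"
  by (rule sq_int_bound[OF assms(1), where C=C])
     (use assms in \<open>auto simp: sq_int_def abs_mult intro!: AE_I2 mult_right_mono\<close>)

lemma l2_nonneg [simp]: "0 \<le> l2 M f" by (simp add: l2_def)
lemma l2_power2: "(l2 M f)\<^sup>2 = (\<integral>x. (f x)\<^sup>2 \<partial>M)" by (simp add: l2_def)

text \<open>The polynomial A s^2 + 2 I s + B is the integral of (s f + g)^2 and hence nonnegative;
  its minimiser s = -I/A gives the inequality. If A = 0 it is affine, and a nonzero slope would make
  it negative somewhere.\<close>

lemma Cauchy_Schwarz_l2:
  assumes f: "sq_int M f" and g: "sq_int M g"
  shows "\<bar>\<integral>x. f x * g x \<partial>M\<bar> \<le> l2 M f * l2 M g"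
proof -
  let ?I = "\<integral>x. f x * g x \<partial>M" and ?A = "\<integral>x. (f x)\<^sup>2 \<partial>M" and ?B = "\<integral>x. (g x)\<^sup>2 \<partial>M"
  note i = sq_int_mult[OF f g] sq_int_integrable[OF f] sq_int_integrable[OF g]
  have quad: "0 \<le> ?A * s\<^sup>2 + 2 * s * ?I + ?B" for s
  proof -
    have "0 \<le> (\<integral>x. (s * f x + g x)\<^sup>2 \<partial>M)" by simp
    also have "(\<lambda>x. (s * f x + g x)\<^sup>2) = (\<lambda>x. s\<^sup>2 * (f x)\<^sup>2 + 2 * s * (f x * g x) + (g x)\<^sup>2)"
      by (auto simp: power2_eq_square algebra_simps)
    also have "(\<integral>x. s\<^sup>2 * (f x)\<^sup>2 + 2 * s * (f x * g x) + (g x)\<^sup>2 \<partial>M) = s\<^sup>2 * ?A + 2 * s * ?I + ?B"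
      using i by (simp add: Bochner_Integration.integral_add)
    finally show ?thesis by (simp add: mult.commute)
  qed
  have "?I\<^sup>2 \<le> ?A * ?B"
  proof (cases "?A = 0")
    case True
    have "?I = 0"
    proof (rule ccontr)
      assume "?I \<noteq> 0"
      \<comment> \<open>At this point the affine polynomial takes the value -1.\<close>
      with quad[of "- (?B + 1) / (2 * ?I)"] True show False by (simp add: field_simps)
    qed
    then show ?thesis by simp
  next
    case False
    then have A: "?A > 0" using integral_nonneg_AE[of "\<lambda>x. (f x)\<^sup>2" M] by (simp add: order_less_le)
    with quad[of "- ?I / ?A"] have "?I\<^sup>2 / ?A \<le> ?B"
      by (simp add: power2_eq_square field_simps)
    with A show ?thesis by (simp add: field_simps)
  qed
  then have "sqrt (?I\<^sup>2) \<le> sqrt (?A * ?B)" by (rule real_sqrt_le_mono)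
  then show ?thesis by (simp add: l2_def real_sqrt_mult)
qed

lemma l2_add_sq:
  assumes "sq_int M f" "sq_int M g"
  shows "(l2 M (\<lambda>x. f x + g x))\<^sup>2 \<le> 2 * (l2 M f)\<^sup>2 + 2 * (l2 M g)\<^sup>2"
proof -
  have "(\<integral>x. (f x + g x)\<^sup>2 \<partial>M) \<le> (\<integral>x. 2 * (f x)\<^sup>2 + 2 * (g x)\<^sup>2 \<partial>M)"
  proof (rule integral_mono)
    show "integrable M (\<lambda>x. (f x + g x)\<^sup>2)" using sq_int_add[OF assms] by (simp add: sq_int_def)
    show "integrable M (\<lambda>x. 2 * (f x)\<^sup>2 + 2 * (g x)\<^sup>2)" using assms by (simp add: sq_int_def)
    show "(f x + g x)\<^sup>2 \<le> 2 * (f x)\<^sup>2 + 2 * (g x)\<^sup>2" for x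
      using sum_squares_bound[of "f x" "g x"] by (simp add: power2_sum)
  qed
  also have "\<dots> = 2 * (\<integral>x. (f x)\<^sup>2 \<partial>M) + 2 * (\<integral>x. (g x)\<^sup>2 \<partial>M)"
    using assms by (simp add: sq_int_def)
  finally show ?thesis by (simp add: l2_power2)
qed

lemma l2_cmult: "l2 M (\<lambda>x. c * f x) = \<bar>c\<bar> * l2 M f"
  by (simp add: l2_def power_mult_distrib real_sqrt_mult)

lemma l2_triangle:
  assumes f: "sq_int M f" and g: "sq_int M g"
  shows "l2 M (\<lambda>x. f x + g x) \<le> l2 M f + l2 M g"
proof (rule power2_le_imp_le)
  have "(l2 M (\<lambda>x. f x + g x))\<^sup>2 = (\<integral>x. (f x)\<^sup>2 + 2 * (f x * g x) + (g x)\<^sup>2 \<partial>M)"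
    unfolding l2_power2 by (simp add: power2_sum mult.assoc algebra_simps)
  also have "\<dots> = (l2 M f)\<^sup>2 + 2 * (\<integral>x. f x * g x \<partial>M) + (l2 M g)\<^sup>2"
    using f g sq_int_mult[OF f g] by (simp add: l2_power2 sq_int_def)
  also have "\<dots> \<le> (l2 M f + l2 M g)\<^sup>2"
    using Cauchy_Schwarz_l2[OF f g] by (simp add: power2_sum)
  finally show "(l2 M (\<lambda>x. f x + g x))\<^sup>2 \<le> (l2 M f + l2 M g)\<^sup>2" .
qed simp

lemma l2_mono:
  assumes "sq_int M g" "f \<in> borel_measurable M" "AE x in M. \<bar>f x\<bar> \<le> C * \<bar>g x\<bar>" "0 \<le> C"
  shows "l2 M f \<le> C * l2 M g"
proof -
  have f: "sq_int M f" using sq_int_bound assms by blast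
  have "(\<integral>x. (f x)\<^sup>2 \<partial>M) \<le> (\<integral>x. C\<^sup>2 * (g x)\<^sup>2 \<partial>M)"
  proof (rule integral_mono_AE)
    show "integrable M (\<lambda>x. (f x)\<^sup>2)" "integrable M (\<lambda>x. C\<^sup>2 * (g x)\<^sup>2)"
      using f assms(1) by (auto simp: sq_int_def)
    show "AE x in M. (f x)\<^sup>2 \<le> C\<^sup>2 * (g x)\<^sup>2"
      using assms(3)
    proof eventually_elim
      case (elim x)
      then have "(\<bar>f x\<bar>)\<^sup>2 \<le> (C * \<bar>g x\<bar>)\<^sup>2" by (intro power_mono) auto
      then show ?case by (simp add: power_mult_distrib)
    qed
  qed
  also have "\<dots> = (C * l2 M g)\<^sup>2" by (simp add: power_mult_distrib l2_power2)
  finally have "(l2 M f)\<^sup>2 \<le> (C * l2 M g)\<^sup>2" by (simp add: l2_power2)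
  then show ?thesis by (rule power2_le_imp_le) (use assms(4) in simp)
qed

lemma indicator_power2_mult: "indicator U x * (r::real)\<^sup>2 = (indicator U x * r)\<^sup>2"
  by (simp add: indicator_def)

text \<open>Turns integrability over \<open>U\<close> into integrability of the extension by zero,
  so that all estimates can be carried out on the whole space.\<close>

lemma L2_on_iff: "L2_on U u \<longleftrightarrow> sq_int lborel (\<lambda>x. indicator U x * u x)"
  by (simp add: L2_on_def sq_int_def set_borel_measurable_def set_integrable_def indicator_power2_mult)

lemma set_integral_square: "set_lebesgue_integral lborel U (\<lambda>x. (u x)\<^sup>2) = (l2 lborel (\<lambda>x. indicator U x * u x))\<^sup>2"
  by (simp add: set_lebesgue_integral_def l2_power2 indicator_power2_mult)

subsection \<open>Test functions\<close>

lemma test_funI: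
  assumes D: "\<And>x. (\<phi> has_derivative D x) (at x)"
    and "\<And>b. b \<in> Basis \<Longrightarrow> continuous_on UNIV (\<lambda>x. D x b)"
    and "compact K" "K \<subseteq> U" "\<And>x. x \<notin> K \<Longrightarrow> \<phi> x = 0"
  shows "test_fun U \<phi>"
proof -
  have "frechet_derivative \<phi> (at x) = D x" for x
    using frechet_derivative_at[OF D[of x]] by simp
  then show ?thesis
    unfolding test_fun_def using assms by (auto simp: differentiable_def)
qed

lemma frechet_derivative_eqI: "(\<phi> has_derivative D) (at x) \<Longrightarrow> frechet_derivative \<phi> (at x) = D"
  using frechet_derivative_at by metis

lemma test_fun_has_derivative:
  "test_fun U \<phi> \<Longrightarrow> (\<phi> has_derivative frechet_derivative \<phi> (at x)) (at x)"
  unfolding test_fun_def using frechet_derivative_works by blast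

lemma test_fun_continuous: "test_fun U \<phi> \<Longrightarrow> continuous_on UNIV \<phi>"
  by (auto simp: continuous_on_eq_continuous_at intro!: has_derivative_continuous test_fun_has_derivative)

lemma continuous_compact_support_bounded:
  fixes f :: "'a::euclidean_space \<Rightarrow> real"
  assumes "continuous_on UNIV f" "compact K" "\<And>x. x \<notin> K \<Longrightarrow> f x = 0"
  obtains C where "C > 0" "\<And>x. \<bar>f x\<bar> \<le> C"
proof -
  have "compact (f ` K)" using assms by (intro compact_continuous_image) (auto intro: continuous_on_subset)
  then have "bounded (f ` K)" by (rule compact_imp_bounded)
  then obtain B where B: "\<And>x. x \<in> K \<Longrightarrow> \<bar>f x\<bar> \<le> B" unfolding bounded_iff by auto
  have "\<bar>f x\<bar> \<le> max B 1" for x using B[of x] assms(3)[of x] by (cases "x \<in> K") auto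
  then show ?thesis by (intro that[of "max B 1"]) auto
qed

text \<open>The complement of the compact support is open and the function vanishes on it, so the
  derivative vanishes there too.\<close>

lemma test_fun_support:
  assumes "test_fun U \<phi>"
  obtains K where "compact K" "K \<subseteq> U" "\<And>x. x \<notin> K \<Longrightarrow> \<phi> x = 0"
    "\<And>x v. x \<notin> K \<Longrightarrow> frechet_derivative \<phi> (at x) v = 0"
proof -
  from assms obtain K where K: "compact K" "K \<subseteq> U" "\<And>x. x \<notin> K \<Longrightarrow> \<phi> x = 0"
    unfolding test_fun_def by blast
  have "frechet_derivative \<phi> (at x) v = 0" if "x \<notin> K" for x v
  proof -
    have "open (- K)" using K(1) by (simp add: compact_imp_closed open_Compl)
    have "((\<lambda>_. 0) has_derivative (\<lambda>v. 0)) (at x)" by simp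
    then have "(\<phi> has_derivative (\<lambda>v. 0)) (at x)"
      by (rule has_derivative_transform_within_open[where s="-K"]) (use \<open>open (-K)\<close> that K(3) in auto)
    then show ?thesis by (simp add: frechet_derivative_eqI)
  qed
  with K show ?thesis using that by blast
qed

lemma test_fun_deriv_continuous:
  "test_fun U \<phi> \<Longrightarrow> b \<in> Basis \<Longrightarrow> continuous_on UNIV (\<lambda>x. frechet_derivative \<phi> (at x) b)"
  by (auto simp: test_fun_def)

lemma test_fun_bounded:
  assumes "test_fun U \<phi>"
  obtains C where "C > 0" "\<And>x. \<bar>\<phi> x\<bar> \<le> C"
  using test_fun_support[OF assms] continuous_compact_support_bounded[OF test_fun_continuous[OF assms]]
  by metis

lemma test_fun_deriv_bounded:
  assumes "test_fun U \<phi>" "b \<in> Basis"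
  obtains C where "C > 0" "\<And>x. \<bar>frechet_derivative \<phi> (at x) b\<bar> \<le> C"
proof -
  obtain K where "compact K" "\<And>x v. x \<notin> K \<Longrightarrow> frechet_derivative \<phi> (at x) v = 0"
    using test_fun_support[OF assms(1)] by metis
  then show ?thesis
    using continuous_compact_support_bounded[OF test_fun_deriv_continuous[OF assms]] that by metis
qed

lemma sq_int_continuous_compact_support:
  fixes f :: "'a::euclidean_space \<Rightarrow> real"
  assumes "continuous_on UNIV f" "compact K" "\<And>x. x \<notin> K \<Longrightarrow> f x = 0"
  shows "sq_int lborel f"
  unfolding sq_int_def
proof
  show m: "f \<in> borel_measurable lborel" using assms borel_measurable_continuous_onI by auto
  obtain C where C: "\<And>x. \<bar>f x\<bar> \<le> C" using continuous_compact_support_bounded[OF assms] by metis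
  show "integrable lborel (\<lambda>x. (f x)\<^sup>2)"
  proof (rule Bochner_Integration.integrable_bound)
    show "integrable lborel (\<lambda>x. C\<^sup>2 * indicator K x)"
      using emeasure_compact_finite[OF assms(2)] assms(2) by (auto intro!: integrable_real_indicator borel_compact)
    show "AE x in lborel. norm ((f x)\<^sup>2) \<le> norm (C\<^sup>2 * indicator K x)"
    proof (intro AE_I2)
      fix x
      have "(\<bar>f x\<bar>)\<^sup>2 \<le> C\<^sup>2" using C[of x] by (intro power_mono) auto
      then show "norm ((f x)\<^sup>2) \<le> norm (C\<^sup>2 * indicator K x)"
        using assms(3)[of x] by (cases "x \<in> K") auto
    qed
  qed (use m in auto)
qed

lemma test_fun_sq_int: "test_fun U \<phi> \<Longrightarrow> sq_int lborel \<phi>"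
  by (metis sq_int_continuous_compact_support test_fun_continuous test_fun_support)

lemma test_fun_deriv_sq_int:
  assumes "test_fun U \<phi>" "b \<in> Basis"
  shows "sq_int lborel (\<lambda>x. frechet_derivative \<phi> (at x) b)"
proof -
  obtain K where "compact K" "\<And>x v. x \<notin> K \<Longrightarrow> frechet_derivative \<phi> (at x) v = 0"
    using test_fun_support[OF assms(1)] by metis
  then show ?thesis
    using sq_int_continuous_compact_support[OF test_fun_deriv_continuous[OF assms]] by simp
qed

lemma test_fun_zero [simp]: "test_fun U \<phi> \<Longrightarrow> x \<notin> U \<Longrightarrow> \<phi> x = 0"
  by (metis subsetD test_fun_support)

lemma test_fun_deriv_zero [simp]: "test_fun U \<phi> \<Longrightarrow> x \<notin> U \<Longrightarrow> frechet_derivative \<phi> (at x) v = 0"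
  by (metis subsetD test_fun_support)

lemma test_fun_subset: "test_fun U \<phi> \<Longrightarrow> U \<subseteq> V \<Longrightarrow> test_fun V \<phi>"
  unfolding test_fun_def by (meson order_trans)

text \<open>The support of \<open>\<phi>\<close> is compact in \<open>U\<close>, so the multiplier
  only has to be C^1 on a neighbourhood \<open>V\<close> of \<open>U\<close>; this admits functions
  of the norm away from the origin. The closed set \<open>C\<close> outside which \<open>m\<close>
  vanishes on \<open>U\<close> lets the product become a test function on another set
  \<open>U'\<close>.\<close>

lemma test_fun_mult:
  assumes \<phi>: "test_fun U \<phi>" and V: "open V" "U \<subseteq> V"
    and m: "\<And>x. x \<in> V \<Longrightarrow> (m has_derivative Dm x) (at x)"
    and mc: "\<And>b. b \<in> Basis \<Longrightarrow> continuous_on V (\<lambda>x. Dm x b)"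
    and C: "closed C" "\<And>x. x \<in> U \<Longrightarrow> x \<notin> C \<Longrightarrow> m x = 0" "U \<inter> C \<subseteq> U'"
  shows "test_fun U' (\<lambda>x. m x * \<phi> x)"
    and "x \<in> V \<Longrightarrow> frechet_derivative (\<lambda>x. m x * \<phi> x) (at x) v =
           m x * frechet_derivative \<phi> (at x) v + Dm x v * \<phi> x"
proof -
  obtain K where K: "compact K" "K \<subseteq> U" "\<And>x. x \<notin> K \<Longrightarrow> \<phi> x = 0"
    "\<And>x v. x \<notin> K \<Longrightarrow> frechet_derivative \<phi> (at x) v = 0" using test_fun_support[OF \<phi>] by blast
  have oK: "open (- K)" using K(1) by (simp add: compact_imp_closed open_Compl)
  define D where "D = (\<lambda>x v. if x \<in> K then m x * frechet_derivative \<phi> (at x) v + Dm x v * \<phi> x else 0)"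
  have on_V: "D x v = m x * frechet_derivative \<phi> (at x) v + Dm x v * \<phi> x" for x v
    using K by (auto simp: D_def)
  have der: "((\<lambda>x. m x * \<phi> x) has_derivative D x) (at x)" for x
  proof (cases "x \<in> V")
    case True
    have "((\<lambda>x. m x * \<phi> x) has_derivative (\<lambda>v. m x * frechet_derivative \<phi> (at x) v + Dm x v * \<phi> x)) (at x)"
      using has_derivative_mult[OF m[OF True] test_fun_has_derivative[OF \<phi>]] .
    then show ?thesis by (simp add: on_V[abs_def])
  next
    case False
    then have x: "x \<in> - K" using K(2) V by auto
    then have D0: "D x = (\<lambda>v. 0)" by (auto simp: D_def)
    have "((\<lambda>_. 0) has_derivative (\<lambda>v. 0)) (at x)" by simp
    then show ?thesis unfolding D0
      by (rule has_derivative_transform_within_open[where s="-K"]) (use oK x K(3) in auto)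
  qed
  have cont: "continuous_on UNIV (\<lambda>x. D x b)" if b: "b \<in> Basis" for b
  proof -
    have 1: "continuous_on V (\<lambda>x. D x b)"
    proof -
      have "continuous_on V m" using m V(1)
        by (auto simp: continuous_on_eq_continuous_at intro!: has_derivative_continuous)
      then show ?thesis unfolding on_V
        using mc[OF b] test_fun_continuous[OF \<phi>] test_fun_deriv_continuous[OF \<phi> b]
        by (intro continuous_intros) (auto intro: continuous_on_subset)
    qed
    have 2: "continuous_on (- K) (\<lambda>x. D x b)"
      by (rule continuous_on_eq[OF continuous_on_const[of "-K" 0]]) (auto simp: D_def)
    have "UNIV = V \<union> - K" using K(2) V by auto
    then show ?thesis using continuous_on_open_Un[OF V(1) oK 1 2] by metis
  qed
  have "compact (K \<inter> C)" "K \<inter> C \<subseteq> U'" using K C by (auto intro: compact_Int_closed)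
  note KC = this
  have "m x * \<phi> x = 0" if "x \<notin> K \<inter> C" for x
    using that K(2,3) C(2) by (cases "x \<in> K") auto
  then show "test_fun U' (\<lambda>x. m x * \<phi> x)"
    using test_funI[of "\<lambda>x. m x * \<phi> x" D "K \<inter> C" U'] der cont KC by blast
  show "frechet_derivative (\<lambda>x. m x * \<phi> x) (at x) v =
           m x * frechet_derivative \<phi> (at x) v + Dm x v * \<phi> x" if "x \<in> V"
    using on_V by (simp add: frechet_derivative_eqI[OF der])
qed

lemma test_fun_affine:
  fixes \<phi> :: "'a::euclidean_space \<Rightarrow> real"
  assumes \<phi>: "test_fun U \<phi>" and c: "c \<noteq> 0"
  shows "test_fun ((\<lambda>x. (x - a) /\<^sub>R c) ` U) (\<lambda>x. \<phi> (a + c *\<^sub>R x))"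
    and "frechet_derivative (\<lambda>x. \<phi> (a + c *\<^sub>R x)) (at x) v = c * frechet_derivative \<phi> (at (a + c *\<^sub>R x)) v"
proof -
  obtain K where K: "compact K" "K \<subseteq> U" "\<And>x. x \<notin> K \<Longrightarrow> \<phi> x = 0" using test_fun_support[OF \<phi>] by metis
  have der: "((\<lambda>x. \<phi> (a + c *\<^sub>R x)) has_derivative
     (\<lambda>v. c * frechet_derivative \<phi> (at (a + c *\<^sub>R x)) v)) (at x)" for x
  proof -
    have "(\<phi> \<circ> (\<lambda>x. a + c *\<^sub>R x) has_derivative
       frechet_derivative \<phi> (at (a + c *\<^sub>R x)) \<circ> (\<lambda>v. c *\<^sub>R v)) (at x)"
      by (rule diff_chain_at) (auto intro!: derivative_eq_intros test_fun_has_derivative[OF \<phi>])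
    moreover have "frechet_derivative \<phi> (at (a + c *\<^sub>R x)) (c *\<^sub>R v) = c * frechet_derivative \<phi> (at (a + c *\<^sub>R x)) v" for v
      using linear_cmul[OF linear_frechet_derivative[of \<phi> "at (a + c *\<^sub>R x)"], of c v] \<phi>
      unfolding test_fun_def by simp
    ultimately show ?thesis by (simp add: o_def)
  qed
  show "frechet_derivative (\<lambda>x. \<phi> (a + c *\<^sub>R x)) (at x) v = c * frechet_derivative \<phi> (at (a + c *\<^sub>R x)) v"
    using frechet_derivative_eqI[OF der] by simp
  show "test_fun ((\<lambda>x. (x - a) /\<^sub>R c) ` U) (\<lambda>x. \<phi> (a + c *\<^sub>R x))"
  proof (rule test_funI[OF der])
    show "continuous_on UNIV (\<lambda>x. c * frechet_derivative \<phi> (at (a + c *\<^sub>R x)) b)" if "b \<in> Basis" for b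
      by (intro continuous_intros continuous_on_compose2[OF test_fun_deriv_continuous[OF \<phi> that]]) auto
    show "compact ((\<lambda>x. (x - a) /\<^sub>R c) ` K)" "(\<lambda>x. (x - a) /\<^sub>R c) ` K \<subseteq> (\<lambda>x. (x - a) /\<^sub>R c) ` U"
      using K by (auto intro!: compact_continuous_image continuous_intros)
    show "\<phi> (a + c *\<^sub>R x) = 0" if "x \<notin> (\<lambda>x. (x - a) /\<^sub>R c) ` K" for x
      using K(3)[of "a + c *\<^sub>R x"] that c by force
  qed
qed

subsection \<open>Smooth step\<close>

text \<open>The cubic Hermite step, with zero slope at both ends. Test functions are C^1, so it
  builds cutoffs and test functions, and it is also the transition profile of the
  competitor.\<close>

definition sstep :: "real \<Rightarrow> real" where
  "sstep t = (if t \<le> 0 then 0 else if t \<ge> 1 then 1 else 3 * t\<^sup>2 - 2 * t ^ 3)"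

definition sstep' :: "real \<Rightarrow> real" where
  "sstep' t = (if t \<le> 0 then 0 else if t \<ge> 1 then 0 else 6 * t - 6 * t\<^sup>2)"

lemma sstep_has_field_derivative [derivative_intros]:
  "(sstep has_real_derivative sstep' t) (at t within S)"
proof -
  have "(sstep has_real_derivative sstep' t) (at t)"
  proof -
    consider "t < 0" | "t = 0" | "0 < t" "t < 1" | "t = 1" | "t > 1" by linarith
    then show ?thesis
    proof cases
      case 1
      have "((\<lambda>_. 0) has_real_derivative sstep' t) (at t)" using 1 by (auto simp: sstep'_def)
      then show ?thesis
        by (rule has_field_derivative_transform_within_open[where S="{..<0}"]) (use 1 in \<open>auto simp: sstep_def\<close>)
    next
      case 3
      have "((\<lambda>t. 3 * t\<^sup>2 - 2 * t ^ 3) has_real_derivative sstep' t) (at t)"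
        using 3 by (auto simp: sstep'_def power2_eq_square intro!: derivative_eq_intros)
      then show ?thesis
        by (rule has_field_derivative_transform_within_open[where S="{0<..<1}"]) (use 3 in \<open>auto simp: sstep_def\<close>)
    next
      case 5
      have "((\<lambda>_. 1) has_real_derivative sstep' t) (at t)" using 5 by (auto simp: sstep'_def)
      then show ?thesis
        by (rule has_field_derivative_transform_within_open[where S="{1<..}"]) (use 5 in \<open>auto simp: sstep_def\<close>)
    next
      case 2
      have l: "(sstep has_real_derivative 0) (at 0 within {..0})"
        by (rule has_field_derivative_transform_within[where f="\<lambda>_. 0" and d=1]) (auto simp: sstep_def)
      have r: "(sstep has_real_derivative 0) (at 0 within {0..})"
        by (rule has_field_derivative_transform_within[where f="\<lambda>t. 3 * t\<^sup>2 - 2 * t ^ 3" and d=1])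
           (auto simp: sstep_def dist_real_def intro!: derivative_eq_intros)
      have "(sstep has_real_derivative 0) (at 0 within {..0} \<union> {0..})"
        using Lim_Un[of _ _ 0 "{..0}" "{0..}"] l r unfolding has_field_derivative_iff by blast
      moreover have "{..0} \<union> {0..} = (UNIV::real set)" by auto
      ultimately show ?thesis using 2 by (simp add: sstep'_def)
    next
      case 4
      have l: "(sstep has_real_derivative 0) (at 1 within {..1})"
        by (rule has_field_derivative_transform_within[where f="\<lambda>t. 3 * t\<^sup>2 - 2 * t ^ 3" and d=1])
           (auto simp: sstep_def dist_real_def intro!: derivative_eq_intros)
      have r: "(sstep has_real_derivative 0) (at 1 within {1..})"
        by (rule has_field_derivative_transform_within[where f="\<lambda>_. 1" and d=1]) (auto simp: sstep_def)
      have "(sstep has_real_derivative 0) (at 1 within {..1} \<union> {1..})"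
        using Lim_Un[of _ _ 1 "{..1}" "{1..}"] l r unfolding has_field_derivative_iff by blast
      moreover have "{..1} \<union> {1..} = (UNIV::real set)" by auto
      ultimately show ?thesis using 4 by (simp add: sstep'_def)
    qed
  qed
  then show ?thesis by (rule has_field_derivative_at_within)
qed

text \<open>The sign of t(1-t) reproduces the case distinction; as a maximum of polynomials the
  derivative is visibly continuous and bounded.\<close>

lemma sstep'_max: "sstep' t = max 0 (6 * t - 6 * t\<^sup>2)"
proof -
  have *: "6 * t - 6 * t\<^sup>2 = 6 * (t * (1 - t))" by (simp add: algebra_simps power2_eq_square)
  consider "t \<le> 0" | "t \<ge> 1" | "0 < t" "t < 1" by linarith
  then show ?thesis
  proof cases
    case 1
    then have "t * (1 - t) \<le> 0" by (intro mult_nonpos_nonneg) auto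
    then show ?thesis unfolding * using 1 by (simp add: sstep'_def)
  next
    case 2
    then have "t * (1 - t) \<le> 0" by (intro mult_nonneg_nonpos) auto
    then show ?thesis unfolding * using 2 by (simp add: sstep'_def)
  next
    case 3
    then have "t * (1 - t) \<ge> 0" by (intro mult_nonneg_nonneg) auto
    then have "max 0 (6 * (t * (1 - t))) = 6 * (t * (1 - t))" by (intro max_absorb2) simp
    then show ?thesis using 3 unfolding *[symmetric] by (simp add: sstep'_def)
  qed
qed

lemma sstep'_nonneg: "0 \<le> sstep' t" and sstep'_le: "sstep' t \<le> 3/2"
proof -
  have "0 \<le> (2 * t - 1)\<^sup>2" by simp
  then have "6 * t - 6 * t\<^sup>2 \<le> 3/2" by (simp add: power2_eq_square algebra_simps)
  then show "sstep' t \<le> 3/2" unfolding sstep'_max by (intro max.boundedI) simp_all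
qed (simp add: sstep'_max)

lemma continuous_on_sstep' [continuous_intros]:
  "continuous_on S f \<Longrightarrow> continuous_on S (\<lambda>x. sstep' (f x))"
  unfolding sstep'_max by (intro continuous_intros)

lemma continuous_on_sstep [continuous_intros]:
  "continuous_on S f \<Longrightarrow> continuous_on S (\<lambda>x. sstep (f x))"
  by (rule continuous_on_compose2[of UNIV sstep])
     (auto simp: continuous_on_eq_continuous_at intro!: DERIV_isCont[of sstep] sstep_has_field_derivative)

lemma sstep_has_derivative: "(sstep has_derivative (\<lambda>v. sstep' t * v)) (at t)"
  using sstep_has_field_derivative[of t UNIV] by (simp add: has_field_derivative_def)

lemma sstep_0: "t \<le> 0 \<Longrightarrow> sstep t = 0" and sstep_1: "t \<ge> 1 \<Longrightarrow> sstep t = 1"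
  and sstep'_0: "t \<le> 0 \<Longrightarrow> sstep' t = 0" and sstep'_1: "t \<ge> 1 \<Longrightarrow> sstep' t = 0"
  by (auto simp: sstep_def sstep'_def)

lemma sstep_mono: "s \<le> t \<Longrightarrow> sstep s \<le> sstep t"
  by (rule DERIV_nonneg_imp_nondecreasing[of s t sstep])
     (auto intro!: exI sstep_has_field_derivative simp: sstep'_nonneg)

lemma sstep_nonneg: "0 \<le> sstep t" and sstep_le_1: "sstep t \<le> 1"
  using sstep_mono[of "min t 0" t] sstep_mono[of t "max t 1"] by (auto simp: sstep_0 sstep_1)

subsection \<open>Uniqueness and calculus of weak derivatives\<close>

lemma sq_int_indicator:
  fixes S :: "'a::euclidean_space set"
  assumes "S \<in> sets borel" "emeasure lborel S < \<infinity>"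
  shows "sq_int lborel (indicator S)"
proof -
  have "(\<lambda>x. (indicator S x :: real)\<^sup>2) = indicator S" by (auto simp: indicator_def)
  then show ?thesis using assms by (auto simp: sq_int_def)
qed

text \<open>Take the product over the coordinates of one step rising from the left face and one
  falling towards the right face, both with argument scaled by n. It vanishes outside the box, and
  at each interior point every factor is eventually 1.\<close>

lemma box_test_fun_approx:
  fixes a b :: "'a::euclidean_space"
  assumes "cbox a b \<subseteq> U"
  obtains \<phi> where "\<And>n::nat. test_fun U (\<phi> n)" "\<And>n x. \<bar>\<phi> n x\<bar> \<le> indicator (cbox a b) x"
    "\<And>x. (\<lambda>n. \<phi> n x) \<longlonglongrightarrow> indicator (box a b) x"
proof -
  define s where "s = (\<lambda>(n::nat) i t. sstep (real n * (t - a \<bullet> i)) * sstep (real n * (b \<bullet> i - t)))"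
  define s' where "s' = (\<lambda>(n::nat) i t. real n * sstep' (real n * (t - a \<bullet> i)) * sstep (real n * (b \<bullet> i - t))
     - sstep (real n * (t - a \<bullet> i)) * (real n * sstep' (real n * (b \<bullet> i - t))))"
  define \<phi> where "\<phi> = (\<lambda>n (x::'a). \<Prod>i\<in>Basis. s n i (x \<bullet> i))"
  have sd: "(s n i has_real_derivative s' n i t) (at t)" for n i t
    unfolding s_def s'_def
    by (auto intro!: derivative_eq_intros DERIV_chain2[OF sstep_has_field_derivative])
  have sder: "((\<lambda>x. s n i (x \<bullet> i)) has_derivative (\<lambda>v. s' n i (x \<bullet> i) * (v \<bullet> i))) (at x)" for n i and x :: 'a
  proof -
    have "((\<lambda>x. x \<bullet> i) has_derivative (\<lambda>v. v \<bullet> i)) (at x)"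
      by (rule bounded_linear.has_derivative[OF bounded_linear_inner_left]) (rule has_derivative_ident)
    from diff_chain_at[OF this sd[of n i "x \<bullet> i", unfolded has_field_derivative_def]]
    show ?thesis by (simp add: o_def)
  qed
  have s_cont: "continuous_on UNIV (\<lambda>x. s n i (x \<bullet> i))" for n i
    unfolding s_def by (intro continuous_intros)
  have s'_cont: "continuous_on UNIV (\<lambda>x. s' n i (x \<bullet> i))" for n i
    unfolding s'_def by (intro continuous_intros)
  have s_out: "s n i t = 0" if "t \<notin> {a \<bullet> i <..< b \<bullet> i}" for n i t
  proof -
    have "real n * (t - a \<bullet> i) \<le> 0 \<or> real n * (b \<bullet> i - t) \<le> 0"
      using that by (auto intro!: mult_nonneg_nonpos)
    then show ?thesis by (auto simp: s_def sstep_0)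
  qed
  have s_01: "0 \<le> s n i t" "s n i t \<le> 1" for n i t
    by (auto simp: s_def sstep_nonneg sstep_le_1 intro!: mult_le_one)
  have \<phi>_out: "\<phi> n x = 0" if "x \<notin> box a b" for n x
    using that s_out by (auto simp: \<phi>_def box_def intro!: prod_zero)
  have "test_fun U (\<phi> n)" for n
  proof (rule test_funI)
    show "(\<phi> n has_derivative (\<lambda>v. \<Sum>i\<in>Basis. (s' n i (x \<bullet> i) * (v \<bullet> i)) * (\<Prod>j\<in>Basis - {i}. s n j (x \<bullet> j)))) (at x)" for x
      unfolding \<phi>_def by (intro has_derivative_prod sder)
    show "continuous_on UNIV (\<lambda>x. \<Sum>i\<in>Basis. (s' n i (x \<bullet> i) * (k \<bullet> i)) * (\<Prod>j\<in>Basis - {i}. s n j (x \<bullet> j)))" for k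
      by (intro continuous_intros continuous_on_prod s_cont s'_cont)
    show "compact (cbox a b)" "cbox a b \<subseteq> U" using assms by auto
    show "\<phi> n x = 0" if "x \<notin> cbox a b" for x
      using that \<phi>_out box_subset_cbox by blast
  qed
  moreover have "\<bar>\<phi> n x\<bar> \<le> indicator (cbox a b) x" for n x
  proof (cases "x \<in> box a b")
    case True
    have "\<bar>\<phi> n x\<bar> \<le> 1" unfolding \<phi>_def abs_prod using s_01 by (intro prod_le_1) auto
    then show ?thesis using True box_subset_cbox[of a b] by auto
  qed (use \<phi>_out in auto)
  moreover have "(\<lambda>n. \<phi> n x) \<longlonglongrightarrow> indicator (box a b) x" for x
  proof (cases "x \<in> box a b")
    case True
    have "(\<lambda>n. s n i (x \<bullet> i)) \<longlonglongrightarrow> 1" if "i \<in> Basis" for i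
    proof -
      \<comment> \<open>Distance to the nearer of the two faces in direction \<open>i\<close>; both
        steps are saturated once n d \<ge> 1.\<close>
      define d where "d = min (x \<bullet> i - a \<bullet> i) (b \<bullet> i - x \<bullet> i)"
      have d: "d > 0" using True that by (auto simp: d_def box_def)
      have "eventually (\<lambda>n. s n i (x \<bullet> i) = 1) sequentially"
        using eventually_ge_at_top[of "nat \<lceil>1 / d\<rceil>"]
      proof eventually_elim
        case (elim n)
        then have "real n \<ge> 1 / d" by linarith
        then have n: "real n * d \<ge> 1" using d by (simp add: field_simps)
        have "real n * d \<le> real n * (x \<bullet> i - a \<bullet> i)" "real n * d \<le> real n * (b \<bullet> i - x \<bullet> i)"
          by (auto simp: d_def intro!: mult_left_mono)
        with n show ?case by (simp add: s_def sstep_1)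
      qed
      then show ?thesis by (rule tendsto_eventually)
    qed
    then have "(\<lambda>n. \<phi> n x) \<longlonglongrightarrow> (\<Prod>i\<in>(Basis::'a set). 1)" unfolding \<phi>_def by (intro tendsto_prod)
    then show ?thesis using True by simp
  qed (simp add: \<phi>_out)
  ultimately show ?thesis using that by blast
qed

text \<open>Boxes are stable under intersection and generate the Borel sets, so a Dynkin argument
  gives zero integral over every Borel set.\<close>

lemma AE_zero_if_box_integrals_zero:
  fixes f :: "'a::euclidean_space \<Rightarrow> real"
  assumes f: "integrable lborel f" and z: "\<And>a b. (LBINT x. indicator (box a b) x * f x) = 0"
  shows "AE x in lborel. f x = 0"
proof (rule sigma_finite_measure.density_zero[OF sigma_finite_lborel f])
  fix A :: "'a set" assume A: "A \<in> sets lborel"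
  have fA: "integrable lborel (\<lambda>x. indicator A x * f x)" if "A \<in> sets borel" for A
    using integrable_mult_indicator[of A lborel f] that f by simp
  \<comment> \<open>The complement step of the Dynkin argument uses the integral over the whole
    space, reached by exhausting it with boxes.\<close>
  have total: "(LBINT x. f x) = 0"
  proof -
    have "(\<lambda>n. \<integral>x. indicator (box (- (real n *\<^sub>R One)) (real n *\<^sub>R One)) x * f x \<partial>lborel) \<longlonglongrightarrow> (LBINT x. f x)"
    proof (rule integral_dominated_convergence[where w="\<lambda>x. \<bar>f x\<bar>"])
      show "AE x in lborel. (\<lambda>n. indicator (box (- (real n *\<^sub>R One)) (real n *\<^sub>R One)) x * f x) \<longlonglongrightarrow> f x"
      proof (intro AE_I2 tendsto_eventually)
        fix x :: 'a
        obtain m :: nat where m: "norm x < real m" using reals_Archimedean2 by blast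
        show "eventually (\<lambda>n. indicator (box (- (real n *\<^sub>R One)) (real n *\<^sub>R One)) x * f x = f x) sequentially"
          using eventually_ge_at_top[of m]
        proof eventually_elim
          case (elim n)
          have "\<bar>x \<bullet> i\<bar> < real n" if "i \<in> Basis" for i
            using Basis_le_norm[OF that, of x] m elim by simp
          then have "x \<in> box (- (real n *\<^sub>R One)) (real n *\<^sub>R One)"
            by (force simp: box_def abs_less_iff minus_less_iff)
          then show ?case by simp
        qed
      qed
    qed (use f in \<open>auto simp: indicator_def\<close>)
    then show ?thesis using z by (simp add: LIMSEQ_const_iff)
  qed
  have "(LBINT x. indicator A x * f x) = 0"
  proof -
    have A': "A \<in> sigma_sets UNIV (range (\<lambda>(a, b). box a b))"
      using A by (simp add: borel_eq_box)
    have Int: "Int_stable (range (\<lambda>(a, b). box a b :: 'a set))"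
      by (auto simp: Int_stable_def box_Int_box)
    have sub: "range (\<lambda>(a, b). box a b :: 'a set) \<subseteq> Pow UNIV" by auto
    from Int sub A' show ?thesis
    proof (induct rule: sigma_sets_induct_disjoint)
      case (basic A) then show ?case using z by auto
    next
      case empty then show ?case by simp
    next
      case (compl A)
      then have [measurable]: "A \<in> sets borel" by (simp add: borel_eq_box)
      have "(LBINT x. indicator (UNIV - A) x * f x) = (LBINT x. f x - indicator A x * f x)"
        by (intro Bochner_Integration.integral_cong) (auto simp: indicator_def)
      also have "\<dots> = 0" using compl total f fA[of A] by simp
      finally show ?case .
    next
      case (union A)
      then have A: "\<And>i. A i \<in> sets borel" by (auto simp: borel_eq_box)
      have "set_lebesgue_integral lborel (\<Union>i. A i) f = (\<Sum>i. set_lebesgue_integral lborel (A i) f)"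
        using union A f fA
        by (intro lebesgue_integral_countable_add) (auto simp: disjoint_family_on_def set_integrable_def)
      then show ?case using union by (simp add: set_lebesgue_integral_def)
    qed
  qed
  then show "set_lebesgue_integral lborel A f = 0" by (simp add: set_lebesgue_integral_def)
qed

text \<open>The fundamental lemma of the calculus of variations. Inside a closed box contained in
  \<open>U\<close>, test functions approximate the indicators of all smaller boxes; countably many
  such boxes cover \<open>U\<close>.\<close>

lemma AE_zero_if_orthogonal_test_funs:
  fixes f :: "'a::euclidean_space \<Rightarrow> real"
  assumes U: "open U" and f: "L2_on U f"
    and z: "\<And>\<phi>. test_fun U \<phi> \<Longrightarrow> (LBINT x. f x * \<phi> x) = 0"
  shows "AE x in lborel. x \<in> U \<longrightarrow> f x = 0"
proof -
  have box0: "AE x in lborel. x \<in> box a b \<longrightarrow> f x = 0" if ab: "cbox a b \<subseteq> U" for a b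
  proof -
    have "AE x in lborel. indicator (box a b) x * f x = 0"
    proof (rule AE_zero_if_box_integrals_zero)
      have "integrable lborel (\<lambda>x. indicator (box a b) x * (indicator U x * f x))"
        using f by (intro sq_int_mult sq_int_indicator) (auto simp: L2_on_iff emeasure_lborel_box_eq)
      moreover have eq: "indicator (box a b) x * (indicator U x * f x) = indicator (box a b) x * f x" for x
        using ab box_subset_cbox[of a b] by (auto simp: indicator_def)
      ultimately show int: "integrable lborel (\<lambda>x. indicator (box a b) x * f x)" by simp
      fix c d
      obtain u v where uv: "box a b \<inter> box c d = box u v" by (auto simp: box_Int_box)
      show "(LBINT x. indicator (box c d) x * (indicator (box a b) x * f x)) = 0"
      proof (cases "box u v = {}")
        case True
        then have "indicator (box c d) x * (indicator (box a b) x * f x) = 0" for x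
          using uv by (auto simp: indicator_def)
        then have "(\<lambda>x. indicator (box c d) x * (indicator (box a b) x * f x)) = (\<lambda>x. 0)" by blast
        then show ?thesis by simp
      next
        case False
        \<comment> \<open>For a nonempty open box the closure is the closed box, which brings the
          support of the approximating functions inside \<open>U\<close>.\<close>
        have "closure (box u v) \<subseteq> closure (box a b)" using uv by (intro closure_mono) auto
        then have "cbox u v \<subseteq> cbox a b" using False uv by (metis closure_box inf_bot_left)
        with ab have "cbox u v \<subseteq> U" by auto
        then obtain \<phi> where \<phi>: "\<And>n::nat. test_fun U (\<phi> n)" "\<And>n x. \<bar>\<phi> n x\<bar> \<le> indicator (cbox u v) x"
          "\<And>x. (\<lambda>n. \<phi> n x) \<longlonglongrightarrow> indicator (box u v) x" using box_test_fun_approx by metis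
        have fU: "(\<lambda>x. indicator U x * f x) \<in> borel_measurable borel" using f by (simp add: L2_on_iff sq_int_def)
        have \<phi>m: "\<phi> n \<in> borel_measurable borel" for n using test_fun_continuous[OF \<phi>(1)] by (rule borel_measurable_continuous_onI)
        have fcb: "integrable lborel (\<lambda>x. indicator (cbox u v) x * (indicator U x * f x))"
          using f by (intro sq_int_mult sq_int_indicator) (auto simp: L2_on_iff emeasure_lborel_cbox_eq)
        have "(\<lambda>n. \<integral>x. (indicator U x * f x) * \<phi> n x \<partial>lborel) \<longlonglongrightarrow> (LBINT x. (indicator U x * f x) * indicator (box u v) x)"
        proof (rule integral_dominated_convergence[where w="\<lambda>x. \<bar>indicator (cbox u v) x * (indicator U x * f x)\<bar>"])
          show "AE x in lborel. (\<lambda>n. indicator U x * f x * \<phi> n x) \<longlonglongrightarrow> indicator U x * f x * indicator (box u v) x"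
            using \<phi>(3) by (auto intro!: AE_I2 tendsto_mult_left)
          show "AE x in lborel. norm (indicator U x * f x * \<phi> n x) \<le> \<bar>indicator (cbox u v) x * (indicator U x * f x)\<bar>" for n
          proof (intro AE_I2)
            fix x
            have "\<bar>indicator U x * f x\<bar> * \<bar>\<phi> n x\<bar> \<le> \<bar>indicator U x * f x\<bar> * indicator (cbox u v) x"
              by (intro mult_left_mono \<phi>) auto
            then show "norm (indicator U x * f x * \<phi> n x) \<le> \<bar>indicator (cbox u v) x * (indicator U x * f x)\<bar>"
              by (simp add: abs_mult mult.commute)
          qed
        qed (use fU \<phi>m fcb in auto)
        moreover have "(LBINT x. (indicator U x * f x) * \<phi> n x) = 0" for n
        proof -
          have "(\<lambda>x. indicator U x * f x * \<phi> n x) = (\<lambda>x. f x * \<phi> n x)"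
          proof
            show "indicator U x * f x * \<phi> n x = f x * \<phi> n x" for x
              using \<phi>(1)[of n] by (cases "x \<in> U") auto
          qed
          then show ?thesis using z[OF \<phi>(1)] by simp
        qed
        moreover have "(indicator U x * f x) * indicator (box u v) x = indicator (box c d) x * (indicator (box a b) x * f x)" for x
          using uv \<open>cbox u v \<subseteq> U\<close> box_subset_cbox[of u v] by (auto simp: indicator_def)
        ultimately show ?thesis by (simp add: LIMSEQ_const_iff)
      qed
    qed
    then show ?thesis by eventually_elim (auto simp: indicator_def)
  qed
  \<comment> \<open>Passing from open to closed boxes in the cover costs only their faces, which are
    null sets.\<close>
  obtain D where D: "countable D" "D \<subseteq> Pow U" "\<And>X. X \<in> D \<Longrightarrow> \<exists>a b. X = cbox a b" "\<Union>D = U"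
    using open_countable_Union_open_cbox[OF U] by metis
  have "AE x in lborel. x \<in> X \<longrightarrow> f x = 0" if "X \<in> D" for X
  proof -
    obtain a b where X: "X = cbox a b" using D(3) \<open>X \<in> D\<close> by blast
    have "cbox a b - box a b \<in> null_sets lborel"
      using negligible_frontier_interval[of a b]
      by (simp add: negligible_iff_null_sets null_sets_completion_iff)
    note 1 = AE_not_in[OF this]
    have "cbox a b \<subseteq> U" using D(2) that unfolding X by auto
    from 1 box0[OF this] show ?thesis unfolding X by eventually_elim auto
  qed
  then have "AE x in lborel. \<forall>X\<in>D. x \<in> X \<longrightarrow> f x = 0"
    using D(1) by (subst AE_ball_countable) auto
  then show ?thesis by eventually_elim (use D(4) in blast)
qed


section \<open>Local square integrability and the rules for weak derivatives\<close>

lemma indicator_mult_cong: "(\<And>x. x \<in> U \<Longrightarrow> u x = v x) \<Longrightarrow> (\<lambda>x. indicator U x * u x) = (\<lambda>x. indicator U x * (v x :: real))"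
  by (auto simp: indicator_def)

lemma L2_on_cong: "(\<And>x. x \<in> U \<Longrightarrow> u x = v x) \<Longrightarrow> L2_on U u \<longleftrightarrow> L2_on U v"
  unfolding L2_on_iff by (subst indicator_mult_cong[of U u v]) auto

lemma L2_on_subset:
  assumes u: "L2_on U u" and V: "V \<in> sets borel" "V \<subseteq> U"
  shows "L2_on V u"
proof -
  have "sq_int lborel (\<lambda>x. indicator V x * (indicator U x * u x))"
    by (rule sq_int_bounded_mult[where C=1]) (use u V in \<open>auto simp: L2_on_iff indicator_def\<close>)
  moreover have "(\<lambda>x. indicator V x * (indicator U x * u x)) = (\<lambda>x. indicator V x * u x)"
    using V by (intro ext) (auto split: split_indicator)
  ultimately show ?thesis by (simp add: L2_on_iff)
qed

lemma L2_on_add: "L2_on U u \<Longrightarrow> L2_on U v \<Longrightarrow> L2_on U (\<lambda>x. u x + v x)"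
  unfolding L2_on_iff by (drule (1) sq_int_add) (simp add: distrib_left)

lemma L2_on_cmult: "L2_on U u \<Longrightarrow> L2_on U (\<lambda>x. c * u x)"
  unfolding L2_on_iff by (drule sq_int_cmult[where c=c]) (simp add: mult.left_commute)

lemma L2_on_zero [simp]: "L2_on U (\<lambda>x. 0)"
  by (simp add: L2_on_iff)

lemma L2_on_bounded_mult:
  assumes u: "L2_on U u" and m: "(\<lambda>x. indicator U x * m x) \<in> borel_measurable borel"
    and b: "\<And>x. x \<in> U \<Longrightarrow> \<bar>m x\<bar> \<le> C" "0 \<le> C"
  shows "L2_on U (\<lambda>x. m x * u x)"
proof -
  have "sq_int lborel (\<lambda>x. (indicator U x * m x) * (indicator U x * u x))"
    by (rule sq_int_bounded_mult[where C=C]) (use u m b in \<open>auto simp: L2_on_iff indicator_def\<close>)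
  moreover have "(\<lambda>x. (indicator U x * m x) * (indicator U x * u x)) = (\<lambda>x. indicator U x * (m x * u x))"
    by (auto simp: indicator_def)
  ultimately show ?thesis by (simp add: L2_on_iff)
qed

lemma L2_on_mult_integrable:
  assumes "L2_on U u" "sq_int lborel f" "\<And>x. x \<notin> U \<Longrightarrow> f x = 0"
  shows "integrable lborel (\<lambda>x. u x * f x)"
proof -
  have "integrable lborel (\<lambda>x. (indicator U x * u x) * f x)"
    using assms by (intro sq_int_mult) (auto simp: L2_on_iff)
  moreover have "(\<lambda>x. (indicator U x * u x) * f x) = (\<lambda>x. u x * f x)"
    using assms(3) by (fastforce simp: indicator_def)
  ultimately show ?thesis by simp
qed

lemma weak_deriv_iff:
  "has_weak_deriv U u b g \<longleftrightarrow> L2_on U g \<and>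
     (\<forall>\<phi>. test_fun U \<phi> \<longrightarrow> (LBINT x. u x * frechet_derivative \<phi> (at x) b) = - (LBINT x. g x * \<phi> x))"
proof -
  have "(\<lambda>x. indicator U x *\<^sub>R (u x * frechet_derivative \<phi> (at x) b)) = (\<lambda>x. u x * frechet_derivative \<phi> (at x) b)"
    "(\<lambda>x. indicator U x *\<^sub>R (g x * \<phi> x)) = (\<lambda>x. g x * \<phi> x)" if "test_fun U \<phi>" for \<phi>
    using that by (auto simp: indicator_def fun_eq_iff)
  then show ?thesis
    unfolding has_weak_deriv_def set_lebesgue_integral_def by auto
qed

lemma weak_derivD: "has_weak_deriv U u b g \<Longrightarrow> test_fun U \<phi> \<Longrightarrow>
   (LBINT x. u x * frechet_derivative \<phi> (at x) b) = - (LBINT x. g x * \<phi> x)"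
  by (simp add: weak_deriv_iff)

lemma weak_deriv_L2: "has_weak_deriv U u b g \<Longrightarrow> L2_on U g"
  by (simp add: weak_deriv_iff)

lemma L2_on_test_integrable: "L2_on U u \<Longrightarrow> test_fun U \<phi> \<Longrightarrow> integrable lborel (\<lambda>x. u x * \<phi> x)"
  by (rule L2_on_mult_integrable) (auto intro: test_fun_sq_int)

lemma L2_on_test_deriv_integrable:
  "L2_on U u \<Longrightarrow> test_fun U \<phi> \<Longrightarrow> b \<in> Basis \<Longrightarrow> integrable lborel (\<lambda>x. u x * frechet_derivative \<phi> (at x) b)"
  by (rule L2_on_mult_integrable) (auto intro: test_fun_deriv_sq_int)

lemma weak_deriv_unique:
  assumes U: "open U" and g: "has_weak_deriv U u b g" and h: "has_weak_deriv U u b h"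
  shows "AE x in lborel. x \<in> U \<longrightarrow> g x = h x"
proof -
  note L = weak_deriv_L2[OF g] weak_deriv_L2[OF h]
  have "AE x in lborel. x \<in> U \<longrightarrow> g x + (-1) * h x = 0"
  proof (rule AE_zero_if_orthogonal_test_funs[OF U])
    show "L2_on U (\<lambda>x. g x + (-1) * h x)" using L by (intro L2_on_add L2_on_cmult)
    fix \<phi> :: "'a \<Rightarrow> real" assume \<phi>: "test_fun U \<phi>"
    have "(LBINT x. (g x + (-1) * h x) * \<phi> x) = (LBINT x. g x * \<phi> x - h x * \<phi> x)"
      by (simp add: algebra_simps)
    also have "\<dots> = 0"
      using weak_derivD[OF g \<phi>] weak_derivD[OF h \<phi>] L2_on_test_integrable[OF L(1) \<phi>] L2_on_test_integrable[OF L(2) \<phi>]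
      by simp
    finally show "(LBINT x. (g x + (-1) * h x) * \<phi> x) = 0" .
  qed
  then show ?thesis by eventually_elim auto
qed

lemma weak_deriv_wderiv: "has_weak_deriv U u b g \<Longrightarrow> has_weak_deriv U u b (wderiv U u b)"
  unfolding wderiv_def by (rule someI[where P="has_weak_deriv U u b"])

text \<open>\<open>wderiv\<close> is picked by \<open>SOME\<close>; uniqueness makes it agree almost
  everywhere with any explicitly known weak derivative, which is how formulas for it are
  obtained.\<close>

lemma wderiv_AE_eq: "open U \<Longrightarrow> has_weak_deriv U u b g \<Longrightarrow> AE x in lborel. x \<in> U \<longrightarrow> wderiv U u b x = g x"
  by (rule weak_deriv_unique[OF _ weak_deriv_wderiv])

lemma weak_deriv_cong:
  assumes "\<And>x. x \<in> U \<Longrightarrow> u x = v x" "\<And>x. x \<in> U \<Longrightarrow> g x = h x"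
  shows "has_weak_deriv U u b g \<longleftrightarrow> has_weak_deriv U v b h"
proof -
  have "(\<lambda>x. u x * frechet_derivative \<phi> (at x) b) = (\<lambda>x. v x * frechet_derivative \<phi> (at x) b)"
    "(\<lambda>x. g x * \<phi> x) = (\<lambda>x. h x * \<phi> x)" if "test_fun U \<phi>" for \<phi>
    using that assms test_fun_zero[OF that] test_fun_deriv_zero[OF that] by (metis mult_zero_right)+
  moreover have "L2_on U g \<longleftrightarrow> L2_on U h" using assms by (intro L2_on_cong) auto
  ultimately show ?thesis unfolding weak_deriv_iff by auto
qed

lemma weak_deriv_AE_cong:
  assumes "has_weak_deriv U u b g" "AE x in lborel. x \<in> U \<longrightarrow> g x = h x" "(\<lambda>x. indicator U x * h x) \<in> borel_measurable borel"
  shows "has_weak_deriv U u b h"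
proof -
  have ae: "AE x in lborel. indicator U x * g x = indicator U x * h x"
    using assms(2) by eventually_elim (auto simp: indicator_def)
  have g: "L2_on U g" using assms(1) by (rule weak_deriv_L2)
  have h: "L2_on U h" unfolding L2_on_iff
    by (rule sq_int_bound[OF g[unfolded L2_on_iff], where C=1])
       (use assms(3) ae in \<open>auto elim!: eventually_mono\<close>)
  have "(LBINT x. g x * \<phi> x) = (LBINT x. h x * \<phi> x)" if "test_fun U \<phi>" for \<phi>
    using L2_on_test_integrable[OF g that] L2_on_test_integrable[OF h that]
    by (intro integral_cong_AE) (use assms(2) that in \<open>auto elim!: eventually_mono\<close>)
  with h assms(1) show ?thesis unfolding weak_deriv_iff by auto
qed

lemma weak_deriv_add:
  assumes b: "b \<in> Basis" and "L2_on U u" "L2_on U v" "has_weak_deriv U u b g" "has_weak_deriv U v b h"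
  shows "has_weak_deriv U (\<lambda>x. u x + v x) b (\<lambda>x. g x + h x)"
  using assms unfolding weak_deriv_iff
  by (auto simp: distrib_right L2_on_test_integrable L2_on_test_deriv_integrable intro!: L2_on_add)

lemma weak_deriv_cmult:
  assumes "has_weak_deriv U u b g"
  shows "has_weak_deriv U (\<lambda>x. c * u x) b (\<lambda>x. c * g x)"
  using assms unfolding weak_deriv_iff by (auto simp: mult.assoc intro!: L2_on_cmult)

lemma weak_deriv_zero: "has_weak_deriv U (\<lambda>x. 0) b (\<lambda>x. 0)"
  by (simp add: weak_deriv_iff)

lemma L2_on_sum: "(\<And>i. i \<in> I \<Longrightarrow> L2_on U (u i)) \<Longrightarrow> L2_on U (\<lambda>x. \<Sum>i\<in>I. u i x)"
  by (induction I rule: infinite_finite_induct) (auto intro!: L2_on_add)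

lemma weak_deriv_sum:
  assumes b: "b \<in> Basis" and "\<And>i. i \<in> I \<Longrightarrow> L2_on U (u i)" "\<And>i. i \<in> I \<Longrightarrow> has_weak_deriv U (u i) b (g i)"
  shows "has_weak_deriv U (\<lambda>x. \<Sum>i\<in>I. u i x) b (\<lambda>x. \<Sum>i\<in>I. g i x)"
  using assms(2,3)
  by (induction I rule: infinite_finite_induct)
     (auto intro!: weak_deriv_add[OF b] weak_deriv_zero L2_on_sum)

lemma weak_deriv_subset:
  assumes "has_weak_deriv U u b g" "V \<subseteq> U" "V \<in> sets borel"
  shows "has_weak_deriv V u b g"
  using assms unfolding weak_deriv_iff
  by (auto intro: L2_on_subset dest!: test_fun_subset[of V _ U])

text \<open>The multiplier \<open>m\<close> may have its support in the smaller set \<open>U\<close>; this covers both the product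
  rule (\<open>U = W\<close>) and extension by zero of a cut-off function.\<close>
lemma weak_deriv_mult:
  assumes b: "b \<in> Basis" and u: "L2_on U u" "has_weak_deriv U u b g"
    and W: "open V" "W \<subseteq> V" "W \<in> sets borel"
    and m: "\<And>x. x \<in> V \<Longrightarrow> (m has_derivative Dm x) (at x)"
      "\<And>b. b \<in> Basis \<Longrightarrow> continuous_on V (\<lambda>x. Dm x b)"
    and C: "closed C" "\<And>x. x \<in> W \<Longrightarrow> x \<notin> C \<Longrightarrow> m x = 0" "W \<inter> C \<subseteq> U"
      "\<And>x. x \<in> W \<Longrightarrow> x \<notin> C \<Longrightarrow> Dm x b = 0"
    and L: "L2_on W (\<lambda>x. m x * g x + Dm x b * u x)"
  shows "has_weak_deriv W (\<lambda>x. m x * u x) b (\<lambda>x. m x * g x + Dm x b * u x)"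
  unfolding weak_deriv_iff
proof (intro conjI allI impI L)
  fix \<phi> :: "'a \<Rightarrow> real" assume \<phi>: "test_fun W \<phi>"
  let ?d = "\<lambda>\<phi> x. frechet_derivative \<phi> (at x) b"
  have t: "test_fun U (\<lambda>x. m x * \<phi> x)"
    by (rule test_fun_mult(1)[OF \<phi> W(1,2) m C(1-3)])
  obtain K where K: "compact K" "K \<subseteq> W" "\<And>x. x \<notin> K \<Longrightarrow> \<phi> x = 0" using test_fun_support[OF \<phi>] by metis
  have d: "?d (\<lambda>x. m x * \<phi> x) x = m x * ?d \<phi> x + Dm x b * \<phi> x" if "x \<in> V" for x
    by (rule test_fun_mult(2)[OF \<phi> W(1,2) m C(1-3) that])
  \<comment> \<open>\<open>Dm\<close> is controlled only on \<open>V\<close>; continuity on the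
    whole space comes from gluing with the zero function on the complement of the support of
    \<open>\<phi>\<close>.\<close>
  have s1: "sq_int lborel (\<lambda>x. Dm x b * \<phi> x)"
  proof (rule sq_int_continuous_compact_support[OF _ K(1)])
    have "continuous_on V (\<lambda>x. Dm x b * \<phi> x)"
      using m(2)[OF b] test_fun_continuous[OF \<phi>] by (intro continuous_intros) (auto intro: continuous_on_subset)
    moreover have "continuous_on (-K) (\<lambda>x. Dm x b * \<phi> x)"
      by (rule continuous_on_eq[OF continuous_on_const[of "-K" 0]]) (use K in auto)
    moreover have "open (-K)" "UNIV = V \<union> -K" using K W by (auto simp: compact_imp_closed open_Compl)
    ultimately show "continuous_on UNIV (\<lambda>x. Dm x b * \<phi> x)" using W(1) by (metis continuous_on_open_Un)
  qed (use K in auto)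
  have z1: "Dm x b * \<phi> x = 0" if "x \<notin> U" for x
    using that C \<phi> by (cases "x \<in> W") auto
  have z2: "m x * \<phi> x = 0" if "x \<notin> U" for x
    using that C \<phi> by (cases "x \<in> W") auto
  have i1: "integrable lborel (\<lambda>x. u x * (Dm x b * \<phi> x))"
    by (rule L2_on_mult_integrable[OF u(1) s1 z1])
  have i2: "integrable lborel (\<lambda>x. g x * (m x * \<phi> x))"
    by (rule L2_on_mult_integrable[OF weak_deriv_L2[OF u(2)] test_fun_sq_int[OF t] z2])
  have i3: "integrable lborel (\<lambda>x. u x * ?d (\<lambda>x. m x * \<phi> x) x)"
    by (rule L2_on_test_deriv_integrable[OF u(1) t b])
  \<comment> \<open>The product rule for the test function \<open>m \<phi>\<close>, solved for the
    term with the derivative of \<open>\<phi>\<close>; off \<open>W\<close> both sides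
    vanish.\<close>
  have e: "m x * u x * ?d \<phi> x = u x * ?d (\<lambda>x. m x * \<phi> x) x - u x * (Dm x b * \<phi> x)" for x
  proof (cases "x \<in> W")
    case True then show ?thesis using d[of x] W by (auto simp: algebra_simps)
  next
    case False
    then have "x \<notin> K" using K by auto
    moreover have "open (-K)" using K by (simp add: compact_imp_closed open_Compl)
    ultimately have "((\<lambda>x. m x * \<phi> x) has_derivative (\<lambda>v. 0)) (at x)"
      using has_derivative_transform_within_open[OF has_derivative_const[of 0], where s="-K" and g="\<lambda>x. m x * \<phi> x"] K(3) by auto
    with False \<phi> show ?thesis by (simp add: frechet_derivative_eqI)
  qed
  have "(LBINT x. m x * u x * ?d \<phi> x) = (LBINT x. u x * ?d (\<lambda>x. m x * \<phi> x) x) - (LBINT x. u x * (Dm x b * \<phi> x))"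
    unfolding e using i1 i3 by simp
  also have "\<dots> = - ((LBINT x. g x * (m x * \<phi> x)) + (LBINT x. u x * (Dm x b * \<phi> x)))"
    by (simp add: weak_derivD[OF u(2) t])
  also have "\<dots> = - (LBINT x. (m x * g x + Dm x b * u x) * \<phi> x)"
    using i1 i2 by (subst Bochner_Integration.integral_add[symmetric]) (auto simp: algebra_simps)
  finally show "(LBINT x. m x * u x * ?d \<phi> x) = - (LBINT x. (m x * g x + Dm x b * u x) * \<phi> x)" .
qed

section \<open>Affine changes of variables and gluing of weak derivatives\<close>

lemma lborel_integral_affine:
  fixes f :: "'a::euclidean_space \<Rightarrow> real"
  assumes [measurable]: "f \<in> borel_measurable borel" and c: "c \<noteq> 0"
  shows "(LBINT x. f x) = \<bar>c\<bar> ^ DIM('a) * (LBINT x. f (a + c *\<^sub>R x))"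
  by (subst lborel_affine[OF c, of a]) (simp add: integral_density integral_distr)

lemma lborel_integrable_affine:
  fixes f :: "'a::euclidean_space \<Rightarrow> real"
  assumes f: "integrable lborel f" and c: "c \<noteq> 0"
  shows "integrable lborel (\<lambda>x. f (a + c *\<^sub>R x))"
proof -
  have [measurable]: "f \<in> borel_measurable borel" using f by auto
  have "integrable (density (distr lborel borel (\<lambda>x. a + c *\<^sub>R x)) (\<lambda>_. ennreal (\<bar>c\<bar> ^ DIM('a)))) f"
    using f lborel_affine[OF c, of a] by (simp add: ennreal_power)
  then show ?thesis using c by (simp add: integrable_density integrable_distr_eq)
qed

lemma AE_lborel_affine:
  fixes P :: "'a::euclidean_space \<Rightarrow> bool"
  assumes ae: "AE x in lborel. P x" and c: "c \<noteq> 0"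
  shows "AE x in lborel. P (a + c *\<^sub>R x)"
proof -
  obtain N where N: "N \<in> null_sets lborel" "{x. \<not> P x} \<subseteq> N" using ae by (auto simp: eventually_ae_filter)
  have [measurable]: "N \<in> sets borel" using N by auto
  have "AE x in density (distr lborel borel (\<lambda>x. a + c *\<^sub>R x)) (\<lambda>_. \<bar>c\<bar> ^ DIM('a)). x \<notin> N"
    using AE_not_in[OF N(1)] unfolding lborel_affine[OF c, of a, symmetric] .
  then have "AE x in lborel. a + c *\<^sub>R x \<notin> N"
    using c by (auto simp: AE_density AE_distr_iff elim!: eventually_mono)
  then show ?thesis by eventually_elim (use N in auto)
qed

lemma sq_int_affine: "sq_int lborel f \<Longrightarrow> c \<noteq> 0 \<Longrightarrow> sq_int lborel (\<lambda>x. f (a + c *\<^sub>R x))"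
  unfolding sq_int_def using lborel_integrable_affine[of "\<lambda>x. (f x)\<^sup>2" c a] by (auto intro!: measurable_compose[of _ _ borel f])

lemma L2_on_scale:
  assumes "L2_on U u" "c \<noteq> 0"
  shows "L2_on ((\<lambda>x. x /\<^sub>R c) ` U) (\<lambda>x. u (c *\<^sub>R x))"
proof -
  have "indicator ((\<lambda>x. x /\<^sub>R c) ` U) x = (indicator U (c *\<^sub>R x) :: real)" for x
    using assms(2) by (force simp: indicator_def image_iff)
  then show ?thesis using sq_int_affine[of "\<lambda>x. indicator U x * u x" c 0] assms by (simp add: L2_on_iff)
qed

text \<open>Test the derivative of u with \<open>\<phi>(x/c)\<close> and substitute; the Jacobian
  appears on both sides and cancels, and the chain rule leaves one factor c.\<close>

lemma weak_deriv_scale: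
  assumes b: "b \<in> Basis" and u: "L2_on U u" "has_weak_deriv U u b g" and c: "c \<noteq> 0"
  shows "has_weak_deriv ((\<lambda>x. x /\<^sub>R c) ` U) (\<lambda>x. u (c *\<^sub>R x)) b (\<lambda>x. c * g (c *\<^sub>R x))"
  unfolding weak_deriv_iff
proof (intro conjI allI impI)
  show "L2_on ((\<lambda>x. x /\<^sub>R c) ` U) (\<lambda>x. c * g (c *\<^sub>R x))"
    by (intro L2_on_cmult L2_on_scale c weak_deriv_L2[OF u(2)])
  fix \<phi> :: "'a \<Rightarrow> real" assume \<phi>: "test_fun ((\<lambda>x. x /\<^sub>R c) ` U) \<phi>"
  let ?\<psi> = "\<lambda>x. \<phi> (0 + inverse c *\<^sub>R x)"
  have ic: "inverse c \<noteq> 0" using c by simp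
  have im: "(\<lambda>x. (x - 0) /\<^sub>R inverse c) ` (\<lambda>x. x /\<^sub>R c) ` U = U"
    using c by (simp add: image_image)
  have t: "test_fun U ?\<psi>" using test_fun_affine(1)[OF \<phi> ic, of 0] unfolding im .
  have d: "frechet_derivative ?\<psi> (at x) b = inverse c * frechet_derivative \<phi> (at (inverse c *\<^sub>R x)) b" for x
    using test_fun_affine(2)[OF \<phi> ic, of 0 x b] by simp
  have m1: "(\<lambda>x. u x * frechet_derivative ?\<psi> (at x) b) \<in> borel_measurable borel"
    using L2_on_test_deriv_integrable[OF u(1) t b] by auto
  have m2: "(\<lambda>x. g x * ?\<psi> x) \<in> borel_measurable borel"
    using L2_on_test_integrable[OF weak_deriv_L2[OF u(2)] t] by auto
  have "(LBINT x. u x * frechet_derivative ?\<psi> (at x) b) = - (LBINT x. g x * ?\<psi> x)"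
    by (rule weak_derivD[OF u(2) t])
  moreover have "(LBINT x. u x * frechet_derivative ?\<psi> (at x) b) =
      \<bar>c\<bar> ^ DIM('a) * (LBINT x. u (c *\<^sub>R x) * (inverse c * frechet_derivative \<phi> (at x) b))"
    using lborel_integral_affine[OF m1 c, of 0] c unfolding d by simp
  moreover have "(LBINT x. g x * ?\<psi> x) = \<bar>c\<bar> ^ DIM('a) * (LBINT x. g (c *\<^sub>R x) * \<phi> x)"
    using lborel_integral_affine[OF m2 c, of 0] c by simp
  ultimately have "\<bar>c\<bar> ^ DIM('a) * (LBINT x. u (c *\<^sub>R x) * (inverse c * frechet_derivative \<phi> (at x) b))
      = \<bar>c\<bar> ^ DIM('a) * - (LBINT x. g (c *\<^sub>R x) * \<phi> x)"
    by (metis mult_minus_right)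
  then have "(LBINT x. u (c *\<^sub>R x) * (inverse c * frechet_derivative \<phi> (at x) b)) = - (LBINT x. g (c *\<^sub>R x) * \<phi> x)"
    unfolding mult_cancel_left using c by (auto simp del: mult_minus_right)
  also have "(\<lambda>x. u (c *\<^sub>R x) * (inverse c * frechet_derivative \<phi> (at x) b)) = (\<lambda>x. inverse c * (u (c *\<^sub>R x) * frechet_derivative \<phi> (at x) b))"
    by auto
  finally show "(LBINT x. u (c *\<^sub>R x) * frechet_derivative \<phi> (at x) b) = - (LBINT x. c * g (c *\<^sub>R x) * \<phi> x)"
    using c by (simp add: field_simps)
qed

text \<open>The partition of unity is \<open>m\<close>, supported in \<open>U\<close>, and \<open>1 - m\<close>, supported in \<open>V\<close>.\<close>
lemma weak_deriv_Un:
  fixes m :: "'a::euclidean_space \<Rightarrow> real"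
  assumes b: "b \<in> Basis" and u: "L2_on (U \<union> V) u" and g: "has_weak_deriv U u b g" "has_weak_deriv V u b g"
    and L: "L2_on (U \<union> V) g" and W: "open W" "U \<union> V \<subseteq> W"
    and m: "\<And>x. x \<in> W \<Longrightarrow> (m has_derivative Dm x) (at x)"
      "\<And>b. b \<in> Basis \<Longrightarrow> continuous_on W (\<lambda>x. Dm x b)"
    and C: "closed C" "\<And>x. x \<in> W \<Longrightarrow> x \<notin> C \<Longrightarrow> m x = 0" "(U \<union> V) \<inter> C \<subseteq> U"
    and D: "closed D" "\<And>x. x \<in> W \<Longrightarrow> x \<notin> D \<Longrightarrow> m x = 1" "(U \<union> V) \<inter> D \<subseteq> V"
  shows "has_weak_deriv (U \<union> V) u b g"
  unfolding weak_deriv_iff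
proof (intro conjI allI impI L)
  fix \<phi> :: "'a \<Rightarrow> real" assume \<phi>: "test_fun (U \<union> V) \<phi>"
  let ?d = "\<lambda>\<phi> x. frechet_derivative \<phi> (at x) b"
  have m': "((\<lambda>x. 1 - m x) has_derivative (\<lambda>v. - Dm x v)) (at x)" if "x \<in> W" for x
    using m(1)[OF that] by (auto intro!: derivative_eq_intros)
  have cm': "continuous_on W (\<lambda>x. - Dm x b)" if "b \<in> Basis" for b
    using m(2)[OF that] by (intro continuous_intros)
  have t1: "test_fun U (\<lambda>x. m x * \<phi> x)"
    by (rule test_fun_mult(1)[OF \<phi> W m C(1)]) (use C W in auto)
  have t2: "test_fun V (\<lambda>x. (1 - m x) * \<phi> x)"
    by (rule test_fun_mult(1)[OF \<phi> W m' cm' D(1)]) (use D W in auto)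
  note t1' = test_fun_subset[OF t1, of "U \<union> V"] and t2' = test_fun_subset[OF t2, of "U \<union> V"]
  have "((\<lambda>x. m x * \<phi> x + (1 - m x) * \<phi> x) has_derivative (\<lambda>v. frechet_derivative (\<lambda>x. m x * \<phi> x) (at x) v +
       frechet_derivative (\<lambda>x. (1 - m x) * \<phi> x) (at x) v)) (at x)" for x
    by (intro has_derivative_add test_fun_has_derivative[OF t1] test_fun_has_derivative[OF t2])
  then have d: "?d \<phi> x = ?d (\<lambda>x. m x * \<phi> x) x + ?d (\<lambda>x. (1 - m x) * \<phi> x) x" for x
    by (subst frechet_derivative_eqI[of \<phi>]) (auto simp: algebra_simps)
  have "(LBINT x. u x * ?d \<phi> x) = (LBINT x. u x * ?d (\<lambda>x. m x * \<phi> x) x) + (LBINT x. u x * ?d (\<lambda>x. (1 - m x) * \<phi> x) x)"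
    unfolding d distrib_left using u t1' t2' b by (simp add: L2_on_test_deriv_integrable)
  also have "\<dots> = - ((LBINT x. g x * (m x * \<phi> x)) + (LBINT x. g x * ((1 - m x) * \<phi> x)))"
    by (simp add: weak_derivD[OF g(1) t1] weak_derivD[OF g(2) t2])
  also have "\<dots> = - (LBINT x. g x * \<phi> x)"
    using L2_on_test_integrable[OF L t1'] L2_on_test_integrable[OF L t2']
    by (subst Bochner_Integration.integral_add[symmetric]) (auto simp: algebra_simps)
  finally show "(LBINT x. u x * ?d \<phi> x) = - (LBINT x. g x * \<phi> x)" .
qed

subsection \<open>Polar coordinates\<close>

lemma nn_integral_lborel_affine:
  fixes f :: "'a::euclidean_space \<Rightarrow> ennreal"
  assumes [measurable]: "f \<in> borel_measurable borel" and c: "c \<noteq> 0"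
  shows "(\<integral>\<^sup>+x. f x \<partial>lborel) = ennreal (\<bar>c\<bar> ^ DIM('a)) * (\<integral>\<^sup>+x. f (a + c *\<^sub>R x) \<partial>lborel)"
  by (subst lborel_affine[OF c, of a]) (simp add: nn_integral_density nn_integral_distr nn_integral_cmult)

lemma hat_measurable [measurable]: "(\<lambda>x::'a::euclidean_space. x /\<^sub>R norm x) \<in> borel_measurable borel"
  by measurable

lemma hat_scale: "r > 0 \<Longrightarrow> (r *\<^sub>R x) /\<^sub>R norm (r *\<^sub>R x) = x /\<^sub>R norm x"
  by (simp add: field_simps)

lemma hat_hat: "(x /\<^sub>R norm x) /\<^sub>R norm (x /\<^sub>R norm x) = x /\<^sub>R norm x"
  by (cases "x = 0") auto

lemma AE_lborel_nonzero: "AE x in (lborel :: 'a::euclidean_space measure). x \<noteq> 0"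
  using AE_lborel_singleton[of 0] by simp

text \<open>Normalises the polar coordinate formula: with r = |y| it says that the weight d |y|^d /
  s^(d+1) on s > |y| has mass 1.\<close>

lemma nn_integral_radial_tail:
  assumes r: "(r::real) > 0" and d: "(d::nat) > 0"
  shows "(\<integral>\<^sup>+s. ennreal (indicator {r<..} s * (real d / s ^ (d + 1))) \<partial>lborel) = ennreal (1 / r ^ d)"
proof -
  have "(\<integral>\<^sup>+s. ennreal (indicator {r<..} s * (real d / s ^ (d + 1))) \<partial>lborel)
      = (\<integral>\<^sup>+s. ennreal (real d / s ^ (d + 1)) * indicator {r..} s \<partial>lborel)"
    by (intro nn_integral_cong_AE) (use AE_lborel_singleton[of r] in \<open>eventually_elim, auto split: split_indicator\<close>)
  also have "\<dots> = ennreal (0 - (- (1 / r ^ d)))"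
  proof (rule nn_integral_FTC_atLeast)
    fix x assume x: "r \<le> x"
    show "((\<lambda>s. - (1 / s ^ d)) has_real_derivative real d / x ^ (d + 1)) (at x)"
    proof -
      have "((\<lambda>s. - (1 / s ^ d)) has_real_derivative - ((0 * x ^ d - 1 * (real d * x ^ (d - Suc 0))) / (x ^ d * x ^ d))) (at x)"
        using x r by (auto intro!: derivative_eq_intros)
      moreover have "- ((0 * x ^ d - 1 * (real d * x ^ (d - Suc 0))) / (x ^ d * x ^ d)) = real d / x ^ (d + 1)"
        using x r d by (cases d) (auto simp: field_simps)
      ultimately show ?thesis by simp
    qed
    show "0 \<le> real d / x ^ (d + 1)" using x r by auto
  next
    have "((\<lambda>s::real. inverse (s ^ d)) \<longlongrightarrow> 0) at_top"
      by (rule tendsto_inverse_0_at_top) (rule filterlim_pow_at_top[OF d filterlim_ident])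
    from tendsto_minus[OF this] show "((\<lambda>s::real. - (1 / s ^ d)) \<longlongrightarrow> 0) at_top" by (simp add: field_simps)
  qed auto
  finally show ?thesis by simp
qed

text \<open>The sphere is represented by the ball: the angular variable is a point x of the unit
  ball, of which only the direction x/|x| enters. The factor d compensates because the unit sphere
  has d times the volume of the unit ball.\<close>

definition polar_dens :: "real \<times> 'a::euclidean_space \<Rightarrow> real" where
  "polar_dens = (\<lambda>(\<rho>, x). indicator {0<..} \<rho> * (real DIM('a) * \<rho> ^ (DIM('a) - 1)) * indicator (ball 0 1) x)"

lemma polar_dens_nonneg: "0 \<le> polar_dens z"
  by (auto simp: polar_dens_def indicator_def split: prod.split)

lemma polar_dens_measurable [measurable]: "polar_dens \<in> borel_measurable (lborel \<Otimes>\<^sub>M lborel)"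
proof -
  have [measurable]: "(ball 0 1 :: 'a set) \<in> sets borel" by simp
  show ?thesis unfolding polar_dens_def by measurable
qed

text \<open>Proved without a surface measure, by Tonelli and two substitutions. For fixed x put
  \<rho> = |x| s, which turns the argument of F into s x; for fixed s put y = s x. What remains is
  F(y) times the integral of d |y|^d / s^(d+1) over s > |y|, which is 1.\<close>

lemma nn_integral_polar:
  fixes F :: "'a::euclidean_space \<Rightarrow> ennreal"
  assumes F[measurable]: "F \<in> borel_measurable borel"
  shows "(\<integral>\<^sup>+y. F y \<partial>lborel) = (\<integral>\<^sup>+\<rho>. \<integral>\<^sup>+x. ennreal (polar_dens (\<rho>, x)) * F (\<rho> *\<^sub>R (x /\<^sub>R norm x)) \<partial>lborel \<partial>lborel)"
proof -
  let ?d = "DIM('a)"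
  let ?B = "ball 0 1 :: 'a set"
  have [measurable]: "?B \<in> sets borel" by simp
  have d: "?d > 0" by simp
  have "(\<integral>\<^sup>+\<rho>. \<integral>\<^sup>+x. ennreal (polar_dens (\<rho>, x)) * F (\<rho> *\<^sub>R (x /\<^sub>R norm x)) \<partial>lborel \<partial>lborel)
      = (\<integral>\<^sup>+x. \<integral>\<^sup>+\<rho>. ennreal (polar_dens (\<rho>, x)) * F (\<rho> *\<^sub>R (x /\<^sub>R norm x)) \<partial>lborel \<partial>lborel)"
    by (rule lborel_pair.Fubini'[symmetric]) measurable
  also have "\<dots> = (\<integral>\<^sup>+x. \<integral>\<^sup>+s. ennreal (indicator {0<..} s * (real ?d * s ^ (?d - 1)) * (indicator ?B x * norm x ^ ?d)) * F (s *\<^sub>R x) \<partial>lborel \<partial>lborel)"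
  proof (intro nn_integral_cong_AE)
    show "AE x in lborel. (\<integral>\<^sup>+\<rho>. ennreal (polar_dens (\<rho>, x)) * F (\<rho> *\<^sub>R (x /\<^sub>R norm x)) \<partial>lborel)
      = (\<integral>\<^sup>+s. ennreal (indicator {0<..} s * (real ?d * s ^ (?d - 1)) * (indicator ?B x * norm x ^ ?d)) * F (s *\<^sub>R x) \<partial>lborel)"
      using AE_lborel_nonzero
    proof eventually_elim
      case (elim x)
      have "(\<integral>\<^sup>+\<rho>. ennreal (polar_dens (\<rho>, x)) * F (\<rho> *\<^sub>R (x /\<^sub>R norm x)) \<partial>lborel)
        = ennreal \<bar>norm x\<bar> * (\<integral>\<^sup>+s. ennreal (polar_dens (0 + norm x * s, x)) * F ((0 + norm x * s) *\<^sub>R (x /\<^sub>R norm x)) \<partial>lborel)"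
        by (rule nn_integral_real_affine) (use elim in \<open>auto simp: polar_dens_def\<close>)
      also have "\<dots> = (\<integral>\<^sup>+s. ennreal (norm x) * (ennreal (polar_dens (norm x * s, x)) * F (s *\<^sub>R x)) \<partial>lborel)"
      proof -
        have eq: "(0 + norm x * s) *\<^sub>R (x /\<^sub>R norm x) = s *\<^sub>R x" for s using elim by (simp add: field_simps)
        show ?thesis unfolding eq
          by (subst nn_integral_cmult[symmetric]) (auto simp: polar_dens_def)
      qed
      also have "\<dots> = (\<integral>\<^sup>+s. ennreal (indicator {0<..} s * (real ?d * s ^ (?d - 1)) * (indicator ?B x * norm x ^ ?d)) * F (s *\<^sub>R x) \<partial>lborel)"
      proof (intro nn_integral_cong)
        fix s
        have "norm x * polar_dens (norm x * s, x) = indicator {0<..} s * (real ?d * s ^ (?d - 1)) * (indicator ?B x * norm x ^ ?d)"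
          using elim by (cases ?d) (auto simp: polar_dens_def power_mult_distrib zero_less_mult_iff split: split_indicator)
        then show "ennreal (norm x) * (ennreal (polar_dens (norm x * s, x)) * F (s *\<^sub>R x)) =
            ennreal (indicator {0<..} s * (real ?d * s ^ (?d - 1)) * (indicator ?B x * norm x ^ ?d)) * F (s *\<^sub>R x)"
          by (simp add: mult.assoc[symmetric] ennreal_mult[symmetric] polar_dens_nonneg)
      qed
      finally show ?case .
    qed
  qed
  also have "\<dots> = (\<integral>\<^sup>+s. \<integral>\<^sup>+x. ennreal (indicator {0<..} s * (real ?d * s ^ (?d - 1)) * (indicator ?B x * norm x ^ ?d)) * F (s *\<^sub>R x) \<partial>lborel \<partial>lborel)"
    by (rule lborel_pair.Fubini') measurable
  also have "\<dots> = (\<integral>\<^sup>+s. \<integral>\<^sup>+y. ennreal (indicator {norm y<..} s * (real ?d / s ^ (?d + 1)) * norm y ^ ?d) * F y \<partial>lborel \<partial>lborel)"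
  proof (rule nn_integral_cong)
    fix s :: real
    let ?H = "\<lambda>y::'a. ennreal (indicator {norm y<..} s * (real ?d / s ^ (?d + 1)) * norm y ^ ?d) * F y"
    show "(\<integral>\<^sup>+x. ennreal (indicator {0<..} s * (real ?d * s ^ (?d - 1)) * (indicator ?B x * norm x ^ ?d)) * F (s *\<^sub>R x) \<partial>lborel) = (\<integral>\<^sup>+y. ?H y \<partial>lborel)"
    proof (cases "s > 0")
      case False
      have "indicator {norm y<..} s = (0::real)" for y :: 'a
        using False order_le_less_trans[OF norm_ge_zero[of y], of s] by (auto simp: indicator_def)
      then have H0: "?H y = 0" for y by simp
      show ?thesis unfolding H0 using False by simp
    next
      case True
      have m: "?H \<in> borel_measurable borel"
      proof -
        show ?thesis unfolding greaterThan_def by measurable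
      qed
      have "(\<integral>\<^sup>+y. ?H y \<partial>lborel) = ennreal (\<bar>s\<bar> ^ ?d) * (\<integral>\<^sup>+x. ?H (0 + s *\<^sub>R x) \<partial>lborel)"
        by (rule nn_integral_lborel_affine[OF m]) (use True in simp)
      also have "\<dots> = (\<integral>\<^sup>+x. ennreal (\<bar>s\<bar> ^ ?d) * ?H (0 + s *\<^sub>R x) \<partial>lborel)"
        using measurable_compose[OF _ m, of "\<lambda>x. 0 + s *\<^sub>R x" lborel] by (intro nn_integral_cmult[symmetric]) auto
      also have "\<dots> = (\<integral>\<^sup>+x. ennreal (indicator {0<..} s * (real ?d * s ^ (?d - 1)) * (indicator ?B x * norm x ^ ?d)) * F (s *\<^sub>R x) \<partial>lborel)"
      proof (intro nn_integral_cong)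
        fix x :: 'a
        have i: "(indicator {norm (s *\<^sub>R x)<..} s :: real) = indicator ?B x"
          using True by (auto simp: indicator_def)
        have p: "s ^ ?d * ((real ?d / s ^ (?d + 1)) * (s * norm x) ^ ?d) = real ?d * s ^ (?d - 1) * norm x ^ ?d"
          using True by (cases ?d) (auto simp: power_mult_distrib field_simps)
        have "s ^ ?d * (indicator {norm (s *\<^sub>R x)<..} s * (real ?d / s ^ (?d + 1)) * norm (s *\<^sub>R x) ^ ?d) =
           indicator {0<..} s * (real ?d * s ^ (?d - 1)) * (indicator ?B x * norm x ^ ?d)"
          unfolding i using p True by (auto simp: indicator_def)
        then show "ennreal (\<bar>s\<bar> ^ ?d) * ?H (0 + s *\<^sub>R x) = ennreal (indicator {0<..} s * (real ?d * s ^ (?d - 1)) * (indicator ?B x * norm x ^ ?d)) * F (s *\<^sub>R x)"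
          using True by (simp add: mult.assoc[symmetric] ennreal_mult[symmetric])
      qed
      finally show ?thesis by simp
    qed
  qed
  also have "\<dots> = (\<integral>\<^sup>+y. \<integral>\<^sup>+s. ennreal (indicator {norm y<..} s * (real ?d / s ^ (?d + 1)) * norm y ^ ?d) * F y \<partial>lborel \<partial>lborel)"
  proof -
    have "(\<lambda>(s, y). indicator {norm y<..} s :: real) = (\<lambda>z. indicator {z. norm (snd z) < fst z} z)"
      for z :: "real \<times> 'a" by (auto simp: indicator_def)
    have [measurable]: "(\<lambda>(y, s). ennreal (indicator {norm y<..} s * (real ?d / s ^ (?d + 1)) * norm y ^ ?d) * F y) \<in> borel_measurable (lborel \<Otimes>\<^sub>M lborel)"
      unfolding greaterThan_def by measurable
    show ?thesis
      by (rule lborel_pair.Fubini'[symmetric]) measurable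
  qed
  also have "\<dots> = (\<integral>\<^sup>+y. F y \<partial>lborel)"
  proof (intro nn_integral_cong_AE)
    show "AE y in lborel. (\<integral>\<^sup>+s. ennreal (indicator {norm y<..} s * (real ?d / s ^ (?d + 1)) * norm y ^ ?d) * F y \<partial>lborel) = F y"
      using AE_lborel_nonzero
    proof eventually_elim
      case (elim y)
      then have ny: "norm y > 0" by simp
      have "(\<integral>\<^sup>+s. ennreal (indicator {norm y<..} s * (real ?d / s ^ (?d + 1)) * norm y ^ ?d) * F y \<partial>lborel)
         = (\<integral>\<^sup>+s. ennreal (indicator {norm y<..} s * (real ?d / s ^ (?d + 1))) * (ennreal (norm y ^ ?d) * F y) \<partial>lborel)"
      proof (rule nn_integral_cong)
        fix s
        have "0 \<le> indicator {norm y<..} s * (real ?d / s ^ (?d + 1))"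
          using order.strict_trans[OF ny, of s] by (auto simp: indicator_def)
        then show "ennreal (indicator {norm y<..} s * (real ?d / s ^ (?d + 1)) * norm y ^ ?d) * F y =
          ennreal (indicator {norm y<..} s * (real ?d / s ^ (?d + 1))) * (ennreal (norm y ^ ?d) * F y)"
          by (subst ennreal_mult) (simp_all only: mult.assoc, simp)
      qed
      also have "\<dots> = ennreal (1 / norm y ^ ?d) * (ennreal (norm y ^ ?d) * F y)"
        unfolding nn_integral_radial_tail[OF ny d, symmetric]
        by (rule nn_integral_multc) (unfold greaterThan_def, measurable)
      also have "\<dots> = F y" using ny by (simp add: mult.assoc[symmetric] ennreal_mult[symmetric])
      finally show ?case .
    qed
  qed
  finally show ?thesis by simp
qed

definition polar_map :: "real \<times> 'a::euclidean_space \<Rightarrow> 'a" where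
  "polar_map = (\<lambda>(\<rho>, x). \<rho> *\<^sub>R (x /\<^sub>R norm x))"

lemma polar_map_measurable [measurable]: "polar_map \<in> lborel \<Otimes>\<^sub>M lborel \<rightarrow>\<^sub>M borel"
  unfolding polar_map_def by measurable

text \<open>With Lebesgue measure written as the image of a weighted product measure, integrability,
  integrals and null sets all transfer by general facts about densities and images.\<close>

lemma lborel_polar:
  "lborel = distr (density (lborel \<Otimes>\<^sub>M lborel) (\<lambda>z. ennreal (polar_dens z))) borel (polar_map :: _ \<Rightarrow> 'a::euclidean_space)"
proof (rule measure_eqI)
  fix A :: "'a set" assume "A \<in> sets lborel"
  then have A[measurable]: "A \<in> sets borel" by simp
  have "emeasure lborel A = (\<integral>\<^sup>+y. indicator A y \<partial>lborel)" by simp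
  also have "\<dots> = (\<integral>\<^sup>+\<rho>. \<integral>\<^sup>+x. ennreal (polar_dens (\<rho>, x)) * indicator A (polar_map (\<rho>, x)) \<partial>lborel \<partial>lborel)"
    unfolding polar_map_def prod.case by (rule nn_integral_polar) simp
  also have "\<dots> = (\<integral>\<^sup>+z. ennreal (polar_dens z) * indicator A (polar_map z) \<partial>(lborel \<Otimes>\<^sub>M lborel))"
    by (rule lborel.nn_integral_fst[where f="\<lambda>z. ennreal (polar_dens z) * indicator A (polar_map z)"]) measurable
  also have "\<dots> = emeasure (density (lborel \<Otimes>\<^sub>M lborel) (\<lambda>z. ennreal (polar_dens z))) (polar_map -` A \<inter> space (lborel \<Otimes>\<^sub>M lborel))"
    using measurable_sets[OF polar_map_measurable A]
    by (subst emeasure_density) (auto intro!: nn_integral_cong split: split_indicator simp: space_pair_measure)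
  finally show "emeasure lborel A = emeasure (distr (density (lborel \<Otimes>\<^sub>M lborel) (\<lambda>z. ennreal (polar_dens z))) borel polar_map) A"
    by (subst emeasure_distr) auto
qed simp

lemma integrable_polar:
  fixes f :: "'a::euclidean_space \<Rightarrow> real"
  assumes [measurable]: "f \<in> borel_measurable borel"
  shows "integrable lborel f \<longleftrightarrow> integrable (lborel \<Otimes>\<^sub>M lborel) (\<lambda>z. polar_dens z * f (polar_map z))"
  by (subst lborel_polar) (simp add: integrable_distr_eq integrable_density polar_dens_nonneg)

lemma integral_polar:
  fixes f :: "'a::euclidean_space \<Rightarrow> real"
  assumes [measurable]: "f \<in> borel_measurable borel"
  shows "(LBINT x. f x) = (\<integral>z. polar_dens z * f (polar_map z) \<partial>(lborel \<Otimes>\<^sub>M lborel))"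
  by (subst lborel_polar) (simp add: integral_distr integral_density polar_dens_nonneg)

lemma AE_polar:
  assumes "AE y in (lborel :: 'a::euclidean_space measure). P y"
  shows "AE \<rho> in lborel. \<rho> > 0 \<longrightarrow> (AE x in lborel. x \<in> ball 0 1 \<longrightarrow> P (\<rho> *\<^sub>R (x /\<^sub>R norm x)))"
proof -
  let ?M = "density (lborel \<Otimes>\<^sub>M lborel) (\<lambda>z. ennreal (polar_dens z)) :: (real \<times> 'a) measure"
  have "AE z in ?M. P (polar_map z)"
  proof -
    have m: "polar_map \<in> ?M \<rightarrow>\<^sub>M borel" by simp
    have "AE x in distr ?M borel polar_map. P x" using assms by (subst (asm) lborel_polar)
    then show ?thesis by (rule AE_distrD[OF m])
  qed
  then have "AE z in lborel \<Otimes>\<^sub>M (lborel :: 'a measure). polar_dens z > 0 \<longrightarrow> P (polar_map z)"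
    by (subst (asm) AE_density) auto
  from lborel_pair.AE_pair[OF this] show ?thesis
    by eventually_elim (auto simp: polar_dens_def polar_map_def)
qed

lemma nn_integral_polar_product:
  fixes u :: "'a::euclidean_space \<Rightarrow> ennreal"
  assumes [measurable]: "W \<in> borel_measurable borel" "(\<lambda>x. u (x /\<^sub>R norm x)) \<in> borel_measurable borel"
  shows "(\<integral>\<^sup>+y. W (norm y) * u (y /\<^sub>R norm y) \<partial>lborel) =
    (\<integral>\<^sup>+\<rho>. ennreal (indicator {0<..} \<rho> * (real DIM('a) * \<rho> ^ (DIM('a) - 1))) * W \<rho> \<partial>lborel) *
    (\<integral>\<^sup>+x. indicator (ball 0 1) x * u (x /\<^sub>R norm x) \<partial>lborel)"
proof -
  have [measurable]: "(ball 0 1 :: 'a set) \<in> sets borel" by simp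
  let ?B = "\<integral>\<^sup>+x. indicator (ball 0 1) x * u (x /\<^sub>R norm x) \<partial>lborel"
  let ?r = "\<lambda>\<rho>. ennreal (indicator {0<..} \<rho> * (real DIM('a) * \<rho> ^ (DIM('a) - 1))) * W \<rho>"
  have "(\<integral>\<^sup>+y. W (norm y) * u (y /\<^sub>R norm y) \<partial>lborel) =
     (\<integral>\<^sup>+\<rho>. \<integral>\<^sup>+x. ennreal (polar_dens (\<rho>, x)) * (W (norm (\<rho> *\<^sub>R (x /\<^sub>R norm x))) *
        u ((\<rho> *\<^sub>R (x /\<^sub>R norm x)) /\<^sub>R norm (\<rho> *\<^sub>R (x /\<^sub>R norm x)))) \<partial>lborel \<partial>lborel)"
    by (rule nn_integral_polar) measurable
  also have "\<dots> = (\<integral>\<^sup>+\<rho>. \<integral>\<^sup>+x. ?r \<rho> * (indicator (ball 0 1) x * u (x /\<^sub>R norm x)) \<partial>lborel \<partial>lborel)"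
  proof (rule nn_integral_cong, rule nn_integral_cong_AE)
    fix \<rho> :: real
    show "AE x in lborel. ennreal (polar_dens (\<rho>, x)) * (W (norm (\<rho> *\<^sub>R (x /\<^sub>R norm x))) *
        u ((\<rho> *\<^sub>R (x /\<^sub>R norm x)) /\<^sub>R norm (\<rho> *\<^sub>R (x /\<^sub>R norm x)))) = ?r \<rho> * (indicator (ball 0 1) x * u (x /\<^sub>R norm x))"
      using AE_lborel_nonzero
    proof eventually_elim
      case (elim x)
      show ?case
      proof (cases "\<rho> > 0 \<and> x \<in> ball 0 1")
        case True
        then have 1: "norm (\<rho> *\<^sub>R (x /\<^sub>R norm x)) = \<rho>" using elim by simp
        have 2: "(\<rho> *\<^sub>R (x /\<^sub>R norm x)) /\<^sub>R \<rho> = x /\<^sub>R norm x"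
          using True by simp
        show ?thesis unfolding 1 2 using True by (simp add: polar_dens_def mult.assoc)
      qed (auto simp: polar_dens_def)
    qed
  qed
  also have "\<dots> = (\<integral>\<^sup>+\<rho>. ?r \<rho> * ?B \<partial>lborel)"
    by (intro nn_integral_cong nn_integral_cmult) simp
  also have "\<dots> = (\<integral>\<^sup>+\<rho>. ?r \<rho> \<partial>lborel) * ?B"
    by (rule nn_integral_multc) simp
  finally show ?thesis .
qed

section \<open>Square integrable functions on the sphere\<close>

abbreviation sph_lift :: "('a::euclidean_space \<Rightarrow> real) \<Rightarrow> 'a \<Rightarrow> real" where
  "sph_lift u \<equiv> (\<lambda>x. indicator (ball 0 1) x * u (x /\<^sub>R norm x))"

lemma L2S_iff: "L2S u \<longleftrightarrow> sfun u \<and> sq_int lborel (sph_lift u)"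
  by (simp add: L2S_def L2_on_iff)

lemma L2S_norm_eq: "L2S_norm (u :: 'a::euclidean_space \<Rightarrow> real) = sqrt (real DIM('a)) * l2 lborel (sph_lift u)"
  by (simp add: L2S_norm_def sph_int_def set_integral_square real_sqrt_mult)

lemma sph_int_square: "sph_int (\<lambda>x. (u x)\<^sup>2) = (L2S_norm u)\<^sup>2"
  by (simp add: L2S_norm_eq sph_int_def set_integral_square power_mult_distrib)

lemma sph_inner_eq: "sph_inner u (v :: 'a::euclidean_space \<Rightarrow> real) = real DIM('a) * (LBINT x. sph_lift u x * sph_lift v x)"
proof -
  have "(\<lambda>x. indicator (ball 0 1) x * (u (x /\<^sub>R norm x) * v (x /\<^sub>R norm x))) = (\<lambda>x. sph_lift u x * sph_lift v x)"
    by (auto simp: indicator_def)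
  then show ?thesis by (simp add: sph_inner_def sph_int_def set_lebesgue_integral_def)
qed

lemma L2S_norm_nonneg [simp]: "0 \<le> L2S_norm u"
  by (simp add: L2S_norm_eq)

lemma Cauchy_Schwarz_sph:
  assumes "L2S u" "L2S v"
  shows "\<bar>sph_inner u v\<bar> \<le> L2S_norm u * L2S_norm (v :: 'a::euclidean_space \<Rightarrow> real)"
proof -
  have "\<bar>sph_inner u v\<bar> = real DIM('a) * \<bar>\<integral>x. sph_lift u x * sph_lift v x \<partial>lborel\<bar>"
    by (simp add: sph_inner_eq abs_mult)
  also have "\<dots> \<le> real DIM('a) * (l2 lborel (sph_lift u) * l2 lborel (sph_lift v))"
    using assms by (intro mult_left_mono Cauchy_Schwarz_l2) (auto simp: L2S_iff)
  also have "\<dots> = L2S_norm u * L2S_norm v" by (simp add: L2S_norm_eq)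
  finally show ?thesis .
qed

lemma L2S_add: "L2S u \<Longrightarrow> L2S v \<Longrightarrow> L2S (\<lambda>x. u x + v x)"
  unfolding L2S_def sfun_def using L2_on_add by fastforce

lemma L2S_cmult: "L2S u \<Longrightarrow> L2S (\<lambda>x. c * u x)"
  unfolding L2S_def sfun_def using L2_on_cmult by fastforce

lemma L2S_diff: "L2S u \<Longrightarrow> L2S v \<Longrightarrow> L2S (\<lambda>x. u x - v x)"
  using L2S_add[OF _ L2S_cmult[of v "-1"]] by simp

lemma sph_inner_diff_left:
  "L2S u \<Longrightarrow> L2S v \<Longrightarrow> L2S w \<Longrightarrow> sph_inner (\<lambda>x. u x - v x) w = sph_inner u w - sph_inner v w"
  using sq_int_mult[of lborel "sph_lift u" "sph_lift w"] sq_int_mult[of lborel "sph_lift v" "sph_lift w"]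
  by (simp add: sph_inner_eq L2S_iff left_diff_distrib right_diff_distrib)

lemma sph_inner_self: "sph_inner u u = (L2S_norm u)\<^sup>2"
  by (simp add: sph_inner_def flip: sph_int_square) (simp add: power2_eq_square)

lemma L2S_norm_cmult: "L2S_norm (\<lambda>x. c * u x) = \<bar>c\<bar> * L2S_norm u"
proof -
  have "sph_lift (\<lambda>x. c * u x) = (\<lambda>x. c * sph_lift u x)" by auto
  then show ?thesis unfolding L2S_norm_eq by (simp only: l2_cmult mult.left_commute)
qed

text \<open>Composing the lift to the ball with x \<mapsto> x/(2|x|) recovers the 0-homogeneous
  extension on the whole space, because radius 1/2 lies inside the ball and the direction is
  unchanged.\<close>

lemma L2S_hat_measurable:
  assumes "L2S u" shows "(\<lambda>x. u (x /\<^sub>R norm x)) \<in> borel_measurable borel"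
proof -
  have g: "sph_lift u \<in> borel_measurable borel" using assms by (simp add: L2S_iff sq_int_def)
  have h: "(\<lambda>x::'a. (1/2) *\<^sub>R (x /\<^sub>R norm x)) \<in> borel_measurable borel" by measurable
  note m = measurable_compose[OF h g]
  have "sph_lift u ((1/2) *\<^sub>R (x /\<^sub>R norm x)) = u (x /\<^sub>R norm x)" for x :: 'a
  proof (cases "x = 0")
    case False
    then show ?thesis using hat_scale[of "1/2" "x /\<^sub>R norm x"] unfolding hat_hat by (auto simp: indicator_def)
  qed auto
  with m show ?thesis by (simp only:)
qed

lemma homogeneous_nn_integral:
  fixes u :: "'a::euclidean_space \<Rightarrow> real" and W :: "real \<Rightarrow> real"
  assumes [measurable]: "W \<in> borel_measurable borel" "(\<lambda>x. u (x /\<^sub>R norm x)) \<in> borel_measurable borel"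
  shows "(\<integral>\<^sup>+y. ennreal ((W (norm y) * u (y /\<^sub>R norm y))\<^sup>2) \<partial>lborel) =
    (\<integral>\<^sup>+\<rho>. ennreal (indicator {0<..} \<rho> * (real DIM('a) * \<rho> ^ (DIM('a) - 1)) * (W \<rho>)\<^sup>2) \<partial>lborel) *
    (\<integral>\<^sup>+x. ennreal ((sph_lift u x)\<^sup>2) \<partial>lborel)"
proof -
  have "(\<integral>\<^sup>+y. ennreal ((W (norm y) * u (y /\<^sub>R norm y))\<^sup>2) \<partial>lborel)
     = (\<integral>\<^sup>+y. ennreal ((W (norm y))\<^sup>2) * ennreal ((u (y /\<^sub>R norm y))\<^sup>2) \<partial>lborel)"
    by (simp add: power_mult_distrib ennreal_mult)
  also have "\<dots> = (\<integral>\<^sup>+\<rho>. ennreal (indicator {0<..} \<rho> * (real DIM('a) * \<rho> ^ (DIM('a) - 1))) * ennreal ((W \<rho>)\<^sup>2) \<partial>lborel) *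
    (\<integral>\<^sup>+x. indicator (ball 0 1) x * ennreal ((u (x /\<^sub>R norm x))\<^sup>2) \<partial>lborel)"
    by (rule nn_integral_polar_product[where W="\<lambda>r. ennreal ((W r)\<^sup>2)" and u="\<lambda>x. ennreal ((u x)\<^sup>2)"]) measurable
  also have "(\<integral>\<^sup>+\<rho>. ennreal (indicator {0<..} \<rho> * (real DIM('a) * \<rho> ^ (DIM('a) - 1))) * ennreal ((W \<rho>)\<^sup>2) \<partial>lborel) =
     (\<integral>\<^sup>+\<rho>. ennreal (indicator {0<..} \<rho> * (real DIM('a) * \<rho> ^ (DIM('a) - 1)) * (W \<rho>)\<^sup>2) \<partial>lborel)"
    by (intro nn_integral_cong) (auto simp: ennreal_mult'' split: split_indicator)
  also have "(\<integral>\<^sup>+x. indicator (ball 0 1) x * ennreal ((u (x /\<^sub>R norm x))\<^sup>2) \<partial>lborel) = (\<integral>\<^sup>+x. ennreal ((sph_lift u x)\<^sup>2) \<partial>lborel)"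
    by (intro nn_integral_cong) (auto split: split_indicator)
  finally show ?thesis .
qed

lemma sq_int_homogeneous:
  fixes u :: "'a::euclidean_space \<Rightarrow> real" and W :: "real \<Rightarrow> real"
  assumes u: "L2S u" and W[measurable]: "W \<in> borel_measurable borel"
    and WI: "integrable lborel (\<lambda>\<rho>. indicator {0<..} \<rho> * \<rho> ^ (DIM('a) - 1) * (W \<rho>)\<^sup>2)"
  shows "sq_int lborel (\<lambda>y. W (norm y) * u (y /\<^sub>R norm y))"
    and "(l2 lborel (\<lambda>y. W (norm y) * u (y /\<^sub>R norm y)))\<^sup>2 =
      (LBINT \<rho>. indicator {0<..} \<rho> * \<rho> ^ (DIM('a) - 1) * (W \<rho>)\<^sup>2) * (L2S_norm u)\<^sup>2"
proof -
  note [measurable] = L2S_hat_measurable[OF u]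
  let ?I = "\<integral>\<rho>. indicator {0<..} \<rho> * \<rho> ^ (DIM('a) - 1) * (W \<rho>)\<^sup>2 \<partial>lborel"
  have "(\<integral>\<^sup>+\<rho>. ennreal (indicator {0<..} \<rho> * (real DIM('a) * \<rho> ^ (DIM('a) - 1)) * (W \<rho>)\<^sup>2) \<partial>lborel)
     = (\<integral>\<^sup>+\<rho>. ennreal (real DIM('a) * (indicator {0<..} \<rho> * \<rho> ^ (DIM('a) - 1) * (W \<rho>)\<^sup>2)) \<partial>lborel)"
    by (simp add: mult_ac)
  also have "\<dots> = ennreal (real DIM('a) * ?I)"
    using WI by (subst nn_integral_eq_integral) (auto split: split_indicator)
  finally have 1: "(\<integral>\<^sup>+\<rho>. ennreal (indicator {0<..} \<rho> * (real DIM('a) * \<rho> ^ (DIM('a) - 1)) * (W \<rho>)\<^sup>2) \<partial>lborel) = ennreal (real DIM('a) * ?I)" .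
  have 2: "(\<integral>\<^sup>+x. ennreal ((sph_lift u x)\<^sup>2) \<partial>lborel) = ennreal ((l2 lborel (sph_lift u))\<^sup>2)"
    using u unfolding l2_power2 L2S_iff sq_int_def by (intro nn_integral_eq_integral) auto
  have I0: "0 \<le> ?I" by (intro integral_nonneg_AE AE_I2) (auto split: split_indicator)
  have 3: "(\<integral>\<^sup>+y. ennreal ((W (norm y) * u (y /\<^sub>R norm y))\<^sup>2) \<partial>lborel) = ennreal (real DIM('a) * ?I * (l2 lborel (sph_lift u))\<^sup>2)"
    unfolding homogeneous_nn_integral[OF W L2S_hat_measurable[OF u]] 1 2 using I0 by (intro ennreal_mult[symmetric]) auto
  show s: "sq_int lborel (\<lambda>y. W (norm y) * u (y /\<^sub>R norm y))"
    unfolding sq_int_def by (auto intro!: integrableI_nonneg simp: 3)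
  have "(l2 lborel (\<lambda>y. W (norm y) * u (y /\<^sub>R norm y)))\<^sup>2 = real DIM('a) * ?I * (l2 lborel (sph_lift u))\<^sup>2"
  proof -
    have "(\<integral>\<^sup>+y. ennreal ((W (norm y) * u (y /\<^sub>R norm y))\<^sup>2) \<partial>lborel) = ennreal ((l2 lborel (\<lambda>y. W (norm y) * u (y /\<^sub>R norm y)))\<^sup>2)"
      unfolding l2_power2 using s by (intro nn_integral_eq_integral) (auto simp: sq_int_def)
    then have "ennreal ((l2 lborel (\<lambda>y. W (norm y) * u (y /\<^sub>R norm y)))\<^sup>2) = ennreal (real DIM('a) * ?I * (l2 lborel (sph_lift u))\<^sup>2)"
      unfolding 3 by simp
    then show ?thesis using I0 by (subst (asm) ennreal_inj) auto
  qed
  then show "(l2 lborel (\<lambda>y. W (norm y) * u (y /\<^sub>R norm y)))\<^sup>2 = ?I * (L2S_norm u)\<^sup>2"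
    by (simp add: L2S_norm_eq power_mult_distrib)
qed

text \<open>The norm splits into a radial and an angular factor; the radial factor is nonzero, so
  finiteness of the product forces the angular factor to be finite. Measurability is read off on the
  unit sphere, which lies in the shell since a < 1 < b.\<close>

lemma L2S_if_homogeneous:
  fixes u :: "'a::euclidean_space \<Rightarrow> real"
  assumes u: "sfun u" and s: "sq_int lborel (\<lambda>y. indicator {a<..<b} (norm y) * u (y /\<^sub>R norm y))" and ab: "0 \<le> a" "a < 1" "1 < b"
  shows "L2S u"
proof -
  have m: "(\<lambda>x. u (x /\<^sub>R norm x)) \<in> borel_measurable borel"
  proof -
    let ?f = "\<lambda>y::'a. indicator {a<..<b} (norm y) * u (y /\<^sub>R norm y)"
    have "(\<lambda>x. ?f (x /\<^sub>R norm x)) \<in> borel_measurable borel"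
    proof (rule measurable_compose[OF hat_measurable])
      show "?f \<in> borel_measurable borel" using s by (simp add: sq_int_def)
    qed
    moreover have "?f (x /\<^sub>R norm x) = u (x /\<^sub>R norm x)" for x
      using u ab by (cases "x = 0") (auto simp: sfun_def)
    ultimately show ?thesis by (simp only:)
  qed
  let ?R = "\<integral>\<^sup>+\<rho>. ennreal (indicator {0<..} \<rho> * (real DIM('a) * \<rho> ^ (DIM('a) - 1)) * (indicator {a<..<b} \<rho>)\<^sup>2) \<partial>lborel"
  have "(\<integral>\<^sup>+y. ennreal ((indicator {a<..<b} (norm y) * u (y /\<^sub>R norm y))\<^sup>2) \<partial>lborel) < \<infinity>"
    using s unfolding sq_int_def integrable_iff_bounded by simp
  then have fin: "?R * (\<integral>\<^sup>+x. ennreal ((sph_lift u x)\<^sup>2) \<partial>lborel) < \<infinity>"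
    by (subst (asm) homogeneous_nn_integral) (use m in auto)
  have "?R \<noteq> 0"
  proof
    assume "?R = 0"
    then have "AE \<rho> in lborel. ennreal (indicator {0<..} \<rho> * (real DIM('a) * \<rho> ^ (DIM('a) - 1)) * (indicator {a<..<b} \<rho>)\<^sup>2) = 0"
      by (subst (asm) nn_integral_0_iff_AE) auto
    then have "AE \<rho> in lborel. \<rho> \<notin> {1<..<b}"
    proof eventually_elim
      case (elim \<rho>)
      have False if "\<rho> \<in> {1<..<b}"
      proof -
        have "0 < real DIM('a) * \<rho> ^ (DIM('a) - 1)" using that by simp
        moreover have "real DIM('a) * \<rho> ^ (DIM('a) - 1) \<le> 0" using elim that ab by (simp add: ennreal_eq_0_iff)
        ultimately show False by linarith
      qed
      then show ?case by auto
    qed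
    then have "{1<..<b} \<in> null_sets lborel" by (subst (asm) AE_iff_null_sets[symmetric]) auto
    then show False using ab by (auto simp: null_sets_def)
  qed
  with fin have "(\<integral>\<^sup>+x. ennreal ((sph_lift u x)\<^sup>2) \<partial>lborel) < \<infinity>"
    by (auto simp: ennreal_mult_less_top)
  moreover have "sph_lift u \<in> borel_measurable borel" using m by (intro borel_measurable_times borel_measurable_indicator) auto
  ultimately show ?thesis using u unfolding L2S_iff sq_int_def integrable_iff_bounded by simp
qed

text \<open>The adjoint of the 0-homogeneous extension to the annulus. It converts pairings in the
  ambient space into pairings on the sphere, the only ones in which the time derivative of the curve
  is tested.\<close>

definition radial_mean :: "('a::euclidean_space \<Rightarrow> real) \<Rightarrow> 'a \<Rightarrow> real" where
  "radial_mean f \<theta> = indicator (sphere 0 1) \<theta> * (LBINT \<rho>. indicator {1/2<..<2} \<rho> * \<rho> ^ (DIM('a) - 1) * f (\<rho> *\<^sub>R \<theta>))"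

text \<open>Square integrability: Cauchy-Schwarz along each ray, then polar coordinates. The adjoint
  identity is Fubini in polar coordinates, with the angular variable outside.\<close>

lemma L2S_radial_mean:
  fixes f :: "'a::euclidean_space \<Rightarrow> real"
  assumes f: "sq_int lborel f"
  shows "L2S (radial_mean f)"
    and "L2S u \<Longrightarrow> (LBINT y. indicator {1/2<..<2} (norm y) * u (y /\<^sub>R norm y) * f y) = sph_inner u (radial_mean f)"
proof -
  have fm[measurable]: "f \<in> borel_measurable borel" using f by (simp add: sq_int_def)
  have [measurable]: "(ball 0 1 :: 'a set) \<in> sets borel" "(sphere 0 1 :: 'a set) \<in> sets borel" by simp_all
  let ?w = "\<lambda>\<rho>. indicator {1/2<..<2::real} \<rho> * \<rho> ^ (DIM('a) - 1) :: real"
  have w0: "0 \<le> ?w \<rho>" for \<rho> by (auto split: split_indicator)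
  have w_int: "integrable lborel ?w"
  proof (rule Bochner_Integration.integrable_bound)
    show "integrable lborel (\<lambda>\<rho>. 2 ^ (DIM('a) - 1) * indicator {1/2<..<2::real} \<rho> :: real)" by simp
    show "AE \<rho> in lborel. norm (?w \<rho>) \<le> norm (2 ^ (DIM('a) - 1) * indicator {1/2<..<2::real} \<rho> :: real)"
      by (intro AE_I2) (auto split: split_indicator intro!: power_mono)
  qed simp
  have m: "radial_mean f \<in> borel_measurable borel"
    unfolding radial_mean_def[abs_def] by (intro borel_measurable_times lborel.borel_measurable_lebesgue_integral) measurable
  have sf: "sfun (radial_mean f)" by (auto simp: sfun_def radial_mean_def)
  have lm: "sph_lift (radial_mean f) \<in> borel_measurable borel"
    using measurable_compose[OF hat_measurable m] by (intro borel_measurable_times borel_measurable_indicator) auto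
  have bnd: "ennreal ((radial_mean f \<theta>)\<^sup>2) \<le> (\<integral>\<^sup>+\<rho>. ennreal (?w \<rho>) \<partial>lborel) * (\<integral>\<^sup>+\<rho>. ennreal (?w \<rho> * (f (\<rho> *\<^sub>R \<theta>))\<^sup>2) \<partial>lborel)" for \<theta>
  proof -
    have "ennreal \<bar>radial_mean f \<theta>\<bar> \<le> ennreal \<bar>\<integral>\<rho>. ?w \<rho> * f (\<rho> *\<^sub>R \<theta>) \<partial>lborel\<bar>"
      by (intro ennreal_leI) (auto simp: radial_mean_def indicator_def)
    also have "\<dots> \<le> (\<integral>\<^sup>+\<rho>. ennreal \<bar>?w \<rho> * f (\<rho> *\<^sub>R \<theta>)\<bar> \<partial>lborel)"
      using integral_norm_bound_ennreal[of lborel "\<lambda>\<rho>. ?w \<rho> * f (\<rho> *\<^sub>R \<theta>)"]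
        not_integrable_integral_eq[of lborel "\<lambda>\<rho>. ?w \<rho> * f (\<rho> *\<^sub>R \<theta>)"] by (cases "integrable lborel (\<lambda>\<rho>. ?w \<rho> * f (\<rho> *\<^sub>R \<theta>))") auto
    \<comment> \<open>The weight is split evenly between the two factors of Cauchy-Schwarz.\<close>
    also have "\<dots> = (\<integral>\<^sup>+\<rho>. ennreal (sqrt (?w \<rho>)) * ennreal (sqrt (?w \<rho>) * \<bar>f (\<rho> *\<^sub>R \<theta>)\<bar>) \<partial>lborel)"
      by (intro nn_integral_cong) (use w0 in \<open>simp add: abs_mult mult.assoc[symmetric] flip: ennreal_mult\<close>)
    finally have "(ennreal \<bar>radial_mean f \<theta>\<bar>)\<^sup>2 \<le> (\<integral>\<^sup>+\<rho>. ennreal (sqrt (?w \<rho>)) * ennreal (sqrt (?w \<rho>) * \<bar>f (\<rho> *\<^sub>R \<theta>)\<bar>) \<partial>lborel)\<^sup>2"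
      by (rule power_mono) simp
    also have "\<dots> \<le> (\<integral>\<^sup>+\<rho>. (ennreal (sqrt (?w \<rho>)))\<^sup>2 \<partial>lborel) * (\<integral>\<^sup>+\<rho>. (ennreal (sqrt (?w \<rho>) * \<bar>f (\<rho> *\<^sub>R \<theta>)\<bar>))\<^sup>2 \<partial>lborel)"
      by (rule Cauchy_Schwarz_nn_integral) measurable
    finally show ?thesis using w0 by (simp add: ennreal_power power_mult_distrib)
  qed
  have f2: "integrable (lborel \<Otimes>\<^sub>M lborel) (\<lambda>z. polar_dens z * (f (polar_map z))\<^sup>2)"
    using f by (subst integrable_polar[symmetric]) (auto simp: sq_int_def)
  show L: "L2S (radial_mean f)"
    unfolding L2S_iff
  proof (intro conjI sf)
    have "(\<integral>\<^sup>+x. ennreal ((sph_lift (radial_mean f) x)\<^sup>2) \<partial>lborel) \<le>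
       (\<integral>\<^sup>+x. (\<integral>\<^sup>+\<rho>. ennreal (?w \<rho>) \<partial>lborel) * (\<integral>\<^sup>+\<rho>. ennreal (polar_dens (\<rho>, x) * (f (polar_map (\<rho>, x)))\<^sup>2) \<partial>lborel) \<partial>lborel)"
    proof (intro nn_integral_mono)
      fix x :: 'a
      show "ennreal ((sph_lift (radial_mean f) x)\<^sup>2) \<le> (\<integral>\<^sup>+\<rho>. ennreal (?w \<rho>) \<partial>lborel) * (\<integral>\<^sup>+\<rho>. ennreal (polar_dens (\<rho>, x) * (f (polar_map (\<rho>, x)))\<^sup>2) \<partial>lborel)"
      proof (cases "x \<in> ball 0 1")
        case True
        then have "ennreal ((sph_lift (radial_mean f) x)\<^sup>2) = ennreal ((radial_mean f (x /\<^sub>R norm x))\<^sup>2)" by simp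
        also note bnd
        also have "(\<integral>\<^sup>+\<rho>. ennreal (?w \<rho> * (f (\<rho> *\<^sub>R (x /\<^sub>R norm x)))\<^sup>2) \<partial>lborel) \<le>
            (\<integral>\<^sup>+\<rho>. ennreal (polar_dens (\<rho>, x) * (f (polar_map (\<rho>, x)))\<^sup>2) \<partial>lborel)"
        proof (intro nn_integral_mono ennreal_leI)
          fix \<rho> :: real
          \<comment> \<open>The polar density carries the factor d \<ge> 1 and so dominates the
            radial weight.\<close>
          have "?w \<rho> \<le> polar_dens (\<rho>, x)"
          proof (cases "\<rho> > 0")
            case True
            have "1 * \<rho> ^ (DIM('a) - 1) \<le> real DIM('a) * \<rho> ^ (DIM('a) - 1)"
              using True DIM_positive[where 'a='a] by (intro mult_right_mono) (auto simp: Suc_leI simp del: DIM_positive)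
            then show ?thesis using \<open>x \<in> ball 0 1\<close> True by (auto simp: polar_dens_def split: split_indicator)
          qed (auto simp: polar_dens_def split: split_indicator)
          then show "?w \<rho> * (f (\<rho> *\<^sub>R (x /\<^sub>R norm x)))\<^sup>2 \<le> polar_dens (\<rho>, x) * (f (polar_map (\<rho>, x)))\<^sup>2"
            unfolding polar_map_def prod.case by (intro mult_right_mono) auto
        qed
        finally show ?thesis by (simp add: mult_left_mono)
      qed simp
    qed
    also have "\<dots> = (\<integral>\<^sup>+\<rho>. ennreal (?w \<rho>) \<partial>lborel) * (\<integral>\<^sup>+x. (\<integral>\<^sup>+\<rho>. ennreal (polar_dens (\<rho>, x) * (f (polar_map (\<rho>, x)))\<^sup>2) \<partial>lborel) \<partial>lborel)"
      by (rule nn_integral_cmult) measurable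
    also have "(\<integral>\<^sup>+x. (\<integral>\<^sup>+\<rho>. ennreal (polar_dens (\<rho>, x) * (f (polar_map (\<rho>, x)))\<^sup>2) \<partial>lborel) \<partial>lborel) =
       (\<integral>\<^sup>+z. ennreal (polar_dens z * (f (polar_map z))\<^sup>2) \<partial>(lborel \<Otimes>\<^sub>M lborel))"
      by (rule lborel_pair.nn_integral_snd) measurable
    also have "(\<integral>\<^sup>+\<rho>. ennreal (?w \<rho>) \<partial>lborel) * \<dots> < \<infinity>"
    proof -
      have "(\<integral>\<^sup>+\<rho>. ennreal (?w \<rho>) \<partial>lborel) < \<infinity>"
        using w_int w0 unfolding integrable_iff_bounded by (simp add: abs_of_nonneg)
      moreover have "(\<integral>\<^sup>+z. ennreal (polar_dens z * (f (polar_map z))\<^sup>2) \<partial>(lborel \<Otimes>\<^sub>M lborel)) < \<infinity>"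
        using f2 unfolding integrable_iff_bounded by (simp add: polar_dens_nonneg abs_mult)
      ultimately show ?thesis by (simp add: ennreal_mult_less_top)
    qed
    finally show "sq_int lborel (sph_lift (radial_mean f))"
      using lm by (auto simp: sq_int_def intro!: integrableI_nonneg)
  qed
  assume u: "L2S u"
  note [measurable] = L2S_hat_measurable[OF u]
  let ?F = "\<lambda>y. indicator {1/2<..<2} (norm y) * u (y /\<^sub>R norm y) * f y"
  have wc: "integrable lborel (\<lambda>\<rho>. indicator {0<..} \<rho> * \<rho> ^ (DIM('a) - 1) * (indicator {1/2<..<2::real} \<rho>)\<^sup>2 :: real)"
    by (rule Bochner_Integration.integrable_bound[OF w_int]) (auto split: split_indicator)
  have sF: "sq_int lborel (\<lambda>y. indicator {1/2<..<2} (norm y) * u (y /\<^sub>R norm y))"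
    by (rule sq_int_homogeneous(1)[OF u _ wc]) simp
  have iF: "integrable lborel ?F" by (rule sq_int_mult[OF sF f])
  have iP: "integrable (lborel \<Otimes>\<^sub>M lborel) (\<lambda>(\<rho>, x). polar_dens (\<rho>, x) * ?F (polar_map (\<rho>, x)))"
  proof -
    have "(\<lambda>(\<rho>, x). polar_dens (\<rho>, x) * ?F (polar_map (\<rho>, x))) = (\<lambda>z. polar_dens z * ?F (polar_map z))"
      by (simp add: fun_eq_iff)
    then show ?thesis using iF by (subst (asm) integrable_polar) (simp_all only:, measurable)
  qed
  have "(LBINT y. ?F y) = (\<integral>z. polar_dens z * ?F (polar_map z) \<partial>(lborel \<Otimes>\<^sub>M lborel))"
    by (rule integral_polar) measurable
  also have "\<dots> = (\<integral>z. (\<lambda>(\<rho>, x). polar_dens (\<rho>, x) * ?F (polar_map (\<rho>, x))) z \<partial>(lborel \<Otimes>\<^sub>M lborel))"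
    by (rule Bochner_Integration.integral_cong) (simp_all add: split_paired_all)
  also have "\<dots> = (LBINT x. \<integral>\<rho>. polar_dens (\<rho>, x) * ?F (polar_map (\<rho>, x)) \<partial>lborel)"
    by (rule lborel_pair.integral_snd[OF iP, symmetric])
  also have "\<dots> = (LBINT x. real DIM('a) * (sph_lift u x * sph_lift (radial_mean f) x))"
  proof (rule integral_cong_AE)
    show "(\<lambda>x. \<integral>\<rho>. polar_dens (\<rho>, x) * ?F (polar_map (\<rho>, x)) \<partial>lborel) \<in> borel_measurable lborel"
      by (rule borel_measurable_integrable[OF lborel_pair.integrable_snd[OF iP]])
    show "(\<lambda>x. real DIM('a) * (sph_lift u x * sph_lift (radial_mean f) x)) \<in> borel_measurable lborel"
      using lm by measurable
    show "AE x in lborel. (LBINT \<rho>. polar_dens (\<rho>, x) * ?F (polar_map (\<rho>, x))) = real DIM('a) * (sph_lift u x * sph_lift (radial_mean f) x)"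
      using AE_lborel_nonzero
    proof eventually_elim
      case (elim x)
      have "polar_dens (\<rho>, x) * ?F (polar_map (\<rho>, x)) = (real DIM('a) * (indicator (ball 0 1) x * u (x /\<^sub>R norm x))) * (?w \<rho> * f (\<rho> *\<^sub>R (x /\<^sub>R norm x)))" for \<rho>
      proof (cases "\<rho> > 0")
        case True
        then have 1: "norm (\<rho> *\<^sub>R (x /\<^sub>R norm x)) = \<rho>" using elim by simp
        have 2: "(\<rho> *\<^sub>R (x /\<^sub>R norm x)) /\<^sub>R \<rho> = x /\<^sub>R norm x" using True by simp
        show ?thesis unfolding polar_map_def prod.case 1 2 using True by (simp add: polar_dens_def)
      qed (auto simp: polar_dens_def split: split_indicator)
      then have "(LBINT \<rho>. polar_dens (\<rho>, x) * ?F (polar_map (\<rho>, x))) = (real DIM('a) * (indicator (ball 0 1) x * u (x /\<^sub>R norm x))) * (LBINT \<rho>. ?w \<rho> * f (\<rho> *\<^sub>R (x /\<^sub>R norm x)))"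
        by simp
      also have "(LBINT \<rho>. ?w \<rho> * f (\<rho> *\<^sub>R (x /\<^sub>R norm x))) = radial_mean f (x /\<^sub>R norm x)"
        using elim by (simp add: radial_mean_def)
      finally show ?case by (simp add: indicator_def)
    qed
  qed
  also have "\<dots> = sph_inner u (radial_mean f)" by (simp add: sph_inner_eq)
  finally show "(LBINT y. ?F y) = sph_inner u (radial_mean f)" .
qed

subsection \<open>Difference quotients\<close>

lemma integral_shift:
  fixes f :: "'a::euclidean_space \<Rightarrow> real"
  assumes "f \<in> borel_measurable borel"
  shows "(LBINT x. f (a + x)) = (LBINT x. f x)"
  using lborel_integral_affine[OF assms, of 1 a] by simp

lemma sq_int_shift: "sq_int lborel f \<Longrightarrow> sq_int lborel (\<lambda>x. f (a + x))"
  using sq_int_affine[of f 1 a] by simp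

lemma l2_shift: "sq_int lborel f \<Longrightarrow> l2 lborel (\<lambda>x. f (a + x)) = l2 lborel f"
  unfolding l2_def using integral_shift[of "\<lambda>x. (f x)\<^sup>2" a] by (auto simp: sq_int_def)

lemma integrable_indicator_Icc [simp]: "integrable lborel (indicator {0..h::real} :: real \<Rightarrow> real)"
  by (rule integrable_real_indicator) (auto simp: emeasure_lborel_Icc_eq)

lemma integrable_shift_product:
  fixes F :: "'a::euclidean_space \<Rightarrow> real"
  assumes F: "integrable lborel F"
  shows "integrable (lborel \<Otimes>\<^sub>M lborel) (\<lambda>(s, x). indicator {0..h} s * F (x + s *\<^sub>R b))"
proof -
  have [measurable]: "F \<in> borel_measurable borel" using F by simp
  show ?thesis
  proof (rule lborel_pair.Fubini_integrable)
    show "(\<lambda>(s, x). indicator {0..h} s * F (x + s *\<^sub>R b)) \<in> borel_measurable (lborel \<Otimes>\<^sub>M lborel)" by measurable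
    have "(LBINT x. norm (indicator {0..h} s * F (x + s *\<^sub>R b))) = indicator {0..h} s * (LBINT x. \<bar>F x\<bar>)" for s
      using integral_shift[of "\<lambda>x. \<bar>F x\<bar>" "s *\<^sub>R b"] by (simp add: abs_mult add.commute)
    then show "integrable lborel (\<lambda>s. \<integral>x. norm (case (s, x) of (s, x) \<Rightarrow> indicator {0..h} s * F (x + s *\<^sub>R b)) \<partial>lborel)"
      by simp
    show "AE s in lborel. integrable lborel (\<lambda>x. case (s, x) of (s, x) \<Rightarrow> indicator {0..h} s * F (x + s *\<^sub>R b))"
      using lborel_integrable_affine[OF F, of 1 "s *\<^sub>R b" for s] by (intro AE_I2) (simp add: add.commute)
  qed
qed

lemma integrable_shift_product2:
  fixes f g :: "'a::euclidean_space \<Rightarrow> real"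
  assumes f: "sq_int lborel f" and g: "sq_int lborel g"
  shows "integrable (lborel \<Otimes>\<^sub>M lborel) (\<lambda>(s, x). indicator {0..h} s * (f (x + s *\<^sub>R b) * g x))"
proof (rule Bochner_Integration.integrable_bound)
  have [measurable]: "f \<in> borel_measurable borel" "g \<in> borel_measurable borel" using f g by (auto simp: sq_int_def)
  show "(\<lambda>(s, x). indicator {0..h} s * (f (x + s *\<^sub>R b) * g x)) \<in> borel_measurable (lborel \<Otimes>\<^sub>M lborel)" by measurable
  have 1: "integrable (lborel \<Otimes>\<^sub>M lborel) (\<lambda>z. case z of (s, x) \<Rightarrow> indicator {0..h} s * (f (x + s *\<^sub>R b))\<^sup>2)"
    using integrable_shift_product[of "\<lambda>x. (f x)\<^sup>2" h b] f by (simp add: sq_int_def)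
  have 2: "integrable (lborel \<Otimes>\<^sub>M lborel) (\<lambda>z. case z of (s, x) \<Rightarrow> indicator {0..h} s * (g (x + s *\<^sub>R 0))\<^sup>2)"
    using integrable_shift_product[of "\<lambda>x. (g x)\<^sup>2" h 0] g by (simp add: sq_int_def)
  show "integrable (lborel \<Otimes>\<^sub>M lborel) (\<lambda>z. (case z of (s, x) \<Rightarrow> indicator {0..h} s * (f (x + s *\<^sub>R b))\<^sup>2)
     + (case z of (s, x) \<Rightarrow> indicator {0..h} s * (g (x + s *\<^sub>R 0))\<^sup>2))"
    using 1 2 by (rule Bochner_Integration.integrable_add)
  show "AE z in lborel \<Otimes>\<^sub>M lborel. norm (case z of (s, x) \<Rightarrow> indicator {0..h} s * (f (x + s *\<^sub>R b) * g x)) \<le>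
    norm ((case z of (s, x) \<Rightarrow> indicator {0..h} s * (f (x + s *\<^sub>R b))\<^sup>2)
     + (case z of (s, x) \<Rightarrow> indicator {0..h} s * (g (x + s *\<^sub>R 0))\<^sup>2))"
  proof (intro AE_I2)
    fix z :: "real \<times> 'a"
    obtain s x where z: "z = (s, x)" by force
    show "norm (case z of (s, x) \<Rightarrow> indicator {0..h} s * (f (x + s *\<^sub>R b) * g x)) \<le>
      norm ((case z of (s, x) \<Rightarrow> indicator {0..h} s * (f (x + s *\<^sub>R b))\<^sup>2)
       + (case z of (s, x) \<Rightarrow> indicator {0..h} s * (g (x + s *\<^sub>R 0))\<^sup>2))"
      using abs_mult_le_squares[of "f (x + s *\<^sub>R b)" "g x"] unfolding z by (auto split: split_indicator)
  qed
qed

text \<open>A Steklov average along \<open>b\<close>, not divided by h: for a smooth function with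
  derivative H in direction b it is the increment over the step h b.\<close>

definition steklov :: "real \<Rightarrow> 'a::euclidean_space \<Rightarrow> ('a \<Rightarrow> real) \<Rightarrow> 'a \<Rightarrow> real" where
  "steklov h b H x = (LBINT s. indicator {0..h} s * H (x + s *\<^sub>R b))"

text \<open>Cauchy-Schwarz in s gives one factor h; Fubini and translation invariance give the
  other.\<close>

lemma steklov_sq_int:
  fixes H :: "'a::euclidean_space \<Rightarrow> real"
  assumes H: "sq_int lborel H" and h: "0 \<le> h"
  shows "sq_int lborel (steklov h b H)" and "l2 lborel (steklov h b H) \<le> h * l2 lborel H"
proof -
  have [measurable]: "H \<in> borel_measurable borel" using H by (auto simp: sq_int_def)
  have m: "steklov h b H \<in> borel_measurable lborel"
    unfolding steklov_def[abs_def] by (rule lborel.borel_measurable_lebesgue_integral) measurable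
  have I: "integrable (lborel \<Otimes>\<^sub>M lborel) (\<lambda>(s, x). indicator {0..h} s * (H (x + s *\<^sub>R b))\<^sup>2)"
    using integrable_shift_product[of "\<lambda>x. (H x)\<^sup>2" h b] H by (simp add: sq_int_def)
  have ae: "AE x in lborel. (steklov h b H x)\<^sup>2 \<le> h * (LBINT s. indicator {0..h} s * (H (x + s *\<^sub>R b))\<^sup>2)"
    using lborel_pair.AE_integrable_snd[OF I]
  proof eventually_elim
    case (elim x)
    have s1: "sq_int lborel (indicator {0..h} :: real \<Rightarrow> real)" by (rule sq_int_indicator) (use h in auto)
    have s2: "sq_int lborel (\<lambda>s. indicator {0..h} s * H (x + s *\<^sub>R b))"
      using elim unfolding sq_int_def by (simp flip: indicator_power2_mult)
    have "\<bar>\<integral>s. indicator {0..h} s * (indicator {0..h} s * H (x + s *\<^sub>R b)) \<partial>lborel\<bar> \<le> l2 lborel (indicator {0..h} :: real \<Rightarrow> real) * l2 lborel (\<lambda>s. indicator {0..h} s * H (x + s *\<^sub>R b))"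
      by (rule Cauchy_Schwarz_l2[OF s1 s2])
    moreover have "(\<lambda>s. indicator {0..h} s * (indicator {0..h} s * H (x + s *\<^sub>R b))) = (\<lambda>s. indicator {0..h} s * H (x + s *\<^sub>R b))"
      by (auto simp: indicator_def)
    ultimately have "\<bar>steklov h b H x\<bar>\<^sup>2 \<le> (l2 lborel (indicator {0..h} :: real \<Rightarrow> real) * l2 lborel (\<lambda>s. indicator {0..h} s * H (x + s *\<^sub>R b)))\<^sup>2"
      unfolding steklov_def by (intro power_mono) simp_all
    also have "\<dots> = h * (LBINT s. indicator {0..h} s * (H (x + s *\<^sub>R b))\<^sup>2)"
    proof -
      have "(\<lambda>s. (indicator {0..h} s :: real)\<^sup>2) = indicator {0..h}" by (auto simp: indicator_def)
      then have "(l2 lborel (indicator {0..h} :: real \<Rightarrow> real))\<^sup>2 = h" using h by (simp add: l2_power2)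
      moreover have "(l2 lborel (\<lambda>s. indicator {0..h} s * H (x + s *\<^sub>R b)))\<^sup>2 = (LBINT s. indicator {0..h} s * (H (x + s *\<^sub>R b))\<^sup>2)"
        unfolding l2_power2 indicator_power2_mult ..
      ultimately show ?thesis by (simp add: power_mult_distrib)
    qed
    finally show ?case by simp
  qed
  have I2: "integrable lborel (\<lambda>x. h * (LBINT s. indicator {0..h} s * (H (x + s *\<^sub>R b))\<^sup>2))"
    using lborel_pair.integrable_snd[OF I] by simp
  have Int: "integrable lborel (\<lambda>x. (steklov h b H x)\<^sup>2)"
    by (rule Bochner_Integration.integrable_bound[OF I2]) (use m ae in \<open>auto elim!: eventually_mono\<close>)
  then show S: "sq_int lborel (steklov h b H)" using m by (simp add: sq_int_def)
  have "(l2 lborel (steklov h b H))\<^sup>2 \<le> (LBINT x. h * (LBINT s. indicator {0..h} s * (H (x + s *\<^sub>R b))\<^sup>2))"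
    unfolding l2_power2 by (rule integral_mono_AE[OF Int I2 ae])
  also have "\<dots> = h * (LBINT s. (LBINT x. indicator {0..h} s * (H (x + s *\<^sub>R b))\<^sup>2))"
    using lborel_pair.Fubini_integral[OF I] by simp
  also have "\<dots> = h * (LBINT s. indicator {0..h} s * (l2 lborel H)\<^sup>2)"
    using integral_shift[of "\<lambda>x. (H x)\<^sup>2" "s *\<^sub>R b" for s] by (simp add: l2_power2 add.commute)
  also have "\<dots> = (h * l2 lborel H)\<^sup>2" using h by (simp add: power2_eq_square)
  finally show "l2 lborel (steklov h b H) \<le> h * l2 lborel H"
    by (rule power2_le_imp_le) (use h in simp)
qed

lemma steklov_inner:
  fixes H g :: "'a::euclidean_space \<Rightarrow> real"
  assumes H: "sq_int lborel H" and g: "sq_int lborel g"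
  shows "(LBINT x. steklov h b H x * g x) = (LBINT s. indicator {0..h} s * (LBINT x. H x * g (x - s *\<^sub>R b)))"
    and "integrable lborel (\<lambda>s. indicator {0..h} s * (LBINT x. H x * g (x - s *\<^sub>R b)))"
proof -
  have [measurable]: "H \<in> borel_measurable borel" "g \<in> borel_measurable borel" using H g by (auto simp: sq_int_def)
  note I = integrable_shift_product2[OF H g, of h b]
  have sh: "(LBINT x. H (x + s *\<^sub>R b) * g x) = (LBINT x. H x * g (x - s *\<^sub>R b))" for s
    using integral_shift[of "\<lambda>x. H x * g (x - s *\<^sub>R b)" "s *\<^sub>R b"] by (simp add: add.commute)
  have "(LBINT x. steklov h b H x * g x) = (LBINT x. (LBINT s. indicator {0..h} s * (H (x + s *\<^sub>R b) * g x)))"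
    by (simp add: steklov_def mult.assoc[symmetric])
  also have "\<dots> = (LBINT s. (LBINT x. indicator {0..h} s * (H (x + s *\<^sub>R b) * g x)))"
    by (rule lborel_pair.Fubini_integral[OF I])
  finally show "(LBINT x. steklov h b H x * g x) = (LBINT s. indicator {0..h} s * (LBINT x. H x * g (x - s *\<^sub>R b)))"
    by (simp add: sh)
  show "integrable lborel (\<lambda>s. indicator {0..h} s * (LBINT x. H x * g (x - s *\<^sub>R b)))"
    using lborel_pair.integrable_fst[OF I] by (simp add: sh)
qed

lemma test_fun_line_integral:
  fixes \<phi> :: "'a::euclidean_space \<Rightarrow> real"
  assumes \<phi>: "test_fun U \<phi>" and h: "0 \<le> h" and b: "b \<in> Basis"
  shows "(LBINT s. indicator {0..h} s * frechet_derivative \<phi> (at (x - s *\<^sub>R b)) b) = \<phi> x - \<phi> (x - h *\<^sub>R b)"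
proof -
  have "(LBINT s. indicator {0..h} s *\<^sub>R frechet_derivative \<phi> (at (x - s *\<^sub>R b)) b) = - \<phi> (x - h *\<^sub>R b) - (- \<phi> (x - 0 *\<^sub>R b))"
  proof (rule integral_FTC_Icc[OF h])
    show "continuous_on {0..h} (\<lambda>s. frechet_derivative \<phi> (at (x - s *\<^sub>R b)) b)"
      by (intro continuous_on_compose2[OF test_fun_deriv_continuous[OF \<phi> b]] continuous_intros) auto
    fix s
    have 1: "((\<lambda>s. x - s *\<^sub>R b) has_vector_derivative (- b)) (at s within {0..h})"
      by (auto intro!: derivative_eq_intros)
    have "((\<phi> \<circ> (\<lambda>s. x - s *\<^sub>R b)) has_vector_derivative frechet_derivative \<phi> (at (x - s *\<^sub>R b)) (- b)) (at s within {0..h})"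
      by (rule vector_derivative_diff_chain_within[OF 1]) (rule has_derivative_at_withinI[OF test_fun_has_derivative[OF \<phi>]])
    moreover have "frechet_derivative \<phi> (at (x - s *\<^sub>R b)) (- b) = - frechet_derivative \<phi> (at (x - s *\<^sub>R b)) b"
      using linear_neg[OF linear_frechet_derivative[of \<phi> "at (x - s *\<^sub>R b)"], of b] \<phi> unfolding test_fun_def by simp
    ultimately have "((\<lambda>s. \<phi> (x - s *\<^sub>R b)) has_vector_derivative - frechet_derivative \<phi> (at (x - s *\<^sub>R b)) b) (at s within {0..h})"
      by (simp add: o_def)
    from has_vector_derivative_minus[OF this]
    show "((\<lambda>s. - \<phi> (x - s *\<^sub>R b)) has_vector_derivative frechet_derivative \<phi> (at (x - s *\<^sub>R b)) b) (at s within {0..h})"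
      by simp
  qed
  then show ?thesis by simp
qed

text \<open>Test both sides with \<open>\<phi>\<close>: Fubini and translation invariance move all
  shifts to \<open>\<phi>\<close>, the weak derivative applies at each shift, and the fundamental
  theorem along lines for \<open>\<phi>\<close> reassembles the difference.\<close>

lemma difference_eq_steklov:
  fixes W H :: "'a::euclidean_space \<Rightarrow> real"
  assumes b: "b \<in> Basis" and W: "sq_int lborel W" and D: "has_weak_deriv UNIV W b H" and h: "0 \<le> h"
  shows "AE x in lborel. W (x + h *\<^sub>R b) - W x = steklov h b H x"
proof -
  have H: "sq_int lborel H" using weak_deriv_L2[OF D] by (simp add: L2_on_iff)
  have [measurable]: "H \<in> borel_measurable borel" "W \<in> borel_measurable borel" using H W by (auto simp: sq_int_def)
  have Ws: "sq_int lborel (\<lambda>x. W (x + h *\<^sub>R b))" using sq_int_shift[OF W, of "h *\<^sub>R b"] by (simp add: add.commute)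
  note S = steklov_sq_int[OF H h, of b]
  let ?f = "\<lambda>x. (W (x + h *\<^sub>R b) - W x) - steklov h b H x"
  have s: "sq_int lborel ?f" by (intro sq_int_diff Ws W S)
  have "AE x in lborel. x \<in> UNIV \<longrightarrow> ?f x = 0"
  proof (rule AE_zero_if_orthogonal_test_funs)
    show "L2_on UNIV ?f" using s by (simp add: L2_on_iff)
    fix \<phi> :: "'a \<Rightarrow> real" assume \<phi>: "test_fun UNIV \<phi>"
    let ?d = "\<lambda>x. frechet_derivative \<phi> (at x) b"
    have \<phi>s: "sq_int lborel \<phi>" by (rule test_fun_sq_int[OF \<phi>])
    have ds: "sq_int lborel ?d" by (rule test_fun_deriv_sq_int[OF \<phi> b])
    have [measurable]: "\<phi> \<in> borel_measurable borel" "?d \<in> borel_measurable borel" using \<phi>s ds by (auto simp: sq_int_def)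
    have \<phi>h: "sq_int lborel (\<lambda>x. \<phi> (x - h *\<^sub>R b))" using sq_int_shift[OF \<phi>s, of "- (h *\<^sub>R b)"] by simp
    have t: "(LBINT x. H x * \<phi> (x - s *\<^sub>R b)) = - (LBINT x. W x * ?d (x - s *\<^sub>R b))" for s
    proof -
      have "test_fun UNIV (\<lambda>x. \<phi> (- (s *\<^sub>R b) + 1 *\<^sub>R x))"
        using test_fun_subset[OF test_fun_affine(1)[OF \<phi>, of 1 "- (s *\<^sub>R b)"]] by simp
      from weak_derivD[OF D this] show ?thesis
        using test_fun_affine(2)[OF \<phi>, of 1 "- (s *\<^sub>R b)"] by simp
    qed
    note I = integrable_shift_product2[OF ds W, of h "-b"]
    have "(LBINT x. steklov h b H x * \<phi> x) = (LBINT s. indicator {0..h} s * - (LBINT x. W x * ?d (x - s *\<^sub>R b)))"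
      unfolding steklov_inner(1)[OF H \<phi>s] t ..
    also have "\<dots> = - (LBINT s. (LBINT x. indicator {0..h} s * (?d (x + s *\<^sub>R (-b)) * W x)))"
      by (simp add: mult.commute)
    also have "(LBINT s. (LBINT x. indicator {0..h} s * (?d (x + s *\<^sub>R (-b)) * W x))) =
      (LBINT x. (LBINT s. indicator {0..h} s * (?d (x + s *\<^sub>R (-b)) * W x)))"
      by (rule lborel_pair.Fubini_integral[OF I, symmetric])
    also have "\<dots> = (LBINT x. W x * (\<phi> x - \<phi> (x - h *\<^sub>R b)))"
    proof -
      have "(LBINT s. indicator {0..h} s * (?d (x + s *\<^sub>R (-b)) * W x)) = W x * (\<phi> x - \<phi> (x - h *\<^sub>R b))" for x
      proof -
        have "(\<lambda>s. indicator {0..h} s * (?d (x + s *\<^sub>R (-b)) * W x)) = (\<lambda>s. W x * (indicator {0..h} s * ?d (x - s *\<^sub>R b)))"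
          by auto
        then show ?thesis using test_fun_line_integral[OF \<phi> h b, of x] by simp
      qed
      then show ?thesis by simp
    qed
    also have "\<dots> = (LBINT x. W x * \<phi> x) - (LBINT x. W x * \<phi> (x - h *\<^sub>R b))"
      using sq_int_mult[OF W \<phi>s] sq_int_mult[OF W \<phi>h] by (simp add: right_diff_distrib)
    also have "(LBINT x. W x * \<phi> (x - h *\<^sub>R b)) = (LBINT x. W (x + h *\<^sub>R b) * \<phi> x)"
      using integral_shift[of "\<lambda>x. W x * \<phi> (x - h *\<^sub>R b)" "h *\<^sub>R b"] by (simp add: add.commute)
    finally have "(LBINT x. steklov h b H x * \<phi> x) = (LBINT x. W (x + h *\<^sub>R b) * \<phi> x) - (LBINT x. W x * \<phi> x)" by simp
    then show "(LBINT x. ?f x * \<phi> x) = 0"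
      using sq_int_mult[OF W \<phi>s] sq_int_mult[OF Ws \<phi>s] sq_int_mult[OF S(1) \<phi>s] by (simp add: left_diff_distrib)
  qed simp
  then show ?thesis by eventually_elim auto
qed

lemma l2_difference_le:
  fixes W H :: "'a::euclidean_space \<Rightarrow> real"
  assumes b: "b \<in> Basis" and W: "sq_int lborel W" and D: "has_weak_deriv UNIV W b H" and h: "0 \<le> h"
  shows "l2 lborel (\<lambda>x. W (x - h *\<^sub>R b) - W x) \<le> h * l2 lborel H"
    and "l2 lborel (\<lambda>x. W (x + h *\<^sub>R b) - W x) \<le> h * l2 lborel H"
proof -
  have H: "sq_int lborel H" using weak_deriv_L2[OF D] by (simp add: L2_on_iff)
  have [measurable]: "H \<in> borel_measurable borel" "W \<in> borel_measurable borel" using H W by (auto simp: sq_int_def)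
  note S = steklov_sq_int[OF H h, of b]
  have "l2 lborel (\<lambda>x. W (x + h *\<^sub>R b) - W x) \<le> 1 * l2 lborel (steklov h b H)"
    by (rule l2_mono[OF S(1)]) (use difference_eq_steklov[OF b W D h] in \<open>auto elim!: eventually_mono\<close>)
  with S(2) show 1: "l2 lborel (\<lambda>x. W (x + h *\<^sub>R b) - W x) \<le> h * l2 lborel H" by simp
  have sd: "sq_int lborel (\<lambda>x. W (x + h *\<^sub>R b) - W x)"
    using sq_int_shift[OF W, of "h *\<^sub>R b"] by (intro sq_int_diff W) (simp add: add.commute)
  have "l2 lborel (\<lambda>x. W (x - h *\<^sub>R b) - W x) = l2 lborel (\<lambda>x. - 1 * (W (- (h *\<^sub>R b) + x + h *\<^sub>R b) - W (- (h *\<^sub>R b) + x)))"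
    by simp
  also have "\<dots> = l2 lborel (\<lambda>x. W (x + h *\<^sub>R b) - W x)"
    unfolding l2_cmult using l2_shift[OF sd, of "- (h *\<^sub>R b)"] by simp
  finally show "l2 lborel (\<lambda>x. W (x - h *\<^sub>R b) - W x) \<le> h * l2 lborel H" using 1 by simp
qed

text \<open>Discrete integration by parts: a translation moves the difference to the other factor
  and reverses the step.\<close>

lemma difference_inner_shift:
  fixes V W :: "'a::euclidean_space \<Rightarrow> real"
  assumes V: "sq_int lborel V" and W: "sq_int lborel W"
  shows "(LBINT x. (V (x + h *\<^sub>R b) - V x) * W x) = (LBINT x. V x * (W (x - h *\<^sub>R b) - W x))"
proof -
  have [measurable]: "V \<in> borel_measurable borel" "W \<in> borel_measurable borel" using V W by (auto simp: sq_int_def)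
  have Vs: "sq_int lborel (\<lambda>x. V (x + h *\<^sub>R b))" using sq_int_shift[OF V, of "h *\<^sub>R b"] by (simp add: add.commute)
  have Ws: "sq_int lborel (\<lambda>x. W (x - h *\<^sub>R b))" using sq_int_shift[OF W, of "- (h *\<^sub>R b)"] by simp
  have "(LBINT x. V (x + h *\<^sub>R b) * W x) = (LBINT x. V x * W (x - h *\<^sub>R b))"
    using integral_shift[of "\<lambda>x. V x * W (x - h *\<^sub>R b)" "h *\<^sub>R b"] by (simp add: add.commute)
  then show ?thesis
    using sq_int_mult[OF V W] sq_int_mult[OF Vs W] sq_int_mult[OF V Ws] by (simp add: left_diff_distrib right_diff_distrib)
qed

text \<open>Move the difference to V and write it as the Steklov average of G, which gives the
  integral over s in [0,h] of <G, W(. - s b)>. Replacing W(. - s b) by W costs at most s |G| |H| for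
  each s. The explicit second order error makes a later division by h harmless.\<close>

lemma difference_quotient_error:
  fixes V W G H :: "'a::euclidean_space \<Rightarrow> real"
  assumes b: "b \<in> Basis" and V: "sq_int lborel V" "has_weak_deriv UNIV V b G"
    and W: "sq_int lborel W" "has_weak_deriv UNIV W b H" and h: "0 \<le> h"
  shows "\<bar>(LBINT x. V x * (W (x - h *\<^sub>R b) - W x)) - h * (LBINT x. G x * W x)\<bar> \<le> h\<^sup>2 * (l2 lborel G * l2 lborel H)"
proof -
  have G: "sq_int lborel G" using weak_deriv_L2[OF V(2)] by (simp add: L2_on_iff)
  have H: "sq_int lborel H" using weak_deriv_L2[OF W(2)] by (simp add: L2_on_iff)
  have [measurable]: "V \<in> borel_measurable borel" "W \<in> borel_measurable borel" using V W by (auto simp: sq_int_def)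
  have Vs: "sq_int lborel (\<lambda>x. V (x + h *\<^sub>R b))" using sq_int_shift[OF V(1), of "h *\<^sub>R b"] by (simp add: add.commute)
  have Ws: "sq_int lborel (\<lambda>x. W (x - s *\<^sub>R b))" for s using sq_int_shift[OF W(1), of "- (s *\<^sub>R b)"] by simp
  note S = steklov_sq_int[OF G h, of b]
  have "(LBINT x. V x * (W (x - h *\<^sub>R b) - W x)) = (LBINT x. (V (x + h *\<^sub>R b) - V x) * W x)"
    using difference_inner_shift[OF V(1) W(1)] by simp
  also have "\<dots> = (LBINT x. steklov h b G x * W x)"
    using difference_eq_steklov[OF b V h] sq_int_mult[OF sq_int_diff[OF Vs V(1)] W(1)] sq_int_mult[OF S(1) W(1)]
    by (intro integral_cong_AE) (auto elim!: eventually_mono)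
  also have "\<dots> = (LBINT s. indicator {0..h} s * (LBINT x. G x * W (x - s *\<^sub>R b)))"
    by (rule steklov_inner(1)[OF G W(1)])
  finally have 1: "(LBINT x. V x * (W (x - h *\<^sub>R b) - W x)) = (LBINT s. indicator {0..h} s * (LBINT x. G x * W (x - s *\<^sub>R b)))" .
  have 2: "h * (LBINT x. G x * W x) = (LBINT s. indicator {0..h} s * (LBINT x. G x * W x))"
    using h by simp
  have i1: "integrable lborel (\<lambda>s. indicator {0..h} s * (LBINT x. G x * W (x - s *\<^sub>R b)))"
    by (rule steklov_inner(2)[OF G W(1)])
  have i2: "integrable lborel (\<lambda>s. indicator {0..h} s * (LBINT x. G x * W x))" by simp
  have A: "(LBINT x. V x * (W (x - h *\<^sub>R b) - W x)) - h * (LBINT x. G x * W x) =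
     (LBINT s. indicator {0..h} s * (LBINT x. G x * W (x - s *\<^sub>R b)) - indicator {0..h} s * (LBINT x. G x * W x))"
    unfolding 1 2 by (rule Bochner_Integration.integral_diff[symmetric, OF i1 i2])
  have B: "\<bar>\<integral>s. indicator {0..h} s * (LBINT x. G x * W (x - s *\<^sub>R b)) - indicator {0..h} s * (LBINT x. G x * W x) \<partial>lborel\<bar>
      \<le> (LBINT s. indicator {0..h} s * (h * (l2 lborel G * l2 lborel H)))"
  proof (rule order_trans[OF integral_abs_bound integral_mono])
    show "integrable lborel (\<lambda>s. \<bar>indicator {0..h} s * (LBINT x. G x * W (x - s *\<^sub>R b)) - indicator {0..h} s * (LBINT x. G x * W x)\<bar>)"
      using i1 i2 by (intro integrable_abs Bochner_Integration.integrable_diff)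
    show "integrable lborel (\<lambda>s. indicator {0..h} s * (h * (l2 lborel G * l2 lborel H)))" by simp
    fix s
    show "\<bar>indicator {0..h} s * (LBINT x. G x * W (x - s *\<^sub>R b)) - indicator {0..h} s * (LBINT x. G x * W x)\<bar> \<le> indicator {0..h} s * (h * (l2 lborel G * l2 lborel H))"
    proof (cases "s \<in> {0..h}")
      case True
      have 3: "(LBINT x. G x * W (x - s *\<^sub>R b)) - (LBINT x. G x * W x) = (LBINT x. G x * (W (x - s *\<^sub>R b) - W x))"
        using sq_int_mult[OF G Ws] sq_int_mult[OF G W(1)] by (simp add: right_diff_distrib)
      have 4: "\<bar>\<integral>x. G x * (W (x - s *\<^sub>R b) - W x) \<partial>lborel\<bar> \<le> l2 lborel G * (s * l2 lborel H)"
        by (rule order_trans[OF Cauchy_Schwarz_l2[OF G sq_int_diff[OF Ws W(1)]] mult_left_mono[OF l2_difference_le(1)[OF b W]]])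
           (use True in auto)
      have 5: "l2 lborel G * (s * l2 lborel H) \<le> h * (l2 lborel G * l2 lborel H)"
        using mult_right_mono[of s h "l2 lborel G * l2 lborel H"] True by (simp add: mult_ac)
      show ?thesis using order_trans[OF 4 5] 3 True by simp
    qed simp
  qed
  have "(LBINT s. indicator {0..h} s * (h * (l2 lborel G * l2 lborel H))) = h\<^sup>2 * (l2 lborel G * l2 lborel H)"
    using h by (simp add: power2_eq_square)
  with B show ?thesis unfolding A by (simp only:)
qed

text \<open>Passage to the limit h to 0 in the difference quotient estimates.\<close>

lemma le_if_le_add_mult:
  fixes x y C :: real
  assumes "\<And>h. 0 < h \<Longrightarrow> x \<le> y + h * C"
  shows "x \<le> y"
proof (rule field_le_epsilon)
  fix e :: real assume e: "e > 0"
  have "x \<le> y + e / (\<bar>C\<bar> + 1) * C" by (rule assms) (use e in auto)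
  also have "e / (\<bar>C\<bar> + 1) * C \<le> e"
  proof -
    have "e * C \<le> e * (\<bar>C\<bar> + 1)" using e by (intro mult_left_mono) auto
    then show ?thesis by (simp add: field_simps)
  qed
  finally show "x \<le> y + e" by simp
qed

text \<open>Integration by parts would give equality with -<V,H>; the bound is all that is used and
  follows by shifting W by h, estimating the shift by H, and dividing by h.\<close>

lemma integration_by_parts_bound:
  fixes V W G H :: "'a::euclidean_space \<Rightarrow> real"
  assumes b: "b \<in> Basis" and V: "sq_int lborel V" "has_weak_deriv UNIV V b G"
    and W: "sq_int lborel W" "has_weak_deriv UNIV W b H"
  shows "\<bar>\<integral>x. G x * W x \<partial>lborel\<bar> \<le> l2 lborel V * l2 lborel H"
proof (rule le_if_le_add_mult)
  fix h :: real assume h: "0 < h"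
  have Ws: "sq_int lborel (\<lambda>x. W (x - h *\<^sub>R b))" using sq_int_shift[OF W(1), of "- (h *\<^sub>R b)"] by simp
  have 0: "\<bar>h * (LBINT x. G x * W x)\<bar> = h * \<bar>\<integral>x. G x * W x \<partial>lborel\<bar>" using h by (simp add: abs_mult)
  have 1: "h * \<bar>\<integral>x. G x * W x \<partial>lborel\<bar> \<le> \<bar>\<integral>x. V x * (W (x - h *\<^sub>R b) - W x) \<partial>lborel\<bar> + h\<^sup>2 * (l2 lborel G * l2 lborel H)"
    using difference_quotient_error[OF b V W, of h] h unfolding 0[symmetric] by linarith
  have "\<bar>\<integral>x. V x * (W (x - h *\<^sub>R b) - W x) \<partial>lborel\<bar> \<le> l2 lborel V * (h * l2 lborel H)"
  proof (rule order_trans[OF Cauchy_Schwarz_l2[OF V(1) sq_int_diff[OF Ws W(1)]] mult_left_mono])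
    show "l2 lborel (\<lambda>x. W (x - h *\<^sub>R b) - W x) \<le> h * l2 lborel H"
      using h by (intro l2_difference_le[OF b W]) auto
  qed simp
  with 1 have "h * \<bar>\<integral>x. G x * W x \<partial>lborel\<bar> \<le> h * (l2 lborel V * l2 lborel H + h * (l2 lborel G * l2 lborel H))"
    by (simp add: algebra_simps power2_eq_square)
  then show "\<bar>\<integral>x. G x * W x \<partial>lborel\<bar> \<le> l2 lborel V * l2 lborel H + h * (l2 lborel G * l2 lborel H)"
    using h by simp
qed

subsection \<open>Sobolev functions on an open set\<close>

lemma H1_on_L2: "H1_on U u \<Longrightarrow> L2_on U u"
  by (simp add: H1_on_def)

lemma H1_on_wderiv: "H1_on U u \<Longrightarrow> b \<in> Basis \<Longrightarrow> has_weak_deriv U u b (wderiv U u b)"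
  unfolding H1_on_def using weak_deriv_wderiv by blast

lemma H1_on_wderiv_L2: "H1_on U u \<Longrightarrow> b \<in> Basis \<Longrightarrow> L2_on U (wderiv U u b)"
  using H1_on_wderiv weak_deriv_L2 by blast

lemma H1_onI: "L2_on U u \<Longrightarrow> (\<And>b. b \<in> Basis \<Longrightarrow> has_weak_deriv U u b (g b)) \<Longrightarrow> H1_on U u"
  unfolding H1_on_def by blast

lemma H1_on_add: "H1_on U u \<Longrightarrow> H1_on U v \<Longrightarrow> H1_on U (\<lambda>x. u x + v x)"
  by (rule H1_onI, intro L2_on_add H1_on_L2, assumption+)
     (rule weak_deriv_add[OF _ H1_on_L2 H1_on_L2 H1_on_wderiv H1_on_wderiv])

lemma H1_on_cmult: "H1_on U u \<Longrightarrow> H1_on U (\<lambda>x. c * u x)"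
  by (rule H1_onI, intro L2_on_cmult H1_on_L2, assumption)
     (rule weak_deriv_cmult[OF H1_on_wderiv])

lemma H1_on_zero: "H1_on U (\<lambda>x. 0)"
  by (rule H1_onI[OF L2_on_zero weak_deriv_zero])

lemma wderiv_add_AE:
  assumes "open U" "H1_on U u" "H1_on U v" "b \<in> Basis"
  shows "AE x in lborel. x \<in> U \<longrightarrow> wderiv U (\<lambda>x. u x + v x) b x = wderiv U u b x + wderiv U v b x"
  by (rule wderiv_AE_eq) (auto intro!: assms weak_deriv_add H1_on_L2 H1_on_wderiv)

lemma wderiv_cmult_AE:
  assumes "open U" "H1_on U u" "b \<in> Basis"
  shows "AE x in lborel. x \<in> U \<longrightarrow> wderiv U (\<lambda>x. c * u x) b x = c * wderiv U u b x"
  by (rule wderiv_AE_eq) (auto intro!: assms weak_deriv_cmult H1_on_wderiv)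

text \<open>Membership in H^2 speaks about the chosen \<open>wderiv\<close>, which obeys linearity
  only almost everywhere; this carries H^1 regularity across such identities.\<close>

lemma H1_on_AE_cong:
  assumes f: "H1_on U f" and ae: "AE x in lborel. x \<in> U \<longrightarrow> f x = g x" and g: "L2_on U g"
  shows "H1_on U g"
proof (rule H1_onI[OF g])
  fix b :: 'a assume b: "b \<in> Basis"
  have "(LBINT x. f x * frechet_derivative \<phi> (at x) b) = (LBINT x. g x * frechet_derivative \<phi> (at x) b)"
    if "test_fun U \<phi>" for \<phi>
    using L2_on_test_deriv_integrable[OF g that b] L2_on_test_deriv_integrable[OF H1_on_L2[OF f] that b]
    by (intro integral_cong_AE) (use ae that in \<open>auto elim!: eventually_mono\<close>)
  then show "has_weak_deriv U g b (wderiv U f b)"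
    using H1_on_wderiv[OF f b] unfolding weak_deriv_iff by auto
qed

lemma H2_on_add:
  assumes U: "open U" and u: "H2_on U u" and v: "H2_on U v"
  shows "H2_on U (\<lambda>x. u x + v x)"
  unfolding H2_on_def
proof (intro conjI ballI)
  have u1: "H1_on U u" and v1: "H1_on U v" using u v by (auto simp: H2_on_def)
  show s: "H1_on U (\<lambda>x. u x + v x)" by (rule H1_on_add[OF u1 v1])
  fix b :: 'a assume b: "b \<in> Basis"
  have "H1_on U (\<lambda>x. wderiv U u b x + wderiv U v b x)" using u v b by (auto simp: H2_on_def intro!: H1_on_add)
  then show "H1_on U (wderiv U (\<lambda>x. u x + v x) b)"
    by (rule H1_on_AE_cong) (use wderiv_add_AE[OF U u1 v1 b] H1_on_wderiv_L2[OF s b] in \<open>auto elim!: eventually_mono\<close>)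
qed

lemma H2_on_cmult:
  assumes U: "open U" and u: "H2_on U u"
  shows "H2_on U (\<lambda>x. c * u x)"
  unfolding H2_on_def
proof (intro conjI ballI)
  have u1: "H1_on U u" using u by (auto simp: H2_on_def)
  show s: "H1_on U (\<lambda>x. c * u x)" by (rule H1_on_cmult[OF u1])
  fix b :: 'a assume b: "b \<in> Basis"
  have "H1_on U (\<lambda>x. c * wderiv U u b x)" using u b by (auto simp: H2_on_def intro!: H1_on_cmult)
  then show "H1_on U (wderiv U (\<lambda>x. c * u x) b)"
    by (rule H1_on_AE_cong) (use wderiv_cmult_AE[OF U u1 b, of c] H1_on_wderiv_L2[OF s b] in \<open>auto elim!: eventually_mono\<close>)
qed

abbreviation l2on :: "'a::euclidean_space set \<Rightarrow> ('a \<Rightarrow> real) \<Rightarrow> real" where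
  "l2on U u \<equiv> l2 lborel (\<lambda>x. indicator U x * u x)"

lemma l2on_cong_AE:
  assumes "AE x in lborel. x \<in> U \<longrightarrow> f x = g x" "L2_on U f" "L2_on U g"
  shows "l2on U f = l2on U g"
  unfolding l2_def
  by (rule arg_cong[where f=sqrt], rule integral_cong_AE)
     (use assms in \<open>auto simp: L2_on_iff sq_int_def indicator_def elim!: eventually_mono\<close>)

lemma l2on_add_sq: "L2_on U u \<Longrightarrow> L2_on U v \<Longrightarrow> (l2on U (\<lambda>x. u x + v x))\<^sup>2 \<le> 2 * (l2on U u)\<^sup>2 + 2 * (l2on U v)\<^sup>2"
  unfolding distrib_left L2_on_iff by (rule l2_add_sq)

lemma l2on_cmult: "l2on U (\<lambda>x. c * u x) = \<bar>c\<bar> * l2on U u"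
  using l2_cmult[of lborel c "\<lambda>x. indicator U x * u x"] by (simp add: mult.left_commute)

lemma H1_norm_sq: "(H1_norm U u)\<^sup>2 = (l2on U u)\<^sup>2 + (\<Sum>b\<in>Basis. (l2on U (wderiv U u b))\<^sup>2)"
  unfolding H1_norm_def set_integral_square by (simp add: sum_nonneg)

lemma H1_norm_nonneg [simp]: "0 \<le> H1_norm U u"
  unfolding H1_norm_def set_integral_square by (simp add: sum_nonneg)

text \<open>A quasi-triangle inequality for squares, applied separately to the function and to each
  derivative; the factor 2 is harmless where only smallness of norms matters.\<close>

lemma H1_norm_add_sq:
  assumes U: "open U" and u: "H1_on U u" and v: "H1_on U v"
  shows "(H1_norm U (\<lambda>x. u x + v x))\<^sup>2 \<le> 2 * (H1_norm U u)\<^sup>2 + 2 * (H1_norm U v)\<^sup>2"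
proof -
  have "(l2on U (wderiv U (\<lambda>x. u x + v x) b))\<^sup>2 \<le> 2 * (l2on U (wderiv U u b))\<^sup>2 + 2 * (l2on U (wderiv U v b))\<^sup>2"
    if b: "b \<in> Basis" for b
  proof -
    have "l2on U (wderiv U (\<lambda>x. u x + v x) b) = l2on U (\<lambda>x. wderiv U u b x + wderiv U v b x)"
      by (rule l2on_cong_AE[OF wderiv_add_AE[OF U u v b]]) (auto intro!: L2_on_add H1_on_wderiv_L2 H1_on_add u v b)
    then show ?thesis using l2on_add_sq[OF H1_on_wderiv_L2[OF u b] H1_on_wderiv_L2[OF v b]] by simp
  qed
  then have "(\<Sum>b\<in>Basis. (l2on U (wderiv U (\<lambda>x. u x + v x) b))\<^sup>2) \<le> (\<Sum>b\<in>Basis. 2 * (l2on U (wderiv U u b))\<^sup>2 + 2 * (l2on U (wderiv U v b))\<^sup>2)"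
    by (rule sum_mono)
  then show ?thesis using l2on_add_sq[OF H1_on_L2[OF u] H1_on_L2[OF v]]
    unfolding H1_norm_sq by (simp add: sum.distrib sum_distrib_left algebra_simps)
qed

lemma H1_norm_cmult:
  assumes U: "open U" and u: "H1_on U u"
  shows "H1_norm U (\<lambda>x. c * u x) = \<bar>c\<bar> * H1_norm U u"
proof -
  have "l2on U (wderiv U (\<lambda>x. c * u x) b) = \<bar>c\<bar> * l2on U (wderiv U u b)" if b: "b \<in> Basis" for b
  proof -
    have "l2on U (wderiv U (\<lambda>x. c * u x) b) = l2on U (\<lambda>x. c * wderiv U u b x)"
      by (rule l2on_cong_AE[OF wderiv_cmult_AE[OF U u b]]) (auto intro!: L2_on_cmult H1_on_wderiv_L2 H1_on_cmult u b)
    then show ?thesis by (simp only: l2on_cmult)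
  qed
  then have "(H1_norm U (\<lambda>x. c * u x))\<^sup>2 = (\<bar>c\<bar> * H1_norm U u)\<^sup>2"
    unfolding H1_norm_sq power_mult_distrib l2on_cmult
    by (simp add: power_mult_distrib sum_distrib_left algebra_simps)
  then show ?thesis by simp
qed

lemma l2on_le_H1_norm: "l2on U u \<le> H1_norm U u"
  by (rule power2_le_imp_le) (auto simp: H1_norm_sq sum_nonneg)

lemma l2on_wderiv_le_H1_norm:
  assumes "b \<in> Basis" shows "l2on U (wderiv U u b) \<le> H1_norm U u"
proof (rule power2_le_imp_le)
  have "(l2on U (wderiv U u b))\<^sup>2 \<le> (\<Sum>b\<in>Basis. (l2on U (wderiv U u b))\<^sup>2)"
    by (rule member_le_sum) (use assms in auto)
  then show "(l2on U (wderiv U u b))\<^sup>2 \<le> (H1_norm U u)\<^sup>2" unfolding H1_norm_sq using zero_le_power2[of "l2on U u"] by linarith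
qed simp

lemma H1_norm_le_H2_norm:
  shows "H1_norm U u \<le> H2_norm U u" and "b \<in> Basis \<Longrightarrow> H1_norm U (wderiv U u b) \<le> H2_norm U u"
proof -
  have *: "(H2_norm U u)\<^sup>2 = (H1_norm U u)\<^sup>2 + (\<Sum>b\<in>Basis. (H1_norm U (wderiv U u b))\<^sup>2)" "0 \<le> H2_norm U u"
    unfolding H2_norm_def by (auto simp: sum_nonneg)
  show "H1_norm U u \<le> H2_norm U u"
    by (rule power2_le_imp_le) (auto simp: * sum_nonneg)
  show "H1_norm U (wderiv U u b) \<le> H2_norm U u" if "b \<in> Basis"
  proof (rule power2_le_imp_le)
    have "(H1_norm U (wderiv U u b))\<^sup>2 \<le> (\<Sum>b\<in>Basis. (H1_norm U (wderiv U u b))\<^sup>2)"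
      by (rule member_le_sum) (use that in auto)
    then show "(H1_norm U (wderiv U u b))\<^sup>2 \<le> (H2_norm U u)\<^sup>2" using * zero_le_power2[of "H1_norm U u"] by linarith
  qed (use * in simp)
qed

text \<open>A cutoff with compact support in \<open>U\<close> turns a local Sobolev function into
  one on the whole space, where translations and hence difference quotients make sense.\<close>

lemma weak_deriv_cutoff:
  fixes u :: "'a::euclidean_space \<Rightarrow> real"
  assumes b: "b \<in> Basis" and \<xi>: "test_fun U \<xi>" and u: "L2_on U u" "has_weak_deriv U u b g"
  shows "sq_int lborel (\<lambda>x. \<xi> x * u x)"
    and "has_weak_deriv UNIV (\<lambda>x. \<xi> x * u x) b (\<lambda>x. \<xi> x * g x + frechet_derivative \<xi> (at x) b * u x)"
proof -
  note g = weak_deriv_L2[OF u(2)]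
  obtain C where C: "C > 0" "\<And>x. \<bar>\<xi> x\<bar> \<le> C" using test_fun_bounded[OF \<xi>] by blast
  obtain D where D: "D > 0" "\<And>x. \<bar>frechet_derivative \<xi> (at x) b\<bar> \<le> D" using test_fun_deriv_bounded[OF \<xi> b] by blast
  obtain K where K: "compact K" "K \<subseteq> U" "\<And>x. x \<notin> K \<Longrightarrow> \<xi> x = 0" "\<And>x v. x \<notin> K \<Longrightarrow> frechet_derivative \<xi> (at x) v = 0"
    using test_fun_support[OF \<xi>] by blast
  have m: "\<xi> \<in> borel_measurable borel" "(\<lambda>x. frechet_derivative \<xi> (at x) b) \<in> borel_measurable borel"
    using test_fun_sq_int[OF \<xi>] test_fun_deriv_sq_int[OF \<xi> b] by (auto simp: sq_int_def)
  have s: "sq_int lborel (\<lambda>x. \<xi> x * f x)" if "L2_on U f" for f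
  proof -
    have "sq_int lborel (\<lambda>x. \<xi> x * (indicator U x * f x))"
      by (rule sq_int_bounded_mult[OF that[unfolded L2_on_iff]]) (use m C in auto)
    moreover have "(\<lambda>x. \<xi> x * (indicator U x * f x)) = (\<lambda>x. \<xi> x * f x)"
      using \<xi> by (auto simp: fun_eq_iff indicator_def)
    ultimately show ?thesis by simp
  qed
  have s': "sq_int lborel (\<lambda>x. frechet_derivative \<xi> (at x) b * f x)" if "L2_on U f" for f
  proof -
    have "sq_int lborel (\<lambda>x. frechet_derivative \<xi> (at x) b * (indicator U x * f x))"
      by (rule sq_int_bounded_mult[OF that[unfolded L2_on_iff]]) (use m D in auto)
    moreover have "(\<lambda>x. frechet_derivative \<xi> (at x) b * (indicator U x * f x)) = (\<lambda>x. frechet_derivative \<xi> (at x) b * f x)"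
      using \<xi> by (auto simp: fun_eq_iff indicator_def)
    ultimately show ?thesis by simp
  qed
  show "sq_int lborel (\<lambda>x. \<xi> x * u x)" by (rule s[OF u(1)])
  show "has_weak_deriv UNIV (\<lambda>x. \<xi> x * u x) b (\<lambda>x. \<xi> x * g x + frechet_derivative \<xi> (at x) b * u x)"
  proof (rule weak_deriv_mult[OF b u])
    show "(\<xi> has_derivative frechet_derivative \<xi> (at x)) (at x)" for x by (rule test_fun_has_derivative[OF \<xi>])
    show "continuous_on UNIV (\<lambda>x. frechet_derivative \<xi> (at x) b)" if "b \<in> Basis" for b by (rule test_fun_deriv_continuous[OF \<xi> that])
    show "closed K" using K by (simp add: compact_imp_closed)
    show "L2_on UNIV (\<lambda>x. \<xi> x * g x + frechet_derivative \<xi> (at x) b * u x)"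
      using sq_int_add[OF s[OF g] s'[OF u(1)]] by (simp add: L2_on_iff)
  qed (use K in auto)
qed

lemma l2_cutoff_le:
  assumes "L2_on U f" "m \<in> borel_measurable borel" "\<And>x. \<bar>m x\<bar> \<le> C" "\<And>x. x \<notin> U \<Longrightarrow> m x = 0"
  shows "l2 lborel (\<lambda>x. m x * f x) \<le> C * l2on U f" and "sq_int lborel (\<lambda>x. m x * f x)"
proof -
  have eq: "(\<lambda>x. m x * f x) = (\<lambda>x. m x * (indicator U x * f x))"
    using assms(4) by (auto simp: fun_eq_iff indicator_def)
  have C0: "0 \<le> C" using assms(3)[of undefined] by linarith
  have f: "sq_int lborel (\<lambda>x. indicator U x * f x)" using assms(1) by (simp add: L2_on_iff)
  have m: "(\<lambda>x. m x * (indicator U x * f x)) \<in> borel_measurable lborel"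
    using f assms(2) by (auto simp: sq_int_def)
  show "l2 lborel (\<lambda>x. m x * f x) \<le> C * l2on U f"
    unfolding eq by (rule l2_mono[OF f m _ C0]) (use assms(3) in \<open>auto simp: abs_mult intro!: AE_I2 mult_right_mono\<close>)
  show "sq_int lborel (\<lambda>x. m x * f x)"
    unfolding eq by (rule sq_int_bounded_mult[OF f]) (use assms in auto)
qed

subsection \<open>Sobolev functions on the sphere\<close>

lemma open_annulus: "open (annulus :: 'a::euclidean_space set)"
  unfolding annulus_def by (intro open_Collect_conj open_Collect_less continuous_intros)

lemma annulus_borel [measurable]: "annulus \<in> sets borel"
  by (rule borel_open[OF open_annulus])

lemma indicator_annulus: "indicator annulus x = (indicator {1/2<..<2} (norm x) :: real)"
  by (auto simp: annulus_def indicator_def)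

lemma hom_ext_scale: "c > 0 \<Longrightarrow> hom_ext u (c *\<^sub>R x) = hom_ext u x"
  unfolding hom_ext_def by (simp only: hat_scale)

text \<open>Its square is the radial mass of the annulus, the integral of \<rho>^(d-1) over 1/2 <
  \<rho> < 2. It is the ratio between the L^2 norm of a 0-homogeneous extension on the annulus and
  the L^2 norm on the sphere.\<close>

definition annulus_const :: "'a::euclidean_space itself \<Rightarrow> real" where
  "annulus_const _ = sqrt (LBINT \<rho>. indicator {0<..} \<rho> * \<rho> ^ (DIM('a) - 1) * (indicator {1/2<..<2::real} \<rho>)\<^sup>2)"

lemma annulus_weight_integrable:
  "integrable lborel (\<lambda>\<rho>. indicator {0<..} \<rho> * \<rho> ^ n * (indicator {1/2<..<2::real} \<rho>)\<^sup>2 :: real)"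
proof (rule Bochner_Integration.integrable_bound)
  show "integrable lborel (\<lambda>\<rho>. 2 ^ n * indicator {1/2<..<2::real} \<rho> :: real)" by simp
qed (auto split: split_indicator intro!: power_mono)

lemma annulus_const_ge_1: "1 \<le> annulus_const TYPE('a::euclidean_space)"
proof -
  have "(LBINT \<rho>. indicator {1<..<2::real} \<rho>) \<le> (LBINT \<rho>. indicator {0<..} \<rho> * \<rho> ^ (DIM('a) - 1) * (indicator {1/2<..<2::real} \<rho>)\<^sup>2)"
    by (intro integral_mono annulus_weight_integrable) (auto split: split_indicator)
  then show ?thesis by (simp add: annulus_const_def)
qed

lemma hom_ext_L2:
  fixes u :: "'a::euclidean_space \<Rightarrow> real"
  assumes "L2S u"
  shows "L2_on annulus (hom_ext u)" and "l2on annulus (hom_ext u) = annulus_const TYPE('a) * L2S_norm u"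
proof -
  note s = sq_int_homogeneous[OF assms _ annulus_weight_integrable]
  have eq: "(\<lambda>x. indicator annulus x * hom_ext u x) = (\<lambda>y. indicator {1/2<..<2} (norm y) * u (y /\<^sub>R norm y))"
    by (simp add: indicator_annulus hom_ext_def)
  show "L2_on annulus (hom_ext u)" unfolding L2_on_iff eq by (rule s(1)) simp
  have "(l2on annulus (hom_ext u))\<^sup>2 = (annulus_const TYPE('a) * L2S_norm u)\<^sup>2"
    unfolding eq by (subst s(2)) (auto simp: annulus_const_def power_mult_distrib intro!: integral_nonneg_AE AE_I2 split: split_indicator)
  then show "l2on annulus (hom_ext u) = annulus_const TYPE('a) * L2S_norm u"
    using annulus_const_ge_1[where 'a='a] by (subst (asm) power2_eq_iff_nonneg) auto
qed

lemma L2S_if_hom_ext: "sfun u \<Longrightarrow> L2_on annulus (hom_ext u) \<Longrightarrow> L2S u"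
  by (rule L2S_if_homogeneous[where a="1/2" and b=2]) (auto simp: L2_on_iff indicator_annulus hom_ext_def)

lemma H1S_H1_on: "H1S u \<Longrightarrow> H1_on annulus (hom_ext u)" and H1S_sfun: "H1S u \<Longrightarrow> sfun u"
  by (auto simp: H1S_def)

lemma H1S_L2S: "H1S u \<Longrightarrow> L2S u"
  by (auto simp: H1S_def intro!: L2S_if_hom_ext H1_on_L2)

lemma H2S_H1S: "H2S u \<Longrightarrow> H1S u"
  by (auto simp: H1S_def H2S_def H2_on_def)

lemma L2S_norm_le_H1S_norm:
  fixes u :: "'a::euclidean_space \<Rightarrow> real"
  assumes "H1S u" shows "L2S_norm u \<le> H1S_norm u"
proof -
  have "1 * L2S_norm u \<le> annulus_const TYPE('a) * L2S_norm u"
    by (intro mult_right_mono annulus_const_ge_1) simp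
  also have "\<dots> \<le> H1S_norm u"
    using hom_ext_L2(2)[OF H1S_L2S[OF assms]] l2on_le_H1_norm[of annulus "hom_ext u"] by (simp add: H1S_norm_def)
  finally show ?thesis by simp
qed

lemma hom_ext_add: "hom_ext (\<lambda>x. u x + v x) = (\<lambda>x. hom_ext u x + hom_ext v x)"
  and hom_ext_cmult: "hom_ext (\<lambda>x. c * u x) = (\<lambda>x. c * hom_ext u x)"
  by (auto simp: hom_ext_def)

lemma H1S_add: "H1S u \<Longrightarrow> H1S v \<Longrightarrow> H1S (\<lambda>x. u x + v x)"
  by (simp add: H1S_def sfun_def hom_ext_add H1_on_add)

lemma H1S_cmult: "H1S u \<Longrightarrow> H1S (\<lambda>x. c * u x)"
  by (simp add: H1S_def sfun_def hom_ext_cmult H1_on_cmult)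

lemma H1S_diff: "H1S u \<Longrightarrow> H1S v \<Longrightarrow> H1S (\<lambda>x. u x - v x)"
  using H1S_add[OF _ H1S_cmult[of v "-1"]] by simp

lemma H2S_add: "H2S u \<Longrightarrow> H2S v \<Longrightarrow> H2S (\<lambda>x. u x + v x)"
  by (simp add: H2S_def sfun_def hom_ext_add H2_on_add[OF open_annulus])

lemma H2S_cmult: "H2S u \<Longrightarrow> H2S (\<lambda>x. c * u x)"
  by (simp add: H2S_def sfun_def hom_ext_cmult H2_on_cmult[OF open_annulus])

lemma H2S_diff: "H2S u \<Longrightarrow> H2S v \<Longrightarrow> H2S (\<lambda>x. u x - v x)"
  using H2S_add[OF _ H2S_cmult[of v "-1"]] by simp

lemma H1S_norm_nonneg [simp]: "0 \<le> H1S_norm u"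
  by (simp add: H1S_norm_def)

lemma H1S_norm_add_sq: "H1S u \<Longrightarrow> H1S v \<Longrightarrow> (H1S_norm (\<lambda>x. u x + v x))\<^sup>2 \<le> 2 * (H1S_norm u)\<^sup>2 + 2 * (H1S_norm v)\<^sup>2"
  unfolding H1S_norm_def hom_ext_add by (intro H1_norm_add_sq open_annulus H1S_H1_on)

lemma H1S_norm_cmult: "H1S u \<Longrightarrow> H1S_norm (\<lambda>x. c * u x) = \<bar>c\<bar> * H1S_norm u"
  unfolding H1S_norm_def hom_ext_cmult by (intro H1_norm_cmult open_annulus H1S_H1_on)

definition sgrad :: "'a::euclidean_space \<Rightarrow> ('a \<Rightarrow> real) \<Rightarrow> 'a \<Rightarrow> real" where
  "sgrad b u = wderiv annulus (hom_ext u) b"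

lemma sgrad_weak_deriv: "H1S u \<Longrightarrow> b \<in> Basis \<Longrightarrow> has_weak_deriv annulus (hom_ext u) b (sgrad b u)"
  unfolding sgrad_def by (intro H1_on_wderiv H1S_H1_on)

lemma sgrad_L2: "H1S u \<Longrightarrow> b \<in> Basis \<Longrightarrow> L2_on annulus (sgrad b u)"
  using sgrad_weak_deriv weak_deriv_L2 by blast

lemma sgrad_diff_AE:
  assumes "H1S u" "H1S v" "b \<in> Basis"
  shows "AE x in lborel. x \<in> annulus \<longrightarrow> sgrad b (\<lambda>x. u x - v x) x = sgrad b u x - sgrad b v x"
proof -
  have "AE x in lborel. x \<in> annulus \<longrightarrow> sgrad b (\<lambda>x. u x + (-1) * v x) x = sgrad b u x + (-1) * sgrad b v x"
    unfolding sgrad_def hom_ext_add hom_ext_cmult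
    by (intro wderiv_AE_eq open_annulus weak_deriv_add weak_deriv_cmult H1_on_L2 L2_on_cmult H1_on_wderiv H1S_H1_on assms)
  then show ?thesis by simp
qed

text \<open>Degree -1 homogeneity, inherited from the 0-homogeneous extension by uniqueness of weak
  derivatives on the intersection of the annulus with its dilate. The exceptional null set depends
  on c.\<close>

lemma sgrad_scale_AE:
  fixes u :: "'a::euclidean_space \<Rightarrow> real"
  assumes u: "H1S u" and b: "b \<in> Basis" and c: "c > 0"
  shows "AE x in lborel. x \<in> annulus \<longrightarrow> c *\<^sub>R x \<in> annulus \<longrightarrow> sgrad b u x = c * sgrad b u (c *\<^sub>R x)"
proof -
  let ?V = "(\<lambda>x. x /\<^sub>R c) ` (annulus :: 'a set)"
  have im: "?V = {x. c *\<^sub>R x \<in> annulus}" using c by (force simp: image_iff)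
  have "?V = (\<lambda>x. c *\<^sub>R x) -` annulus" unfolding im by auto
  moreover have "open ((\<lambda>x. c *\<^sub>R x) -` (annulus :: 'a set))"
    by (rule open_vimage[OF open_annulus]) (intro continuous_intros)
  ultimately have oV: "open ?V" by metis
  have oU: "open (annulus \<inter> ?V)" using oV open_annulus by auto
  have c0: "c \<noteq> 0" using c by simp
  have "has_weak_deriv ?V (\<lambda>x. hom_ext u (c *\<^sub>R x)) b (\<lambda>x. c * sgrad b u (c *\<^sub>R x))"
    by (rule weak_deriv_scale[OF b H1_on_L2[OF H1S_H1_on[OF u]] sgrad_weak_deriv[OF u b] c0])
  then have 1: "has_weak_deriv ?V (hom_ext u) b (\<lambda>x. c * sgrad b u (c *\<^sub>R x))"
    by (simp add: hom_ext_scale[OF c])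
  have "AE x in lborel. x \<in> annulus \<inter> ?V \<longrightarrow> sgrad b u x = c * sgrad b u (c *\<^sub>R x)"
    by (rule weak_deriv_unique[OF oU weak_deriv_subset[OF sgrad_weak_deriv[OF u b]] weak_deriv_subset[OF 1]])
       (use oU in auto)
  then show ?thesis by eventually_elim (auto simp: im)
qed


section \<open>Radial cutoffs and the Dirichlet form of the sphere\<close>

lemma annulus_inner: "x \<in> annulus \<longleftrightarrow> 1/4 < x \<bullet> x \<and> x \<bullet> x < 4"
proof -
  have "1/2 < norm x \<longleftrightarrow> (1/2)\<^sup>2 < (norm x)\<^sup>2" using power2_less_imp_less[of "1/2" "norm x"] power_strict_mono[of "1/2" "norm x" 2] by auto
  moreover have "norm x < 2 \<longleftrightarrow> (norm x)\<^sup>2 < 2\<^sup>2" using power2_less_imp_less[of "norm x" 2] power_strict_mono[of "norm x" 2 2] by auto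
  ultimately show ?thesis by (simp add: annulus_def power2_norm_eq_inner power2_eq_square[of "2::real"] power2_eq_square[of "1/2::real"])
qed

text \<open>Written in terms of the squared radius, which is smooth also at the origin; the
  parameters p and q are therefore squared radii.\<close>

definition rcut :: "real \<Rightarrow> real \<Rightarrow> 'a::euclidean_space \<Rightarrow> real" where
  "rcut p q x = sstep ((x \<bullet> x - p) / (q - p))"

definition rcut' :: "real \<Rightarrow> real \<Rightarrow> 'a::euclidean_space \<Rightarrow> 'a \<Rightarrow> real" where
  "rcut' p q x v = sstep' ((x \<bullet> x - p) / (q - p)) * (2 * (x \<bullet> v) / (q - p))"

lemma rcut_has_derivative: "p < q \<Longrightarrow> (rcut p q has_derivative rcut' p q x) (at x)"
proof -
  assume pq: "p < q"
  have "((\<lambda>x. (x \<bullet> x - p) / (q - p)) has_derivative (\<lambda>v. 2 * (x \<bullet> v) / (q - p))) (at x)"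
  proof -
    have "((\<lambda>x. (x \<bullet> x - p) * c) has_derivative (\<lambda>v. 2 * (x \<bullet> v) * c)) (at x)" for c
      by (auto intro!: derivative_eq_intros simp: inner_commute)
    from this[of "inverse (q - p)"] show ?thesis by (simp add: divide_inverse)
  qed
  from diff_chain_at[OF this sstep_has_derivative]
  show ?thesis by (simp add: o_def rcut_def[abs_def] rcut'_def[abs_def])
qed

lemma rcut'_continuous: "p < q \<Longrightarrow> continuous_on S (\<lambda>x. rcut' p q x b)"
  unfolding rcut'_def by (intro continuous_intros) auto

lemma rcut_0: "p < q \<Longrightarrow> x \<bullet> x \<le> p \<Longrightarrow> rcut p q x = 0"
  and rcut_1: "p < q \<Longrightarrow> q \<le> x \<bullet> x \<Longrightarrow> rcut p q x = 1"
  unfolding rcut_def by (rule sstep_0 sstep_1; simp add: divide_nonpos_pos le_divide_eq)+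

lemma rcut'_0: "p < q \<Longrightarrow> x \<bullet> x \<le> p \<Longrightarrow> rcut' p q x v = 0"
  and rcut'_1: "p < q \<Longrightarrow> q \<le> x \<bullet> x \<Longrightarrow> rcut' p q x v = 0"
  using sstep'_0[of "(x \<bullet> x - p) / (q - p)"] sstep'_1[of "(x \<bullet> x - p) / (q - p)"]
  unfolding rcut'_def by (simp_all add: divide_nonpos_pos le_divide_eq)

lemma rcut_bounds: "0 \<le> rcut p q x" "rcut p q x \<le> 1"
  by (auto simp: rcut_def sstep_nonneg sstep_le_1)

definition rbump :: "real \<Rightarrow> real \<Rightarrow> real \<Rightarrow> real \<Rightarrow> 'a::euclidean_space \<Rightarrow> real" where
  "rbump p q q' p' x = rcut p q x * (1 - rcut q' p' x)"

lemma rbump_has_derivative: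
  assumes "p < q" "q' < p'"
  shows "(rbump p q q' p' has_derivative (\<lambda>v. rcut p q x * (- rcut' q' p' x v) + rcut' p q x v * (1 - rcut q' p' x))) (at x)"
  unfolding rbump_def[abs_def]
  by (rule has_derivative_mult[OF rcut_has_derivative[OF assms(1)]])
     (use rcut_has_derivative[OF assms(2)] in \<open>auto intro!: derivative_eq_intros\<close>)

lemma rcut_continuous: "p < q \<Longrightarrow> continuous_on S (rcut p q)"
  by (meson continuous_at_imp_continuous_on has_derivative_continuous rcut_has_derivative)

lemma rbump_test_fun:
  assumes "1/4 < p" "p < q" "q' < p'" "p' < 4"
  shows "test_fun annulus (rbump p q q' p' :: 'a::euclidean_space \<Rightarrow> real)"
proof (rule test_funI[OF rbump_has_derivative[OF assms(2,3)]])
  show "continuous_on UNIV (\<lambda>x::'a. rcut p q x * (- rcut' q' p' x b) + rcut' p q x b * (1 - rcut q' p' x))" for b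
    using assms by (intro continuous_intros rcut'_continuous rcut_continuous)
  let ?K = "{x::'a. p \<le> x \<bullet> x} \<inter> {x. x \<bullet> x \<le> p'}"
  have "bounded ?K"
  proof (rule boundedI[where B=2])
    fix x assume "x \<in> ?K"
    then have "(norm x)\<^sup>2 \<le> 2\<^sup>2" using assms unfolding power2_norm_eq_inner by simp
    then show "norm x \<le> 2" by (rule power2_le_imp_le) simp
  qed
  moreover have "closed ?K" by (intro closed_Int closed_Collect_le continuous_intros)
  ultimately show "compact ?K" by (simp add: compact_eq_bounded_closed)
  show "?K \<subseteq> annulus" using assms by (auto simp: annulus_inner)
  show "rbump p q q' p' x = 0" if "x \<notin> ?K" for x
    using that assms by (auto simp: rbump_def not_le rcut_0 rcut_1)
qed

lemma rbump_1:
  assumes "p < q" "q' < p'" "q \<le> x \<bullet> x" "x \<bullet> x \<le> q'"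
  shows "rbump p q q' p' x = 1" "frechet_derivative (rbump p q q' p') (at x) v = 0"
  using assms frechet_derivative_eqI[OF rbump_has_derivative[OF assms(1,2)], of x]
  by (auto simp: rbump_def rcut_0 rcut_1 rcut'_0 rcut'_1)

lemma rbump_0:
  assumes "p < q" "q' < p'" "x \<bullet> x \<le> p \<or> p' \<le> x \<bullet> x"
  shows "rbump p q q' p' x = 0"
  using assms by (auto simp: rbump_def rcut_0 rcut_1)

lemma rbump_nonneg: "0 \<le> rbump p q q' p' x"
  by (simp add: rbump_def rcut_bounds)

text \<open>In squared radii the annulus is (1/4, 4) and the plateau is [9/16, 9/4], that is 3/4
  \<le> |x| \<le> 3/2. Together with the preimages of the plateau under dilation by 2 and 1/2 it
  covers the whole annulus.\<close>

abbreviation inner_cutoff :: "'a::euclidean_space \<Rightarrow> real" where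
  "inner_cutoff \<equiv> rbump (2/5) (9/16) (9/4) 3"

text \<open>Equal to 1 on the support [2/5, 3] (in squared radii) of the inner cutoff, so that
  inside it the extension is not changed.\<close>

abbreviation outer_cutoff :: "'a::euclidean_space \<Rightarrow> real" where
  "outer_cutoff \<equiv> rbump (3/10) (2/5) 3 (7/2)"

lemma inner_cutoff_test: "test_fun annulus inner_cutoff" and outer_cutoff_test: "test_fun annulus outer_cutoff"
  by (intro rbump_test_fun; simp)+

lemma outer_cutoff_on_support:
  "inner_cutoff x \<noteq> 0 \<Longrightarrow> outer_cutoff x = 1 \<and> frechet_derivative outer_cutoff (at x) v = 0"
  using rbump_0[of "2/5" "9/16" "9/4" 3 x] rbump_1[of "3/10" "2/5" 3 "7/2" x] by force

text \<open>Up to a positive factor this is the Dirichlet form of the sphere: the gradients are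
  homogeneous of degree -1 and the weight is radial.\<close>

definition grad_form :: "('a::euclidean_space \<Rightarrow> real) \<Rightarrow> ('a \<Rightarrow> real) \<Rightarrow> real" where
  "grad_form u v = (\<Sum>b\<in>Basis. \<integral>x. inner_cutoff x * (sgrad b u x * sgrad b v x) \<partial>lborel)"

text \<open>The representative of a spherical function to which whole-space translations are
  applied.\<close>

definition hom_cut :: "('a::euclidean_space \<Rightarrow> real) \<Rightarrow> 'a \<Rightarrow> real" where
  "hom_cut u x = outer_cutoff x * hom_ext u x"

definition hom_cut' :: "'a::euclidean_space \<Rightarrow> ('a \<Rightarrow> real) \<Rightarrow> 'a \<Rightarrow> real" where
  "hom_cut' b u x = outer_cutoff x * sgrad b u x + frechet_derivative outer_cutoff (at x) b * hom_ext u x"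

lemma hom_cut_weak_deriv:
  assumes "H1S u" "b \<in> Basis"
  shows "sq_int lborel (hom_cut u)" "has_weak_deriv UNIV (hom_cut u) b (hom_cut' b u)"
  using weak_deriv_cutoff[OF assms(2) outer_cutoff_test H1_on_L2[OF H1S_H1_on[OF assms(1)]] sgrad_weak_deriv[OF assms]]
  unfolding hom_cut_def[abs_def] hom_cut'_def[abs_def] by auto

lemma test_fun_measurable: "test_fun U \<phi> \<Longrightarrow> \<phi> \<in> borel_measurable borel"
  using test_fun_sq_int sq_int_measurable by fastforce

lemma test_fun_deriv_measurable: "test_fun U \<phi> \<Longrightarrow> b \<in> Basis \<Longrightarrow> (\<lambda>x. frechet_derivative \<phi> (at x) b) \<in> borel_measurable borel"
  using test_fun_deriv_sq_int sq_int_measurable by fastforce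

lemma cutoff_bounds:
  assumes b: "b \<in> Basis" and \<xi>: "test_fun U \<xi>"
  obtains C where "C > 0" "\<And>x. \<bar>\<xi> x\<bar> \<le> C" "\<And>x. \<bar>frechet_derivative \<xi> (at x) b\<bar> \<le> C"
proof -
  obtain C where C: "C > 0" "\<And>x. \<bar>\<xi> x\<bar> \<le> C" using test_fun_bounded[OF \<xi>] by blast
  obtain D where D: "D > 0" "\<And>x. \<bar>frechet_derivative \<xi> (at x) b\<bar> \<le> D" using test_fun_deriv_bounded[OF \<xi> b] by blast
  show ?thesis by (rule that[of "max C D"]) (use C D in \<open>auto intro: le_max_iff_disj[THEN iffD2]\<close>)
qed

lemma l2_cutoff_deriv_le:
  assumes b: "b \<in> Basis" and \<xi>: "test_fun U \<xi>" and f: "L2_on U f" and g: "L2_on U g"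
    and C: "\<And>x. \<bar>\<xi> x\<bar> \<le> C" "\<And>x. \<bar>frechet_derivative \<xi> (at x) b\<bar> \<le> C"
  shows "l2 lborel (\<lambda>x. \<xi> x * g x + frechet_derivative \<xi> (at x) b * f x) \<le> C * (l2on U g + l2on U f)"
proof -
  note m = test_fun_measurable[OF \<xi>] test_fun_deriv_measurable[OF \<xi> b]
  have 1: "l2 lborel (\<lambda>x. \<xi> x * g x) \<le> C * l2on U g" "sq_int lborel (\<lambda>x. \<xi> x * g x)"
    by (rule l2_cutoff_le[OF g m(1) C(1)]; use \<xi> in simp)+
  have 2: "l2 lborel (\<lambda>x. frechet_derivative \<xi> (at x) b * f x) \<le> C * l2on U f" "sq_int lborel (\<lambda>x. frechet_derivative \<xi> (at x) b * f x)"
    by (rule l2_cutoff_le[OF f m(2) C(2)]; use \<xi> in simp)+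
  show ?thesis using l2_triangle[OF 1(2) 2(2)] 1 2 by (simp add: distrib_left)
qed

lemma hom_cut_norms:
  obtains C where "C > 0" "\<And>u::'a::euclidean_space \<Rightarrow> real. L2S u \<Longrightarrow> l2 lborel (hom_cut u) \<le> C * L2S_norm u"
    "\<And>b (u::'a::euclidean_space \<Rightarrow> real). b \<in> Basis \<Longrightarrow> H1S u \<Longrightarrow> l2 lborel (hom_cut' b u) \<le> C * H1S_norm u"
proof -
  have "\<exists>C>0. (\<forall>x. \<bar>outer_cutoff (x::'a)\<bar> \<le> C) \<and> (\<forall>x::'a. \<bar>frechet_derivative outer_cutoff (at x) b\<bar> \<le> C)" if "b \<in> Basis" for b
    using cutoff_bounds[OF that outer_cutoff_test] by metis
  then obtain C where C: "\<And>b. b \<in> Basis \<Longrightarrow> C b > 0" "\<And>b x. b \<in> Basis \<Longrightarrow> \<bar>outer_cutoff (x::'a)\<bar> \<le> C b"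
    "\<And>b x::'a. b \<in> Basis \<Longrightarrow> \<bar>frechet_derivative outer_cutoff (at x) b\<bar> \<le> C b" by metis
  define M where "M = (\<Sum>b\<in>(Basis::'a set). C b)"
  have CM: "C b \<le> M" if "b \<in> Basis" for b
    unfolding M_def by (rule member_le_sum) (use that C(1) in \<open>auto intro: less_imp_le\<close>)
  obtain b0 :: 'a where b0: "b0 \<in> Basis" using nonempty_Basis by blast
  have M0: "M > 0" using C(1)[OF b0] CM[OF b0] by linarith
  let ?A = "annulus_const TYPE('a)"
  have A: "1 \<le> ?A" by (rule annulus_const_ge_1)
  show ?thesis
  proof (rule that[of "2 * M * ?A"])
    show "2 * M * ?A > 0" using M0 A by simp
    show "l2 lborel (hom_cut u) \<le> 2 * M * ?A * L2S_norm u" if u: "L2S u" for u :: "'a \<Rightarrow> real"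
    proof -
      have "l2 lborel (hom_cut u) \<le> M * l2on annulus (hom_ext u)"
        unfolding hom_cut_def[abs_def]
        by (rule l2_cutoff_le(1)[OF hom_ext_L2(1)[OF u] test_fun_measurable[OF outer_cutoff_test]])
           (use C(2)[OF b0] CM[OF b0] test_fun_zero[OF outer_cutoff_test] in \<open>auto intro: order_trans\<close>)
      also have "\<dots> = M * ?A * L2S_norm u" by (simp add: hom_ext_L2(2)[OF u])
      also have "\<dots> \<le> 2 * M * ?A * L2S_norm u" using M0 A by (intro mult_right_mono) auto
      finally show ?thesis .
    qed
    show "l2 lborel (hom_cut' b u) \<le> 2 * M * ?A * H1S_norm u" if b: "b \<in> Basis" and u: "H1S u" for b and u :: "'a \<Rightarrow> real"
    proof -
      have "l2 lborel (hom_cut' b u) \<le> M * (l2on annulus (sgrad b u) + l2on annulus (hom_ext u))"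
        unfolding hom_cut'_def[abs_def]
        by (rule l2_cutoff_deriv_le[OF b outer_cutoff_test H1_on_L2[OF H1S_H1_on[OF u]] sgrad_L2[OF u b]])
           (use C(2,3)[OF b] CM[OF b] in \<open>auto intro: order_trans\<close>)
      also have "\<dots> \<le> M * (H1S_norm u + H1S_norm u)"
        using M0 l2on_le_H1_norm[of annulus "hom_ext u"] l2on_wderiv_le_H1_norm[OF b, of annulus "hom_ext u"]
        by (intro mult_left_mono add_mono) (auto simp: H1S_norm_def sgrad_def)
      also have "\<dots> = 2 * M * 1 * H1S_norm u" by simp
      also have "\<dots> \<le> 2 * M * ?A * H1S_norm u" using M0 A by (intro mult_right_mono mult_left_mono) auto
      finally show ?thesis .
    qed
  qed
qed

text \<open>Where the inner cutoff is nonzero the outer one is 1 with zero derivative, so the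
  derivative of the cut-off extension is the original gradient there.\<close>

lemma hom_cut'_inner_cutoff: "inner_cutoff x * (sgrad b u x * f x) = hom_cut' b u x * (inner_cutoff x * f x)"
proof (cases "inner_cutoff x = 0")
  case False
  then have "hom_cut' b u x = sgrad b u x"
    using outer_cutoff_on_support[of x b] by (simp add: hom_cut'_def)
  then show ?thesis by simp
qed simp

text \<open>Integration by parts on the sphere, with difference quotients of the cut-off homogeneous extension.\<close>
lemma grad_form_bound:
  obtains C where "C > 0" "\<And>u v::'a::euclidean_space \<Rightarrow> real. H1S u \<Longrightarrow> H2S v \<Longrightarrow> \<bar>grad_form u v\<bar> \<le> C * L2S_norm u * H2S_norm v"
proof -
  obtain C where C: "C > 0" "\<And>u::'a \<Rightarrow> real. L2S u \<Longrightarrow> l2 lborel (hom_cut u) \<le> C * L2S_norm u"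
    using hom_cut_norms by metis
  have "\<exists>C>0. (\<forall>x. \<bar>inner_cutoff (x::'a)\<bar> \<le> C) \<and> (\<forall>x::'a. \<bar>frechet_derivative inner_cutoff (at x) b\<bar> \<le> C)" if "b \<in> Basis" for b
    using cutoff_bounds[OF that inner_cutoff_test] by metis
  then obtain D where D: "\<And>b. b \<in> Basis \<Longrightarrow> D b > 0" "\<And>b x. b \<in> Basis \<Longrightarrow> \<bar>inner_cutoff (x::'a)\<bar> \<le> D b"
    "\<And>b x::'a. b \<in> Basis \<Longrightarrow> \<bar>frechet_derivative inner_cutoff (at x) b\<bar> \<le> D b" by metis
  have bound: "\<bar>\<integral>x. inner_cutoff x * (sgrad b u x * sgrad b v x) \<partial>lborel\<bar> \<le> C * L2S_norm u * (2 * D b * H2S_norm v)"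
    if b: "b \<in> Basis" and u: "H1S u" and v: "H2S v" for b :: 'a and u v :: "'a \<Rightarrow> real"
  proof -
    let ?s = "sgrad b v"
    have s1: "H1_on annulus ?s" using v b unfolding H2S_def H2_on_def sgrad_def by blast
    \<comment> \<open>One derivative falls on the gradient of \<open>v\<close>; this is where H^2
      regularity enters.\<close>
    note W = weak_deriv_cutoff[OF b inner_cutoff_test H1_on_L2[OF s1] H1_on_wderiv[OF s1 b]]
    have "\<bar>\<integral>x. inner_cutoff x * (sgrad b u x * sgrad b v x) \<partial>lborel\<bar> = \<bar>\<integral>x. hom_cut' b u x * (inner_cutoff x * ?s x) \<partial>lborel\<bar>"
      by (simp add: hom_cut'_inner_cutoff)
    also have "\<dots> \<le> l2 lborel (hom_cut u) * l2 lborel (\<lambda>x. inner_cutoff x * wderiv annulus ?s b x + frechet_derivative inner_cutoff (at x) b * ?s x)"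
      by (rule integration_by_parts_bound[OF b hom_cut_weak_deriv[OF u b] W])
    also have "\<dots> \<le> (C * L2S_norm u) * (2 * D b * H2S_norm v)"
    proof (rule mult_mono)
      show "l2 lborel (hom_cut u) \<le> C * L2S_norm u" by (rule C(2)[OF H1S_L2S[OF u]])
      have "l2 lborel (\<lambda>x. inner_cutoff x * wderiv annulus ?s b x + frechet_derivative inner_cutoff (at x) b * ?s x)
          \<le> D b * (l2on annulus (wderiv annulus ?s b) + l2on annulus ?s)"
        by (rule l2_cutoff_deriv_le[OF b inner_cutoff_test H1_on_L2[OF s1] H1_on_wderiv_L2[OF s1 b] D(2,3)[OF b]])
      also have "\<dots> \<le> D b * (H2S_norm v + H2S_norm v)"
      proof (intro mult_left_mono add_mono)
        have "H1_norm annulus ?s \<le> H2S_norm v" using H1_norm_le_H2_norm(2)[OF b] by (simp add: H2S_norm_def sgrad_def)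
        then show "l2on annulus (wderiv annulus ?s b) \<le> H2S_norm v" "l2on annulus ?s \<le> H2S_norm v"
          using l2on_wderiv_le_H1_norm[OF b, of annulus ?s] l2on_le_H1_norm[of annulus ?s] by linarith+
        show "0 \<le> D b" using D(1)[OF b] by simp
      qed
      finally show "l2 lborel (\<lambda>x. inner_cutoff x * wderiv annulus ?s b x + frechet_derivative inner_cutoff (at x) b * ?s x) \<le> 2 * D b * H2S_norm v"
        by simp
    qed (use C(1) in auto)
    finally show ?thesis by (simp add: mult_ac)
  qed
  define M where "M = (\<Sum>b\<in>(Basis::'a set). C * (2 * D b))"
  have M0: "M \<ge> 0" unfolding M_def using C(1) D(1) by (intro sum_nonneg) (auto intro!: mult_nonneg_nonneg less_imp_le)
  show ?thesis
  proof (rule that[of "M + 1"])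
    show "M + 1 > 0" using M0 by simp
    fix u v :: "'a \<Rightarrow> real" assume u: "H1S u" and v: "H2S v"
    have H0: "0 \<le> H2S_norm v" using order_trans[OF H1_norm_nonneg H1_norm_le_H2_norm(1)] by (simp add: H2S_norm_def)
    have "\<bar>grad_form u v\<bar> \<le> (\<Sum>b\<in>(Basis::'a set). C * L2S_norm u * (2 * D b * H2S_norm v))"
      unfolding grad_form_def by (rule order_trans[OF sum_abs sum_mono]) (rule bound[OF _ u v])
    also have "\<dots> = M * L2S_norm u * H2S_norm v"
      unfolding M_def sum_distrib_right by (intro sum.cong) (auto simp: mult_ac)
    also have "\<dots> \<le> (M + 1) * L2S_norm u * H2S_norm v" using H0 by (intro mult_right_mono) auto
    finally show "\<bar>grad_form u v\<bar> \<le> (M + 1) * L2S_norm u * H2S_norm v" .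
  qed
qed

lemma L2_on_cutoff_square_integrable:
  assumes "test_fun U \<xi>" "L2_on U f" "L2_on U g"
  shows "integrable lborel (\<lambda>x. \<xi> x * (f x * g x))"
proof -
  obtain C where C: "\<And>x. \<bar>\<xi> x\<bar> \<le> C" using test_fun_bounded[OF assms(1)] by blast
  have "sq_int lborel (\<lambda>x. \<xi> x * f x)"
    by (rule l2_cutoff_le(2)[OF assms(2) test_fun_measurable[OF assms(1)] C]) (use assms in simp)
  from L2_on_mult_integrable[OF assms(3) this] show ?thesis using assms by (simp add: mult_ac)
qed

text \<open>The form only sees the gradient under the inner cutoff, but by homogeneity the gradient
  elsewhere in the annulus is a multiple of its value at 2x or x/2, which lies on the plateau. The
  three regions contribute 4, 1 and 2^d after a change of variables, whence 5 + 2^d.\<close>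

lemma H1S_norm_le_grad_form:
  obtains C where "C > 0" "\<And>u::'a::euclidean_space \<Rightarrow> real. H1S u \<Longrightarrow> (H1S_norm u)\<^sup>2 \<le> C * ((L2S_norm u)\<^sup>2 + grad_form u u)"
proof -
  let ?A = "annulus_const TYPE('a)"
  let ?C = "?A\<^sup>2 + (5 + 2 ^ DIM('a))"
  have "(H1S_norm u)\<^sup>2 \<le> ?C * ((L2S_norm u)\<^sup>2 + grad_form u u)" if u: "H1S u" for u :: "'a \<Rightarrow> real"
  proof -
    have part: "(l2on annulus (sgrad b u))\<^sup>2 \<le> (5 + 2 ^ DIM('a)) * (LBINT x. inner_cutoff x * (sgrad b u x * sgrad b u x))"
      if b: "b \<in> Basis" for b
    proof -
      let ?g = "sgrad b u"
      define Q where "Q = (\<lambda>x. inner_cutoff x * (?g x * ?g x))"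
      have Q0: "0 \<le> Q x" for x by (simp add: Q_def rbump_nonneg)
      have Qi: "integrable lborel Q" unfolding Q_def
        by (rule L2_on_cutoff_square_integrable[OF inner_cutoff_test sgrad_L2[OF u b] sgrad_L2[OF u b]])
      then have Qm: "Q \<in> borel_measurable borel" by simp
      have mid: "(?g x)\<^sup>2 \<le> Q x" if "9/16 \<le> x \<bullet> x" "x \<bullet> x \<le> 9/4" for x
        using rbump_1(1)[of "2/5" "9/16" "9/4" 3 x] that by (simp add: Q_def power2_eq_square)
      have ae: "AE x in lborel. (indicator annulus x * ?g x)\<^sup>2 \<le> 4 * Q (0 + 2 *\<^sub>R x) + Q x + Q (0 + (1/2) *\<^sub>R x)"
        using sgrad_scale_AE[OF u b zero_less_numeral[of "num.Bit0 num.One"]] sgrad_scale_AE[OF u b, of "1/2", simplified]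
      proof eventually_elim
        case (elim x)
        have i2: "(2 *\<^sub>R x) \<bullet> (2 *\<^sub>R x) = 4 * (x \<bullet> x)" and i1: "((1/2) *\<^sub>R x) \<bullet> ((1/2) *\<^sub>R x) = (x \<bullet> x) / 4" by simp_all
        show ?case
        proof (cases "x \<in> annulus")
          case True
          then have xx: "1/4 < x \<bullet> x" "x \<bullet> x < 4" by (auto simp: annulus_inner)
          consider "x \<bullet> x < 9/16" | "9/16 \<le> x \<bullet> x" "x \<bullet> x \<le> 9/4" | "9/4 < x \<bullet> x" by linarith
          then show ?thesis
          proof cases
            case 1
            then have "2 *\<^sub>R x \<in> annulus" using xx unfolding annulus_inner i2 by simp
            then have "?g x = 2 * ?g (2 *\<^sub>R x)" using elim True by simp
            moreover have "(?g (2 *\<^sub>R x))\<^sup>2 \<le> Q (2 *\<^sub>R x)" by (rule mid) (use 1 xx i2 in auto)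
            ultimately show ?thesis using Q0[of x] Q0[of "(1/2) *\<^sub>R x"] True by (simp add: power_mult_distrib)
          next
            case 2
            then show ?thesis using mid[of x] Q0[of "2 *\<^sub>R x"] Q0[of "(1/2) *\<^sub>R x"] True by simp
          next
            case 3
            then have "(1/2) *\<^sub>R x \<in> annulus" using xx unfolding annulus_inner i1 by simp
            then have "?g ((1/2) *\<^sub>R x) = 2 * ?g x" using elim True by simp
            moreover have "(?g ((1/2) *\<^sub>R x))\<^sup>2 \<le> Q ((1/2) *\<^sub>R x)" by (rule mid) (use 3 xx i1 in auto)
            ultimately show ?thesis using Q0[of x] Q0[of "2 *\<^sub>R x"] Q0[of "(1/2) *\<^sub>R x"] True by (simp add: power_mult_distrib)
          qed
        qed (use Q0[of x] Q0[of "2 *\<^sub>R x"] Q0[of "(1/2) *\<^sub>R x"] in simp)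
      qed
      have i2: "integrable lborel (\<lambda>x. Q (0 + 2 *\<^sub>R x))" and i1: "integrable lborel (\<lambda>x. Q (0 + (1/2) *\<^sub>R x))"
        by (rule lborel_integrable_affine[OF Qi]; simp)+
      have "(l2on annulus ?g)\<^sup>2 \<le> (LBINT x. 4 * Q (0 + 2 *\<^sub>R x) + Q x + Q (0 + (1/2) *\<^sub>R x))"
        unfolding l2_power2
        by (rule integral_mono_AE) (use sgrad_L2[OF u b] ae i1 i2 Qi in \<open>auto simp: L2_on_iff sq_int_def\<close>)
      also have "\<dots> = 4 * (LBINT x. Q (0 + 2 *\<^sub>R x)) + (LBINT x. Q x) + (LBINT x. Q (0 + (1/2) *\<^sub>R x))"
        using i1 i2 Qi by (simp add: Bochner_Integration.integral_add)
      also have "(LBINT x. Q (0 + (1/2) *\<^sub>R x)) = 2 ^ DIM('a) * (LBINT x. Q x)"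
        using lborel_integral_affine[OF Qm, of "1/2" 0] by (simp add: power_divide field_simps)
      also have "(LBINT x. Q (0 + 2 *\<^sub>R x)) \<le> (LBINT x. Q x)"
      proof -
        have "0 \<le> (LBINT x. Q (0 + 2 *\<^sub>R x))" using Q0 by (intro integral_nonneg_AE AE_I2)
        then have "1 * (LBINT x. Q (0 + 2 *\<^sub>R x)) \<le> 2 ^ DIM('a) * (LBINT x. Q (0 + 2 *\<^sub>R x))"
          by (intro mult_right_mono) auto
        then show ?thesis using lborel_integral_affine[OF Qm, of 2 0] by simp
      qed
      finally show ?thesis by (simp add: Q_def algebra_simps)
    qed
    have "(H1S_norm u)\<^sup>2 \<le> (?A * L2S_norm u)\<^sup>2 + (\<Sum>b\<in>Basis. (5 + 2 ^ DIM('a)) * (LBINT x. inner_cutoff x * (sgrad b u x * sgrad b u x)))"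
      unfolding H1S_norm_def H1_norm_sq hom_ext_L2(2)[OF H1S_L2S[OF u]] sgrad_def[symmetric]
      by (intro add_left_mono sum_mono part)
    also have "\<dots> = ?A\<^sup>2 * (L2S_norm u)\<^sup>2 + (5 + 2 ^ DIM('a)) * grad_form u u"
      by (simp add: grad_form_def sum_distrib_left power_mult_distrib)
    also have "\<dots> \<le> ?C * ((L2S_norm u)\<^sup>2 + grad_form u u)"
    proof -
      have "0 \<le> grad_form u u" unfolding grad_form_def
        by (intro sum_nonneg integral_nonneg_AE AE_I2) (simp add: rbump_nonneg)
      then have "?A\<^sup>2 * grad_form u u \<ge> 0" "(5 + 2 ^ DIM('a)) * (L2S_norm u)\<^sup>2 \<ge> 0" by simp_all
      then show ?thesis by (simp add: algebra_simps)
    qed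
    finally show ?thesis .
  qed
  moreover have "?C > 0" by (simp add: add_nonneg_pos)
  ultimately show ?thesis using that by blast
qed

text \<open>In the first identity the mixed term pairs the difference with \<open>v\<close>. If
  \<open>v\<close> lies in H^2 this term is bounded by the L^2 norm of the difference, so
  convergence of the energies upgrades L^2 convergence to H^1 convergence.\<close>

lemma grad_form_diff:
  assumes u: "H1S u" and v: "H1S v"
  shows "grad_form (\<lambda>x. u x - v x) (\<lambda>x. u x - v x) = grad_form u u - grad_form v v - 2 * grad_form (\<lambda>x. u x - v x) v"
    and "grad_form u u - grad_form v v = grad_form (\<lambda>x. u x - v x) u + grad_form (\<lambda>x. u x - v x) v"
proof -
  have w: "H1S (\<lambda>x. u x - v x)" by (rule H1S_diff[OF u v])
  let ?I = "\<lambda>b u v. \<integral>x. inner_cutoff x * (sgrad b u x * sgrad b v x) \<partial>lborel"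
  have i: "integrable lborel (\<lambda>x. inner_cutoff x * (sgrad b f x * sgrad b g x))" if "b \<in> Basis" "H1S f" "H1S g" for b f g
    using that by (intro L2_on_cutoff_square_integrable[OF inner_cutoff_test] sgrad_L2)
  have d: "?I b (\<lambda>x. u x - v x) f = ?I b u f - ?I b v f" if b: "b \<in> Basis" and f: "H1S f" for b f
  proof -
    have "?I b (\<lambda>x. u x - v x) f = (LBINT x. inner_cutoff x * (sgrad b u x * sgrad b f x) - inner_cutoff x * (sgrad b v x * sgrad b f x))"
    proof (rule integral_cong_AE)
      show "AE x in lborel. inner_cutoff x * (sgrad b (\<lambda>x. u x - v x) x * sgrad b f x) =
          inner_cutoff x * (sgrad b u x * sgrad b f x) - inner_cutoff x * (sgrad b v x * sgrad b f x)"
        using sgrad_diff_AE[OF u v b]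
      proof eventually_elim
        case (elim x)
        then show ?case using test_fun_zero[OF inner_cutoff_test, of x]
          by (cases "x \<in> annulus") (auto simp: left_diff_distrib right_diff_distrib)
      qed
    qed (use i[OF b w f] i[OF b u f] i[OF b v f] in auto)
    then show ?thesis using i[OF b u f] i[OF b v f] by simp
  qed
  have c: "?I b f g = ?I b g f" for b f g by (simp add: mult_ac)
  have lin: "grad_form (\<lambda>x. u x - v x) f = grad_form u f - grad_form v f" if "H1S f" for f
    unfolding grad_form_def sum_subtractf[symmetric] by (intro sum.cong d that refl)
  have sym: "grad_form f g = grad_form g f" for f g
    unfolding grad_form_def by (intro sum.cong c refl)
  show "grad_form (\<lambda>x. u x - v x) (\<lambda>x. u x - v x) = grad_form u u - grad_form v v - 2 * grad_form (\<lambda>x. u x - v x) v"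
    using lin[OF w] lin[OF u] lin[OF v] sym[of u "\<lambda>x. u x - v x"] sym[of v "\<lambda>x. u x - v x"] sym[of u v] by simp
  show "grad_form u u - grad_form v v = grad_form (\<lambda>x. u x - v x) u + grad_form (\<lambda>x. u x - v x) v"
    using lin[OF u] lin[OF v] sym[of u v] by simp
qed

text \<open>Expresses a pairing of the ambient extension with any square integrable function as a
  pairing on the sphere, so that spatial difference quotients become admissible test functions for
  the time derivative.\<close>

lemma hom_cut_inner:
  fixes u f :: "'a::euclidean_space \<Rightarrow> real"
  assumes u: "L2S u" and f: "sq_int lborel f"
  shows "(LBINT x. hom_cut u x * f x) = sph_inner u (radial_mean (\<lambda>x. outer_cutoff x * f x))"
    and "L2S (radial_mean (\<lambda>x. outer_cutoff x * f x))"
proof -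
  have s: "sq_int lborel (\<lambda>x. outer_cutoff x * f x)"
  proof -
    obtain C where C: "\<And>x. \<bar>outer_cutoff (x::'a)\<bar> \<le> C" using test_fun_bounded[OF outer_cutoff_test] by metis
    show ?thesis by (rule sq_int_bounded_mult[OF f _ C]) (simp add: test_fun_measurable[OF outer_cutoff_test])
  qed
  show "L2S (radial_mean (\<lambda>x. outer_cutoff x * f x))" by (rule L2S_radial_mean(1)[OF s])
  have "(LBINT x. hom_cut u x * f x) = (LBINT y. indicator {1/2<..<2} (norm y) * u (y /\<^sub>R norm y) * (outer_cutoff y * f y))"
  proof (rule Bochner_Integration.integral_cong[OF refl])
    show "hom_cut u x * f x = indicator {1/2<..<2} (norm x) * u (x /\<^sub>R norm x) * (outer_cutoff x * f x)" for x
      using test_fun_zero[OF outer_cutoff_test, of x] unfolding indicator_annulus[symmetric]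
      by (cases "x \<in> annulus") (auto simp: hom_cut_def hom_ext_def)
  qed
  also have "\<dots> = sph_inner u (radial_mean (\<lambda>x. outer_cutoff x * f x))"
    by (rule L2S_radial_mean(2)[OF s u])
  finally show "(LBINT x. hom_cut u x * f x) = sph_inner u (radial_mean (\<lambda>x. outer_cutoff x * f x))" .
qed

text \<open>Testing with difference quotients of the cut-off gradient of \<open>\<eta>\<close> shows that this gradient is the time
  integral of the gradients of \<open>v\<close>.\<close>
lemma grad_form_time_integral:
  obtains C where "C > 0"
    "\<And>(\<eta> :: 'a::euclidean_space \<Rightarrow> real) (v :: real \<Rightarrow> 'a \<Rightarrow> real) I. H2S \<eta> \<Longrightarrow> (\<And>\<tau>. \<tau> \<in> I \<Longrightarrow> H1S (v \<tau>)) \<Longrightarrow>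
      integrable lborel (\<lambda>\<tau>. indicator I \<tau> * H1S_norm (v \<tau>)) \<Longrightarrow>
      (\<And>\<sigma>. L2S \<sigma> \<Longrightarrow> sph_inner \<eta> \<sigma> = (LBINT \<tau>. indicator I \<tau> * sph_inner (v \<tau>) \<sigma>)) \<Longrightarrow>
      \<bar>grad_form \<eta> \<eta>\<bar> \<le> C * (LBINT \<tau>. indicator I \<tau> * H1S_norm (v \<tau>)) * H1S_norm \<eta>"
proof -
  obtain C where C: "C > 0" "\<And>b (u::'a \<Rightarrow> real). b \<in> Basis \<Longrightarrow> H1S u \<Longrightarrow> l2 lborel (hom_cut' b u) \<le> C * H1S_norm u"
    using hom_cut_norms by metis
  obtain D where D: "D > 0" "\<And>x. \<bar>inner_cutoff (x::'a)\<bar> \<le> D" using test_fun_bounded[OF inner_cutoff_test] by metis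
  have bound: "\<bar>\<integral>x. inner_cutoff x * (sgrad b \<eta> x * sgrad b \<eta> x) \<partial>lborel\<bar> \<le> C * (LBINT \<tau>. indicator I \<tau> * H1S_norm (v \<tau>)) * (D * H1S_norm \<eta>)"
    if b: "b \<in> Basis" and \<eta>: "H2S \<eta>" and v: "\<And>\<tau>. \<tau> \<in> I \<Longrightarrow> H1S (v \<tau>)"
      and N: "integrable lborel (\<lambda>\<tau>. indicator I \<tau> * H1S_norm (v \<tau>))"
      and weak: "\<And>\<sigma>. L2S \<sigma> \<Longrightarrow> sph_inner \<eta> \<sigma> = (LBINT \<tau>. indicator I \<tau> * sph_inner (v \<tau>) \<sigma>)"
    for b and \<eta> :: "'a \<Rightarrow> real" and v I
  proof -
    let ?M = "\<integral>\<tau>. indicator I \<tau> * H1S_norm (v \<tau>) \<partial>lborel"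
    have \<eta>1: "H1S \<eta>" by (rule H2S_H1S[OF \<eta>])
    let ?s = "sgrad b \<eta>"
    have s1: "H1_on annulus ?s" using \<eta> b unfolding H2S_def H2_on_def sgrad_def by blast
    define W where "W = (\<lambda>x. inner_cutoff x * ?s x)"
    define H where "H = (\<lambda>x. inner_cutoff x * wderiv annulus ?s b x + frechet_derivative inner_cutoff (at x) b * ?s x)"
    have W: "sq_int lborel W" "has_weak_deriv UNIV W b H"
      unfolding W_def H_def by (rule weak_deriv_cutoff[OF b inner_cutoff_test H1_on_L2[OF s1] H1_on_wderiv[OF s1 b]])+
    note V = hom_cut_weak_deriv[OF \<eta>1 b]
    have M0: "0 \<le> ?M" by (intro integral_nonneg_AE AE_I2) simp
    have eq: "(LBINT x. inner_cutoff x * (?s x * ?s x)) = (LBINT x. hom_cut' b \<eta> x * W x)"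
      unfolding W_def by (simp add: hom_cut'_inner_cutoff)
    have "\<bar>\<integral>x. hom_cut' b \<eta> x * W x \<partial>lborel\<bar> \<le> C * ?M * l2 lborel W"
    proof (rule le_if_le_add_mult)
      fix h :: real assume h: "0 < h"
      let ?D = "\<lambda>x. W (x - h *\<^sub>R b) - W x"
      have Ds: "sq_int lborel ?D" using sq_int_shift[OF W(1), of "- (h *\<^sub>R b)"] by (intro sq_int_diff W) simp
      \<comment> \<open>The difference is moved from \<open>W\<close> to the extension of v(\<tau>),
        where it costs h times the gradient; only the L^2 norm of \<open>W\<close> remains.\<close>
      have each: "\<bar>\<integral>x. hom_cut (v \<tau>) x * ?D x \<partial>lborel\<bar> \<le> h * (C * H1S_norm (v \<tau>)) * l2 lborel W" if \<tau>: "\<tau> \<in> I" for \<tau>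
      proof -
        note Vt = hom_cut_weak_deriv[OF v[OF \<tau>] b]
        have Vs: "sq_int lborel (\<lambda>x. hom_cut (v \<tau>) (x + h *\<^sub>R b) - hom_cut (v \<tau>) x)"
          using sq_int_shift[OF Vt(1), of "h *\<^sub>R b"] by (intro sq_int_diff Vt) (simp add: add.commute)
        have "\<bar>\<integral>x. hom_cut (v \<tau>) x * ?D x \<partial>lborel\<bar> = \<bar>\<integral>x. (hom_cut (v \<tau>) (x + h *\<^sub>R b) - hom_cut (v \<tau>) x) * W x \<partial>lborel\<bar>"
          using difference_inner_shift[OF Vt(1) W(1)] by simp
        also have "\<dots> \<le> l2 lborel (\<lambda>x. hom_cut (v \<tau>) (x + h *\<^sub>R b) - hom_cut (v \<tau>) x) * l2 lborel W"
          by (rule Cauchy_Schwarz_l2[OF Vs W(1)])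
        also have "\<dots> \<le> (h * l2 lborel (hom_cut' b (v \<tau>))) * l2 lborel W"
          using h by (intro mult_right_mono l2_difference_le(2)[OF b Vt]) auto
        also have "\<dots> \<le> (h * (C * H1S_norm (v \<tau>))) * l2 lborel W"
          using h by (intro mult_right_mono mult_left_mono C(2)[OF b v[OF \<tau>]]) auto
        finally show ?thesis .
      qed
      let ?r = "radial_mean (\<lambda>x. outer_cutoff x * ?D x)"
      have rL: "L2S ?r" by (rule hom_cut_inner(2)[OF H1S_L2S[OF \<eta>1] Ds])
      have "(LBINT x. hom_cut \<eta> x * ?D x) = sph_inner \<eta> ?r"
        by (rule hom_cut_inner(1)[OF H1S_L2S[OF \<eta>1] Ds])
      also have "\<dots> = (LBINT \<tau>. indicator I \<tau> * sph_inner (v \<tau>) ?r)" by (rule weak[OF rL])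
      finally have 1: "(LBINT x. hom_cut \<eta> x * ?D x) = (LBINT \<tau>. indicator I \<tau> * sph_inner (v \<tau>) ?r)" .
      have 2: "\<bar>\<integral>\<tau>. indicator I \<tau> * sph_inner (v \<tau>) ?r \<partial>lborel\<bar> \<le> (LBINT \<tau>. (h * C * l2 lborel W) * (indicator I \<tau> * H1S_norm (v \<tau>)))"
      proof (cases "integrable lborel (\<lambda>\<tau>. indicator I \<tau> * sph_inner (v \<tau>) ?r)")
        case True
        show ?thesis
        proof (rule order_trans[OF integral_abs_bound integral_mono])
          show "integrable lborel (\<lambda>\<tau>. \<bar>indicator I \<tau> * sph_inner (v \<tau>) ?r\<bar>)" using True by simp
          show "integrable lborel (\<lambda>\<tau>. (h * C * l2 lborel W) * (indicator I \<tau> * H1S_norm (v \<tau>)))" using N by simp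
          show "\<bar>indicator I \<tau> * sph_inner (v \<tau>) ?r\<bar> \<le> (h * C * l2 lborel W) * (indicator I \<tau> * H1S_norm (v \<tau>))" for \<tau>
            using each[of \<tau>] hom_cut_inner(1)[OF H1S_L2S[OF v] Ds, of \<tau>] by (cases "\<tau> \<in> I") (auto simp: mult_ac)
        qed
      next
        \<comment> \<open>A non-integrable function has integral 0 by convention, so the bound is
          trivial here.\<close>
        case False
        have "0 \<le> (LBINT \<tau>. (h * C * l2 lborel W) * (indicator I \<tau> * H1S_norm (v \<tau>)))"
          using h C(1) by (intro integral_nonneg_AE AE_I2) simp
        then show ?thesis using not_integrable_integral_eq[OF False] by simp
      qed
      have 3: "\<bar>\<integral>x. hom_cut \<eta> x * ?D x \<partial>lborel\<bar> \<le> h * (C * ?M * l2 lborel W)"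
        using 2 unfolding 1 integral_mult_right_zero by (simp only: mult_ac)
      have 0: "h * \<bar>\<integral>x. hom_cut' b \<eta> x * W x \<partial>lborel\<bar> = \<bar>h * (LBINT x. hom_cut' b \<eta> x * W x)\<bar>" using h by (simp add: abs_mult)
      \<comment> \<open>Replaces the difference of \<open>W\<close> by h times the gradient term, up
        to an error of order h^2; dividing by h then closes the estimate.\<close>
      have "\<bar>(LBINT x. hom_cut \<eta> x * ?D x) - h * (LBINT x. hom_cut' b \<eta> x * W x)\<bar> \<le> h\<^sup>2 * (l2 lborel (hom_cut' b \<eta>) * l2 lborel H)"
        by (rule difference_quotient_error[OF b V W]) (use h in simp)
      with 3 have "h * \<bar>\<integral>x. hom_cut' b \<eta> x * W x \<partial>lborel\<bar> \<le> h * (C * ?M * l2 lborel W) + h\<^sup>2 * (l2 lborel (hom_cut' b \<eta>) * l2 lborel H)"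
        unfolding 0 by linarith
      also have "\<dots> = h * (C * ?M * l2 lborel W + h * (l2 lborel (hom_cut' b \<eta>) * l2 lborel H))"
        by (simp add: algebra_simps power2_eq_square)
      finally show "\<bar>\<integral>x. hom_cut' b \<eta> x * W x \<partial>lborel\<bar> \<le> C * ?M * l2 lborel W + h * (l2 lborel (hom_cut' b \<eta>) * l2 lborel H)"
        using h by (simp only: mult_le_cancel_left_pos)
    qed
    also have "\<dots> \<le> C * ?M * (D * H1S_norm \<eta>)"
    proof (rule mult_left_mono)
      have "l2 lborel W \<le> D * l2on annulus ?s" unfolding W_def
        by (rule l2_cutoff_le(1)[OF sgrad_L2[OF \<eta>1 b] test_fun_measurable[OF inner_cutoff_test] D(2)])
           (use test_fun_zero[OF inner_cutoff_test] in auto)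
      also have "\<dots> \<le> D * H1S_norm \<eta>"
        using D(1) l2on_wderiv_le_H1_norm[OF b, of annulus "hom_ext \<eta>"] by (intro mult_left_mono) (auto simp: H1S_norm_def sgrad_def)
      finally show "l2 lborel W \<le> D * H1S_norm \<eta>" .
    qed (use C(1) M0 in simp)
    finally show ?thesis unfolding eq .
  qed
  show ?thesis
  proof (rule that[of "real DIM('a) * (C * D)"])
    show "real DIM('a) * (C * D) > 0" using C(1) D(1) by simp
    fix \<eta> :: "'a \<Rightarrow> real" and v :: "real \<Rightarrow> 'a \<Rightarrow> real" and I
    assume a: "H2S \<eta>" "\<And>\<tau>. \<tau> \<in> I \<Longrightarrow> H1S (v \<tau>)" "integrable lborel (\<lambda>\<tau>. indicator I \<tau> * H1S_norm (v \<tau>))"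
      "\<And>\<sigma>. L2S \<sigma> \<Longrightarrow> sph_inner \<eta> \<sigma> = (LBINT \<tau>. indicator I \<tau> * sph_inner (v \<tau>) \<sigma>)"
    have "\<bar>grad_form \<eta> \<eta>\<bar> \<le> (\<Sum>b\<in>(Basis::'a set). C * (LBINT \<tau>. indicator I \<tau> * H1S_norm (v \<tau>)) * (D * H1S_norm \<eta>))"
      unfolding grad_form_def by (rule order_trans[OF sum_abs sum_mono]) (rule bound[OF _ a])
    then show "\<bar>grad_form \<eta> \<eta>\<bar> \<le> real DIM('a) * (C * D) * (LBINT \<tau>. indicator I \<tau> * H1S_norm (v \<tau>)) * H1S_norm \<eta>"
      by (simp add: mult_ac)
  qed
qed

subsection \<open>Functions of time\<close>

text \<open>Test with the difference of two steep steps starting at a and b. Its derivative is a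
  difference of two one-sided unit-mass kernels, which by continuity of f pick out f(a) - f(b),
  while the test function itself tends to the indicator of (a,b].\<close>

lemma weak_FTC_open:
  fixes f g :: "real \<Rightarrow> real"
  assumes f: "continuous_on {0..T} f" and g: "set_integrable lborel {0<..<T} g"
    and weak: "\<And>\<phi>. test_fun {0<..<T} \<phi> \<Longrightarrow>
      set_lebesgue_integral lborel {0<..<T} (\<lambda>t. f t * frechet_derivative \<phi> (at t) 1) = - set_lebesgue_integral lborel {0<..<T} (\<lambda>t. g t * \<phi> t)"
    and ab: "0 < a" "a < b" "b < T"
  shows "f b - f a = (LBINT t. indicator {a..b} t * g t)"
proof -
  define F where "F = (\<lambda>t. indicator {0<..<T} t * f t)"
  have Fm[measurable]: "F \<in> borel_measurable borel"
  proof -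
    have "continuous_on {0<..<T} f" by (rule continuous_on_subset[OF f]) auto
    from set_measurable_continuous_on[OF _ this] show ?thesis
      by (simp add: F_def set_borel_measurable_def)
  qed
  obtain B where B: "B > 0" "\<And>t. \<bar>F t\<bar> \<le> B"
  proof -
    have "compact (f ` {0..T})" by (intro compact_continuous_image f) auto
    then obtain B where "B > 0" "\<And>t. t \<in> {0..T} \<Longrightarrow> \<bar>f t\<bar> \<le> B"
      using bounded_pos[of "f ` {0..T}"] compact_imp_bounded by auto
    then show ?thesis by (intro that[of B]) (auto simp: F_def indicator_def)
  qed
  have Fc: "isCont F c" if "0 < c" "c < T" for c
  proof -
    have "continuous_on {0<..<T} F"
      by (rule continuous_on_eq[OF continuous_on_subset[OF f]]) (auto simp: F_def)
    then show ?thesis using that by (simp add: continuous_on_eq_continuous_at)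
  qed
  have sm[measurable]: "sstep' \<in> borel_measurable borel"
    by (rule borel_measurable_continuous_onI) (intro continuous_intros)
  have si: "integrable lborel (\<lambda>s. (3/2) * indicator {0..1::real} s :: real)" by simp
  have sb: "\<bar>sstep' s\<bar> \<le> (3/2) * indicator {0..1} s" for s
    using sstep'_nonneg[of s] sstep'_le[of s] sstep'_0[of s] sstep'_1[of s] by (auto simp: indicator_def)
  have s1: "(LBINT s. sstep' s) = 1"
  proof -
    have "(LBINT s. indicator {0..1} s *\<^sub>R sstep' s) = sstep 1 - sstep 0"
      by (rule integral_FTC_Icc)
         (auto intro!: continuous_intros simp flip: has_real_derivative_iff_has_vector_derivative intro: sstep_has_field_derivative)
    moreover have "(\<lambda>s. indicator {0..1} s *\<^sub>R sstep' s) = sstep'"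
      by (auto simp: fun_eq_iff indicator_def sstep'_def)
    ultimately show ?thesis by (simp add: sstep_def)
  qed
  \<comment> \<open>A lower bound for the steepness that keeps b + 1/\<nu> below T, so that the test
    functions are supported in (0,T).\<close>
  define N where "N = nat \<lceil>1 / (T - b)\<rceil> + 1"
  define \<nu> where "\<nu> n = real (n + N)" for n
  have \<nu>: "\<nu> n > 0" "1 / \<nu> n < T - b" for n
  proof -
    have "1 / (T - b) < real N" unfolding N_def using ab by linarith
    also have "\<dots> \<le> \<nu> n" by (simp add: \<nu>_def)
    finally have 1: "1 / (T - b) < \<nu> n" .
    have "0 < 1 / (T - b)" using ab by simp
    with 1 show "\<nu> n > 0" by linarith
    with 1 ab show "1 / \<nu> n < T - b" by (simp add: field_simps)
  qed
  have \<nu>_top: "filterlim \<nu> at_top sequentially"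
    unfolding \<nu>_def by (rule filterlim_compose[OF filterlim_real_sequentially filterlim_add_const_nat_at_top])
  have mean: "(\<lambda>n. \<integral>t. F t * (\<nu> n * sstep' (\<nu> n * (t - c))) \<partial>lborel) \<longlonglongrightarrow> F c"
    and mi: "integrable lborel (\<lambda>t. F t * (\<nu> n * sstep' (\<nu> n * (t - c))))" if c: "0 < c" "c < T" for c n
  proof -
    have dom: "integrable lborel (\<lambda>s. B * ((3/2) * indicator {0..1::real} s))" using si by simp
    have bd: "\<bar>F (c + s / \<nu> n) * sstep' s\<bar> \<le> B * ((3/2) * indicator {0..1} s)" for s n
      unfolding abs_mult by (intro mult_mono B sb) (use B(1) in auto)
    have ii: "integrable lborel (\<lambda>s. F (c + s / \<nu> n) * sstep' s)" for n
      by (rule Bochner_Integration.integrable_bound[OF dom], measurable) (intro AE_I2, simp only: real_norm_def, rule order_trans[OF bd abs_ge_self])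
    have sub: "F (c + 1 / \<nu> n * s) * (\<nu> n * sstep' (\<nu> n * (c + 1 / \<nu> n * s - c))) = \<nu> n * (F (c + s / \<nu> n) * sstep' s)" for n s
      using \<nu>(1)[of n] by simp
    have "(LBINT t. F t * (\<nu> n * sstep' (\<nu> n * (t - c)))) = (LBINT s. F (c + s / \<nu> n) * sstep' s)" for n
      using \<nu>(1)[of n] by (subst lborel_integral_real_affine[where c="1 / \<nu> n" and t=c]) (simp_all only: sub, simp_all)
    moreover have "(\<lambda>n. \<integral>s. F (c + s / \<nu> n) * sstep' s \<partial>lborel) \<longlonglongrightarrow> (LBINT s. F c * sstep' s)"
    proof (rule integral_dominated_convergence[OF _ _ dom])
      show "AE s in lborel. (\<lambda>n. F (c + s / \<nu> n) * sstep' s) \<longlonglongrightarrow> F c * sstep' s"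
      proof (intro AE_I2 tendsto_mult tendsto_const)
        fix s
        have "(\<lambda>n. c + s / \<nu> n) \<longlonglongrightarrow> c + 0"
          by (intro tendsto_intros real_tendsto_divide_at_top[OF tendsto_const \<nu>_top])
        then show "(\<lambda>n. F (c + s / \<nu> n)) \<longlonglongrightarrow> F c"
          using isCont_tendsto_compose[OF Fc[OF c]] by simp
      qed
      show "AE s in lborel. norm (F (c + s / \<nu> n) * sstep' s) \<le> B * (3 / 2 * indicator {0..1} s)" for n
        using bd by simp
    qed measurable
    ultimately show "(\<lambda>n. \<integral>t. F t * (\<nu> n * sstep' (\<nu> n * (t - c))) \<partial>lborel) \<longlonglongrightarrow> F c"
      using s1 by simp
    show "integrable lborel (\<lambda>t. F t * (\<nu> n * sstep' (\<nu> n * (t - c))))"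
    proof (subst lborel_integrable_real_affine_iff[symmetric, where c="1 / \<nu> n" and t=c])
      show "integrable lborel (\<lambda>s. F (c + 1 / \<nu> n * s) * (\<nu> n * sstep' (\<nu> n * (c + 1 / \<nu> n * s - c))))"
        unfolding sub using ii by simp
    qed (use \<nu>(1)[of n] in simp)
  qed
  define \<phi> where "\<phi> n t = sstep (\<nu> n * (t - a)) - sstep (\<nu> n * (t - b))" for n t
  define \<phi>' where "\<phi>' n t = \<nu> n * sstep' (\<nu> n * (t - a)) - \<nu> n * sstep' (\<nu> n * (t - b))" for n t
  have der: "(\<phi> n has_derivative (\<lambda>v. \<phi>' n t * v)) (at t)" for n t
  proof -
    have "(\<phi> n has_real_derivative \<phi>' n t) (at t)"
      unfolding \<phi>_def[abs_def] \<phi>'_def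
      by (auto intro!: derivative_eq_intros DERIV_chain2[OF sstep_has_field_derivative])
    then show ?thesis by (simp add: has_field_derivative_def)
  qed
  have test: "test_fun {0<..<T} (\<phi> n)" for n
  proof (rule test_funI[OF der])
    show "continuous_on UNIV (\<lambda>t. \<phi>' n t * k)" for k unfolding \<phi>'_def by (intro continuous_intros)
    show "compact {a..b + 1 / \<nu> n}" "{a..b + 1 / \<nu> n} \<subseteq> {0<..<T}" using ab \<nu>(2)[of n] by auto
    fix t assume "t \<notin> {a..b + 1 / \<nu> n}"
    then consider "t < a" | "b + 1 / \<nu> n < t" by fastforce
    then show "\<phi> n t = 0"
    proof cases
      case 1
      then have "\<nu> n * (t - a) \<le> 0" "\<nu> n * (t - b) \<le> 0" using \<nu>(1)[of n] ab by (auto intro!: mult_nonneg_nonpos)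
      then show ?thesis by (simp add: \<phi>_def sstep_0)
    next
      case 2
      then have "\<nu> n * (t - b) \<ge> 1" using \<nu>(1)[of n] by (simp add: field_simps)
      moreover have "\<nu> n * (t - b) \<le> \<nu> n * (t - a)" using \<nu>(1)[of n] ab by (intro mult_left_mono) auto
      ultimately show ?thesis by (simp add: \<phi>_def sstep_1)
    qed
  qed
  have d1: "frechet_derivative (\<phi> n) (at t) 1 = \<phi>' n t" for n t
    using frechet_derivative_eqI[OF der[of n t]] by simp
  have L: "(\<lambda>n. \<integral>t. F t * \<phi>' n t \<partial>lborel) \<longlonglongrightarrow> F a - F b"
  proof -
    have "(LBINT t. F t * \<phi>' n t) = (LBINT t. F t * (\<nu> n * sstep' (\<nu> n * (t - a)))) - (LBINT t. F t * (\<nu> n * sstep' (\<nu> n * (t - b))))" for n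
    proof -
      have "(LBINT t. F t * \<phi>' n t) = (LBINT t. F t * (\<nu> n * sstep' (\<nu> n * (t - a))) - F t * (\<nu> n * sstep' (\<nu> n * (t - b))))"
        by (intro Bochner_Integration.integral_cong refl) (simp add: \<phi>'_def right_diff_distrib)
      also have "\<dots> = (LBINT t. F t * (\<nu> n * sstep' (\<nu> n * (t - a)))) - (LBINT t. F t * (\<nu> n * sstep' (\<nu> n * (t - b))))"
        by (rule Bochner_Integration.integral_diff; rule mi; use ab in linarith)
      finally show ?thesis .
    qed
    then show ?thesis using ab by (simp only:) (intro tendsto_diff mean; simp)
  qed
  define H where "H = (\<lambda>t. indicator {0<..<T} t * g t)"
  have Hi: "integrable lborel H" using g by (simp add: set_integrable_def H_def)
  have Hm[measurable]: "H \<in> borel_measurable borel" using Hi by simp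
  have R: "(\<lambda>n. \<integral>t. H t * \<phi> n t \<partial>lborel) \<longlonglongrightarrow> (LBINT t. H t * indicator {a<..b} t)"
  proof (rule integral_dominated_convergence[where w="\<lambda>t. \<bar>H t\<bar>"])
    have [measurable]: "\<phi> n \<in> borel_measurable borel" for n by (rule test_fun_measurable[OF test])
    show "(\<lambda>t. H t * \<phi> n t) \<in> borel_measurable lborel" for n by measurable
    show "AE t in lborel. (\<lambda>n. H t * \<phi> n t) \<longlonglongrightarrow> H t * indicator {a<..b} t"
    proof (intro AE_I2 tendsto_mult tendsto_const)
      fix t
      have ev: "eventually (\<lambda>n. sstep (\<nu> n * (t - c)) = indicator {c<..} t) sequentially" for c
      proof (cases "c < t")
        case True
        have "eventually (\<lambda>n. \<nu> n \<ge> 1 / (t - c)) sequentially" using \<nu>_top by (simp add: filterlim_at_top)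
        then show ?thesis by eventually_elim (use True in \<open>auto simp: field_simps intro!: sstep_1\<close>)
      next
        case False
        have "sstep (\<nu> n * (t - c)) = 0" for n
          by (rule sstep_0) (use False \<nu>(1)[of n] in \<open>auto intro!: mult_nonneg_nonpos\<close>)
        then show ?thesis using False by simp
      qed
      have "eventually (\<lambda>n. \<phi> n t = indicator {a<..b} t) sequentially"
        using ev[of a] ev[of b] by eventually_elim (use ab in \<open>auto simp: \<phi>_def indicator_def\<close>)
      then show "(\<lambda>n. \<phi> n t) \<longlonglongrightarrow> indicator {a<..b} t" by (rule tendsto_eventually)
    qed
    show "AE t in lborel. norm (H t * \<phi> n t) \<le> \<bar>H t\<bar>" for n
    proof (intro AE_I2)
      fix t
      have "\<bar>\<phi> n t\<bar> \<le> 1" unfolding \<phi>_def using sstep_nonneg[of "\<nu> n * (t - a)"] sstep_nonneg[of "\<nu> n * (t - b)"] sstep_le_1[of "\<nu> n * (t - a)"] sstep_le_1[of "\<nu> n * (t - b)"] by linarith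
      then show "norm (H t * \<phi> n t) \<le> \<bar>H t\<bar>" by (simp add: abs_mult mult_left_le)
    qed
  qed (use Hi in auto)
  have "(LBINT t. F t * \<phi>' n t) = - (LBINT t. H t * \<phi> n t)" for n
    using weak[OF test[of n]] by (simp add: d1 set_lebesgue_integral_def F_def H_def mult.assoc)
  then have "(\<lambda>n. \<integral>t. F t * \<phi>' n t \<partial>lborel) \<longlonglongrightarrow> - (LBINT t. H t * indicator {a<..b} t)"
    using tendsto_minus[OF R] by simp
  from LIMSEQ_unique[OF L this] have "F b - F a = (LBINT t. H t * indicator {a<..b} t)" by simp
  also have "\<dots> = (LBINT t. indicator {a..b} t * g t)"
  proof (rule integral_cong_AE)
    have "(\<lambda>t. indicator {a..b} t * H t) = (\<lambda>t. indicator {a..b} t * g t)"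
      using ab by (auto simp: H_def indicator_def fun_eq_iff)
    moreover have "(\<lambda>t. indicator {a..b} t * H t) \<in> borel_measurable lborel" by measurable
    ultimately show "(\<lambda>t. indicator {a..b} t * g t) \<in> borel_measurable lborel" by simp
    show "AE t in lborel. H t * indicator {a<..b} t = indicator {a..b} t * g t"
      using AE_lborel_singleton[of a] by eventually_elim (use ab in \<open>auto simp: H_def indicator_def\<close>)
  qed measurable
  finally show ?thesis using ab by (simp add: F_def)
qed

text \<open>Weak derivatives only see the open interval; continuity of f on the closed one and
  integrability of g allow the end points to be approached from inside.\<close>

lemma weak_FTC:
  fixes f g :: "real \<Rightarrow> real"
  assumes f: "continuous_on {0..T} f" and g: "set_integrable lborel {0<..<T} g"
    and weak: "\<And>\<phi>. test_fun {0<..<T} \<phi> \<Longrightarrow>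
      set_lebesgue_integral lborel {0<..<T} (\<lambda>t. f t * frechet_derivative \<phi> (at t) 1) = - set_lebesgue_integral lborel {0<..<T} (\<lambda>t. g t * \<phi> t)"
    and ab: "0 \<le> a" "a \<le> b" "b \<le> T"
  shows "f b - f a = (LBINT t. indicator {a..b} t * g t)"
proof (cases "a = b")
  case True
  have "AE t in lborel. indicator {b..b} t * g t = 0"
    using AE_lborel_singleton[of b] by eventually_elim auto
  moreover have "(\<lambda>t. indicator {b..b} t * g t) = (\<lambda>t. g b * indicator {b} t)"
    by (auto simp: indicator_def)
  ultimately show ?thesis using True by simp
next
  case False
  then have lt: "a < b" using ab by simp
  \<comment> \<open>The shift 3 keeps c at most (b-a)/3, so that a + c < b - c for every
    index.\<close>
  define c where "c k = (b - a) / real (k + 3)" for k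
  have c: "0 < c k" "c k \<le> (b - a) / 3" for k
  proof -
    show "0 < c k" using lt by (simp add: c_def)
    show "c k \<le> (b - a) / 3" unfolding c_def by (rule divide_left_mono) (use lt in auto)
  qed
  have c0: "c \<longlonglongrightarrow> 0"
    unfolding c_def
    by (intro real_tendsto_divide_at_top[OF tendsto_const] filterlim_compose[OF filterlim_real_sequentially filterlim_add_const_nat_at_top])
  have in1: "a + c k \<in> {0..T}" "b - c k \<in> {0..T}" for k using c[of k] ab lt by auto
  have la: "(\<lambda>k. a + c k) \<longlonglongrightarrow> a" and lb: "(\<lambda>k. b - c k) \<longlonglongrightarrow> b"
    using tendsto_add[OF tendsto_const c0, of a] tendsto_diff[OF tendsto_const c0, of b] by simp_all
  have fa: "(\<lambda>k. f (a + c k)) \<longlonglongrightarrow> f a"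
    by (rule continuous_on_tendsto_compose[OF f la]) (use ab in1 in auto)
  have fb: "(\<lambda>k. f (b - c k)) \<longlonglongrightarrow> f b"
    by (rule continuous_on_tendsto_compose[OF f lb]) (use ab in1 in auto)
  have eq: "f (b - c k) - f (a + c k) = (LBINT t. indicator {a + c k..b - c k} t * g t)" for k
    by (rule weak_FTC_open[OF f g weak]) (use c[of k] ab lt in auto)
  define H where "H = (\<lambda>t. indicator {0<..<T} t * g t)"
  have Hi: "integrable lborel H" using g by (simp add: set_integrable_def H_def)
  have Hm[measurable]: "H \<in> borel_measurable borel" using Hi by simp
  have e2: "(\<lambda>t. indicator {a + c k..b - c k} t * g t) = (\<lambda>t. indicator {a + c k..b - c k} t * H t)" for k
    using c[of k] ab lt by (auto simp: H_def indicator_def fun_eq_iff)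
  have "(\<lambda>k. \<integral>t. indicator {a + c k..b - c k} t * H t \<partial>lborel) \<longlonglongrightarrow> (LBINT t. indicator {a<..<b} t * H t)"
  proof (rule integral_dominated_convergence[where w="\<lambda>t. \<bar>H t\<bar>"])
    show "AE t in lborel. (\<lambda>k. indicator {a + c k..b - c k} t * H t) \<longlonglongrightarrow> indicator {a<..<b} t * H t"
    proof (intro AE_I2 tendsto_mult tendsto_const)
      fix t
      show "(\<lambda>k. indicator {a + c k..b - c k} t :: real) \<longlonglongrightarrow> indicator {a<..<b} t"
      proof (cases "t \<in> {a<..<b}")
        case True
        then have "eventually (\<lambda>k. c k < min (t - a) (b - t)) sequentially"
          using c0 by (intro order_tendstoD(2)) auto
        then have "eventually (\<lambda>k. (indicator {a + c k..b - c k} t :: real) = indicator {a<..<b} t) sequentially"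
          by eventually_elim (use True in \<open>auto simp: indicator_def\<close>)
        then show ?thesis by (rule tendsto_eventually)
      next
        case False
        then have "(indicator {a + c k..b - c k} t :: real) = indicator {a<..<b} t" for k
          using c(1)[of k] by (auto simp: indicator_def)
        then show ?thesis by simp
      qed
    qed
  qed (use Hi in \<open>auto simp: indicator_def\<close>)
  then have "(\<lambda>k. f (b - c k) - f (a + c k)) \<longlonglongrightarrow> (LBINT t. indicator {a<..<b} t * H t)"
    unfolding eq e2 .
  from LIMSEQ_unique[OF tendsto_diff[OF fb fa] this]
  have "f b - f a = (LBINT t. indicator {a<..<b} t * H t)" .
  also have "(\<lambda>t. indicator {a<..<b} t * H t) = (\<lambda>t. indicator {a<..<b} t * g t)"
    using ab by (auto simp: H_def indicator_def fun_eq_iff)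
  also have "(LBINT t. indicator {a<..<b} t * g t) = (LBINT t. indicator {a..b} t * g t)"
  proof -
    have i: "integrable lborel (\<lambda>t. indicator {a<..<b} t * g t)"
    proof -
      have "integrable lborel (\<lambda>t. indicator {a<..<b} t * H t)"
        using integrable_mult_indicator[OF _ Hi, of "{a<..<b}"] by simp
      moreover have "(\<lambda>t. indicator {a<..<b} t * H t) = (\<lambda>t. indicator {a<..<b} t * g t)"
        using ab by (auto simp: H_def indicator_def fun_eq_iff)
      ultimately show ?thesis by simp
    qed
    have "(\<lambda>t. indicator {a..b} t * g t) = (\<lambda>t. indicator {a<..<b} t * g t + (g a * indicator {a} t + g b * indicator {b} t))"
      using lt by (auto simp: fun_eq_iff indicator_def)
    then show ?thesis using i by (simp add: Bochner_Integration.integral_add)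
  qed
  finally show ?thesis .
qed

subsection \<open>Homogeneous extensions to the punctured ball\<close>

lemma sq_int_borel: "sq_int lborel f \<Longrightarrow> f \<in> borel_measurable borel"
  by (drule sq_int_measurable) simp

lemma test_fun_deriv_basis_sum:
  fixes \<phi> :: "'a::euclidean_space \<Rightarrow> real"
  assumes "test_fun U \<phi>"
  shows "frechet_derivative \<phi> (at x) v = (\<Sum>b\<in>Basis. (v \<bullet> b) * frechet_derivative \<phi> (at x) b)"
proof -
  have l: "linear (frechet_derivative \<phi> (at x))"
    using assms unfolding test_fun_def by (intro linear_frechet_derivative) simp
  have "frechet_derivative \<phi> (at x) (\<Sum>b\<in>Basis. (v \<bullet> b) *\<^sub>R b) = (\<Sum>b\<in>Basis. (v \<bullet> b) * frechet_derivative \<phi> (at x) b)"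
    by (simp add: linear_sum[OF l] linear_cmul[OF l])
  then show ?thesis by (simp add: euclidean_representation)
qed

lemma component_mult_test_fun:
  fixes \<phi> :: "'a::euclidean_space \<Rightarrow> real"
  assumes "test_fun U \<phi>"
  shows "test_fun U (\<lambda>x. (x \<bullet> b) * \<phi> x)"
    and "frechet_derivative (\<lambda>x. (x \<bullet> b) * \<phi> x) (at x) v = (x \<bullet> b) * frechet_derivative \<phi> (at x) v + (v \<bullet> b) * \<phi> x"
proof -
  have d: "((\<lambda>x. x \<bullet> b) has_derivative (\<lambda>v. v \<bullet> b)) (at x)" for x :: 'a
    by (rule bounded_linear.has_derivative[OF bounded_linear_inner_left]) (rule has_derivative_ident)
  have c: "continuous_on UNIV (\<lambda>x::'a. k \<bullet> b)" for k :: 'a by simp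
  show "test_fun U (\<lambda>x. (x \<bullet> b) * \<phi> x)"
    by (rule test_fun_mult(1)[OF assms open_UNIV _ d c closed_UNIV]) auto
  show "frechet_derivative (\<lambda>x. (x \<bullet> b) * \<phi> x) (at x) v = (x \<bullet> b) * frechet_derivative \<phi> (at x) v + (v \<bullet> b) * \<phi> x"
    by (rule test_fun_mult(2)[OF assms open_UNIV _ d c closed_UNIV, where U'=U]) auto
qed

text \<open>The function is the divergence of the field x \<phi>(x). Along a ray, \<rho>^(d-1) times
  it is the derivative of \<rho>^d \<phi>(\<rho> \<theta>), which vanishes at both ends of the
  annulus.\<close>

lemma radial_mean_divergence_zero:
  fixes \<phi> :: "'a::euclidean_space \<Rightarrow> real"
  assumes \<phi>: "test_fun annulus \<phi>"
  shows "radial_mean (\<lambda>x. real DIM('a) * \<phi> x + frechet_derivative \<phi> (at x) x) = (\<lambda>_. 0)"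
proof
  fix \<theta> :: 'a
  let ?d = "DIM('a)"
  let ?f = "\<lambda>x. real ?d * \<phi> x + frechet_derivative \<phi> (at x) x"
  show "radial_mean ?f \<theta> = 0"
  proof (cases "\<theta> \<in> sphere 0 1")
    case True
    then have n: "norm \<theta> = 1" by simp
    have l: "linear (frechet_derivative \<phi> (at x))" for x
      using \<phi> unfolding test_fun_def by (intro linear_frechet_derivative) simp
    have out: "(1/2) *\<^sub>R \<theta> \<notin> annulus" "2 *\<^sub>R \<theta> \<notin> annulus" using n by (auto simp: annulus_def)
    have F: "((\<lambda>\<rho>. \<rho> ^ ?d * \<phi> (\<rho> *\<^sub>R \<theta>)) has_vector_derivative \<rho> ^ (?d - 1) * ?f (\<rho> *\<^sub>R \<theta>)) (at \<rho> within {1/2..2})" for \<rho>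
    proof -
      have 1: "((\<lambda>\<rho>. \<rho> *\<^sub>R \<theta>) has_vector_derivative \<theta>) (at \<rho> within {1/2..2})"
        by (auto intro!: derivative_eq_intros)
      have "((\<phi> \<circ> (\<lambda>\<rho>. \<rho> *\<^sub>R \<theta>)) has_vector_derivative frechet_derivative \<phi> (at (\<rho> *\<^sub>R \<theta>)) \<theta>) (at \<rho> within {1/2..2})"
        by (rule vector_derivative_diff_chain_within[OF 1]) (rule has_derivative_at_withinI[OF test_fun_has_derivative[OF \<phi>]])
      then have "((\<lambda>\<rho>. \<phi> (\<rho> *\<^sub>R \<theta>)) has_real_derivative frechet_derivative \<phi> (at (\<rho> *\<^sub>R \<theta>)) \<theta>) (at \<rho> within {1/2..2})"
        by (simp add: o_def has_real_derivative_iff_has_vector_derivative)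
      then have "((\<lambda>\<rho>. \<rho> ^ ?d * \<phi> (\<rho> *\<^sub>R \<theta>)) has_real_derivative
         \<rho> ^ ?d * frechet_derivative \<phi> (at (\<rho> *\<^sub>R \<theta>)) \<theta> + real ?d * \<rho> ^ (?d - 1) * \<phi> (\<rho> *\<^sub>R \<theta>)) (at \<rho> within {1/2..2})"
        by (auto intro!: derivative_eq_intros)
      moreover have "\<rho> ^ ?d * frechet_derivative \<phi> (at (\<rho> *\<^sub>R \<theta>)) \<theta> + real ?d * \<rho> ^ (?d - 1) * \<phi> (\<rho> *\<^sub>R \<theta>) = \<rho> ^ (?d - 1) * ?f (\<rho> *\<^sub>R \<theta>)"
      proof -
        obtain m where m: "?d = Suc m" using DIM_positive[where 'a='a] by (cases ?d) auto
        show ?thesis by (simp add: m linear_cmul[OF l] algebra_simps)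
      qed
      ultimately show ?thesis by (simp add: has_real_derivative_iff_has_vector_derivative)
    qed
    have dc: "continuous_on UNIV (\<lambda>x. ?f x)"
    proof -
      have "continuous_on UNIV (\<lambda>x. real ?d * \<phi> x + (\<Sum>b\<in>Basis. (x \<bullet> b) * frechet_derivative \<phi> (at x) b))"
        by (intro continuous_intros test_fun_continuous[OF \<phi>] test_fun_deriv_continuous[OF \<phi>])
      then show ?thesis by (simp only: test_fun_deriv_basis_sum[OF \<phi>, symmetric])
    qed
    have "(LBINT \<rho>. indicator {1/2..2} \<rho> *\<^sub>R (\<rho> ^ (?d - 1) * ?f (\<rho> *\<^sub>R \<theta>))) = 2 ^ ?d * \<phi> (2 *\<^sub>R \<theta>) - (1/2) ^ ?d * \<phi> ((1/2) *\<^sub>R \<theta>)"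
    proof (rule integral_FTC_Icc[OF _ F])
      have "continuous_on {1/2..2} (\<lambda>\<rho>. ?f (\<rho> *\<^sub>R \<theta>))"
        by (rule continuous_on_compose2[OF dc]) (auto intro!: continuous_intros)
      then show "continuous_on {1/2..2} (\<lambda>\<rho>. \<rho> ^ (?d - 1) * ?f (\<rho> *\<^sub>R \<theta>))"
        by (rule continuous_on_mult[OF continuous_on_power[OF continuous_on_id]])
    qed simp
    also have "\<dots> = 0" using \<phi> out by simp
    also have "(\<lambda>\<rho>. indicator {1/2..2} \<rho> *\<^sub>R (\<rho> ^ (?d - 1) * ?f (\<rho> *\<^sub>R \<theta>))) = (\<lambda>\<rho>. indicator {1/2<..<2} \<rho> * \<rho> ^ (?d - 1) * ?f (\<rho> *\<^sub>R \<theta>))"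
    proof
      fix \<rho> :: real
      have "?f ((1/2) *\<^sub>R \<theta>) = 0" "?f (2 *\<^sub>R \<theta>) = 0" using \<phi> out by simp_all
      then have "?f (\<rho> *\<^sub>R \<theta>) = 0" if "\<rho> = 1/2 \<or> \<rho> = 2" using that by (elim disjE) (simp_all only:)
      then show "indicator {1/2..2} \<rho> *\<^sub>R (\<rho> ^ (?d - 1) * ?f (\<rho> *\<^sub>R \<theta>)) = indicator {1/2<..<2} \<rho> * \<rho> ^ (?d - 1) * ?f (\<rho> *\<^sub>R \<theta>)"
        by (cases "\<rho> = 1/2 \<or> \<rho> = 2") (auto simp: indicator_def)
    qed
    finally show ?thesis by (simp add: radial_mean_def)
  qed (simp add: radial_mean_def)
qed

text \<open>Euler's relation for degree 0, in weak form: testing with \<open>\<phi>\<close> gives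
  minus the pairing of the extension with the divergence of x \<phi>(x), and the radial mean of that
  divergence is zero.\<close>

lemma sgrad_euler:
  fixes u :: "'a::euclidean_space \<Rightarrow> real"
  assumes u: "H1S u"
  shows "AE x in lborel. x \<in> annulus \<longrightarrow> (\<Sum>b\<in>Basis. (x \<bullet> b) * sgrad b u x) = 0"
proof (rule AE_zero_if_orthogonal_test_funs[OF open_annulus])
  have Lb: "L2_on annulus (\<lambda>x. (x \<bullet> b) * sgrad b u x)" if b: "b \<in> Basis" for b
  proof (rule L2_on_bounded_mult[OF sgrad_L2[OF u b], where C=2])
    show "\<bar>x \<bullet> b\<bar> \<le> 2" if "x \<in> annulus" for x using that Basis_le_norm[OF b, of x] by (simp add: annulus_def)
  qed simp_all
  then show "L2_on annulus (\<lambda>x. \<Sum>b\<in>Basis. (x \<bullet> b) * sgrad b u x)" by (rule L2_on_sum)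
  fix \<phi> :: "'a \<Rightarrow> real" assume \<phi>: "test_fun annulus \<phi>"
  let ?f = "\<lambda>x. real DIM('a) * \<phi> x + frechet_derivative \<phi> (at x) x"
  note U = H1_on_L2[OF H1S_H1_on[OF u]]
  have i1: "integrable lborel (\<lambda>x. ((x \<bullet> b) * sgrad b u x) * \<phi> x)" if "b \<in> Basis" for b
    by (rule L2_on_test_integrable[OF Lb[OF that] \<phi>])
  have i2: "integrable lborel (\<lambda>x. hom_ext u x * frechet_derivative (\<lambda>x. (x \<bullet> b) * \<phi> x) (at x) b)" if "b \<in> Basis" for b
    by (rule L2_on_test_deriv_integrable[OF U component_mult_test_fun(1)[OF \<phi>] that])
  have "(LBINT x. (\<Sum>b\<in>Basis. (x \<bullet> b) * sgrad b u x) * \<phi> x) = (\<Sum>b\<in>Basis. \<integral>x. ((x \<bullet> b) * sgrad b u x) * \<phi> x \<partial>lborel)"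
    unfolding sum_distrib_right by (rule Bochner_Integration.integral_sum) (rule i1)
  also have "\<dots> = (\<Sum>b\<in>Basis. - (LBINT x. hom_ext u x * frechet_derivative (\<lambda>x. (x \<bullet> b) * \<phi> x) (at x) b))"
  proof (rule sum.cong[OF refl])
    fix b :: 'a assume b: "b \<in> Basis"
    show "(LBINT x. ((x \<bullet> b) * sgrad b u x) * \<phi> x) = - (LBINT x. hom_ext u x * frechet_derivative (\<lambda>x. (x \<bullet> b) * \<phi> x) (at x) b)"
      using weak_derivD[OF sgrad_weak_deriv[OF u b] component_mult_test_fun(1)[OF \<phi>, of b]] by (simp add: mult_ac)
  qed
  also have "\<dots> = - (LBINT x. (\<Sum>b\<in>Basis. hom_ext u x * frechet_derivative (\<lambda>x. (x \<bullet> b) * \<phi> x) (at x) b))"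
    by (subst Bochner_Integration.integral_sum) (auto intro: i2 simp: sum_negf)
  also have "(\<lambda>x. \<Sum>b\<in>Basis. hom_ext u x * frechet_derivative (\<lambda>x. (x \<bullet> b) * \<phi> x) (at x) b) = (\<lambda>x. hom_ext u x * ?f x)"
  proof
    fix x
    have "(\<Sum>b\<in>Basis. hom_ext u x * frechet_derivative (\<lambda>x. (x \<bullet> b) * \<phi> x) (at x) b) =
        hom_ext u x * (\<Sum>b\<in>Basis. (x \<bullet> b) * frechet_derivative \<phi> (at x) b + \<phi> x)"
      unfolding sum_distrib_left by (intro sum.cong refl) (simp add: component_mult_test_fun(2)[OF \<phi>])
    also have "\<dots> = hom_ext u x * ?f x"
      unfolding test_fun_deriv_basis_sum[OF \<phi>, of x x] by (simp add: sum.distrib)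
    finally show "(\<Sum>b\<in>Basis. hom_ext u x * frechet_derivative (\<lambda>x. (x \<bullet> b) * \<phi> x) (at x) b) = hom_ext u x * ?f x" .
  qed
  also have "(LBINT x. hom_ext u x * ?f x) = (LBINT y. indicator {1/2<..<2} (norm y) * u (y /\<^sub>R norm y) * ?f y)"
  proof (rule Bochner_Integration.integral_cong[OF refl])
    show "hom_ext u x * ?f x = indicator {1/2<..<2} (norm x) * u (x /\<^sub>R norm x) * ?f x" for x
      using \<phi> unfolding indicator_annulus[symmetric] by (cases "x \<in> annulus") (auto simp: hom_ext_def)
  qed
  also have "\<dots> = sph_inner u (radial_mean ?f)"
  proof (rule L2S_radial_mean(2)[OF _ H1S_L2S[OF u]])
    have "sq_int lborel (\<lambda>x. \<Sum>b\<in>Basis. frechet_derivative (\<lambda>x. (x \<bullet> b) * \<phi> x) (at x) b)"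
      by (intro sq_int_sum test_fun_deriv_sq_int[OF component_mult_test_fun(1)[OF \<phi>]])
    moreover have "(\<Sum>b\<in>Basis. frechet_derivative (\<lambda>x. (x \<bullet> b) * \<phi> x) (at x) b) = ?f x" for x
      unfolding test_fun_deriv_basis_sum[OF \<phi>, of x x]
      by (simp add: component_mult_test_fun(2)[OF \<phi>] sum.distrib)
    ultimately show "sq_int lborel ?f" by simp
  qed
  also have "\<dots> = 0" unfolding radial_mean_divergence_zero[OF \<phi>] by (simp add: sph_inner_eq)
  finally show "(LBINT x. (\<Sum>b\<in>Basis. (x \<bullet> b) * sgrad b u x) * \<phi> x) = 0" by simp
qed

section \<open>An exactly homogeneous representative of the gradient\<close>

definition radial_weight :: "'a::euclidean_space itself \<Rightarrow> real" where
  "radial_weight _ = (LBINT \<rho>. indicator {1/2<..<2} \<rho> * \<rho> ^ (DIM('a) - 1) * (1 / \<rho>))"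

lemma radial_weight_pos: "radial_weight TYPE('a::euclidean_space) > 0"
proof -
  have i: "integrable lborel (\<lambda>\<rho>. indicator {1/2<..<2} \<rho> * \<rho> ^ (DIM('a) - 1) * (1 / \<rho>) :: real)"
  proof (rule Bochner_Integration.integrable_bound)
    show "integrable lborel (\<lambda>\<rho>. (2 ^ (DIM('a) - 1) * 2) * indicator {1/2<..<2::real} \<rho> :: real)" by simp
    show "AE \<rho> in lborel. norm (indicator {1/2<..<2} \<rho> * \<rho> ^ (DIM('a) - 1) * (1 / \<rho>)) \<le> norm ((2 ^ (DIM('a) - 1) * 2) * indicator {1/2<..<2::real} \<rho> :: real)"
    proof (intro AE_I2)
      fix \<rho> :: real
      show "norm (indicator {1/2<..<2} \<rho> * \<rho> ^ (DIM('a) - 1) * (1 / \<rho>)) \<le> norm ((2 ^ (DIM('a) - 1) * 2) * indicator {1/2<..<2::real} \<rho> :: real)"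
      proof (cases "\<rho> \<in> {1/2<..<2}")
        case True
        have "\<rho> ^ (DIM('a) - 1) * (1 / \<rho>) \<le> 2 ^ (DIM('a) - 1) * 2"
          using True by (intro mult_mono power_mono) (auto simp: field_simps)
        then show ?thesis using True by simp
      qed simp
    qed
  qed simp
  have "(LBINT \<rho>. (1/2) * indicator {1<..<2::real} \<rho>) \<le> (LBINT \<rho>. indicator {1/2<..<2::real} \<rho> * \<rho> ^ (DIM('a) - 1) * (1 / \<rho>))"
  proof (rule integral_mono[OF _ i])
    fix \<rho> :: real
    show "(1/2) * indicator {1<..<2::real} \<rho> \<le> indicator {1/2<..<2} \<rho> * \<rho> ^ (DIM('a) - 1) * (1 / \<rho>)"
    proof (cases "\<rho> \<in> {1<..<2}")
      case True
      have "1 * (1/2) \<le> \<rho> ^ (DIM('a) - 1) * (1 / \<rho>)"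
        using True by (intro mult_mono) (auto simp: field_simps)
      then show ?thesis using True by simp
    qed (auto simp: indicator_def)
  qed simp
  then show ?thesis by (simp add: radial_weight_def)
qed

text \<open>The gradient is known only almost everywhere in the ambient space and cannot be
  restricted to the sphere. For a function homogeneous of degree -1 the normalised radial mean
  recovers its value on the sphere.\<close>

definition sph_grad :: "'a::euclidean_space \<Rightarrow> ('a \<Rightarrow> real) \<Rightarrow> 'a \<Rightarrow> real" where
  "sph_grad b u \<theta> = radial_mean (\<lambda>x. indicator annulus x * sgrad b u x) \<theta> / radial_weight TYPE('a)"

text \<open>Homogeneous of degree -1 at every point and every dilation, unlike \<open>sgrad\<close>;
  this allows the gradient to be continued beyond the annulus.\<close>

definition hgrad :: "'a::euclidean_space \<Rightarrow> ('a \<Rightarrow> real) \<Rightarrow> 'a \<Rightarrow> real" where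
  "hgrad b u x = 1 / norm x * sph_grad b u (x /\<^sub>R norm x)"

lemma sph_grad_L2S:
  assumes "H1S u" "b \<in> Basis" shows "L2S (sph_grad b u)"
  using L2S_cmult[OF L2S_radial_mean(1)[OF sgrad_L2[OF assms, unfolded L2_on_iff]], of "1 / radial_weight TYPE('a)"]
  by (simp add: sph_grad_def[abs_def])

lemma hgrad_scale: "c > 0 \<Longrightarrow> c * hgrad b u (c *\<^sub>R x) = hgrad b u x"
  unfolding hgrad_def by (simp only: hat_scale) (simp add: field_simps)

text \<open>Along almost every ray the gradient is almost everywhere a constant times 1/\<rho>, and
  the radial mean then evaluates this constant.\<close>

lemma hgrad_AE_eq:
  fixes u :: "'a::euclidean_space \<Rightarrow> real"
  assumes u: "H1S u" and b: "b \<in> Basis"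
  shows "AE x in lborel. x \<in> annulus \<longrightarrow> hgrad b u x = sgrad b u x"
proof -
  define g where "g = (\<lambda>x. indicator annulus x * sgrad b u x)"
  have gm[measurable]: "g \<in> borel_measurable borel" using sgrad_L2[OF u b] unfolding g_def L2_on_iff by (rule sq_int_borel)
  have "AE c in lborel. AE x in lborel. c > 0 \<longrightarrow> x \<in> annulus \<longrightarrow> c *\<^sub>R x \<in> annulus \<longrightarrow> g x = c * g (c *\<^sub>R x)"
  proof (rule AE_I2)
    fix c :: real
    show "AE x in lborel. c > 0 \<longrightarrow> x \<in> annulus \<longrightarrow> c *\<^sub>R x \<in> annulus \<longrightarrow> g x = c * g (c *\<^sub>R x)"
    proof (cases "c > 0")
      case True
      from sgrad_scale_AE[OF u b this] show ?thesis by eventually_elim (simp add: g_def)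
    qed simp
  qed
  \<comment> \<open>Fubini exchanges the quantifiers: homogeneity held for each c off a null set of
    x, and now holds for almost every x and almost every c, which is a statement about single
    rays.\<close>
  then have "AE x in lborel. AE c in lborel. c > 0 \<longrightarrow> x \<in> annulus \<longrightarrow> c *\<^sub>R x \<in> annulus \<longrightarrow> g x = c * g (c *\<^sub>R x)"
  proof (subst (asm) lborel_pair.AE_commute)
    show "{z \<in> space (lborel \<Otimes>\<^sub>M lborel). fst z > 0 \<longrightarrow> snd z \<in> annulus \<longrightarrow> fst z *\<^sub>R snd z \<in> annulus \<longrightarrow> g (snd z) = fst z * g (fst z *\<^sub>R snd z)}
      \<in> sets (lborel \<Otimes>\<^sub>M (lborel :: 'a measure))"
      by measurable
  qed
  then show ?thesis
  proof eventually_elim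
    case (elim x)
    show ?case
    proof
      assume x: "x \<in> annulus"
      then have nx: "norm x > 0" "x \<noteq> 0" by (auto simp: annulus_def)
      have "AE \<rho> in lborel. (0 + (1 / norm x) *\<^sub>R \<rho>) > 0 \<longrightarrow> x \<in> annulus \<longrightarrow> (0 + (1 / norm x) *\<^sub>R \<rho>) *\<^sub>R x \<in> annulus \<longrightarrow>
          g x = (0 + (1 / norm x) *\<^sub>R \<rho>) * g ((0 + (1 / norm x) *\<^sub>R \<rho>) *\<^sub>R x)"
        by (rule AE_lborel_affine[OF elim]) (use nx in simp)
      then have ae: "AE \<rho> in lborel. \<rho> \<in> {1/2<..<2} \<longrightarrow> g (\<rho> *\<^sub>R (x /\<^sub>R norm x)) = norm x * g x / \<rho>"
      proof eventually_elim
        case (elim \<rho>)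
        show ?case
        proof
          assume \<rho>: "\<rho> \<in> {1/2<..<2}"
          have eq: "(0 + (1 / norm x) *\<^sub>R \<rho>) *\<^sub>R x = \<rho> *\<^sub>R (x /\<^sub>R norm x)" by (simp add: field_simps)
          have nn: "norm (\<rho> *\<^sub>R (x /\<^sub>R norm x)) = \<rho>" using \<rho> nx by simp
          have "\<rho> *\<^sub>R (x /\<^sub>R norm x) \<in> annulus" unfolding annulus_def mem_Collect_eq nn using \<rho> by simp
          with elim[unfolded eq] \<rho> nx x have "g x = \<rho> / norm x * g (\<rho> *\<^sub>R (x /\<^sub>R norm x))" by simp
          then show "g (\<rho> *\<^sub>R (x /\<^sub>R norm x)) = norm x * g x / \<rho>" using \<rho> nx by (simp add: field_simps)
        qed
      qed
      have "radial_mean g (x /\<^sub>R norm x) = (LBINT \<rho>. indicator {1/2<..<2} \<rho> * \<rho> ^ (DIM('a) - 1) * g (\<rho> *\<^sub>R (x /\<^sub>R norm x)))"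
        using nx by (simp add: radial_mean_def)
      also have "\<dots> = (LBINT \<rho>. (norm x * g x) * (indicator {1/2<..<2} \<rho> * \<rho> ^ (DIM('a) - 1) * (1 / \<rho>)))"
      proof (rule integral_cong_AE)
        have [measurable]: "(\<lambda>\<rho>. g (\<rho> *\<^sub>R (x /\<^sub>R norm x))) \<in> borel_measurable borel"
          by (rule measurable_compose[OF _ gm]) measurable
        show "(\<lambda>\<rho>. indicator {1/2<..<2} \<rho> * \<rho> ^ (DIM('a) - 1) * g (\<rho> *\<^sub>R (x /\<^sub>R norm x))) \<in> borel_measurable lborel" by measurable
        show "AE \<rho> in lborel. indicator {1/2<..<2} \<rho> * \<rho> ^ (DIM('a) - 1) * g (\<rho> *\<^sub>R (x /\<^sub>R norm x)) =
           (norm x * g x) * (indicator {1/2<..<2} \<rho> * \<rho> ^ (DIM('a) - 1) * (1 / \<rho>))"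
          using ae
        proof eventually_elim
          case (elim \<rho>)
          then show ?case by (cases "\<rho> \<in> {1/2<..<2}") simp_all
        qed
      qed measurable
      also have "\<dots> = norm x * g x * radial_weight TYPE('a)"
        by (simp only: integral_mult_right_zero radial_weight_def)
      finally have "radial_mean g (x /\<^sub>R norm x) = norm x * g x * radial_weight TYPE('a)" .
      then show "hgrad b u x = sgrad b u x"
        using nx x radial_weight_pos[where 'a='a] by (simp add: hgrad_def sph_grad_def g_def)
    qed
  qed
qed

section \<open>Homogeneous functions and their gradients down to the origin\<close>

lemma homogeneous_L2_on:
  fixes u :: "'a::euclidean_space \<Rightarrow> real"
  assumes u: "L2S u" and w: "(\<lambda>\<rho>. indicator {r<..<s} \<rho> * w \<rho>) \<in> borel_measurable borel" and r: "0 \<le> r"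
    and i: "integrable lborel (\<lambda>\<rho>. indicator {r<..<s} \<rho> * (\<rho> ^ (DIM('a) - 1) * (w \<rho>)\<^sup>2))"
  shows "L2_on {x. r < norm x \<and> norm x < s} (\<lambda>x. w (norm x) * u (x /\<^sub>R norm x))"
proof -
  have "sq_int lborel (\<lambda>y. (indicator {r<..<s} (norm y) * w (norm y)) * u (y /\<^sub>R norm y))"
  proof (rule sq_int_homogeneous(1)[OF u w])
    have "(\<lambda>\<rho>. indicator {0<..} \<rho> * \<rho> ^ (DIM('a) - 1) * (indicator {r<..<s} \<rho> * w \<rho>)\<^sup>2) = (\<lambda>\<rho>. indicator {r<..<s} \<rho> * (\<rho> ^ (DIM('a) - 1) * (w \<rho>)\<^sup>2))"
      using r by (auto simp: indicator_def fun_eq_iff)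
    then show "integrable lborel (\<lambda>\<rho>. indicator {0<..} \<rho> * \<rho> ^ (DIM('a) - 1) * (indicator {r<..<s} \<rho> * w \<rho>)\<^sup>2)" using i by simp
  qed
  moreover have "(\<lambda>y. (indicator {r<..<s} (norm y) * w (norm y)) * u (y /\<^sub>R norm y)) =
      (\<lambda>x. indicator {x. r < norm x \<and> norm x < s} x * (w (norm x) * u (x /\<^sub>R norm x)))"
    by (auto simp: indicator_def)
  ultimately show ?thesis by (simp only: L2_on_iff)
qed

lemma homogeneous_L2_on_bounded:
  fixes u :: "'a::euclidean_space \<Rightarrow> real"
  assumes u: "L2S u" and w: "(\<lambda>\<rho>. indicator {r<..<s} \<rho> * w \<rho>) \<in> borel_measurable borel" and r: "0 \<le> r"
    and M: "\<And>\<rho>. r < \<rho> \<Longrightarrow> \<rho> < s \<Longrightarrow> \<bar>w \<rho>\<bar> \<le> M"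
  shows "L2_on {x. r < norm x \<and> norm x < s} (\<lambda>x. w (norm x) * u (x /\<^sub>R norm x))"
proof (rule homogeneous_L2_on[OF u w r])
  have eq: "(\<lambda>\<rho>. indicator {r<..<s} \<rho> * (\<rho> ^ (DIM('a) - 1) * (w \<rho>)\<^sup>2)) = (\<lambda>\<rho>. \<rho> ^ (DIM('a) - 1) * (indicator {r<..<s} \<rho> * w \<rho>)\<^sup>2)"
    by (auto simp: indicator_def fun_eq_iff)
  show "integrable lborel (\<lambda>\<rho>. indicator {r<..<s} \<rho> * (\<rho> ^ (DIM('a) - 1) * (w \<rho>)\<^sup>2))"
  proof (rule Bochner_Integration.integrable_bound)
    have "{r<..<s} \<subseteq> {r..s}" by auto
    note fin = emeasure_bounded_finite[OF bounded_subset[OF bounded_closed_interval this]]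
    show "integrable lborel (\<lambda>\<rho>. (\<bar>s\<bar> ^ (DIM('a) - 1) * M\<^sup>2) * indicator {r<..<s} \<rho>)"
      using fin
      by (intro integrable_mult_right integrable_real_indicator) auto
    show "(\<lambda>\<rho>. indicator {r<..<s} \<rho> * (\<rho> ^ (DIM('a) - 1) * (w \<rho>)\<^sup>2)) \<in> borel_measurable lborel"
      unfolding eq using w by measurable
    show "AE \<rho> in lborel. norm (indicator {r<..<s} \<rho> * (\<rho> ^ (DIM('a) - 1) * (w \<rho>)\<^sup>2)) \<le> norm ((\<bar>s\<bar> ^ (DIM('a) - 1) * M\<^sup>2) * indicator {r<..<s} \<rho>)"
    proof (intro AE_I2)
      fix \<rho> :: real
      show "norm (indicator {r<..<s} \<rho> * (\<rho> ^ (DIM('a) - 1) * (w \<rho>)\<^sup>2)) \<le> norm ((\<bar>s\<bar> ^ (DIM('a) - 1) * M\<^sup>2) * indicator {r<..<s} \<rho>)"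
      proof (cases "\<rho> \<in> {r<..<s}")
        case True
        have "\<bar>w \<rho>\<bar>\<^sup>2 \<le> M\<^sup>2" by (intro power_mono M) (use True in auto)
        moreover have "\<rho> ^ (DIM('a) - 1) \<le> \<bar>s\<bar> ^ (DIM('a) - 1)" using True r by (intro power_mono) auto
        ultimately have "\<rho> ^ (DIM('a) - 1) * (w \<rho>)\<^sup>2 \<le> \<bar>s\<bar> ^ (DIM('a) - 1) * M\<^sup>2"
          by (intro mult_mono) auto
        then show ?thesis using True r by (simp add: abs_mult)
      qed simp
    qed
  qed
qed

lemma annulus_scaled: "c > 0 \<Longrightarrow> (\<lambda>x. x /\<^sub>R c) ` annulus = {x::'a::euclidean_space. 1/2 / c < norm x \<and> norm x < 2 / c}"
proof -
  assume c: "c > 0"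
  have "(\<lambda>x. x /\<^sub>R c) ` annulus = {x::'a. c *\<^sub>R x \<in> annulus}" using c by (force simp: image_iff)
  also have "\<dots> = {x. 1/2 / c < norm x \<and> norm x < 2 / c}" using c by (auto simp: annulus_def field_simps)
  finally show ?thesis .
qed

lemma open_norm_shell: "open {x::'a::euclidean_space. r < norm x \<and> norm x < s}"
  by (intro open_Collect_conj open_Collect_less continuous_intros)

text \<open>Induction over dyadic inner radii: the shell is glued with a dilated copy of the
  annulus. Both carry the same formula for the derivative because \<open>hgrad\<close> is exactly
  homogeneous.\<close>

lemma hom_ext_weak_deriv_shell:
  fixes u :: "'a::euclidean_space \<Rightarrow> real"
  assumes u: "H1S u" and b: "b \<in> Basis"
  shows "has_weak_deriv {x. (1/2) ^ Suc n < norm x \<and> norm x < 2} (hom_ext u) b (hgrad b u)"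
proof -
  note uL = H1S_L2S[OF u] and gL = sph_grad_L2S[OF u b]
  have Lu: "L2_on {x. r < norm x \<and> norm x < s} (hom_ext u)" if "0 \<le> r" for r s
    using homogeneous_L2_on_bounded[OF uL _ that, of s "\<lambda>_. 1" 1] by (simp add: hom_ext_def[abs_def])
  have Lg: "L2_on {x. r < norm x \<and> norm x < s} (hgrad b u)" if "0 < r" for r s
    using homogeneous_L2_on_bounded[OF gL _ less_imp_le[OF that], of s "\<lambda>\<rho>. 1 / \<rho>" "1 / r"] that
    by (simp add: hgrad_def[abs_def] field_simps)
  have A: "(annulus :: 'a set) = {x. 1/2 < norm x \<and> norm x < 2}" by (simp add: annulus_def)
  have base: "has_weak_deriv annulus (hom_ext u) b (hgrad b u)"
  proof (rule weak_deriv_AE_cong[OF sgrad_weak_deriv[OF u b]])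
    show "AE x in lborel. x \<in> annulus \<longrightarrow> sgrad b u x = hgrad b u x"
      using hgrad_AE_eq[OF u b] by eventually_elim simp
    show "(\<lambda>x. indicator annulus x * hgrad b u x) \<in> borel_measurable borel"
      using Lg[of "1/2" 2] unfolding A L2_on_iff by (intro sq_int_borel) simp
  qed
  have scaled: "has_weak_deriv {x. 1/2 / c < norm x \<and> norm x < 2 / c} (hom_ext u) b (hgrad b u)" if c: "c > 0" for c
  proof -
    have c0: "c \<noteq> 0" using c by simp
    have "has_weak_deriv ((\<lambda>x. x /\<^sub>R c) ` annulus) (\<lambda>x. hom_ext u (c *\<^sub>R x)) b (\<lambda>x. c * hgrad b u (c *\<^sub>R x))"
      by (rule weak_deriv_scale[OF b H1_on_L2[OF H1S_H1_on[OF u]] base c0])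
    then show ?thesis by (simp only: annulus_scaled[OF c] hgrad_scale[OF c] hom_ext_scale[OF c])
  qed
  show ?thesis
  proof (induction n)
    case 0
    then show ?case using base by (simp add: A)
  next
    case (Suc n)
    define r :: real where "r = (1/2) ^ Suc n"
    have r: "0 < r" "r \<le> 1/2" by (auto simp: r_def power_le_one)
    let ?U = "{x::'a. r < norm x \<and> norm x < 2}" and ?V = "{x::'a. r/2 < norm x \<and> norm x < 2 * r}"
    have V: "has_weak_deriv ?V (hom_ext u) b (hgrad b u)" using scaled[of "1 / r"] r by (simp add: field_simps)
    have r2: "(1/2) ^ Suc (Suc n) = r / 2" by (simp add: r_def)
    have UV: "?U \<union> ?V = {x. (1/2) ^ Suc (Suc n) < norm x \<and> norm x < 2}" unfolding r2 using r by auto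
    \<comment> \<open>The squared radii of the transition: 1.2 r and 1.6 r lie strictly between r
      and 2 r, the bounds of the overlap of the two shells.\<close>
    let ?p = "(1.2 * r)\<^sup>2" and ?q = "(1.6 * r)\<^sup>2"
    have pq: "?p < ?q" using r by (intro power_strict_mono) auto
    have nsq: "y \<bullet> y = (norm y)\<^sup>2" for y :: 'a by (simp add: power2_norm_eq_inner)
    have "has_weak_deriv (?U \<union> ?V) (hom_ext u) b (hgrad b u)"
    proof (rule weak_deriv_Un[OF b _ Suc[folded r_def] V, where W=UNIV and m="rcut ?p ?q" and Dm="rcut' ?p ?q" and C="{x. ?p \<le> x \<bullet> x}" and D="{x. x \<bullet> x \<le> ?q}"])
      show "L2_on (?U \<union> ?V) (hom_ext u)" unfolding UV by (rule Lu) simp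
      show "L2_on (?U \<union> ?V) (hgrad b u)" unfolding UV by (rule Lg) simp
      show "(rcut ?p ?q has_derivative rcut' ?p ?q x) (at x)" for x :: 'a by (rule rcut_has_derivative[OF pq])
      show "continuous_on UNIV (\<lambda>x::'a. rcut' ?p ?q x b)" for b by (rule rcut'_continuous[OF pq])
      show "closed {x::'a. ?p \<le> x \<bullet> x}" "closed {x::'a. x \<bullet> x \<le> ?q}" by (intro closed_Collect_le continuous_intros)+
      show "rcut ?p ?q x = 0" if "x \<notin> {x. ?p \<le> x \<bullet> x}" for x :: 'a using that by (intro rcut_0[OF pq]) auto
      show "rcut ?p ?q x = 1" if "x \<notin> {x. x \<bullet> x \<le> ?q}" for x :: 'a using that by (intro rcut_1[OF pq]) auto
      show "(?U \<union> ?V) \<inter> {x. ?p \<le> x \<bullet> x} \<subseteq> ?U"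
      proof
        fix x assume x: "x \<in> (?U \<union> ?V) \<inter> {x. ?p \<le> x \<bullet> x}"
        then have "?p \<le> (norm x)\<^sup>2" by (simp add: nsq)
        then have "1.2 * r \<le> norm x" by (rule power2_le_imp_le) simp
        then show "x \<in> ?U" using x r by auto
      qed
      show "(?U \<union> ?V) \<inter> {x. x \<bullet> x \<le> ?q} \<subseteq> ?V"
      proof
        fix x assume x: "x \<in> (?U \<union> ?V) \<inter> {x. x \<bullet> x \<le> ?q}"
        then have "(norm x)\<^sup>2 \<le> ?q" by (simp add: nsq)
        then have "norm x \<le> 1.6 * r" by (rule power2_le_imp_le) (use r in simp)
        then show "x \<in> ?V" using x r by auto
      qed
    qed auto
    then show ?case unfolding UV .
  qed
qed

subsection \<open>Radial profiles times functions on the sphere\<close>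

lemma powr_integral:
  assumes "(e::real) > -1" and c: "0 \<le> c"
  shows "integrable lborel (\<lambda>\<rho>. indicator {0..c} \<rho> * \<rho> powr e)" and "(LBINT \<rho>. indicator {0..c} \<rho> * \<rho> powr e) = c powr (e + 1) / (e + 1)"
proof -
  have "((\<lambda>x. if x \<in> {0..c} then x powr e else 0) has_integral (c powr (e + 1) / (e + 1))) UNIV"
    using has_integral_powr_from_0[OF assms] by (subst has_integral_restrict_UNIV) simp
  moreover have "(\<lambda>x. if x \<in> {0..c} then x powr e else 0) = (\<lambda>\<rho>. indicator {0..c} \<rho> * \<rho> powr e)"
    by (auto simp: indicator_def)
  ultimately have hi: "((\<lambda>\<rho>. indicator {0..c} \<rho> * \<rho> powr e) has_integral (c powr (e + 1) / (e + 1))) UNIV" by simp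
  have nn: "(\<integral>\<^sup>+\<rho>. ennreal (indicator {0..c} \<rho> * \<rho> powr e) \<partial>lborel) = ennreal (c powr (e + 1) / (e + 1))"
    by (rule nn_integral_has_integral_lborel[OF _ _ hi]) auto
  show i: "integrable lborel (\<lambda>\<rho>. indicator {0..c} \<rho> * \<rho> powr e)"
    by (rule integrableI_nonneg) (auto simp: nn)
  have "ennreal (LBINT \<rho>. indicator {0..c} \<rho> * \<rho> powr e) = ennreal (c powr (e + 1) / (e + 1))"
    unfolding nn[symmetric] by (rule nn_integral_eq_integral[symmetric, OF i]) auto
  then show "(LBINT \<rho>. indicator {0..c} \<rho> * \<rho> powr e) = c powr (e + 1) / (e + 1)"
    using assms by (subst (asm) ennreal_inj) (auto intro!: integral_nonneg_AE)
qed

lemma L2_on_insert: "L2_on U f \<Longrightarrow> L2_on (insert a U) f"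
proof -
  assume f: "L2_on U f"
  show ?thesis
  proof (cases "a \<in> U")
    case True then show ?thesis using f by (simp add: insert_absorb)
  next
    case False
    have "sq_int lborel (\<lambda>x. indicator U x * f x + f a * indicator {a} x)"
      using f by (intro sq_int_add sq_int_cmult sq_int_indicator) (auto simp: L2_on_iff)
    moreover have "(\<lambda>x. indicator U x * f x + f a * indicator {a} x) = (\<lambda>x. indicator (insert a U) x * f x)"
      using False by (auto simp: indicator_def fun_eq_iff)
    ultimately show ?thesis by (simp add: L2_on_iff)
  qed
qed

text \<open>The growth bound makes the radial integrand at most a multiple of
  \<rho>^(2\<alpha>+d-3), and the assumption on 2\<alpha>+d-2 says that this exponent exceeds
  -1.\<close>

lemma homogeneous_L2_on_ball:
  fixes u :: "'a::euclidean_space \<Rightarrow> real"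
  assumes u: "L2S u" and w: "(\<lambda>\<rho>. indicator {0<..<1} \<rho> * w \<rho>) \<in> borel_measurable borel"
    and K: "2 * \<alpha> + real DIM('a) - 2 > 0" and M: "\<And>\<rho>. 0 < \<rho> \<Longrightarrow> \<rho> < 1 \<Longrightarrow> \<bar>w \<rho>\<bar> \<le> M * \<rho> powr (\<alpha> - 1)"
  shows "L2_on (ball 0 1) (\<lambda>x. w (norm x) * u (x /\<^sub>R norm x))"
proof -
  have L: "L2_on {x. 0 < norm x \<and> norm x < 1} (\<lambda>x. w (norm x) * u (x /\<^sub>R norm x))"
  proof (rule homogeneous_L2_on[OF u w order_refl])
    have eq: "(\<lambda>\<rho>. indicator {0<..<1} \<rho> * (\<rho> ^ (DIM('a) - 1) * (w \<rho>)\<^sup>2)) = (\<lambda>\<rho>. \<rho> ^ (DIM('a) - 1) * (indicator {0<..<1} \<rho> * w \<rho>)\<^sup>2)"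
      by (auto simp: indicator_def fun_eq_iff)
    show "integrable lborel (\<lambda>\<rho>. indicator {0<..<1} \<rho> * (\<rho> ^ (DIM('a) - 1) * (w \<rho>)\<^sup>2))"
    proof (rule Bochner_Integration.integrable_bound)
      show "integrable lborel (\<lambda>\<rho>. M\<^sup>2 * (indicator {0..1} \<rho> * \<rho> powr (2 * \<alpha> + real DIM('a) - 3)))"
        by (intro integrable_mult_right powr_integral) (use K in auto)
      show "(\<lambda>\<rho>. indicator {0<..<1} \<rho> * (\<rho> ^ (DIM('a) - 1) * (w \<rho>)\<^sup>2)) \<in> borel_measurable lborel"
        unfolding eq using w by measurable
      show "AE \<rho> in lborel. norm (indicator {0<..<1} \<rho> * (\<rho> ^ (DIM('a) - 1) * (w \<rho>)\<^sup>2)) \<le> norm (M\<^sup>2 * (indicator {0..1} \<rho> * \<rho> powr (2 * \<alpha> + real DIM('a) - 3)))"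
      proof (intro AE_I2)
        fix \<rho> :: real
        show "norm (indicator {0<..<1} \<rho> * (\<rho> ^ (DIM('a) - 1) * (w \<rho>)\<^sup>2)) \<le> norm (M\<^sup>2 * (indicator {0..1} \<rho> * \<rho> powr (2 * \<alpha> + real DIM('a) - 3)))"
        proof (cases "\<rho> \<in> {0<..<1}")
          case True
          have "\<bar>w \<rho>\<bar>\<^sup>2 \<le> (M * \<rho> powr (\<alpha> - 1))\<^sup>2" by (intro power_mono M) (use True in auto)
          then have "\<rho> ^ (DIM('a) - 1) * (w \<rho>)\<^sup>2 \<le> \<rho> ^ (DIM('a) - 1) * (M * \<rho> powr (\<alpha> - 1))\<^sup>2"
            using True by (intro mult_left_mono) auto
          also have "\<dots> = M\<^sup>2 * (\<rho> powr real (DIM('a) - 1) * (\<rho> powr (\<alpha> - 1) * \<rho> powr (\<alpha> - 1)))"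
          proof -
            have "\<rho> ^ (DIM('a) - 1) = \<rho> powr real (DIM('a) - 1)" using True by (simp only: powr_realpow greaterThanLessThan_iff)
            then show ?thesis by (simp only: power_mult_distrib power2_eq_square mult_ac)
          qed
          also have "\<dots> = M\<^sup>2 * \<rho> powr (real (DIM('a) - 1) + ((\<alpha> - 1) + (\<alpha> - 1)))"
            by (simp only: powr_add)
          also have "real (DIM('a) - 1) + ((\<alpha> - 1) + (\<alpha> - 1)) = 2 * \<alpha> + real DIM('a) - 3"
            using DIM_positive[where 'a='a] by (simp add: of_nat_diff Suc_leI)
          finally show ?thesis using True by (simp add: abs_mult)
        qed simp
      qed
    qed
  qed
  have "ball 0 1 = insert 0 {x::'a. 0 < norm x \<and> norm x < 1}" by auto
  with L2_on_insert[OF L, of 0] show ?thesis by simp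
qed

lemma norm_has_derivative: "x \<noteq> 0 \<Longrightarrow> (norm has_derivative (\<lambda>v. (x \<bullet> v) / norm x)) (at (x::'a::euclidean_space))"
  using GDERIV_norm[of x] unfolding gderiv_def sgn_div_norm by (simp add: inner_commute divide_inverse mult.commute)

lemma radial_has_derivative:
  assumes "(k has_real_derivative k' (norm x)) (at (norm x))" "x \<noteq> 0"
  shows "((\<lambda>x::'a::euclidean_space. k (norm x)) has_derivative (\<lambda>v. k' (norm x) * ((x \<bullet> v) / norm x))) (at x)"
  using diff_chain_at[OF norm_has_derivative[OF assms(2)] assms(1)[unfolded has_field_derivative_def]] by (simp add: o_def)

text \<open>The product rule away from the origin, where a function of the norm is C^1.\<close>

lemma radial_mult_weak_deriv:
  fixes u :: "'a::euclidean_space \<Rightarrow> real"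
  assumes u: "H1S u" and b: "b \<in> Basis"
    and k: "\<And>\<rho>. 0 < \<rho> \<Longrightarrow> (k has_real_derivative k' \<rho>) (at \<rho>)" "continuous_on {0<..} k'"
    and W: "W \<in> sets borel" "W \<subseteq> {x. (1/2) ^ Suc n < norm x \<and> norm x < 2}"
    and L: "L2_on W (\<lambda>x. k (norm x) * hgrad b u x + k' (norm x) * ((x \<bullet> b) / norm x) * hom_ext u x)"
  shows "has_weak_deriv W (\<lambda>x. k (norm x) * hom_ext u x) b (\<lambda>x. k (norm x) * hgrad b u x + k' (norm x) * ((x \<bullet> b) / norm x) * hom_ext u x)"
proof (rule weak_deriv_mult[OF b _ hom_ext_weak_deriv_shell[OF u b, of n], where V="- {0}" and C=UNIV and Dm="\<lambda>x v. k' (norm x) * ((x \<bullet> v) / norm x)"])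
  show "L2_on {x. (1 / 2) ^ Suc n < norm x \<and> norm x < 2} (hom_ext u)"
    using homogeneous_L2_on_bounded[OF H1S_L2S[OF u], of "(1/2) ^ Suc n" 2 "\<lambda>_. 1" 1] by (simp add: hom_ext_def[abs_def])
  show "open (- {0::'a})" by (rule open_Compl) simp
  have pos: "(0::real) < (1/2) ^ Suc n" by simp
  show "W \<subseteq> - {0}"
  proof
    fix x assume "x \<in> W"
    then have "(1/2) ^ Suc n < norm x" using W(2) by blast
    with pos have "0 < norm x" by linarith
    then show "x \<in> - {0}" by simp
  qed
  show "((\<lambda>x. k (norm x)) has_derivative (\<lambda>v. k' (norm x) * ((x \<bullet> v) / norm x))) (at x)" if "x \<in> - {0}" for x :: 'a
    using that by (intro radial_has_derivative k) auto
  show "continuous_on (- {0}) (\<lambda>x::'a. k' (norm x) * ((x \<bullet> b) / norm x))" for b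
    by (intro continuous_intros continuous_on_compose2[OF k(2)]) auto
qed (use W L in auto)

text \<open>The origin is removable. A test function is cut off near 0 at radius about 2^(-n), and
  the error term involves the gradient of the cutoff, of size 1/|x|. The growth assumption makes
  k(|x|)/|x| times the extension square integrable, so dominated convergence removes the
  error.\<close>

lemma radial_mult_ball:
  fixes u :: "'a::euclidean_space \<Rightarrow> real"
  assumes u: "H1S u" and b: "b \<in> Basis"
    and k: "\<And>\<rho>. 0 < \<rho> \<Longrightarrow> (k has_real_derivative k' \<rho>) (at \<rho>)" "continuous_on {0<..} k'"
    and K: "2 * \<alpha> + real DIM('a) - 2 > 0"
    and M: "\<And>\<rho>. 0 < \<rho> \<Longrightarrow> \<rho> < 1 \<Longrightarrow> \<bar>k \<rho>\<bar> \<le> M * \<rho> powr \<alpha>"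
      "\<And>\<rho>. 0 < \<rho> \<Longrightarrow> \<rho> < 1 \<Longrightarrow> \<bar>k' \<rho>\<bar> \<le> M * \<rho> powr (\<alpha> - 1)"
  shows "L2_on (ball 0 1) (\<lambda>x. k (norm x) * hom_ext u x)"
    and "has_weak_deriv (ball 0 1) (\<lambda>x. k (norm x) * hom_ext u x) b (\<lambda>x. k (norm x) * hgrad b u x + k' (norm x) * ((x \<bullet> b) / norm x) * hom_ext u x)"
proof -
  let ?f = "\<lambda>x. k (norm x) * hom_ext u x"
  let ?F = "\<lambda>x. k (norm x) * hgrad b u x + k' (norm x) * ((x \<bullet> b) / norm x) * hom_ext u x"
  have M0: "M \<ge> 0"
  proof -
    have "0 \<le> M * (1/2) powr \<alpha>" using M(1)[of "1/2"] by (auto intro: order_trans[OF abs_ge_zero])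
    then show ?thesis by (simp add: zero_le_mult_iff)
  qed
  have kc: "continuous_on {0<..} k" using k(1) by (auto simp: continuous_on_eq_continuous_at intro: DERIV_isCont)
  have km: "(\<lambda>\<rho>. indicator {0<..<1} \<rho> * k \<rho>) \<in> borel_measurable borel" "(\<lambda>\<rho>. indicator {0<..<1} \<rho> * k' \<rho>) \<in> borel_measurable borel"
    "(\<lambda>\<rho>. indicator {0<..<1} \<rho> * (k \<rho> / \<rho>)) \<in> borel_measurable borel"
  proof -
    have "continuous_on {0<..<1} k" "continuous_on {0<..<1} k'" "continuous_on {0<..<1} (\<lambda>\<rho>. k \<rho> / \<rho>)"
      by (auto intro!: continuous_intros continuous_on_subset[OF kc] continuous_on_subset[OF k(2)])
    then show "(\<lambda>\<rho>. indicator {0<..<1} \<rho> * k \<rho>) \<in> borel_measurable borel" "(\<lambda>\<rho>. indicator {0<..<1} \<rho> * k' \<rho>) \<in> borel_measurable borel"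
      "(\<lambda>\<rho>. indicator {0<..<1} \<rho> * (k \<rho> / \<rho>)) \<in> borel_measurable borel"
      by (auto dest!: borel_measurable_continuous_on_indicator[rotated])
  qed
  have m1: "\<bar>k \<rho>\<bar> \<le> M * \<rho> powr (\<alpha> - 1)" if "0 < \<rho>" "\<rho> < 1" for \<rho>
  proof -
    have "\<rho> powr \<alpha> \<le> \<rho> powr (\<alpha> - 1)" using that by (intro powr_mono') auto
    then show ?thesis using M(1)[OF that] mult_left_mono[OF _ M0] by (blast intro: order_trans)
  qed
  have m2: "\<bar>k \<rho> / \<rho>\<bar> \<le> M * \<rho> powr (\<alpha> - 1)" if "0 < \<rho>" "\<rho> < 1" for \<rho>
    using M(1)[OF that] that by (simp add: powr_diff divide_le_eq)
  note uL = H1S_L2S[OF u] and gL = sph_grad_L2S[OF u b]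
  show Lf: "L2_on (ball 0 1) ?f"
    using homogeneous_L2_on_ball[OF uL km(1) K m1] by (simp add: hom_ext_def[abs_def])
  have Lfr: "L2_on (ball 0 1) (\<lambda>x. k (norm x) / norm x * hom_ext u x)"
    using homogeneous_L2_on_ball[OF uL km(3) K m2] by (simp add: hom_ext_def[abs_def])
  have Lk': "L2_on (ball 0 1) (\<lambda>x. k' (norm x) * hom_ext u x)"
    using homogeneous_L2_on_ball[OF uL km(2) K M(2)] by (simp add: hom_ext_def[abs_def])
  have Lg: "L2_on (ball 0 1) (\<lambda>x. k (norm x) * hgrad b u x)"
    using homogeneous_L2_on_ball[OF gL km(3) K m2] by (simp add: hgrad_def[abs_def])
  have LF: "L2_on (ball 0 1) ?F"
  proof -
    have "\<bar>(x \<bullet> b) / norm x\<bar> \<le> 1" for x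
      using Basis_le_norm[OF b, of x] by (cases "x = 0") (auto simp: divide_le_eq)
    then have "L2_on (ball 0 1) (\<lambda>x. ((x \<bullet> b) / norm x) * (k' (norm x) * hom_ext u x))"
    proof (intro L2_on_bounded_mult[OF Lk', where C=1])
      have [measurable]: "(ball 0 1 :: 'a set) \<in> sets borel" by simp
      show "(\<lambda>x. indicator (ball 0 1) x * ((x \<bullet> b) / norm x)) \<in> borel_measurable borel" by measurable
    qed auto
    from L2_on_add[OF Lg this] show ?thesis by (simp add: mult_ac)
  qed
  show "has_weak_deriv (ball 0 1) ?f b ?F"
    unfolding weak_deriv_iff
  proof (intro conjI allI impI LF)
    fix \<phi> :: "'a \<Rightarrow> real" assume \<phi>: "test_fun (ball 0 1) \<phi>"
    let ?d = "\<lambda>x. frechet_derivative \<phi> (at x) b"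
    \<comment> \<open>Squared radii again: the cutoff rises between |x|^2 = 4^(-n) and twice that
      value.\<close>
    define p where "p n = ((1/2::real) ^ n)\<^sup>2" for n :: nat
    have p: "p n > 0" "p n < 2 * p n" for n by (simp_all add: p_def)
    let ?\<eta> = "\<lambda>n. rcut (p n) (2 * p n) :: 'a \<Rightarrow> real" and ?\<eta>' = "\<lambda>n. rcut' (p n) (2 * p n) :: 'a \<Rightarrow> 'a \<Rightarrow> real"
    let ?W = "\<lambda>n. {x::'a. (1/2) ^ Suc n < norm x \<and> norm x < 1}"
    have Wb: "?W n \<in> sets borel" "?W n \<subseteq> ball 0 1" for n by (auto intro!: borel_open open_norm_shell)
    have wd: "has_weak_deriv (?W n) ?f b ?F" for n
      by (rule radial_mult_weak_deriv[OF u b k Wb(1) _ L2_on_subset[OF LF Wb]]) auto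
    have prod: "test_fun (?W n) (\<lambda>x. ?\<eta> n x * \<phi> x)"
      and prod': "frechet_derivative (\<lambda>x. ?\<eta> n x * \<phi> x) (at x) b = ?\<eta> n x * ?d x + ?\<eta>' n x b * \<phi> x" for n x
    proof -
      have sub: "ball 0 1 \<inter> {x. p n \<le> x \<bullet> x} \<subseteq> ?W n"
      proof
        fix x :: 'a assume x: "x \<in> ball 0 1 \<inter> {x. p n \<le> x \<bullet> x}"
        then have "((1/2) ^ n)\<^sup>2 \<le> (norm x)\<^sup>2" by (simp add: p_def power2_norm_eq_inner)
        then have "(1/2) ^ n \<le> norm x" by (rule power2_le_imp_le) simp
        moreover have "(1/2::real) ^ Suc n < (1/2) ^ n" by simp
        ultimately have "(1/2) ^ Suc n < norm x" by linarith
        then show "x \<in> ?W n" using x by auto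
      qed
      have cl: "closed {x::'a. p n \<le> x \<bullet> x}" by (intro closed_Collect_le continuous_intros)
      show "test_fun (?W n) (\<lambda>x. ?\<eta> n x * \<phi> x)"
        by (rule test_fun_mult(1)[OF \<phi> open_UNIV subset_UNIV rcut_has_derivative[OF p(2)] rcut'_continuous[OF p(2)] cl rcut_0[OF p(2)] sub]) auto
      show "frechet_derivative (\<lambda>x. ?\<eta> n x * \<phi> x) (at x) b = ?\<eta> n x * ?d x + ?\<eta>' n x b * \<phi> x"
        by (rule test_fun_mult(2)[OF \<phi> open_UNIV subset_UNIV rcut_has_derivative[OF p(2)] rcut'_continuous[OF p(2)] cl rcut_0[OF p(2)] sub]) auto
    qed
    have \<phi>s: "sq_int lborel \<phi>" by (rule test_fun_sq_int[OF \<phi>])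
    have ds: "sq_int lborel ?d" by (rule test_fun_deriv_sq_int[OF \<phi> b])
    have i1: "integrable lborel (\<lambda>x. ?f x * ?d x)" by (rule L2_on_test_deriv_integrable[OF Lf \<phi> b])
    have i2: "integrable lborel (\<lambda>x. ?F x * \<phi> x)" by (rule L2_on_test_integrable[OF LF \<phi>])
    have i3: "integrable lborel (\<lambda>x. k (norm x) / norm x * hom_ext u x * \<phi> x)" by (rule L2_on_test_integrable[OF Lfr \<phi>])
    have \<eta>m: "?\<eta> n \<in> borel_measurable borel" "(\<lambda>x. ?\<eta>' n x b) \<in> borel_measurable borel" for n
      by (rule borel_measurable_continuous_onI rcut_continuous rcut'_continuous p)+
    have \<eta>1: "(\<lambda>n. ?\<eta> n x) \<longlonglongrightarrow> 1" and \<eta>0: "(\<lambda>n. ?\<eta>' n x b) \<longlonglongrightarrow> 0" if x: "x \<noteq> 0" for x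
    proof -
      have "(\<lambda>n. 2 * p n) \<longlonglongrightarrow> 2 * 0\<^sup>2" unfolding p_def by (intro tendsto_intros LIMSEQ_power_zero) simp
      from order_tendstoD(2)[OF this, of "x \<bullet> x"] have "eventually (\<lambda>n. 2 * p n < x \<bullet> x) sequentially" using x by simp
      then have e: "eventually (\<lambda>n. ?\<eta> n x = 1 \<and> ?\<eta>' n x b = 0) sequentially"
        by eventually_elim (use p in \<open>auto intro!: rcut_1 rcut'_1\<close>)
      show "(\<lambda>n. ?\<eta> n x) \<longlonglongrightarrow> 1" "(\<lambda>n. ?\<eta>' n x b) \<longlonglongrightarrow> 0"
        by (rule tendsto_eventually, rule eventually_mono[OF e], simp)+
    qed
    \<comment> \<open>On the transition zone |x|^2 \<le> 2p, so the derivative bound (3/2)(2|x|/p)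
      becomes at most 6/|x|, uniformly in n.\<close>
    have \<eta>b: "\<bar>?\<eta>' n x b\<bar> \<le> 6 / norm x" if x: "x \<noteq> 0" for n x
    proof (cases "p n \<le> x \<bullet> x \<and> x \<bullet> x \<le> 2 * p n")
      case True
      have nx: "norm x > 0" using x by simp
      have "\<bar>?\<eta>' n x b\<bar> = sstep' ((x \<bullet> x - p n) / p n) * (2 * \<bar>x \<bullet> b\<bar> / p n)"
        using p[of n] by (simp add: rcut'_def abs_mult sstep'_nonneg)
      also have "\<dots> \<le> (3/2) * (2 * norm x / p n)"
        using p[of n] Basis_le_norm[OF b, of x] by (intro mult_mono sstep'_le divide_right_mono) (auto simp: sstep'_nonneg)
      also have "\<dots> \<le> 6 / norm x"
      proof -
        have "norm x * norm x \<le> 2 * p n" using True by (simp add: power2_norm_eq_inner flip: power2_eq_square)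
        then show ?thesis using nx p[of n] by (simp add: field_simps)
      qed
      finally show ?thesis .
    next
      case False
      then have "?\<eta>' n x b = 0" using p[of n] by (auto intro: rcut'_0 rcut'_1)
      then show ?thesis by simp
    qed
    have A: "(\<lambda>n. \<integral>x. ?f x * (?\<eta> n x * ?d x) \<partial>lborel) \<longlonglongrightarrow> (LBINT x. ?f x * ?d x)"
    proof (rule integral_dominated_convergence[where w="\<lambda>x. \<bar>?f x * ?d x\<bar>"])
      have eq: "(\<lambda>x. ?f x * (?\<eta> n x * ?d x)) = (\<lambda>x. ?\<eta> n x * (?f x * ?d x))" for n by (auto simp: mult_ac)
      show "(\<lambda>x. ?f x * (?\<eta> n x * ?d x)) \<in> borel_measurable lborel" for n
        unfolding eq by (rule borel_measurable_times[OF _ borel_measurable_integrable[OF i1]]) (simp add: \<eta>m)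
      show "AE x in lborel. (\<lambda>n. ?f x * (?\<eta> n x * ?d x)) \<longlonglongrightarrow> ?f x * ?d x"
        using AE_lborel_nonzero
      proof eventually_elim
        case (elim x)
        from tendsto_mult[OF tendsto_const tendsto_mult[OF \<eta>1[OF elim] tendsto_const], of "?f x" "?d x"] show ?case by simp
      qed
      show "AE x in lborel. norm (?f x * (?\<eta> n x * ?d x)) \<le> \<bar>?f x * ?d x\<bar>" for n
      proof (intro AE_I2)
        fix x :: 'a
        have "\<bar>?\<eta> n x\<bar> \<le> 1" using rcut_bounds[of "p n" "2 * p n" x] by simp
        then have "\<bar>?\<eta> n x\<bar> * \<bar>?f x * ?d x\<bar> \<le> 1 * \<bar>?f x * ?d x\<bar>" by (intro mult_right_mono) auto
        then show "norm (?f x * (?\<eta> n x * ?d x)) \<le> \<bar>?f x * ?d x\<bar>" by (simp add: abs_mult mult_ac)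
      qed
    qed (use i1 in auto)
    have B: "(\<lambda>n. \<integral>x. ?f x * (?\<eta>' n x b * \<phi> x) \<partial>lborel) \<longlonglongrightarrow> (\<integral>x. (0::real) \<partial>(lborel::'a measure))"
    proof (rule integral_dominated_convergence[where w="\<lambda>x. 6 * \<bar>k (norm x) / norm x * hom_ext u x * \<phi> x\<bar>"])
      have eq: "(\<lambda>x. ?f x * (?\<eta>' n x b * \<phi> x)) = (\<lambda>x. ?\<eta>' n x b * (?f x * \<phi> x))" for n by (auto simp: mult_ac)
      show "(\<lambda>x. ?f x * (?\<eta>' n x b * \<phi> x)) \<in> borel_measurable lborel" for n
        unfolding eq by (rule borel_measurable_times[OF _ borel_measurable_integrable[OF L2_on_test_integrable[OF Lf \<phi>]]]) (simp add: \<eta>m)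
      show "AE x in lborel. (\<lambda>n. ?f x * (?\<eta>' n x b * \<phi> x)) \<longlonglongrightarrow> 0"
        using AE_lborel_nonzero
      proof eventually_elim
        case (elim x)
        from tendsto_mult[OF tendsto_const tendsto_mult[OF \<eta>0[OF elim] tendsto_const], of "?f x" "\<phi> x"] show ?case by simp
      qed
      show "AE x in lborel. norm (?f x * (?\<eta>' n x b * \<phi> x)) \<le> 6 * \<bar>k (norm x) / norm x * hom_ext u x * \<phi> x\<bar>" for n
        using AE_lborel_nonzero
      proof eventually_elim
        case (elim x)
        have "\<bar>?\<eta>' n x b\<bar> * \<bar>?f x * \<phi> x\<bar> \<le> 6 / norm x * \<bar>?f x * \<phi> x\<bar>" by (intro mult_right_mono \<eta>b elim) auto
        then show ?case by (simp add: abs_mult mult_ac)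
      qed
      show "integrable lborel (\<lambda>x. 6 * \<bar>k (norm x) / norm x * hom_ext u x * \<phi> x\<bar>)"
        by (rule integrable_mult_right[OF integrable_abs[OF i3]])
    qed simp
    have C: "(\<lambda>n. \<integral>x. ?\<eta> n x * (?F x * \<phi> x) \<partial>lborel) \<longlonglongrightarrow> (LBINT x. ?F x * \<phi> x)"
    proof (rule integral_dominated_convergence[where w="\<lambda>x. \<bar>?F x * \<phi> x\<bar>"])
      show "(\<lambda>x. ?\<eta> n x * (?F x * \<phi> x)) \<in> borel_measurable lborel" for n
        by (rule borel_measurable_times[OF _ borel_measurable_integrable[OF i2]]) (simp add: \<eta>m)
      show "AE x in lborel. (\<lambda>n. ?\<eta> n x * (?F x * \<phi> x)) \<longlonglongrightarrow> ?F x * \<phi> x"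
        using AE_lborel_nonzero
      proof eventually_elim
        case (elim x)
        from tendsto_mult[OF \<eta>1[OF elim] tendsto_const, of "?F x * \<phi> x"] show ?case by simp
      qed
      show "AE x in lborel. norm (?\<eta> n x * (?F x * \<phi> x)) \<le> \<bar>?F x * \<phi> x\<bar>" for n
      proof (intro AE_I2)
        fix x :: 'a
        have "\<bar>?\<eta> n x\<bar> \<le> 1" using rcut_bounds[of "p n" "2 * p n" x] by simp
        then have "\<bar>?\<eta> n x\<bar> * \<bar>?F x * \<phi> x\<bar> \<le> 1 * \<bar>?F x * \<phi> x\<bar>" by (intro mult_right_mono) auto
        then show "norm (?\<eta> n x * (?F x * \<phi> x)) \<le> \<bar>?F x * \<phi> x\<bar>" by (simp add: abs_mult)
      qed
    qed (use i2 in auto)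
    \<comment> \<open>The weak derivative on the punctured ball, tested with the cut-off function;
      the last term is the error that tends to 0.\<close>
    have eqn: "(LBINT x. ?f x * (?\<eta> n x * ?d x)) = - (LBINT x. ?\<eta> n x * (?F x * \<phi> x)) - (LBINT x. ?f x * (?\<eta>' n x b * \<phi> x))" for n
    proof -
      have j0: "integrable lborel (\<lambda>x. ?f x * (?\<eta> n x * ?d x + ?\<eta>' n x b * \<phi> x))"
        using L2_on_test_deriv_integrable[OF Lf test_fun_subset[OF prod[of n] Wb(2)] b] unfolding prod' .
      have j1: "integrable lborel (\<lambda>x. ?f x * (?\<eta> n x * ?d x))"
      proof -
        have "integrable lborel (\<lambda>x. ?\<eta> n x * (?f x * ?d x))"
        proof (rule Bochner_Integration.integrable_bound[OF i1])
          show "(\<lambda>x. ?\<eta> n x * (?f x * ?d x)) \<in> borel_measurable lborel"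
            by (rule borel_measurable_times[OF _ borel_measurable_integrable[OF i1]]) (simp add: \<eta>m)
          show "AE x in lborel. norm (?\<eta> n x * (?f x * ?d x)) \<le> norm (?f x * ?d x)"
          proof (intro AE_I2)
            fix x :: 'a
            have "\<bar>?\<eta> n x\<bar> \<le> 1" using rcut_bounds[of "p n" "2 * p n" x] by simp
            then have "\<bar>?\<eta> n x\<bar> * \<bar>?f x * ?d x\<bar> \<le> 1 * \<bar>?f x * ?d x\<bar>" by (intro mult_right_mono) auto
            then show "norm (?\<eta> n x * (?f x * ?d x)) \<le> norm (?f x * ?d x)" by (simp add: abs_mult)
          qed
        qed
        then show ?thesis by (simp add: mult_ac)
      qed
      have j2: "integrable lborel (\<lambda>x. ?f x * (?\<eta>' n x b * \<phi> x))"
        using Bochner_Integration.integrable_diff[OF j0 j1] by (simp add: distrib_left)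
      have "(LBINT x. ?f x * (?\<eta> n x * ?d x + ?\<eta>' n x b * \<phi> x)) = - (LBINT x. ?F x * (?\<eta> n x * \<phi> x))"
        using weak_derivD[OF wd[of n] prod[of n]] unfolding prod' .
      moreover have "(LBINT x. ?f x * (?\<eta> n x * ?d x + ?\<eta>' n x b * \<phi> x)) = (LBINT x. ?f x * (?\<eta> n x * ?d x)) + (LBINT x. ?f x * (?\<eta>' n x b * \<phi> x))"
        unfolding distrib_left[of "?f _"] by (rule Bochner_Integration.integral_add[OF j1 j2])
      moreover have "(\<lambda>x. ?F x * (?\<eta> n x * \<phi> x)) = (\<lambda>x. ?\<eta> n x * (?F x * \<phi> x))" by (auto simp: mult.left_commute)
      ultimately show ?thesis by simp
    qed
    have "(\<lambda>n. \<integral>x. ?f x * (?\<eta> n x * ?d x) \<partial>lborel) \<longlonglongrightarrow> - (LBINT x. ?F x * \<phi> x) - 0"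
      unfolding eqn using B by (intro tendsto_diff tendsto_minus C) simp
    from LIMSEQ_unique[OF A this] show "(LBINT x. ?f x * ?d x) = - (LBINT x. ?F x * \<phi> x)" by simp
  qed
qed


lemma H1_on_cong: "(\<And>x. x \<in> U \<Longrightarrow> u x = v x) \<Longrightarrow> H1_on U u \<longleftrightarrow> H1_on U v"
  unfolding H1_on_def using L2_on_cong[of U u v] weak_deriv_cong[of U u v] by (metis (no_types, lifting))

lemma H1_on_sum: "(\<And>i. i \<in> I \<Longrightarrow> H1_on U (u i)) \<Longrightarrow> H1_on U (\<lambda>x. \<Sum>i\<in>I. u i x)"
  by (induction I rule: infinite_finite_induct) (auto intro!: H1_on_add H1_on_zero)

lemma C1_bounded_Icc:
  assumes "\<And>r. (\<kappa> has_real_derivative \<kappa>' r) (at r)" "continuous_on UNIV \<kappa>'"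
  obtains B :: real where "B > 0" "\<And>r. 0 \<le> r \<Longrightarrow> r \<le> 1 \<Longrightarrow> \<bar>\<kappa> r\<bar> \<le> B" "\<And>r. 0 \<le> r \<Longrightarrow> r \<le> 1 \<Longrightarrow> \<bar>\<kappa>' r\<bar> \<le> B"
proof -
  have "continuous_on UNIV \<kappa>" using assms(1) by (auto simp: continuous_on_eq_continuous_at intro: DERIV_isCont)
  then have "bounded (\<kappa> ` {0..1})" "bounded (\<kappa>' ` {0..1})"
    using assms(2) by (auto intro!: compact_imp_bounded compact_continuous_image intro: continuous_on_subset)
  then obtain B1 B2 where "\<forall>r\<in>{0..1}. \<bar>\<kappa> r\<bar> \<le> B1" "\<forall>r\<in>{0..1}. \<bar>\<kappa>' r\<bar> \<le> B2"
    unfolding bounded_iff ball_simps by (auto simp only: real_norm_def)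
  then show ?thesis by (intro that[of "max 1 (max B1 B2)"]) (auto simp: max.coboundedI1 max.coboundedI2 le_max_iff_disj)
qed

lemma C1_shift_measurable:
  assumes "\<And>r. (\<kappa> has_real_derivative \<kappa>' r) (at r)" "continuous_on UNIV \<kappa>'"
  shows "\<kappa> \<in> borel_measurable borel" "\<kappa>' \<in> borel_measurable borel"
proof -
  have "continuous_on UNIV \<kappa>" using DERIV_isCont[OF assms(1)] by (simp add: continuous_on_eq_continuous_at)
  then show "\<kappa> \<in> borel_measurable borel" "\<kappa>' \<in> borel_measurable borel"
    using assms(2) by (simp_all add: borel_measurable_continuous_onI)
qed

section \<open>Finite separated sums as slices and as functions on the ball\<close>

context
  fixes I :: "'i set" and \<kappa> \<kappa>' :: "'i \<Rightarrow> real \<Rightarrow> real" and w :: "'i \<Rightarrow> 'a::euclidean_space \<Rightarrow> real"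
  assumes w: "\<And>i. i \<in> I \<Longrightarrow> H1S (w i)"
    and \<kappa>: "\<And>i r. i \<in> I \<Longrightarrow> (\<kappa> i has_real_derivative \<kappa>' i r) (at r)" "\<And>i. i \<in> I \<Longrightarrow> continuous_on UNIV (\<kappa>' i)"
begin

text \<open>The product of [0,1] with the sphere is modelled by 1 < |x| < 2, hence the argument |x|
  - 1 of the profile. The shell stays away from the origin, so boundedness of the profile on [0,1]
  suffices for the norms.\<close>

lemma shell_profile:
  assumes i: "i \<in> I"
  shows "L2_on shell (\<lambda>x. \<kappa> i (norm x - 1) * hom_ext (w i) x)"
    and "b \<in> Basis \<Longrightarrow> has_weak_deriv shell (\<lambda>x. \<kappa> i (norm x - 1) * hom_ext (w i) x) b
      (\<lambda>x. \<kappa> i (norm x - 1) * hgrad b (w i) x + \<kappa>' i (norm x - 1) * ((x \<bullet> b) / norm x) * hom_ext (w i) x)"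
proof -
  obtain B where B: "B > 0" "\<And>r. 0 \<le> r \<Longrightarrow> r \<le> 1 \<Longrightarrow> \<bar>\<kappa> i r\<bar> \<le> B" "\<And>r. 0 \<le> r \<Longrightarrow> r \<le> 1 \<Longrightarrow> \<bar>\<kappa>' i r\<bar> \<le> B"
    using C1_bounded_Icc[OF \<kappa>[OF i]] by blast
  note [measurable] = C1_shift_measurable[OF \<kappa>[OF i]]
  note wL = H1S_L2S[OF w[OF i]]
  have sh: "(shell :: 'a set) = {x. 1 < norm x \<and> norm x < 2}" by (simp add: shell_def)
  show Lf: "L2_on shell (\<lambda>x. \<kappa> i (norm x - 1) * hom_ext (w i) x)"
    unfolding sh hom_ext_def
    by (rule homogeneous_L2_on_bounded[OF wL, where w="\<lambda>\<rho>. \<kappa> i (\<rho> - 1)" and M=B]) (use B in auto)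
  have L1: "L2_on shell (\<lambda>x. \<kappa>' i (norm x - 1) * hom_ext (w i) x)"
    unfolding sh hom_ext_def
    by (rule homogeneous_L2_on_bounded[OF wL, where w="\<lambda>\<rho>. \<kappa>' i (\<rho> - 1)" and M=B]) (use B in auto)
  assume b: "b \<in> Basis"
  have L2: "L2_on shell (\<lambda>x. \<kappa> i (norm x - 1) * hgrad b (w i) x)"
  proof -
    have "L2_on {x. 1 < norm x \<and> norm x < 2} (\<lambda>x. \<kappa> i (norm x - 1) * (1 / norm x) * sph_grad b (w i) (x /\<^sub>R norm x))"
    proof (rule homogeneous_L2_on_bounded[OF sph_grad_L2S[OF w[OF i] b], where w="\<lambda>\<rho>. \<kappa> i (\<rho> - 1) * (1 / \<rho>)" and M=B])
      show "\<bar>\<kappa> i (\<rho> - 1) * (1 / \<rho>)\<bar> \<le> B" if "1 < \<rho>" "\<rho> < 2" for \<rho>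
      proof -
        have "\<bar>\<kappa> i (\<rho> - 1)\<bar> * \<bar>1 / \<rho>\<bar> \<le> B * 1" using that B by (intro mult_mono) auto
        then show ?thesis by (simp add: abs_mult)
      qed
    qed auto
    then show ?thesis unfolding sh by (simp add: hgrad_def mult.assoc)
  qed
  have L3: "L2_on shell (\<lambda>x. ((x \<bullet> b) / norm x) * (\<kappa>' i (norm x - 1) * hom_ext (w i) x))"
  proof (rule L2_on_bounded_mult[OF L1, where C=1])
    have [measurable]: "(shell :: 'a set) \<in> sets borel" unfolding sh by (rule borel_open[OF open_norm_shell])
    show "(\<lambda>x. indicator shell x * ((x \<bullet> b) / norm x)) \<in> borel_measurable borel" by measurable
    show "\<bar>(x \<bullet> b) / norm x\<bar> \<le> 1" for x using Basis_le_norm[OF b, of x] by (cases "x = 0") (auto simp: divide_le_eq)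
  qed simp
  show "has_weak_deriv shell (\<lambda>x. \<kappa> i (norm x - 1) * hom_ext (w i) x) b
      (\<lambda>x. \<kappa> i (norm x - 1) * hgrad b (w i) x + \<kappa>' i (norm x - 1) * ((x \<bullet> b) / norm x) * hom_ext (w i) x)"
  proof (rule radial_mult_weak_deriv[OF w[OF i] b, where k="\<lambda>\<rho>. \<kappa> i (\<rho> - 1)" and k'="\<lambda>\<rho>. \<kappa>' i (\<rho> - 1)" and n=0])
    show "((\<lambda>\<rho>. \<kappa> i (\<rho> - 1)) has_real_derivative \<kappa>' i (\<rho> - 1)) (at \<rho>)" for \<rho>
    proof -
      have "((\<lambda>\<rho>. \<rho> - 1) has_real_derivative 1) (at \<rho>)" by (auto intro!: derivative_eq_intros)
      from DERIV_chain2[OF \<kappa>(1)[OF i] this] show ?thesis by simp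
    qed
    show "continuous_on {0<..} (\<lambda>\<rho>. \<kappa>' i (\<rho> - 1))"
      by (rule continuous_on_compose2[OF \<kappa>(2)[OF i]]) (auto intro!: continuous_intros)
    show "(shell :: 'a set) \<in> sets borel" unfolding sh by (rule borel_open[OF open_norm_shell])
    show "(shell :: 'a set) \<subseteq> {x. (1 / 2) ^ Suc 0 < norm x \<and> norm x < 2}" unfolding sh by auto
    show "L2_on shell (\<lambda>x. \<kappa> i (norm x - 1) * hgrad b (w i) x + \<kappa>' i (norm x - 1) * ((x \<bullet> b) / norm x) * hom_ext (w i) x)"
      using L2_on_add[OF L2 L3] by (simp add: mult_ac)
  qed
qed

lemma shell_lift_profile:
  "shell_lift (\<lambda>r \<theta>. \<Sum>i\<in>I. \<kappa> i r * w i \<theta>) = (\<lambda>x. \<Sum>i\<in>I. \<kappa> i (norm x - 1) * hom_ext (w i) x)"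
  by (simp add: shell_lift_def[abs_def] hom_ext_def)

lemma H1_prod_profile: "H1_prod (\<lambda>r \<theta>. \<Sum>i\<in>I. \<kappa> i r * w i \<theta>)"
  unfolding H1_prod_def shell_lift_profile
proof (intro conjI allI)
  show "sfun (\<lambda>\<theta>. \<Sum>i\<in>I. \<kappa> i r * w i \<theta>)" for r
    using H1S_sfun[OF w] by (auto simp: sfun_def intro!: sum.neutral)
  show "H1_on shell (\<lambda>x. \<Sum>i\<in>I. \<kappa> i (norm x - 1) * hom_ext (w i) x)"
    by (intro H1_on_sum H1_onI[OF shell_profile(1) shell_profile(2)])
qed

text \<open>Contracting the gradient with x kills the angular part by Euler's relation and leaves
  the derivative of the profile. Since \<open>rad_deriv\<close> uses a chosen weak derivative, polar
  coordinates give the identity for almost every radius and then almost every direction.\<close>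

lemma rad_deriv_profile:
  assumes fin: "finite I"
  shows "AE r in lborel. r \<in> {0<..<1} \<longrightarrow> (AE x in lborel. x \<in> ball 0 1 \<longrightarrow>
     rad_deriv (\<lambda>r \<theta>. \<Sum>i\<in>I. \<kappa> i r * w i \<theta>) r (x /\<^sub>R norm x) = (\<Sum>i\<in>I. \<kappa>' i r * w i (x /\<^sub>R norm x)))"
proof -
  let ?u = "\<lambda>r \<theta>. \<Sum>i\<in>I. \<kappa> i r * w i \<theta>"
  let ?g = "\<lambda>b x. \<Sum>i\<in>I. \<kappa> i (norm x - 1) * hgrad b (w i) x + \<kappa>' i (norm x - 1) * ((x \<bullet> b) / norm x) * hom_ext (w i) x"
  have o: "open (shell :: 'a set)" unfolding shell_def by (rule open_norm_shell)
  have "AE x in lborel. x \<in> shell \<longrightarrow> wderiv shell (shell_lift ?u) b x = ?g b x" if b: "b \<in> Basis" for b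
    unfolding shell_lift_profile
    by (rule wderiv_AE_eq[OF o], rule weak_deriv_sum[OF b shell_profile(1) shell_profile(2)[OF _ b]])
  then have 1: "AE x in lborel. \<forall>b\<in>Basis. x \<in> shell \<longrightarrow> wderiv shell (shell_lift ?u) b x = ?g b x"
    by (subst AE_ball_countable) (auto simp: countable_finite)
  have h: "AE x in lborel. x \<in> annulus \<longrightarrow> hgrad b (w i) x = sgrad b (w i) x" if "b \<in> Basis" "i \<in> I" for b i
    by (rule hgrad_AE_eq[OF w[OF that(2)] that(1)])
  have 2: "AE x in lborel. \<forall>i\<in>I. x \<in> annulus \<longrightarrow> (\<Sum>b\<in>Basis. (x \<bullet> b) * hgrad b (w i) x) = 0"
  proof (subst AE_ball_countable[OF countable_finite[OF fin]], intro ballI)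
    fix i assume i: "i \<in> I"
    have "AE x in lborel. \<forall>b\<in>Basis. x \<in> annulus \<longrightarrow> hgrad b (w i) x = sgrad b (w i) x"
      using h[OF _ i] by (subst AE_ball_countable) (auto simp: countable_finite)
    with sgrad_euler[OF w[OF i]] show "AE x in lborel. x \<in> annulus \<longrightarrow> (\<Sum>b\<in>Basis. (x \<bullet> b) * hgrad b (w i) x) = 0"
      by eventually_elim simp
  qed
  have "AE x in lborel. x \<in> shell \<longrightarrow> (\<Sum>b\<in>Basis. (x \<bullet> b) * wderiv shell (shell_lift ?u) b x) = norm x * (\<Sum>i\<in>I. \<kappa>' i (norm x - 1) * w i (x /\<^sub>R norm x))"
    using 1 2
  proof eventually_elim
    case (elim x)
    show ?case
    proof
      assume x: "x \<in> shell"
      then have xa: "x \<in> annulus" and nx: "norm x > 0" by (auto simp: shell_def annulus_def)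
      have "(\<Sum>b\<in>Basis. (x \<bullet> b) * wderiv shell (shell_lift ?u) b x) = (\<Sum>b\<in>Basis. (x \<bullet> b) * ?g b x)"
        using elim x by (intro sum.cong) auto
      also have "\<dots> = (\<Sum>i\<in>I. \<Sum>b\<in>Basis. (x \<bullet> b) * (\<kappa> i (norm x - 1) * hgrad b (w i) x + \<kappa>' i (norm x - 1) * ((x \<bullet> b) / norm x) * hom_ext (w i) x))"
        unfolding sum_distrib_left by (rule sum.swap)
      also have "\<dots> = (\<Sum>i\<in>I. \<kappa> i (norm x - 1) * (\<Sum>b\<in>Basis. (x \<bullet> b) * hgrad b (w i) x) + \<kappa>' i (norm x - 1) / norm x * hom_ext (w i) x * (\<Sum>b\<in>Basis. (x \<bullet> b) * (x \<bullet> b)))"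
        by (intro sum.cong refl) (simp add: sum_distrib_left distrib_left sum.distrib mult_ac sum_divide_distrib)
      \<comment> \<open>Euler's relation annihilates the first inner sum; the second is
        |x|^2.\<close>
      also have "\<dots> = (\<Sum>i\<in>I. norm x * (\<kappa>' i (norm x - 1) * w i (x /\<^sub>R norm x)))"
      proof (rule sum.cong[OF refl])
        fix i assume i: "i \<in> I"
        have "(\<Sum>b\<in>Basis. (x \<bullet> b) * (x \<bullet> b)) = norm x * norm x"
          unfolding euclidean_inner[of x x, symmetric] by (simp add: power2_norm_eq_inner flip: power2_eq_square)
        then show "\<kappa> i (norm x - 1) * (\<Sum>b\<in>Basis. (x \<bullet> b) * hgrad b (w i) x) + \<kappa>' i (norm x - 1) / norm x * hom_ext (w i) x * (\<Sum>b\<in>Basis. (x \<bullet> b) * (x \<bullet> b))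
           = norm x * (\<kappa>' i (norm x - 1) * w i (x /\<^sub>R norm x))"
          using elim(2) i xa nx by (simp add: hom_ext_def)
      qed
      finally show "(\<Sum>b\<in>Basis. (x \<bullet> b) * wderiv shell (shell_lift ?u) b x) = norm x * (\<Sum>i\<in>I. \<kappa>' i (norm x - 1) * w i (x /\<^sub>R norm x))"
        by (simp only: sum_distrib_left)
    qed
  qed
  \<comment> \<open>Slice parameter r corresponds to radius 1 + r in the shell.\<close>
  from AE_lborel_affine[OF AE_polar[OF this] one_neq_zero, of 1]
  show ?thesis
  proof eventually_elim
    case (elim r)
    show ?case
    proof
      assume r: "r \<in> {0<..<1}"
      then have "1 + 1 *\<^sub>R r > 0" by simp
      with elim have "AE x in lborel. x \<in> ball 0 1 \<longrightarrow> (1 + 1 *\<^sub>R r) *\<^sub>R (x /\<^sub>R norm x) \<in> shell \<longrightarrow>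
         (\<Sum>b\<in>Basis. (((1 + 1 *\<^sub>R r) *\<^sub>R (x /\<^sub>R norm x)) \<bullet> b) * wderiv shell (shell_lift ?u) b ((1 + 1 *\<^sub>R r) *\<^sub>R (x /\<^sub>R norm x))) =
         norm ((1 + 1 *\<^sub>R r) *\<^sub>R (x /\<^sub>R norm x)) * (\<Sum>i\<in>I. \<kappa>' i (norm ((1 + 1 *\<^sub>R r) *\<^sub>R (x /\<^sub>R norm x)) - 1) * w i (((1 + 1 *\<^sub>R r) *\<^sub>R (x /\<^sub>R norm x)) /\<^sub>R norm ((1 + 1 *\<^sub>R r) *\<^sub>R (x /\<^sub>R norm x))))"
        by blast
      then show "AE x in lborel. x \<in> ball 0 1 \<longrightarrow> rad_deriv ?u r (x /\<^sub>R norm x) = (\<Sum>i\<in>I. \<kappa>' i r * w i (x /\<^sub>R norm x))"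
        using AE_lborel_nonzero
      proof eventually_elim
        case (elim x)
        show ?case
        proof
          assume xb: "x \<in> ball 0 1"
          let ?h = "x /\<^sub>R norm x"
          have n: "norm ((1 + 1 *\<^sub>R r) *\<^sub>R ?h) = 1 + r" using r elim(2) by simp
          have hh: "((1 + 1 *\<^sub>R r) *\<^sub>R ?h) /\<^sub>R (1 + r) = ?h" using r by simp
          have "(1 + 1 *\<^sub>R r) *\<^sub>R ?h \<in> shell" unfolding shell_def mem_Collect_eq n using r by simp
          with elim(1) xb have "(\<Sum>b\<in>Basis. (((1 + 1 *\<^sub>R r) *\<^sub>R ?h) \<bullet> b) * wderiv shell (shell_lift ?u) b ((1 + 1 *\<^sub>R r) *\<^sub>R ?h)) =
             (1 + r) * (\<Sum>i\<in>I. \<kappa>' i (1 + r - 1) * w i ?h)"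
            unfolding n hh by blast
          moreover have "(\<Sum>b\<in>Basis. (((1 + 1 *\<^sub>R r) *\<^sub>R ?h) \<bullet> b) * wderiv shell (shell_lift ?u) b ((1 + 1 *\<^sub>R r) *\<^sub>R ?h)) = (1 + r) * rad_deriv ?u r ?h"
            by (simp add: rad_deriv_def sum_distrib_left mult.assoc)
          ultimately show "rad_deriv ?u r ?h = (\<Sum>i\<in>I. \<kappa>' i r * w i ?h)" using r by simp
        qed
      qed
    qed
  qed
qed

text \<open>With the factor \<rho>^\<alpha> each radial profile and its derivative satisfy the
  growth bounds under which the origin is removable.\<close>

lemma H1B_profile:
  assumes K: "2 * \<alpha> + real DIM('a) - 2 > 0"
  shows "H1B (polar_fun \<alpha> (\<lambda>r \<theta>. \<Sum>i\<in>I. \<kappa> i r * w i \<theta>))"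
  unfolding H1B_def
proof (intro conjI allI impI)
  let ?f = "\<lambda>i x. (norm x powr \<alpha> * \<kappa> i (norm x)) * hom_ext (w i) x"
  show "polar_fun \<alpha> (\<lambda>r \<theta>. \<Sum>i\<in>I. \<kappa> i r * w i \<theta>) x = 0" if "x \<notin> ball 0 1" for x
    using that by (simp add: polar_fun_def)
  have eq: "polar_fun \<alpha> (\<lambda>r \<theta>. \<Sum>i\<in>I. \<kappa> i r * w i \<theta>) x = (\<Sum>i\<in>I. ?f i x)" if "x \<in> ball 0 1" for x
    using that by (simp add: polar_fun_def hom_ext_def sum_distrib_left mult.assoc)
  have "H1_on (ball 0 1) (?f i)" if i: "i \<in> I" for i
  proof -
    obtain B where B: "B > 0" "\<And>r. 0 \<le> r \<Longrightarrow> r \<le> 1 \<Longrightarrow> \<bar>\<kappa> i r\<bar> \<le> B" "\<And>r. 0 \<le> r \<Longrightarrow> r \<le> 1 \<Longrightarrow> \<bar>\<kappa>' i r\<bar> \<le> B"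
      using C1_bounded_Icc[OF \<kappa>[OF i]] by blast
    let ?k = "\<lambda>\<rho>. \<rho> powr \<alpha> * \<kappa> i \<rho>" and ?k' = "\<lambda>\<rho>. \<alpha> * \<rho> powr (\<alpha> - 1) * \<kappa> i \<rho> + \<rho> powr \<alpha> * \<kappa>' i \<rho>"
    have d: "(?k has_real_derivative ?k' \<rho>) (at \<rho>)" if "0 < \<rho>" for \<rho>
      using that \<kappa>(1)[OF i, of \<rho>] by (auto intro!: derivative_eq_intros)
    have c: "continuous_on {0<..} ?k'"
    proof -
      have "continuous_on UNIV (\<kappa> i)" using \<kappa>(1)[OF i] by (auto simp: continuous_on_eq_continuous_at intro: DERIV_isCont)
      then show ?thesis using \<kappa>(2)[OF i]
        by (intro continuous_intros) (auto intro: continuous_on_subset)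
    qed
    have b1: "\<bar>?k \<rho>\<bar> \<le> ((\<bar>\<alpha>\<bar> + 1) * B) * \<rho> powr \<alpha>" if "0 < \<rho>" "\<rho> < 1" for \<rho>
    proof -
      have "\<bar>?k \<rho>\<bar> \<le> \<rho> powr \<alpha> * B" unfolding abs_mult using B(2)[of \<rho>] that by (simp add: mult_left_mono)
      also have "\<dots> \<le> ((\<bar>\<alpha>\<bar> + 1) * B) * \<rho> powr \<alpha>" using B(1) by (simp add: algebra_simps)
      finally show ?thesis .
    qed
    have b2: "\<bar>?k' \<rho>\<bar> \<le> ((\<bar>\<alpha>\<bar> + 1) * B) * \<rho> powr (\<alpha> - 1)" if "0 < \<rho>" "\<rho> < 1" for \<rho>
    proof -
      have p: "\<rho> powr \<alpha> \<le> \<rho> powr (\<alpha> - 1)" using that by (intro powr_mono') auto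
      have "\<bar>?k' \<rho>\<bar> \<le> \<bar>\<alpha>\<bar> * \<rho> powr (\<alpha> - 1) * \<bar>\<kappa> i \<rho>\<bar> + \<rho> powr \<alpha> * \<bar>\<kappa>' i \<rho>\<bar>"
        by (rule order_trans[OF abs_triangle_ineq]) (simp add: abs_mult)
      also have "\<dots> \<le> \<bar>\<alpha>\<bar> * \<rho> powr (\<alpha> - 1) * B + \<rho> powr (\<alpha> - 1) * B"
        using B that p by (intro add_mono mult_mono) auto
      finally show ?thesis by (simp add: algebra_simps)
    qed
    show ?thesis
      by (rule H1_onI[OF radial_mult_ball(1)[OF w[OF i] SOME_Basis d c K b1 b2] radial_mult_ball(2)[OF w[OF i] _ d c K b1 b2]])
  qed
  then have "H1_on (ball 0 1) (\<lambda>x. \<Sum>i\<in>I. ?f i x)" by (rule H1_on_sum)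
  then show "H1_on (ball 0 1) (polar_fun \<alpha> (\<lambda>r \<theta>. \<Sum>i\<in>I. \<kappa> i r * w i \<theta>))"
    by (subst H1_on_cong[OF eq]) auto
qed

end

subsection \<open>Curves on the sphere\<close>

lemma integral_shrinking_interval:
  fixes q :: "real \<Rightarrow> real"
  assumes q: "integrable lborel (\<lambda>t. indicator {0..T} t * q t)" and X: "\<And>n. X n \<in> {0..T}" "X \<longlonglongrightarrow> t" and t: "t \<in> {0..T}"
  shows "(\<lambda>n. \<integral>s. indicator {min (X n) t..max (X n) t} s * q s \<partial>lborel) \<longlonglongrightarrow> 0"
proof -
  define Q where "Q = (\<lambda>s. indicator {0..T} s * q s)"
  have Qi: "integrable lborel Q" using q by (simp add: Q_def)
  then have Qm[measurable]: "Q \<in> borel_measurable borel" by simp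
  have "(\<lambda>n. \<integral>s. indicator {min (X n) t..max (X n) t} s * Q s \<partial>lborel) \<longlonglongrightarrow> (\<integral>s. 0 \<partial>(lborel::real measure))"
  proof (rule integral_dominated_convergence[where w="\<lambda>s. \<bar>Q s\<bar>"])
    show "AE s in lborel. (\<lambda>n. indicator {min (X n) t..max (X n) t} s * Q s) \<longlonglongrightarrow> 0"
      using AE_lborel_singleton[of t]
    proof eventually_elim
      case (elim s)
      then have "0 < dist s t" by simp
      with X(2) have "eventually (\<lambda>n. dist (X n) t < dist s t) sequentially" by (rule tendstoD)
      then have "eventually (\<lambda>n. indicator {min (X n) t..max (X n) t} s * Q s = 0) sequentially"
        by eventually_elim (auto simp: indicator_def dist_real_def min_def max_def split: if_splits)
      then show ?case by (rule tendsto_eventually)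
    qed
  qed (use Qi in \<open>auto simp: indicator_def\<close>)
  moreover have "(\<lambda>s. indicator {min (X n) t..max (X n) t} s * Q s) = (\<lambda>s. indicator {min (X n) t..max (X n) t} s * q s)" for n
    using X(1)[of n] t by (auto simp: Q_def indicator_def fun_eq_iff)
  ultimately show ?thesis by simp
qed

lemma integrable_subinterval:
  fixes q :: "real \<Rightarrow> real"
  assumes "integrable lborel (\<lambda>t. indicator {0..T} t * q t)" "0 \<le> a" "b \<le> T"
  shows "integrable lborel (\<lambda>t. indicator {a..b} t * q t)"
proof -
  have "integrable lborel (\<lambda>t. indicator {a..b} t * (indicator {0..T} t * q t))"
    using integrable_mult_indicator[OF _ assms(1), of "{a..b}"] by simp
  moreover have "(\<lambda>t. indicator {a..b} t * (indicator {0..T} t * q t)) = (\<lambda>t. indicator {a..b} t * q t)"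
    using assms(2,3) by (auto simp: indicator_def fun_eq_iff)
  ultimately show ?thesis by simp
qed

lemma integral_split_interval:
  fixes q :: "real \<Rightarrow> real"
  assumes q: "integrable lborel (\<lambda>t. indicator {0..T} t * q t)" and ab: "0 \<le> a" "a \<le> b" "b \<le> c" "c \<le> T"
  shows "(LBINT t. indicator {a..c} t * q t) = (LBINT t. indicator {a..b} t * q t) + (LBINT t. indicator {b..c} t * q t)"
proof -
  have i: "integrable lborel (\<lambda>t. indicator {a..b} t * q t)" "integrable lborel (\<lambda>t. indicator {b..c} t * q t)"
    "integrable lborel (\<lambda>t. indicator {a..c} t * q t)"
    by (rule integrable_subinterval[OF q]; use ab in linarith)+
  have "(LBINT t. indicator {a..c} t * q t) = (LBINT t. indicator {a..b} t * q t + indicator {b..c} t * q t)"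
  proof (rule integral_cong_AE)
    show "AE t in lborel. indicator {a..c} t * q t = indicator {a..b} t * q t + indicator {b..c} t * q t"
      using AE_lborel_singleton[of b] by eventually_elim (use ab in \<open>auto simp: indicator_def\<close>)
  qed (use i in auto)
  then show ?thesis using i by simp
qed

text \<open>Otherwise q minus its average would be strictly positive on the interval and yet have
  integral zero.\<close>

lemma exists_le_average:
  fixes q :: "real \<Rightarrow> real"
  assumes q: "integrable lborel (\<lambda>t. indicator {a..b} t * q t)" and ab: "a < b"
  shows "\<exists>t\<in>{a..b}. (b - a) * q t \<le> (LBINT t. indicator {a..b} t * q t)"
proof (rule ccontr)
  let ?I = "\<integral>t. indicator {a..b} t * q t \<partial>lborel"
  assume "\<not> ?thesis"
  then have g: "?I / (b - a) < q t" if "t \<in> {a..b}" for t using that ab by (auto simp: divide_less_eq mult.commute not_le)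
  let ?r = "\<lambda>t. indicator {a..b} t * q t - indicator {a..b} t * (?I / (b - a))"
  have ic: "integrable lborel (\<lambda>t. indicator {a..b} t * (?I / (b - a)))"
    by (intro integrable_mult_left integrable_real_indicator) (use ab in \<open>auto simp: emeasure_lborel_Icc_eq\<close>)
  have i: "integrable lborel ?r" by (intro Bochner_Integration.integrable_diff q ic)
  have r0: "0 \<le> ?r t" for t using g[of t] by (auto simp: indicator_def)
  have "(LBINT t. ?r t) = 0"
    using ab by (subst Bochner_Integration.integral_diff[OF q ic]) (simp_all only: integral_mult_left_zero, simp)
  then have "AE t in lborel. ?r t = 0" using integral_nonneg_eq_0_iff_AE[OF i] r0 by auto
  then have "AE t in lborel. t \<notin> {a..b}"
  proof eventually_elim
    case (elim t)
    show ?case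
    proof
      assume t: "t \<in> {a..b}"
      with elim g[OF t] show False by simp
    qed
  qed
  then have "{a..b} \<in> null_sets lborel" by (subst (asm) AE_iff_null_sets[symmetric]) auto
  then show False using ab by (auto simp: null_sets_def)
qed

text \<open>Sum the hypothesis over points of a fine mesh at which \<open>q\<close> is below its average on the cell; the
  contribution of the two end points vanishes as the mesh is refined.\<close>
lemma increment_le_integral:
  fixes q e :: "real \<Rightarrow> real"
  assumes q: "integrable lborel (\<lambda>t. indicator {0..T} t * q t)" and q0: "\<And>t. 0 \<le> q t" and C: "0 \<le> C"
    and e: "\<And>s t. 0 \<le> s \<Longrightarrow> s \<le> t \<Longrightarrow> t \<le> T \<Longrightarrow>
      \<bar>e t - e s\<bar> \<le> C * sqrt ((t - s) * (LBINT x. indicator {s..t} x * q x)) * (sqrt (q s) + sqrt (q t))"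
    and ab: "0 \<le> a" "a < b" "b \<le> T"
  shows "\<bar>e b - e a\<bar> \<le> 8 * C * (LBINT x. indicator {a..b} x * q x)"
proof -
  define Q where "Q s t = (LBINT x. indicator {s..t} x * q x)" for s t
  have Q0: "0 \<le> Q s t" for s t unfolding Q_def using q0 by (intro integral_nonneg_AE AE_I2) simp
  have Qadd: "Q s u = Q s t + Q t u" if "0 \<le> s" "s \<le> t" "t \<le> u" "u \<le> T" for s t u
    unfolding Q_def by (rule integral_split_interval[OF q that])
  have Qmono: "Q s t \<le> Q s' t'" if "0 \<le> s'" "s' \<le> s" "s \<le> t" "t \<le> t'" "t' \<le> T" for s s' t t'
    using Qadd[of s' s t'] Qadd[of s t t'] that Q0[of s' s] Q0[of t t'] by linarith
  have bound: "\<bar>e b - e a\<bar> \<le> 8 * C * Q a b + (C * sqrt (b - a) * (sqrt (Q a b) * (sqrt (q a) + sqrt (q b)))) * sqrt (1 / real (Suc m))" for m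
  proof -
    define n where "n = Suc m"
    define h where "h = (b - a) / real n"
    have n0: "real n > 0" and h0: "h > 0" using ab by (auto simp: n_def h_def)
    have hn: "real n * h = b - a" using n0 by (simp add: h_def)
    define y where "y i = a + real i * h" for i
    have y_0: "y 0 = a" and y_n: "y n = b" using hn by (auto simp: y_def)
    have ySuc: "y (Suc i) = y i + h" for i by (simp add: y_def algebra_simps)
    have y_mono: "y i \<le> y j" if "i \<le> j" for i j using that h0 by (simp add: y_def)
    have y_range: "0 \<le> y i" "y i \<le> T" if "i \<le> n" for i
      using y_mono[of 0 i] y_mono[OF that] ab by (auto simp: y_0 y_n)
    have "\<exists>t\<in>{y i..y (Suc i)}. h * q t \<le> Q (y i) (y (Suc i))" if "i < n" for i
      using exists_le_average[OF integrable_subinterval[OF q], of "y i" "y (Suc i)"] y_range[of i] y_range[of "Suc i"] that h0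
      by (simp add: Q_def ySuc)
    then obtain t where t: "\<And>i. i < n \<Longrightarrow> t i \<in> {y i..y (Suc i)}" "\<And>i. i < n \<Longrightarrow> h * q (t i) \<le> Q (y i) (y (Suc i))"
      by metis
    define m' where "m' i = Q (y i) (y (Suc i))" for i
    have m0: "0 \<le> m' i" for i by (simp add: m'_def Q0)
    \<comment> \<open>Consecutive sample points are at most 2h apart, and the interval between them
      lies in the two cells that contain them.\<close>
    have step: "\<bar>e (t (Suc i)) - e (t i)\<bar> \<le> 3 * C * (m' i + m' (Suc i))" if i: "Suc i < n" for i
    proof -
      have tt: "0 \<le> t i" "t i \<le> t (Suc i)" "t (Suc i) \<le> T" "t (Suc i) - t i \<le> 2 * h"
        using t(1)[of i] t(1)[of "Suc i"] i y_range[of i] y_range[of "Suc (Suc i)"] by (auto simp: ySuc)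
      define S where "S = m' i + m' (Suc i)"
      have "Q (t i) (t (Suc i)) \<le> Q (y i) (y (Suc (Suc i)))"
        using t(1)[of i] t(1)[of "Suc i"] i y_range[of i] y_range[of "Suc (Suc i)"] tt by (intro Qmono) auto
      also have "\<dots> = S" unfolding m'_def S_def
        using y_range[of i] y_range[of "Suc (Suc i)"] i y_mono[of i "Suc i"] y_mono[of "Suc i" "Suc (Suc i)"] by (intro Qadd) auto
      finally have Qt: "Q (t i) (t (Suc i)) \<le> S" .
      have S0: "0 \<le> S" using m0 by (simp add: S_def)
      have "\<bar>e (t (Suc i)) - e (t i)\<bar> \<le> C * sqrt ((t (Suc i) - t i) * Q (t i) (t (Suc i))) * (sqrt (q (t i)) + sqrt (q (t (Suc i))))"
        unfolding Q_def by (rule e[OF tt(1-3)])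
      also have "\<dots> \<le> C * sqrt (2 * h * S) * (sqrt (q (t i)) + sqrt (q (t (Suc i))))"
        using tt Qt C Q0 q0 h0 by (intro mult_right_mono mult_left_mono real_sqrt_le_mono mult_mono) auto
      also have "\<dots> = C * sqrt (2 * S) * (sqrt (h * q (t i)) + sqrt (h * q (t (Suc i))))"
      proof -
        have "sqrt (2 * h * S) = sqrt h * sqrt (2 * S)" by (simp only: real_sqrt_mult[symmetric] mult_ac)
        then show ?thesis by (simp only: real_sqrt_mult[of h] distrib_left mult_ac)
      qed
      also have "\<dots> \<le> C * sqrt (2 * S) * (sqrt S + sqrt S)"
        using t(2)[of i] t(2)[of "Suc i"] i m0 C S0 unfolding m'_def[symmetric] S_def
        by (intro mult_left_mono add_mono real_sqrt_le_mono) (auto intro: order_trans)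
      also have "\<dots> = (2 * sqrt 2) * (C * S)"
        using S0 by (simp add: real_sqrt_mult mult_ac)
      \<comment> \<open>From 2 sqrt 2 \<le> 3. Every cell occurs in at most two steps, which gives 6
        for the interior; the two end pieces add 1 each, whence the constant 8.\<close>
      also have "\<dots> \<le> 3 * (C * S)"
      proof (rule mult_right_mono)
        have "(2 * sqrt 2)\<^sup>2 \<le> (3::real)\<^sup>2" by (simp add: power_mult_distrib)
        then show "2 * sqrt 2 \<le> (3::real)" by (rule power2_le_imp_le) simp
      qed (use C S0 in simp)
      finally show ?thesis by (simp add: mult.assoc S_def)
    qed
    have chain: "\<bar>e (t i) - e (t 0)\<bar> \<le> 3 * C * (\<Sum>j<i. m' j + m' (Suc j))" if "i < n" for i
      using that
    proof (induction i)
      case (Suc i)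
      then show ?case using step[of i] by (simp add: distrib_left)
    qed simp
    have Qsum: "Q a (y i) = (\<Sum>j<i. m' j)" if "i \<le> n" for i
      using that
    proof (induction i)
      case 0
      have "Q a a = 0" using Qadd[of a a a] ab by simp
      then show ?case by (simp add: y_0)
    next
      case (Suc i)
      then show ?case using Qadd[of a "y i" "y (Suc i)"] ab y_range[of "Suc i"] y_mono[of 0 i] y_mono[of i "Suc i"] by (simp add: y_0 m'_def)
    qed
    have sums: "(\<Sum>j<m. m' j + m' (Suc j)) \<le> 2 * Q a b"
    proof -
      have "(\<Sum>j<m. m' (Suc j)) \<le> (\<Sum>j<n. m' j)"
      proof -
        have "(\<Sum>j<n. m' j) = m' 0 + (\<Sum>j<m. m' (Suc j))" unfolding n_def by (rule sum.lessThan_Suc_shift)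
        then show ?thesis using m0[of 0] by simp
      qed
      moreover have "(\<Sum>j<m. m' j) \<le> (\<Sum>j<n. m' j)" using m0[of m] by (simp add: n_def)
      ultimately show ?thesis using Qsum[of n] by (simp add: y_n sum.distrib)
    qed
    have mid: "\<bar>e (t m) - e (t 0)\<bar> \<le> 6 * C * Q a b"
    proof -
      have "\<bar>e (t m) - e (t 0)\<bar> \<le> 3 * C * (\<Sum>j<m. m' j + m' (Suc j))" by (rule chain) (simp add: n_def)
      also have "\<dots> \<le> 3 * C * (2 * Q a b)" using sums C by (intro mult_left_mono) auto
      finally show ?thesis by simp
    qed
    have t0: "a \<le> t 0" "t 0 \<le> a + h" and tm: "b - h \<le> t m" "t m \<le> b"
      using t(1)[of 0] t(1)[of m] y_n by (auto simp: n_def y_0 ySuc)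
    have tr: "t 0 \<le> b" "a \<le> t m"
      using t0 tm hn n0 h0 y_mono[of 1 n] y_mono[of 0 m] t(1)[of m] y_n ySuc[of 0] by (auto simp: n_def y_0)
    have qt: "h * q (t 0) \<le> Q a b" "h * q (t m) \<le> Q a b"
      using t(2)[of 0] t(2)[of m] Qmono[of a "y 0" "y 1" b] Qmono[of a "y m" "y n" b] y_mono[of 0 1] y_mono[of 1 n] y_mono[of 0 m] y_mono[of m n] ab
      by (auto simp: n_def y_0 y_n[unfolded n_def])
    \<comment> \<open>At a sampled point h q is at most the integral, so its root is absorbed. The
      value of q at an end point of [a,b] is not controlled, but it keeps a factor sqrt h that
      vanishes as the mesh is refined.\<close>
    have endp: "C * sqrt (h * Q a b) * (sqrt (q s) + sqrt (q r)) \<le> C * Q a b + C * sqrt (h * Q a b) * sqrt (q r)"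
      if "h * q s \<le> Q a b" for s r
    proof -
      have "sqrt (h * Q a b) * sqrt (q s) = sqrt (Q a b) * sqrt (h * q s)" by (simp add: real_sqrt_mult)
      also have "\<dots> \<le> sqrt (Q a b) * sqrt (Q a b)" using that Q0 by (intro mult_left_mono real_sqrt_le_mono) auto
      also have "\<dots> = Q a b" using Q0 by simp
      finally have "C * (sqrt (h * Q a b) * sqrt (q s)) \<le> C * Q a b" by (rule mult_left_mono[OF _ C])
      then show ?thesis by (simp add: algebra_simps)
    qed
    have left: "\<bar>e (t 0) - e a\<bar> \<le> C * Q a b + C * sqrt (h * Q a b) * sqrt (q a)"
    proof -
      have "\<bar>e (t 0) - e a\<bar> \<le> C * sqrt ((t 0 - a) * Q a (t 0)) * (sqrt (q a) + sqrt (q (t 0)))"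
        unfolding Q_def by (rule e) (use ab t0 tr in auto)
      also have "\<dots> \<le> C * sqrt (h * Q a b) * (sqrt (q a) + sqrt (q (t 0)))"
        using C q0 Q0 t0 tr ab h0 by (intro mult_right_mono mult_left_mono real_sqrt_le_mono mult_mono Qmono) auto
      also have "\<dots> \<le> C * Q a b + C * sqrt (h * Q a b) * sqrt (q a)"
        using endp[OF qt(1), of a] by (simp add: add.commute)
      finally show ?thesis .
    qed
    have right: "\<bar>e b - e (t m)\<bar> \<le> C * Q a b + C * sqrt (h * Q a b) * sqrt (q b)"
    proof -
      have "\<bar>e b - e (t m)\<bar> \<le> C * sqrt ((b - t m) * Q (t m) b) * (sqrt (q (t m)) + sqrt (q b))"
        unfolding Q_def by (rule e) (use ab tm tr in auto)
      also have "\<dots> \<le> C * sqrt (h * Q a b) * (sqrt (q (t m)) + sqrt (q b))"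
        using C q0 Q0 tm tr ab h0 by (intro mult_right_mono mult_left_mono real_sqrt_le_mono mult_mono Qmono) auto
      also note endp[OF qt(2), of b]
      finally show ?thesis .
    qed
    have "\<bar>e b - e a\<bar> \<le> \<bar>e b - e (t m)\<bar> + \<bar>e (t m) - e (t 0)\<bar> + \<bar>e (t 0) - e a\<bar>" by linarith
    also have "\<dots> \<le> 8 * C * Q a b + C * sqrt (h * Q a b) * (sqrt (q a) + sqrt (q b))"
      using left right mid by (simp add: distrib_left)
    also have "sqrt (h * Q a b) = sqrt (b - a) * sqrt (Q a b) * sqrt (1 / real (Suc m))"
      by (simp add: h_def n_def real_sqrt_mult real_sqrt_divide)
    finally show ?thesis by (simp add: mult_ac)
  qed
  have "(\<lambda>m. 8 * C * Q a b + (C * sqrt (b - a) * (sqrt (Q a b) * (sqrt (q a) + sqrt (q b)))) * sqrt (1 / real (Suc m)))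
      \<longlonglongrightarrow> 8 * C * Q a b + (C * sqrt (b - a) * (sqrt (Q a b) * (sqrt (q a) + sqrt (q b)))) * sqrt 0"
    by (intro tendsto_intros LIMSEQ_Suc[OF lim_1_over_n])
  then have "\<bar>e b - e a\<bar> \<le> 8 * C * Q a b + (C * sqrt (b - a) * (sqrt (Q a b) * (sqrt (q a) + sqrt (q b)))) * sqrt 0"
    by (rule LIMSEQ_le_const) (use bound in auto)
  then show ?thesis by (simp add: Q_def)
qed

lemma integrable_if_square_integrable:
  fixes g :: "real \<Rightarrow> real"
  assumes sq: "integrable lborel (\<lambda>t. indicator {0..T} t * (g t)\<^sup>2)" and g: "\<And>t. 0 \<le> g t"
  shows "integrable lborel (\<lambda>t. indicator {0..T} t * g t)"
proof (rule Bochner_Integration.integrable_bound)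
  show "integrable lborel (\<lambda>t. indicator {0..T} t + indicator {0..T} t * (g t)\<^sup>2)"
    by (intro Bochner_Integration.integrable_add sq) simp
  have "(\<lambda>t. sqrt (indicator {0..T} t * (g t)\<^sup>2)) \<in> borel_measurable lborel"
    by (rule measurable_compose[OF borel_measurable_integrable[OF sq] borel_measurable_sqrt])
  moreover have "(\<lambda>t. sqrt (indicator {0..T} t * (g t)\<^sup>2)) = (\<lambda>t. indicator {0..T} t * g t)"
    using g by (auto simp: indicator_def)
  ultimately show "(\<lambda>t. indicator {0..T} t * g t) \<in> borel_measurable lborel" by simp
  show "AE t in lborel. norm (indicator {0..T} t * g t) \<le> norm (indicator {0..T} t + indicator {0..T} t * (g t)\<^sup>2)"
  proof (intro AE_I2)
    fix t
    have "g t \<le> 1 + (g t)\<^sup>2" using abs_mult_le_squares[of 1 "g t"] by simp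
    then show "norm (indicator {0..T} t * g t) \<le> norm (indicator {0..T} t + indicator {0..T} t * (g t)\<^sup>2)"
      using g[of t] by (auto simp: indicator_def)
  qed
qed

text \<open>What the two regularity alternatives have in common: values in H^2, continuity into L^2,
  and a weak time derivative with square integrable L^2 norm.\<close>

locale sphere_curve =
  fixes T :: real and \<psi> d\<psi> :: "real \<Rightarrow> 'a::euclidean_space \<Rightarrow> real"
  assumes T: "T > 0" and H2: "\<And>t. t \<in> {0..T} \<Longrightarrow> H2S (\<psi> t)"
    and cont: "\<And>t. t \<in> {0..T} \<Longrightarrow> ((\<lambda>s. L2S_norm (\<lambda>x. \<psi> s x - \<psi> t x)) \<longlongrightarrow> 0) (at t within {0..T})"
    and dL2: "\<And>t. t \<in> {0..T} \<Longrightarrow> L2S (d\<psi> t)"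
    and td: "time_deriv T \<psi> d\<psi>"
    and joint: "(\<lambda>(t,x). indicator {0..T} t * d\<psi> t (x /\<^sub>R norm x)) \<in> borel_measurable (lborel \<Otimes>\<^sub>M lborel)"
    and dsq: "integrable lborel (\<lambda>t. indicator {0..T} t * (L2S_norm (d\<psi> t))\<^sup>2)"
begin

lemma psi_L2S: "t \<in> {0..T} \<Longrightarrow> L2S (\<psi> t)"
  by (intro H1S_L2S H2S_H1S H2)

lemma speed_integrable: "integrable lborel (\<lambda>t. indicator {0..T} t * L2S_norm (d\<psi> t))"
  by (rule integrable_if_square_integrable[OF dsq L2S_norm_nonneg])

text \<open>Pairing with a fixed \<open>\<eta>\<close> reduces the vector-valued derivative to a
  scalar one. Joint measurability makes the paired speed measurable in time.\<close>

lemma inner_FTC: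
  assumes \<eta>: "L2S \<eta>" and ab: "0 \<le> a" "a \<le> b" "b \<le> T"
  shows "sph_inner (\<psi> b) \<eta> - sph_inner (\<psi> a) \<eta> = (LBINT t. indicator {a..b} t * sph_inner (d\<psi> t) \<eta>)"
    and "integrable lborel (\<lambda>t. indicator {0..T} t * sph_inner (d\<psi> t) \<eta>)"
proof -
  have lm: "sph_lift \<eta> \<in> borel_measurable borel" using \<eta> by (auto simp: L2S_iff intro: sq_int_borel)
  have m: "(\<lambda>t. indicator {0..T} t * sph_inner (d\<psi> t) \<eta>) \<in> borel_measurable lborel"
  proof -
    have [measurable]: "(ball 0 1 :: 'a set) \<in> sets borel" by simp
    have 1: "(\<lambda>z. (case z of (t, x) \<Rightarrow> indicator {0..T} t * d\<psi> t (x /\<^sub>R norm x)) * (indicator (ball 0 1) (snd z) * sph_lift \<eta> (snd z))) \<in> borel_measurable (lborel \<Otimes>\<^sub>M lborel)"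
      by (intro borel_measurable_times joint measurable_compose[OF measurable_snd] borel_measurable_indicator) (use lm L2S_hat_measurable[OF \<eta>] in auto)
    have "(\<lambda>t. real DIM('a) * (LBINT x. (indicator {0..T} t * d\<psi> t (x /\<^sub>R norm x)) * (indicator (ball 0 1) x * sph_lift \<eta> x))) \<in> borel_measurable lborel"
      by (intro borel_measurable_times borel_measurable_const lborel.borel_measurable_lebesgue_integral) (use 1 in \<open>simp add: case_prod_beta\<close>)
    moreover have "real DIM('a) * (LBINT x. (indicator {0..T} t * d\<psi> t (x /\<^sub>R norm x)) * (indicator (ball 0 1) x * sph_lift \<eta> x)) = indicator {0..T} t * sph_inner (d\<psi> t) \<eta>" for t
    proof -
      have "(\<lambda>x. (indicator {0..T} t * d\<psi> t (x /\<^sub>R norm x)) * (indicator (ball 0 1) x * sph_lift \<eta> x)) = (\<lambda>x. indicator {0..T} t * (sph_lift (d\<psi> t) x * sph_lift \<eta> x))"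
        by (auto simp: mult_ac)
      then show ?thesis by (simp only: integral_mult_right_zero sph_inner_eq) (simp add: mult_ac)
    qed
    ultimately show ?thesis by simp
  qed
  show i: "integrable lborel (\<lambda>t. indicator {0..T} t * sph_inner (d\<psi> t) \<eta>)"
  proof (rule Bochner_Integration.integrable_bound[OF _ m])
    show "integrable lborel (\<lambda>t. (indicator {0..T} t * L2S_norm (d\<psi> t)) * L2S_norm \<eta>)"
      by (intro integrable_mult_left speed_integrable)
    show "AE t in lborel. norm (indicator {0..T} t * sph_inner (d\<psi> t) \<eta>) \<le> norm ((indicator {0..T} t * L2S_norm (d\<psi> t)) * L2S_norm \<eta>)"
      using Cauchy_Schwarz_sph[OF dL2 \<eta>] by (intro AE_I2) (auto simp: indicator_def)
  qed
  show "sph_inner (\<psi> b) \<eta> - sph_inner (\<psi> a) \<eta> = (LBINT t. indicator {a..b} t * sph_inner (d\<psi> t) \<eta>)"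
  proof (rule weak_FTC[OF _ _ _ ab])
    show "continuous_on {0..T} (\<lambda>t. sph_inner (\<psi> t) \<eta>)"
      unfolding continuous_on_def
    proof
      fix t assume t: "t \<in> {0..T}"
      have "((\<lambda>s. sph_inner (\<psi> s) \<eta> - sph_inner (\<psi> t) \<eta>) \<longlongrightarrow> 0) (at t within {0..T})"
      proof (rule Lim_null_comparison)
        show "eventually (\<lambda>s. norm (sph_inner (\<psi> s) \<eta> - sph_inner (\<psi> t) \<eta>) \<le> L2S_norm (\<lambda>x. \<psi> s x - \<psi> t x) * L2S_norm \<eta>) (at t within {0..T})"
          unfolding eventually_at_filter
        proof (intro always_eventually allI impI)
          fix s assume s: "s \<in> {0..T}"
          show "norm (sph_inner (\<psi> s) \<eta> - sph_inner (\<psi> t) \<eta>) \<le> L2S_norm (\<lambda>x. \<psi> s x - \<psi> t x) * L2S_norm \<eta>"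
            using Cauchy_Schwarz_sph[OF L2S_diff[OF psi_L2S[OF s] psi_L2S[OF t]] \<eta>] sph_inner_diff_left[OF psi_L2S[OF s] psi_L2S[OF t] \<eta>] by simp
        qed
        show "((\<lambda>s. L2S_norm (\<lambda>x. \<psi> s x - \<psi> t x) * L2S_norm \<eta>) \<longlongrightarrow> 0) (at t within {0..T})"
          using tendsto_mult_left_zero[OF cont[OF t]] .
      qed
      then show "((\<lambda>t. sph_inner (\<psi> t) \<eta>) \<longlongrightarrow> sph_inner (\<psi> t) \<eta>) (at t within {0..T})" by (simp add: LIM_zero_iff)
    qed
    have "set_integrable lborel {0..T} (\<lambda>t. sph_inner (d\<psi> t) \<eta>)" using i by (simp add: set_integrable_def)
    then show "set_integrable lborel {0<..<T} (\<lambda>t. sph_inner (d\<psi> t) \<eta>)" by (rule set_integrable_subset) auto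
    show "set_lebesgue_integral lborel {0<..<T} (\<lambda>t. sph_inner (\<psi> t) \<eta> * frechet_derivative \<phi> (at t) 1)
       = - set_lebesgue_integral lborel {0<..<T} (\<lambda>t. sph_inner (d\<psi> t) \<eta> * \<phi> t)" if "test_fun {0<..<T} \<phi>" for \<phi>
      using td \<eta> that unfolding time_deriv_def by blast
  qed
qed

text \<open>Pair the increment with itself, divide by its norm to get the integral of the speed, and
  apply Cauchy-Schwarz in time.\<close>

lemma increment_le:
  assumes ab: "0 \<le> a" "a \<le> b" "b \<le> T"
  shows "(L2S_norm (\<lambda>x. \<psi> b x - \<psi> a x))\<^sup>2 \<le> (b - a) * (LBINT t. indicator {a..b} t * (L2S_norm (d\<psi> t))\<^sup>2)"
proof -
  let ?\<eta> = "\<lambda>x. \<psi> b x - \<psi> a x" and ?q = "\<integral>t. indicator {a..b} t * (L2S_norm (d\<psi> t))\<^sup>2 \<partial>lborel"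
  have pa: "L2S (\<psi> a)" and pb: "L2S (\<psi> b)" using ab by (auto intro!: psi_L2S)
  have \<eta>: "L2S ?\<eta>" by (rule L2S_diff[OF pb pa])
  note i = integrable_subinterval[OF _ ab(1,3)]
  have "(L2S_norm ?\<eta>)\<^sup>2 = (LBINT t. indicator {a..b} t * sph_inner (d\<psi> t) ?\<eta>)"
    using inner_FTC(1)[OF \<eta> ab] sph_inner_diff_left[OF pb pa \<eta>] by (simp add: sph_inner_self)
  also have "\<dots> \<le> (LBINT t. (indicator {a..b} t * L2S_norm (d\<psi> t)) * L2S_norm ?\<eta>)"
  proof (rule integral_mono)
    show "integrable lborel (\<lambda>t. indicator {a..b} t * sph_inner (d\<psi> t) ?\<eta>)" by (rule i[OF inner_FTC(2)[OF \<eta>]]) (use ab in auto)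
    show "integrable lborel (\<lambda>t. (indicator {a..b} t * L2S_norm (d\<psi> t)) * L2S_norm ?\<eta>)"
      by (intro integrable_mult_left i speed_integrable)
    show "indicator {a..b} t * sph_inner (d\<psi> t) ?\<eta> \<le> (indicator {a..b} t * L2S_norm (d\<psi> t)) * L2S_norm ?\<eta>" for t
      using Cauchy_Schwarz_sph[OF dL2[of t] \<eta>] ab by (auto simp: indicator_def)
  qed
  also have "\<dots> = (LBINT t. indicator {a..b} t * L2S_norm (d\<psi> t)) * L2S_norm ?\<eta>" by simp
  finally have 1: "(L2S_norm ?\<eta>)\<^sup>2 \<le> (LBINT t. indicator {a..b} t * L2S_norm (d\<psi> t)) * L2S_norm ?\<eta>" .
  have 2: "(LBINT t. indicator {a..b} t * L2S_norm (d\<psi> t)) \<le> sqrt ((b - a) * ?q)"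
  proof -
    have s1: "sq_int lborel (indicator {a..b} :: real \<Rightarrow> real)" by (rule sq_int_indicator) (use ab in auto)
    have s2: "sq_int lborel (\<lambda>t. indicator {a..b} t * L2S_norm (d\<psi> t))"
      unfolding sq_int_def indicator_power2_mult[symmetric] using i[OF speed_integrable] i[OF dsq] by auto
    have "(LBINT t. indicator {a..b} t * L2S_norm (d\<psi> t)) = (LBINT t. indicator {a..b} t * (indicator {a..b} t * L2S_norm (d\<psi> t)))"
      by (intro Bochner_Integration.integral_cong refl) (simp add: indicator_def)
    also have "\<dots> \<le> l2 lborel (indicator {a..b} :: real \<Rightarrow> real) * l2 lborel (\<lambda>t. indicator {a..b} t * L2S_norm (d\<psi> t))"
      using Cauchy_Schwarz_l2[OF s1 s2] by linarith
    also have "\<dots> = sqrt ((b - a) * ?q)"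
    proof -
      have "(\<lambda>t. (indicator {a..b} t :: real)\<^sup>2) = indicator {a..b}" by (auto simp: indicator_def)
      then show ?thesis using ab unfolding l2_def indicator_power2_mult[symmetric] by (simp add: real_sqrt_mult)
    qed
    finally show ?thesis .
  qed
  show ?thesis
  proof (cases "L2S_norm ?\<eta> = 0")
    case True
    then show ?thesis using ab by (simp add: integral_nonneg_AE)
  next
    case False
    then have pos: "L2S_norm ?\<eta> > 0" using L2S_norm_nonneg[of ?\<eta>] by linarith
    from 1 pos have "L2S_norm ?\<eta> \<le> (LBINT t. indicator {a..b} t * L2S_norm (d\<psi> t))" by (simp add: power2_eq_square)
    with 2 have "L2S_norm ?\<eta> \<le> sqrt ((b - a) * ?q)" by linarith
    then have "(L2S_norm ?\<eta>)\<^sup>2 \<le> (sqrt ((b - a) * ?q))\<^sup>2" by (rule power_mono) simp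
    then show ?thesis using ab by (simp add: integral_nonneg_AE)
  qed
qed

end

context sphere_curve
begin

lemma increment_le_sym:
  assumes "a \<in> {0..T}" "b \<in> {0..T}"
  shows "(L2S_norm (\<lambda>x. \<psi> b x - \<psi> a x))\<^sup>2 \<le> T * (LBINT t. indicator {min b a..max b a} t * (L2S_norm (d\<psi> t))\<^sup>2)"
proof -
  have I0: "0 \<le> (LBINT t. indicator {c..d} t * (L2S_norm (d\<psi> t))\<^sup>2)" for c d
    by (intro integral_nonneg_AE AE_I2) simp
  have *: "(L2S_norm (\<lambda>x. \<psi> d x - \<psi> c x))\<^sup>2 \<le> T * (LBINT t. indicator {c..d} t * (L2S_norm (d\<psi> t))\<^sup>2)"
    if "0 \<le> c" "c \<le> d" "d \<le> T" for c d
    by (rule order_trans[OF increment_le[OF that] mult_right_mono[OF _ I0]]) (use that in simp)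
  show ?thesis
  proof (cases "a \<le> b")
    case True then show ?thesis using *[of a b] assms by simp
  next
    case False
    have "L2S_norm (\<lambda>x. \<psi> b x - \<psi> a x) = L2S_norm (\<lambda>x. \<psi> a x - \<psi> b x)"
      using L2S_norm_cmult[of "-1" "\<lambda>x. \<psi> a x - \<psi> b x"] by simp
    then show ?thesis using *[of b a] assms False by simp
  qed
qed

lemma H1S_norm_increment_sym:
  assumes "a \<in> {0..T}" "b \<in> {0..T}"
  shows "H1S_norm (\<lambda>x. \<psi> b x - \<psi> a x) = H1S_norm (\<lambda>x. \<psi> a x - \<psi> b x)"
  using H1S_norm_cmult[OF H1S_diff[OF H2S_H1S[OF H2[OF assms(1)]] H2S_H1S[OF H2[OF assms(2)]]], of "-1"] by simp

text \<open>The H^2 norms are only square integrable in time, so the energy increment cannot be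
  estimated by their values at two given times; averaging over a mesh turns the two-point bound into
  an integral bound. Hence the energy is continuous, and together with L^2 continuity this gives H^1
  continuity.\<close>

lemma H1_continuous_parabolic:
  assumes N: "integrable lborel (\<lambda>t. indicator {0..T} t * (H2S_norm (\<psi> t))\<^sup>2)"
    and X: "\<And>n. X n \<in> {0..T}" "X \<longlonglongrightarrow> t" and t: "t \<in> {0..T}"
  shows "(\<lambda>n. H1S_norm (\<lambda>x. \<psi> (X n) x - \<psi> t x)) \<longlonglongrightarrow> 0"
proof -
  obtain C where C: "C > 0" "\<And>u v::'a \<Rightarrow> real. H1S u \<Longrightarrow> H2S v \<Longrightarrow> \<bar>grad_form u v\<bar> \<le> C * L2S_norm u * H2S_norm v"
    using grad_form_bound by metis
  obtain C' where C': "C' > 0" "\<And>u::'a \<Rightarrow> real. H1S u \<Longrightarrow> (H1S_norm u)\<^sup>2 \<le> C' * ((L2S_norm u)\<^sup>2 + grad_form u u)"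
    using H1S_norm_le_grad_form by metis
  have N0: "0 \<le> H2S_norm u" for u :: "'a \<Rightarrow> real"
    using order_trans[OF H1_norm_nonneg H1_norm_le_H2_norm(1)] by (simp add: H2S_norm_def)
  \<comment> \<open>One integrable density dominating both the squared speed, which controls the L^2
    increment, and the squared H^2 norm.\<close>
  define q where "q s = (L2S_norm (d\<psi> s))\<^sup>2 + (H2S_norm (\<psi> s))\<^sup>2" for s
  define e where "e s = grad_form (\<psi> s) (\<psi> s)" for s
  define Q where "Q a b = (LBINT x. indicator {a..b} x * q x)" for a b
  have q0: "0 \<le> q s" for s by (simp add: q_def)
  have qi: "integrable lborel (\<lambda>t. indicator {0..T} t * q t)"
    unfolding q_def distrib_left by (intro Bochner_Integration.integrable_add dsq N)
  have Q0: "0 \<le> Q a b" for a b unfolding Q_def using q0 by (intro integral_nonneg_AE AE_I2) simp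
  have dQ: "(LBINT x. indicator {a..b} x * (L2S_norm (d\<psi> x))\<^sup>2) \<le> Q a b" if "0 \<le> a" "b \<le> T" for a b
    unfolding Q_def by (rule integral_mono) (use integrable_subinterval[OF dsq that] integrable_subinterval[OF qi that] in \<open>auto simp: q_def indicator_def\<close>)
  have inc: "\<bar>e b - e a\<bar> \<le> C * sqrt ((b - a) * Q a b) * (sqrt (q a) + sqrt (q b))" if ab: "0 \<le> a" "a \<le> b" "b \<le> T" for a b
  proof -
    have ha: "H2S (\<psi> a)" and hb: "H2S (\<psi> b)" using H2 ab by auto
    let ?v = "\<lambda>x. \<psi> b x - \<psi> a x"
    have v: "H1S ?v" by (rule H1S_diff[OF H2S_H1S[OF hb] H2S_H1S[OF ha]])
    have "\<bar>e b - e a\<bar> = \<bar>grad_form ?v (\<psi> b) + grad_form ?v (\<psi> a)\<bar>"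
      unfolding e_def using grad_form_diff(2)[OF H2S_H1S[OF hb] H2S_H1S[OF ha]] by simp
    also have "\<dots> \<le> C * L2S_norm ?v * H2S_norm (\<psi> b) + C * L2S_norm ?v * H2S_norm (\<psi> a)"
      by (rule order_trans[OF abs_triangle_ineq add_mono[OF C(2)[OF v hb] C(2)[OF v ha]]])
    also have "\<dots> = C * L2S_norm ?v * (H2S_norm (\<psi> a) + H2S_norm (\<psi> b))" by (simp add: algebra_simps)
    also have "\<dots> \<le> C * sqrt ((b - a) * Q a b) * (sqrt (q a) + sqrt (q b))"
    proof (intro mult_mono mult_left_mono add_mono)
      have "(L2S_norm ?v)\<^sup>2 \<le> (b - a) * Q a b"
        by (rule order_trans[OF increment_le[OF ab] mult_left_mono[OF dQ]]) (use ab in auto)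
      then show "L2S_norm ?v \<le> sqrt ((b - a) * Q a b)" by (rule real_le_rsqrt)
      show "H2S_norm (\<psi> a) \<le> sqrt (q a)" "H2S_norm (\<psi> b) \<le> sqrt (q b)"
        by (auto intro!: real_le_rsqrt simp: q_def)
    qed (use C(1) N0 Q0 ab in auto)
    finally show ?thesis .
  qed
  have inc2: "\<bar>e b - e a\<bar> \<le> 8 * C * Q (min b a) (max b a)" if "a \<in> {0..T}" "b \<in> {0..T}" for a b
  proof -
    have *: "\<bar>e d - e c\<bar> \<le> 8 * C * Q c d" if "0 \<le> c" "c < d" "d \<le> T" for c d
      unfolding Q_def by (rule increment_le_integral[OF qi q0 less_imp_le[OF C(1)] inc[unfolded Q_def] that])
    consider "a < b" | "a = b" | "b < a" by linarith
    then show ?thesis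
      using *[of a b] *[of b a] that C(1) Q0[of b a] by cases (auto simp: abs_minus_commute)
  qed
  define R where "R n = Q (min (X n) t) (max (X n) t)" for n
  have R: "R \<longlonglongrightarrow> 0" unfolding R_def Q_def by (rule integral_shrinking_interval[OF qi X t])
  have R0: "0 \<le> R n" for n by (simp add: R_def Q0)
  have ht: "H2S (\<psi> t)" by (rule H2[OF t])
  have bound: "H1S_norm (\<lambda>x. \<psi> (X n) x - \<psi> t x) \<le> sqrt (C' * (T * R n + 8 * C * R n + 2 * (C * sqrt (T * R n) * H2S_norm (\<psi> t))))" for n
  proof (rule real_le_rsqrt)
    let ?v = "\<lambda>x. \<psi> (X n) x - \<psi> t x"
    have hx: "H2S (\<psi> (X n))" by (rule H2[OF X(1)])
    have v: "H1S ?v" by (rule H1S_diff[OF H2S_H1S[OF hx] H2S_H1S[OF ht]])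
    have l: "(L2S_norm ?v)\<^sup>2 \<le> T * R n"
      unfolding R_def using t X(1)[of n] T
      by (intro order_trans[OF increment_le_sym[OF t X(1)] mult_left_mono[OF dQ]]) auto
    then have l': "L2S_norm ?v \<le> sqrt (T * R n)" by (rule real_le_rsqrt)
    have "grad_form ?v ?v = e (X n) - e t - 2 * grad_form ?v (\<psi> t)"
      unfolding e_def by (rule grad_form_diff(1)[OF H2S_H1S[OF hx] H2S_H1S[OF ht]])
    also have "\<dots> \<le> 8 * C * R n + 2 * (C * L2S_norm ?v * H2S_norm (\<psi> t))"
      using inc2[OF t X(1)[of n]] C(2)[OF v ht] unfolding R_def by linarith
    also have "\<dots> \<le> 8 * C * R n + 2 * (C * sqrt (T * R n) * H2S_norm (\<psi> t))"
      using l' C(1) N0 by (intro add_left_mono mult_left_mono mult_right_mono) auto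
    finally have "(L2S_norm ?v)\<^sup>2 + grad_form ?v ?v \<le> T * R n + 8 * C * R n + 2 * (C * sqrt (T * R n) * H2S_norm (\<psi> t))"
      using l by linarith
    then show "(H1S_norm ?v)\<^sup>2 \<le> C' * (T * R n + 8 * C * R n + 2 * (C * sqrt (T * R n) * H2S_norm (\<psi> t)))"
      by (rule order_trans[OF C'(2)[OF v] mult_left_mono]) (use C'(1) in simp)
  qed
  have "(\<lambda>n. sqrt (C' * (T * R n + 8 * C * R n + 2 * (C * sqrt (T * R n) * H2S_norm (\<psi> t)))))
      \<longlonglongrightarrow> sqrt (C' * (T * 0 + 8 * C * 0 + 2 * (C * sqrt (T * 0) * H2S_norm (\<psi> t))))"
    by (intro tendsto_intros R)
  then have L: "(\<lambda>n. sqrt (C' * (T * R n + 8 * C * R n + 2 * (C * sqrt (T * R n) * H2S_norm (\<psi> t))))) \<longlonglongrightarrow> 0" by simp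
  show ?thesis
    by (rule tendsto_sandwich[OF _ _ tendsto_const L]) (use bound in \<open>auto intro!: always_eventually\<close>)
qed

text \<open>In place of integrability of the H^2 norms there is an H^1 speed: the energy of an
  increment is at most its H^1 norm times the integrated H^1 speed, and one factor of the norm is
  absorbed. H^2 membership of the increment is used only qualitatively.\<close>

lemma H1_continuous_sobolev:
  assumes h1: "\<And>s. s \<in> {0..T} \<Longrightarrow> H1S (d\<psi> s)"
    and N: "integrable lborel (\<lambda>t. indicator {0..T} t * H1S_norm (d\<psi> t))"
    and X: "\<And>n. X n \<in> {0..T}" "X \<longlonglongrightarrow> t" and t: "t \<in> {0..T}"
  shows "(\<lambda>n. H1S_norm (\<lambda>x. \<psi> (X n) x - \<psi> t x)) \<longlonglongrightarrow> 0"
proof -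
  obtain C where C: "C > 0"
    "\<And>(\<eta> :: 'a \<Rightarrow> real) (v :: real \<Rightarrow> 'a \<Rightarrow> real) I. H2S \<eta> \<Longrightarrow> (\<And>\<tau>. \<tau> \<in> I \<Longrightarrow> H1S (v \<tau>)) \<Longrightarrow>
      integrable lborel (\<lambda>\<tau>. indicator I \<tau> * H1S_norm (v \<tau>)) \<Longrightarrow>
      (\<And>\<sigma>. L2S \<sigma> \<Longrightarrow> sph_inner \<eta> \<sigma> = (LBINT \<tau>. indicator I \<tau> * sph_inner (v \<tau>) \<sigma>)) \<Longrightarrow>
      \<bar>grad_form \<eta> \<eta>\<bar> \<le> C * (LBINT \<tau>. indicator I \<tau> * H1S_norm (v \<tau>)) * H1S_norm \<eta>"
    by (rule grad_form_time_integral) blast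
  obtain C' where C': "C' > 0" "\<And>u::'a \<Rightarrow> real. H1S u \<Longrightarrow> (H1S_norm u)\<^sup>2 \<le> C' * ((L2S_norm u)\<^sup>2 + grad_form u u)"
    using H1S_norm_le_grad_form by metis
  define M where "M a b = (LBINT \<tau>. indicator {a..b} \<tau> * H1S_norm (d\<psi> \<tau>))" for a b
  have inc: "(H1S_norm (\<lambda>x. \<psi> b x - \<psi> a x))\<^sup>2 \<le> 2 * C' * (L2S_norm (\<lambda>x. \<psi> b x - \<psi> a x))\<^sup>2 + (C' * C * M a b)\<^sup>2"
    if ab: "0 \<le> a" "a \<le> b" "b \<le> T" for a b
  proof -
    let ?v = "\<lambda>x. \<psi> b x - \<psi> a x"
    have ha: "H2S (\<psi> a)" and hb: "H2S (\<psi> b)" using H2 ab by auto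
    have v: "H2S ?v" by (rule H2S_diff[OF hb ha])
    have "\<bar>grad_form ?v ?v\<bar> \<le> C * M a b * H1S_norm ?v"
      unfolding M_def
    proof (rule C(2)[OF v])
      show "H1S (d\<psi> \<tau>)" if "\<tau> \<in> {a..b}" for \<tau> using that ab by (intro h1) auto
      show "integrable lborel (\<lambda>\<tau>. indicator {a..b} \<tau> * H1S_norm (d\<psi> \<tau>))" by (rule integrable_subinterval[OF N ab(1,3)])
      show "sph_inner ?v \<sigma> = (LBINT \<tau>. indicator {a..b} \<tau> * sph_inner (d\<psi> \<tau>) \<sigma>)" if "L2S \<sigma>" for \<sigma>
        using inner_FTC(1)[OF that ab] sph_inner_diff_left[OF psi_L2S psi_L2S that, of b a] ab by simp
    qed
    then have "(L2S_norm ?v)\<^sup>2 + grad_form ?v ?v \<le> (L2S_norm ?v)\<^sup>2 + C * M a b * H1S_norm ?v" by linarith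
    then have "(H1S_norm ?v)\<^sup>2 \<le> C' * ((L2S_norm ?v)\<^sup>2 + C * M a b * H1S_norm ?v)"
      by (rule order_trans[OF C'(2)[OF H2S_H1S[OF v]] mult_left_mono]) (use C'(1) in simp)
    also have "\<dots> = C' * (L2S_norm ?v)\<^sup>2 + (C' * C * M a b) * H1S_norm ?v" by (simp add: algebra_simps)
    \<comment> \<open>Young's inequality; half of the squared norm goes to the left-hand
      side.\<close>
    also have "(C' * C * M a b) * H1S_norm ?v \<le> (C' * C * M a b)\<^sup>2 / 2 + (H1S_norm ?v)\<^sup>2 / 2"
      using sum_squares_bound[of "C' * C * M a b" "H1S_norm ?v"] by simp
    finally show ?thesis by (simp add: field_simps)
  qed
  define R where "R n = M (min (X n) t) (max (X n) t)" for n
  define D where "D n = (LBINT s. indicator {min (X n) t..max (X n) t} s * (L2S_norm (d\<psi> s))\<^sup>2)" for n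
  have R: "R \<longlonglongrightarrow> 0" unfolding R_def M_def by (rule integral_shrinking_interval[OF N X t])
  have D: "D \<longlonglongrightarrow> 0" unfolding D_def by (rule integral_shrinking_interval[OF dsq X t])
  have bound: "H1S_norm (\<lambda>x. \<psi> (X n) x - \<psi> t x) \<le> sqrt (2 * C' * (T * D n) + (C' * C * R n)\<^sup>2)" for n
  proof (rule real_le_rsqrt)
    have l: "(L2S_norm (\<lambda>x. \<psi> (X n) x - \<psi> t x))\<^sup>2 \<le> T * D n"
      unfolding D_def by (rule increment_le_sym[OF t X(1)])
    have "(H1S_norm (\<lambda>x. \<psi> (X n) x - \<psi> t x))\<^sup>2 \<le> 2 * C' * (L2S_norm (\<lambda>x. \<psi> (X n) x - \<psi> t x))\<^sup>2 + (C' * C * R n)\<^sup>2"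
    proof (cases "t \<le> X n")
      case True
      then show ?thesis using inc[of t "X n"] t X(1)[of n] by (simp add: R_def)
    next
      case False
      have "L2S_norm (\<lambda>x. \<psi> (X n) x - \<psi> t x) = L2S_norm (\<lambda>x. \<psi> t x - \<psi> (X n) x)"
        using L2S_norm_cmult[of "-1" "\<lambda>x. \<psi> t x - \<psi> (X n) x"] by simp
      then show ?thesis using inc[of "X n" t] t X(1)[of n] False H1S_norm_increment_sym[OF t X(1)] by (simp add: R_def)
    qed
    also have "\<dots> \<le> 2 * C' * (T * D n) + (C' * C * R n)\<^sup>2" using l C'(1) by simp
    finally show "(H1S_norm (\<lambda>x. \<psi> (X n) x - \<psi> t x))\<^sup>2 \<le> 2 * C' * (T * D n) + (C' * C * R n)\<^sup>2" .
  qed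
  have "(\<lambda>n. sqrt (2 * C' * (T * D n) + (C' * C * R n)\<^sup>2)) \<longlonglongrightarrow> sqrt (2 * C' * (T * 0) + (C' * C * 0)\<^sup>2)"
    by (intro tendsto_intros R D)
  then have L: "(\<lambda>n. sqrt (2 * C' * (T * D n) + (C' * C * R n)\<^sup>2)) \<longlonglongrightarrow> 0" by simp
  show ?thesis
    by (rule tendsto_sandwich[OF _ _ tendsto_const L]) (use bound in \<open>auto intro!: always_eventually\<close>)
qed

end

text \<open>In the H^1 alternative the L^2 speed is dominated by the H^1 speed; the domination
  argument also needs its measurability in time, which Fubini supplies.\<close>

lemma L2S_norm_sq_measurable:
  fixes d\<psi> :: "real \<Rightarrow> 'a::euclidean_space \<Rightarrow> real"
  assumes joint: "(\<lambda>(t,x). indicator {0..T} t * d\<psi> t (x /\<^sub>R norm x)) \<in> borel_measurable (lborel \<Otimes>\<^sub>M lborel)"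
  shows "(\<lambda>t. indicator {0..T} t * (L2S_norm (d\<psi> t))\<^sup>2) \<in> borel_measurable lborel"
proof -
  have 1: "(\<lambda>z. (indicator (ball 0 1) (snd z) * (case z of (t, x) \<Rightarrow> indicator {0..T} t * d\<psi> t (x /\<^sub>R norm x)))\<^sup>2) \<in> borel_measurable (lborel \<Otimes>\<^sub>M (lborel :: 'a measure))"
    by (intro borel_measurable_power borel_measurable_times joint measurable_compose[OF measurable_snd] borel_measurable_indicator) auto
  have "(\<lambda>t. real DIM('a) * (LBINT x. (indicator (ball 0 1) x * (indicator {0..T} t * d\<psi> t (x /\<^sub>R norm x)))\<^sup>2)) \<in> borel_measurable lborel"
    by (intro borel_measurable_times borel_measurable_const lborel.borel_measurable_lebesgue_integral) (use 1 in \<open>simp add: case_prod_beta\<close>)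
  moreover have "real DIM('a) * (LBINT x. (indicator (ball 0 1) x * (indicator {0..T} t * d\<psi> t (x /\<^sub>R norm x)))\<^sup>2) = indicator {0..T} t * (L2S_norm (d\<psi> t))\<^sup>2" for t
  proof -
    have "(\<lambda>x. (indicator (ball 0 1) x * (indicator {0..T} t * d\<psi> t (x /\<^sub>R norm x)))\<^sup>2) = (\<lambda>x. indicator {0..T} t * (sph_lift (d\<psi> t) x)\<^sup>2)"
      by (auto simp: indicator_def)
    then show ?thesis by (simp only: integral_mult_right_zero) (simp add: L2S_norm_eq power_mult_distrib l2_power2)
  qed
  ultimately show ?thesis by simp
qed

lemma sphere_curve_H1_continuous:
  fixes \<psi> d\<psi> :: "real \<Rightarrow> 'a::euclidean_space \<Rightarrow> real"
  assumes T: "T > 0" and H2: "\<forall>t\<in>{0..T}. H2S (\<psi> t)"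
    and cont: "\<forall>t\<in>{0..T}. ((\<lambda>s. L2S_norm (\<lambda>x. \<psi> s x - \<psi> t x)) \<longlongrightarrow> 0) (at t within {0..T})"
    and reg: "(L2T T H2S_norm \<psi> \<and> L2T T L2S_norm \<psi> \<and> (\<forall>t\<in>{0..T}. L2S (d\<psi> t)) \<and> L2T T L2S_norm d\<psi> \<and> time_deriv T \<psi> d\<psi>)
        \<or> (L2T T H1S_norm \<psi> \<and> (\<forall>t\<in>{0..T}. H1S (d\<psi> t)) \<and> L2T T H1S_norm d\<psi> \<and> time_deriv T \<psi> d\<psi>)"
  shows "sphere_curve T \<psi> d\<psi>"
    and "(\<And>n. X n \<in> {0..T}) \<Longrightarrow> X \<longlonglongrightarrow> t \<Longrightarrow> t \<in> {0..T} \<Longrightarrow> (\<lambda>n. H1S_norm (\<lambda>x. \<psi> (X n) x - \<psi> t x)) \<longlonglongrightarrow> 0"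
proof -
  have "sphere_curve T \<psi> d\<psi> \<and> (\<forall>X t. (\<forall>n. X n \<in> {0..T}) \<longrightarrow> X \<longlonglongrightarrow> t \<longrightarrow> t \<in> {0..T} \<longrightarrow> (\<lambda>n. H1S_norm (\<lambda>x. \<psi> (X n) x - \<psi> t x)) \<longlonglongrightarrow> 0)"
    using reg
  proof (elim disjE)
    assume a: "L2T T H2S_norm \<psi> \<and> L2T T L2S_norm \<psi> \<and> (\<forall>t\<in>{0..T}. L2S (d\<psi> t)) \<and> L2T T L2S_norm d\<psi> \<and> time_deriv T \<psi> d\<psi>"
    have s: "sphere_curve T \<psi> d\<psi>"
      by unfold_locales (use a T H2 cont in \<open>auto simp: L2T_def set_integrable_def\<close>)
    have N: "integrable lborel (\<lambda>t. indicator {0..T} t * (H2S_norm (\<psi> t))\<^sup>2)" using a by (simp add: L2T_def set_integrable_def)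
    show ?thesis using s sphere_curve.H1_continuous_parabolic[OF s N] by blast
  next
    assume a: "L2T T H1S_norm \<psi> \<and> (\<forall>t\<in>{0..T}. H1S (d\<psi> t)) \<and> L2T T H1S_norm d\<psi> \<and> time_deriv T \<psi> d\<psi>"
    then have joint: "(\<lambda>(t,x). indicator {0..T} t * d\<psi> t (x /\<^sub>R norm x)) \<in> borel_measurable (lborel \<Otimes>\<^sub>M lborel)"
      and sq: "integrable lborel (\<lambda>t. indicator {0..T} t * (H1S_norm (d\<psi> t))\<^sup>2)"
      and h1: "\<And>t. t \<in> {0..T} \<Longrightarrow> H1S (d\<psi> t)" by (auto simp: L2T_def set_integrable_def)
    have dsq: "integrable lborel (\<lambda>t. indicator {0..T} t * (L2S_norm (d\<psi> t))\<^sup>2)"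
    proof (rule Bochner_Integration.integrable_bound[OF sq L2S_norm_sq_measurable[OF joint]], intro AE_I2)
      fix t
      show "norm (indicator {0..T} t * (L2S_norm (d\<psi> t))\<^sup>2) \<le> norm (indicator {0..T} t * (H1S_norm (d\<psi> t))\<^sup>2)"
        using power_mono[OF L2S_norm_le_H1S_norm[OF h1[of t]] L2S_norm_nonneg, of 2] by (auto simp: indicator_def)
    qed
    have s: "sphere_curve T \<psi> d\<psi>"
      by unfold_locales (use a T H2 cont joint dsq h1 in \<open>auto intro: H1S_L2S\<close>)
    have N: "integrable lborel (\<lambda>t. indicator {0..T} t * H1S_norm (d\<psi> t))"
      by (rule integrable_if_square_integrable[OF sq H1S_norm_nonneg])
    show ?thesis using s sphere_curve.H1_continuous_sobolev[OF s h1 N] by blast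
  qed
  then show "sphere_curve T \<psi> d\<psi>"
    and "(\<And>n. X n \<in> {0..T}) \<Longrightarrow> X \<longlonglongrightarrow> t \<Longrightarrow> t \<in> {0..T} \<Longrightarrow> (\<lambda>n. H1S_norm (\<lambda>x. \<psi> (X n) x - \<psi> t x)) \<longlonglongrightarrow> 0"
    by blast+
qed

subsection \<open>The competitor attached to a chain of boundary data\<close>

text \<open>Base points in H^2 and increments in H^1, as in the differentiability assumption; the
  radius \<delta> depends on the base point.\<close>

definition H1_cont :: "(('a::euclidean_space \<Rightarrow> real) \<Rightarrow> real) \<Rightarrow> bool" where
  "H1_cont F \<longleftrightarrow> (\<forall>u. H2S u \<longrightarrow> (\<forall>e>0. \<exists>\<delta>>0. \<forall>v. H1S v \<longrightarrow> H1S_norm v < \<delta> \<longrightarrow> \<bar>F (\<lambda>x. u x + v x) - F u\<bar> < e))"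

lemma H1_cont_if_differentiable:
  fixes F :: "('a::euclidean_space \<Rightarrow> real) \<Rightarrow> real"
  assumes F: "\<And>u. H2S u \<Longrightarrow> L2S (gradF u) \<and>
          (\<forall>e>0. \<exists>\<delta>>0. \<forall>v. H1S v \<longrightarrow> H1S_norm v < \<delta> \<longrightarrow>
             \<bar>F (\<lambda>x. u x + v x) - F u - sph_inner v (gradF u)\<bar> \<le> e * H1S_norm v)"
  shows "H1_cont F"
  unfolding H1_cont_def
proof (intro allI impI)
  fix u :: "'a \<Rightarrow> real" and e :: real assume u: "H2S u" and e: "e > 0"
  obtain \<delta> where \<delta>: "\<delta> > 0" "\<And>v. H1S v \<Longrightarrow> H1S_norm v < \<delta> \<Longrightarrow> \<bar>F (\<lambda>x. u x + v x) - F u - sph_inner v (gradF u)\<bar> \<le> 1 * H1S_norm v"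
    using F[OF u] zero_less_one by metis
  let ?L = "L2S_norm (gradF u) + 2"
  have L: "?L > 0" using L2S_norm_nonneg[of "gradF u"] by linarith
  show "\<exists>\<delta>>0. \<forall>v. H1S v \<longrightarrow> H1S_norm v < \<delta> \<longrightarrow> \<bar>F (\<lambda>x. u x + v x) - F u\<bar> < e"
  proof (intro exI[of _ "min \<delta> (e / ?L)"] conjI allI impI)
    show "0 < min \<delta> (e / ?L)" using \<delta>(1) e L by simp
    fix v :: "'a \<Rightarrow> real" assume v: "H1S v" "H1S_norm v < min \<delta> (e / ?L)"
    have "\<bar>sph_inner v (gradF u)\<bar> \<le> L2S_norm v * L2S_norm (gradF u)"
      using Cauchy_Schwarz_sph[OF H1S_L2S[OF v(1)]] F[OF u] by blast
    also have "\<dots> \<le> H1S_norm v * L2S_norm (gradF u)"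
      by (intro mult_right_mono L2S_norm_le_H1S_norm v) simp
    finally have "\<bar>F (\<lambda>x. u x + v x) - F u\<bar> \<le> H1S_norm v * (L2S_norm (gradF u) + 1)"
      using \<delta>(2)[OF v(1)] v(2) by (simp add: distrib_left)
    also have "\<dots> \<le> H1S_norm v * ?L" by (intro mult_left_mono) auto
    also have "\<dots> < e" using v(2) L by (simp add: less_divide_eq)
    finally show "\<bar>F (\<lambda>x. u x + v x) - F u\<bar> < e" .
  qed
qed

lemma H1_cont_tendsto:
  assumes F: "H1_cont F" and u: "H2S u" and v: "eventually (\<lambda>r. H1S (v r)) G" and l: "((\<lambda>r. H1S_norm (v r)) \<longlongrightarrow> 0) G"
  shows "((\<lambda>r. F (\<lambda>x. u x + v r x)) \<longlongrightarrow> F u) G"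
proof (rule tendstoI)
  fix e :: real assume "e > 0"
  then obtain \<delta> where \<delta>: "\<delta> > 0" "\<And>v. H1S v \<Longrightarrow> H1S_norm v < \<delta> \<Longrightarrow> \<bar>F (\<lambda>x. u x + v x) - F u\<bar> < e"
    using F u unfolding H1_cont_def by metis
  from v order_tendstoD(2)[OF l \<delta>(1)] show "eventually (\<lambda>r. dist (F (\<lambda>x. u x + v r x)) (F u) < e) G"
    by eventually_elim (simp add: dist_real_def \<delta>(2))
qed

lemma H1S_zero: "H1S (\<lambda>x::'a::euclidean_space. 0)"
  unfolding H1S_def sfun_def hom_ext_def[abs_def] using H1_on_sum[of "{}" annulus "\<lambda>_ _. 0"] by simp

lemma H1S_sum: "(\<And>i. i \<in> I \<Longrightarrow> H1S (w i)) \<Longrightarrow> H1S (\<lambda>x. \<Sum>i\<in>I. w i x)"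
  by (induction I rule: infinite_finite_induct) (auto intro: H1S_add H1S_zero)

lemma H1S_norm_sum_tendsto:
  fixes w :: "'i \<Rightarrow> 'a::euclidean_space \<Rightarrow> real"
  assumes fin: "finite I" and w: "\<And>i. i \<in> I \<Longrightarrow> H1S (w i)" and a: "\<And>i. i \<in> I \<Longrightarrow> (a i \<longlongrightarrow> 0) G"
  shows "((\<lambda>r. H1S_norm (\<lambda>x. \<Sum>i\<in>I. a i r * w i x)) \<longlongrightarrow> 0) G"
  using fin w a
proof (induction I)
  case empty
  have "H1S_norm (\<lambda>x::'a. 0) = 0" using H1S_norm_cmult[OF H1S_zero, of 0] by simp
  then show ?case by simp
next
  case (insert i I)
  let ?s = "\<lambda>r x. \<Sum>j\<in>I. a j r * w j x"
  have wi: "H1S (w i)" and wI: "\<And>j. j \<in> I \<Longrightarrow> H1S (w j)" using insert.prems by auto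
  have IH: "((\<lambda>r. H1S_norm (?s r)) \<longlongrightarrow> 0) G" using insert by simp
  have b: "H1S_norm (\<lambda>x. a i r * w i x + ?s r x) \<le> sqrt (2 * (\<bar>a i r\<bar> * H1S_norm (w i))\<^sup>2 + 2 * (H1S_norm (?s r))\<^sup>2)" for r
  proof (rule real_le_rsqrt)
    have "H1S (?s r)" by (intro H1S_sum H1S_cmult wI)
    then show "(H1S_norm (\<lambda>x. a i r * w i x + ?s r x))\<^sup>2 \<le> 2 * (\<bar>a i r\<bar> * H1S_norm (w i))\<^sup>2 + 2 * (H1S_norm (?s r))\<^sup>2"
      using H1S_norm_add_sq[OF H1S_cmult[OF wi, of "a i r"]] H1S_norm_cmult[OF wi, of "a i r"] by simp
  qed
  have "((\<lambda>r. sqrt (2 * (\<bar>a i r\<bar> * H1S_norm (w i))\<^sup>2 + 2 * (H1S_norm (?s r))\<^sup>2)) \<longlongrightarrow> sqrt (2 * (\<bar>0\<bar> * H1S_norm (w i))\<^sup>2 + 2 * 0\<^sup>2)) G"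
    by (intro tendsto_intros IH insert.prems) simp
  then have l: "((\<lambda>r. sqrt (2 * (\<bar>a i r\<bar> * H1S_norm (w i))\<^sup>2 + 2 * (H1S_norm (?s r))\<^sup>2)) \<longlongrightarrow> 0) G" by simp
  have "((\<lambda>r. H1S_norm (\<lambda>x. a i r * w i x + ?s r x)) \<longlongrightarrow> 0) G"
    by (rule tendsto_sandwich[OF _ _ tendsto_const l]) (use b in \<open>auto intro!: always_eventually\<close>)
  then show ?case using insert.hyps by simp
qed

text \<open>At most one step is in transit at a time: earlier ones are complete and telescope, later
  ones have not started.\<close>

lemma sum_sstep:
  assumes "i < n" "real i \<le> s" "s \<le> real i + 1"
  shows "(\<Sum>j<n. sstep (s - real j) * (a (Suc j) - a j)) = a i - a 0 + sstep (s - real i) * (a (Suc i) - a i)"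
proof -
  have "(\<Sum>j<n. sstep (s - real j) * (a (Suc j) - a j)) = (\<Sum>j<Suc i. sstep (s - real j) * (a (Suc j) - a j))"
    using assms by (intro sum.mono_neutral_right) (auto intro!: sstep_0)
  also have "\<dots> = (\<Sum>j<i. a (Suc j) - a j) + sstep (s - real i) * (a (Suc i) - a i)"
    using assms by (auto intro!: sum.cong simp: sstep_1)
  finally show ?thesis by (simp add: sum_lessThan_telescope)
qed

lemma sum_sstep_end:
  assumes "real n \<le> s"
  shows "(\<Sum>j<n. sstep (s - real j) * (a (Suc j) - a j)) = a n - a 0"
proof -
  have "(\<Sum>j<n. sstep (s - real j) * (a (Suc j) - a j)) = (\<Sum>j<n. a (Suc j) - a j)"
    using assms by (auto intro!: sum.cong simp: sstep_1)
  then show ?thesis by (simp add: sum_lessThan_telescope)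
qed

lemma L2S_norm_cong:
  assumes "\<And>x. u (x /\<^sub>R norm x) = v (x /\<^sub>R norm x)"
  shows "L2S_norm u = L2S_norm v"
  unfolding L2S_norm_def sph_int_def using assms by simp

context
  fixes P :: "nat \<Rightarrow> 'a::euclidean_space \<Rightarrow> real" and n :: nat
  assumes P: "\<And>i. i \<le> n \<Longrightarrow> H2S (P i)" and n: "n > 0"
begin

text \<open>The chain is traversed while the radius decreases from 1 to 1/2, one smooth step at a time; below
  1/2 the competitor no longer depends on the radius. The index \<open>n\<close> stands for the initial datum.\<close>

definition "chain_weight i r = (if i < n then sstep (2 * real n * (1 - r) - real i) else 1)"
definition "chain_weight' i r = (if i < n then - (2 * real n) * sstep' (2 * real n * (1 - r) - real i) else 0)"
definition "chain_part i = (if i < n then (\<lambda>x. P (Suc i) x - P i x) else P 0)"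
definition "chain_fun r = (\<lambda>\<theta>. \<Sum>i<Suc n. chain_weight i r * chain_part i \<theta>)"

lemma chain_weight_deriv: "(chain_weight i has_real_derivative chain_weight' i r) (at r)"
proof (cases "i < n")
  case True
  have "((\<lambda>r. sstep (2 * real n * (1 - r) - real i)) has_real_derivative sstep' (2 * real n * (1 - r) - real i) * (- (2 * real n))) (at r)"
    by (rule DERIV_chain2[OF sstep_has_field_derivative]) (auto intro!: derivative_eq_intros)
  then show ?thesis using True by (simp add: chain_weight_def[abs_def] chain_weight'_def mult.commute)
qed (simp add: chain_weight_def[abs_def] chain_weight'_def)

lemma chain_weight'_cont: "continuous_on UNIV (chain_weight' i)"
  unfolding chain_weight'_def[abs_def] by (cases "i < n") (auto intro!: continuous_intros)

lemma chain_part_H2S: "i < Suc n \<Longrightarrow> H2S (chain_part i)"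
  by (auto simp: chain_part_def intro!: H2S_diff P)

lemma chain_fun_eq: "chain_fun r = (\<lambda>\<theta>. P 0 \<theta> + (\<Sum>j<n. sstep (2 * real n * (1 - r) - real j) * (P (Suc j) \<theta> - P j \<theta>)))"
  by (simp add: chain_fun_def chain_weight_def chain_part_def add.commute)

lemma chain_fun_inner: "r \<le> 1/2 \<Longrightarrow> chain_fun r = P n"
proof -
  assume "r \<le> 1/2"
  then have "real n \<le> 2 * real n * (1 - r)" using mult_left_mono[of "1/2" "1 - r" "2 * real n"] by simp
  then show ?thesis using sum_sstep_end[of n "2 * real n * (1 - r)" "\<lambda>j. P j _"] by (simp add: chain_fun_eq)
qed

lemma chain_fun_outer:
  assumes "1/2 \<le> r" "r \<le> 1"
  obtains i t where "i < n" "0 \<le> t" "t \<le> 1" "chain_fun r = (\<lambda>\<theta>. P i \<theta> + t * (P (Suc i) \<theta> - P i \<theta>))"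
proof -
  define s where "s = 2 * real n * (1 - r)"
  have s: "0 \<le> s" "s \<le> real n"
    using assms mult_left_mono[of "1 - r" "1/2" "2 * real n"] by (auto simp: s_def)
  \<comment> \<open>The integer part of s, except at the inner end s = n, where the last index n - 1
    is taken.\<close>
  obtain i where i: "i < n" "real i \<le> s" "s \<le> real i + 1"
  proof (cases "s < real n")
    case True
    then show ?thesis using s by (intro that[of "nat \<lfloor>s\<rfloor>"]) linarith+
  next
    case False
    then show ?thesis using s n by (intro that[of "n - 1"]) auto
  qed
  show thesis
    by (rule that[OF i(1) sstep_nonneg sstep_le_1, of "s - real i"])
       (simp add: chain_fun_eq s_def[symmetric] sum_sstep[OF i, of "\<lambda>j. P j _"])
qed

lemma H2S_chain_fun:
  assumes "r \<le> 1" shows "H2S (chain_fun r)"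
proof (cases "r \<le> 1/2")
  case True
  then show ?thesis using chain_fun_inner P by simp
next
  case False
  then obtain i t where "i < n" "chain_fun r = (\<lambda>\<theta>. P i \<theta> + t * (P (Suc i) \<theta> - P i \<theta>))"
    by (rule_tac chain_fun_outer[of r]) (use assms in auto)
  then show ?thesis by (auto intro!: H2S_add H2S_cmult H2S_diff P)
qed

lemma chain_weight_cont: "(chain_weight i \<longlongrightarrow> chain_weight i r) (at r within A)"
  using DERIV_isCont[OF chain_weight_deriv[of i r]] unfolding isCont_def by (rule tendsto_within_subset) simp

lemma chain_fun_F_cont:
  assumes F: "H1_cont F"
  shows "continuous_on {0..1} (\<lambda>r. F (chain_fun r))"
  unfolding continuous_on_def
proof
  fix r :: real assume r: "r \<in> {0..1}"
  have "((\<lambda>s. F (\<lambda>x. chain_fun r x + (\<Sum>i<Suc n. (chain_weight i s - chain_weight i r) * chain_part i x))) \<longlongrightarrow> F (chain_fun r)) (at r within {0..1})"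
  proof (rule H1_cont_tendsto[OF F])
    show "H2S (chain_fun r)" using r by (intro H2S_chain_fun) auto
    show "((\<lambda>s. H1S_norm (\<lambda>x. \<Sum>i<Suc n. (chain_weight i s - chain_weight i r) * chain_part i x)) \<longlongrightarrow> 0) (at r within {0..1})"
      by (rule H1S_norm_sum_tendsto) (use chain_part_H2S in \<open>auto intro: H2S_H1S LIM_zero chain_weight_cont\<close>)
    show "eventually (\<lambda>s. H1S (\<lambda>x. \<Sum>i<Suc n. (chain_weight i s - chain_weight i r) * chain_part i x)) (at r within {0..1})"
      using chain_part_H2S by (intro always_eventually allI H1S_sum H1S_cmult) (auto intro: H2S_H1S)
  qed
  moreover have "(\<lambda>x. chain_fun r x + (\<Sum>i<Suc n. (chain_weight i s - chain_weight i r) * chain_part i x)) = chain_fun s" for s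
    unfolding chain_fun_def by (simp only: sum.distrib[symmetric] left_diff_distrib) simp
  ultimately show "((\<lambda>s. F (chain_fun s)) \<longlongrightarrow> F (chain_fun r)) (at r within {0..1})" by simp
qed

text \<open>The difference to the datum is a finite sum of fixed spherical functions with
  coefficients tending to 0. The limit holds along all radii, so the exceptional set is
  empty.\<close>

lemma chain_trace: "trace_eq (polar_fun \<alpha> chain_fun) (P 0)"
  unfolding trace_eq_def
proof (intro exI[of _ "{}"] conjI)
  let ?v = "\<lambda>r x. \<Sum>i<Suc n. (r powr \<alpha> * chain_weight i r - chain_weight i 1) * chain_part i x"
  have h1: "i < Suc n \<Longrightarrow> H1S (chain_part i)" for i by (intro H2S_H1S chain_part_H2S)
  have v1: "H1S (?v r)" for r by (intro H1S_sum H1S_cmult h1) auto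
  have eq: "L2S_norm (\<lambda>\<theta>. polar_fun \<alpha> chain_fun (r *\<^sub>R \<theta>) - P 0 \<theta>) = L2S_norm (?v r)" if r: "r \<in> {0<..<1}" for r
  proof (rule L2S_norm_cong)
    fix x :: 'a
    have v: "?v r y = r powr \<alpha> * chain_fun r y - P 0 y" for y
    proof -
      have "(\<Sum>i<Suc n. chain_weight i 1 * chain_part i y) = P 0 y"
        using chain_fun_eq[of 1] by (simp add: chain_fun_def fun_eq_iff sstep_0)
      then show ?thesis unfolding chain_fun_def sum_distrib_left by (simp only: left_diff_distrib sum_subtractf mult.assoc)
    qed
    show "polar_fun \<alpha> chain_fun (r *\<^sub>R (x /\<^sub>R norm x)) - P 0 (x /\<^sub>R norm x) = ?v r (x /\<^sub>R norm x)"
    proof (cases "x = 0")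
      case True
      have "chain_fun r 0 = 0" using H1S_sfun[OF H2S_H1S[OF H2S_chain_fun[of r]]] r by (simp add: sfun_def)
      then show ?thesis using True unfolding v by (simp add: polar_fun_def)
    next
      case False
      have n: "norm (r *\<^sub>R (x /\<^sub>R norm x)) = r" using False r by simp
      have e: "(r *\<^sub>R (x /\<^sub>R norm x)) /\<^sub>R r = x /\<^sub>R norm x" using r by simp
      show ?thesis unfolding v polar_fun_def n e using r by simp
    qed
  qed
  have "((\<lambda>r. H1S_norm (?v r)) \<longlongrightarrow> 0) (at 1 within {0<..<1})"
  proof (rule H1S_norm_sum_tendsto)
    fix i
    have "((\<lambda>r. r powr \<alpha> * chain_weight i r) \<longlongrightarrow> 1 powr \<alpha> * chain_weight i 1) (at 1 within {0<..<1})"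
      by (intro tendsto_intros chain_weight_cont) auto
    then show "((\<lambda>r. r powr \<alpha> * chain_weight i r - chain_weight i 1) \<longlongrightarrow> 0) (at 1 within {0<..<1})"
      by (intro LIM_zero) simp
  qed (use h1 in auto)
  then have "((\<lambda>r. L2S_norm (?v r)) \<longlongrightarrow> 0) (at 1 within {0<..<1})"
    by (rule tendsto_sandwich[OF _ _ tendsto_const, rotated 2])
       (intro always_eventually allI L2S_norm_nonneg L2S_norm_le_H1S_norm v1)+
  moreover have "eventually (\<lambda>r. L2S_norm (\<lambda>\<theta>. polar_fun \<alpha> chain_fun (r *\<^sub>R \<theta>) - P 0 \<theta>) = L2S_norm (?v r)) (at 1 within {0<..<1})"
    using eq by (auto simp: eventually_at_filter)
  ultimately show "((\<lambda>r. L2S_norm (\<lambda>\<theta>. polar_fun \<alpha> chain_fun (r *\<^sub>R \<theta>) - P 0 \<theta>)) \<longlongrightarrow> 0) (at 1 within ({0<..<1} - {}))"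
    by (simp add: tendsto_cong)
qed auto

lemma chain_H1_prod: "H1_prod chain_fun"
  unfolding chain_fun_def
  by (rule H1_prod_profile[OF _ chain_weight_deriv chain_weight'_cont]) (use chain_part_H2S H2S_H1S in auto)

lemma chain_H1B:
  assumes "2 * \<alpha> + real DIM('a) - 2 > 0" shows "H1B (polar_fun \<alpha> chain_fun)"
  unfolding chain_fun_def
  by (rule H1B_profile[OF _ chain_weight_deriv chain_weight'_cont assms]) (use chain_part_H2S H2S_H1S in auto)

text \<open>At each radius at most one step has nonzero slope. Its slope is at most 3/2 and the
  radial variable is stretched by 2n, which gives (3n)^2 = 9 n^2.\<close>

lemma chain_speed:
  "(L2S_norm (\<lambda>\<theta>. \<Sum>i<Suc n. chain_weight' i r * chain_part i \<theta>))\<^sup>2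
     \<le> (\<Sum>i<n. 9 * (real n)\<^sup>2 * (L2S_norm (\<lambda>x. P (Suc i) x - P i x))\<^sup>2 * indicator {1 - (real i + 1) / (2 * real n)..1 - real i / (2 * real n)} r)"
    (is "?L \<le> (\<Sum>i<n. ?R i)")
proof -
  define s where "s = 2 * real n * (1 - r)"
  have R0: "0 \<le> ?R i" for i by simp
  have e: "(\<Sum>i<Suc n. chain_weight' i r * chain_part i \<theta>) = (\<Sum>i<n. - (2 * real n) * sstep' (s - real i) * (P (Suc i) \<theta> - P i \<theta>))" for \<theta>
    by (simp add: chain_weight'_def chain_part_def s_def)
  show ?thesis
  proof (cases "\<exists>i<n. real i < s \<and> s < real i + 1")
    case True
    then obtain i where i: "i < n" "real i < s" "s < real i + 1" by blast
    have z: "sstep' (s - real j) = 0" if "j \<noteq> i" for j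
    proof (cases "j < i")
      case True
      then have "real j + 1 \<le> real i" by simp
      then show ?thesis using i by (intro sstep'_1) linarith
    next
      case False
      then have "real i + 1 \<le> real j" using that by simp
      then show ?thesis using i by (intro sstep'_0) linarith
    qed
    have "(\<Sum>j<n. - (2 * real n) * sstep' (s - real j) * (P (Suc j) \<theta> - P j \<theta>)) = - (2 * real n) * sstep' (s - real i) * (P (Suc i) \<theta> - P i \<theta>)" for \<theta>
      using sum.mono_neutral_right[of "{..<n}" "{i}" "\<lambda>j. - (2 * real n) * sstep' (s - real j) * (P (Suc j) \<theta> - P j \<theta>)"] i z by simp
    then have "?L = (2 * real n * sstep' (s - real i))\<^sup>2 * (L2S_norm (\<lambda>x. P (Suc i) x - P i x))\<^sup>2"
      unfolding e by (simp only: L2S_norm_cmult power_mult_distrib) (simp add: power_mult_distrib)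
    also have "\<dots> \<le> (3 * real n)\<^sup>2 * (L2S_norm (\<lambda>x. P (Suc i) x - P i x))\<^sup>2"
      using mult_left_mono[OF sstep'_le, of "2 * real n" "s - real i"] by (intro mult_right_mono power_mono) (auto simp: sstep'_nonneg)
    also have "\<dots> = ?R i"
    proof -
      have "1 - (real i + 1) / (2 * real n) \<le> r" "r \<le> 1 - real i / (2 * real n)"
        using i n by (auto simp: s_def field_simps)
      then show ?thesis by (simp add: power_mult_distrib)
    qed
    also have "\<dots> \<le> (\<Sum>i<n. ?R i)" using i R0 by (intro member_le_sum) auto
    finally show ?thesis .
  next
    case False
    then have "sstep' (s - real i) = 0" if "i < n" for i
      using that sstep'_0[of "s - real i"] sstep'_1[of "s - real i"] by fastforce
    then have "?L = 0" unfolding e by (simp add: L2S_norm_def sph_int_def)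
    then show ?thesis using R0 by (simp add: sum_nonneg)
  qed
qed

text \<open>Each step occupies a radial interval of length 1/(2n), so 9 n^2 becomes 9n/2; the weight
  is at most 1 on [0,1].\<close>

lemma chain_cost:
  assumes e: "0 \<le> e"
  shows "set_lebesgue_integral lborel {0..1} (\<lambda>r. sph_int (\<lambda>\<theta>. (rad_deriv chain_fun r \<theta>)\<^sup>2) * r powr e)
     \<le> 9 * real n / 2 * (\<Sum>i<n. (L2S_norm (\<lambda>x. P (Suc i) x - P i x))\<^sup>2)"
proof -
  let ?l = "\<lambda>i. (L2S_norm (\<lambda>x. P (Suc i) x - P i x))\<^sup>2"
  let ?J = "\<lambda>i. {1 - (real i + 1) / (2 * real n)..1 - real i / (2 * real n)}"
  let ?B = "\<lambda>r. \<Sum>i<n. 9 * (real n)\<^sup>2 * ?l i * indicator (?J i) r"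
  have J: "integrable lborel (indicator (?J i) :: real \<Rightarrow> real)" "(LBINT r. indicator (?J i) r) = 1 / (2 * real n)" for i
    using n by (auto simp: emeasure_lborel_Icc_eq field_simps intro!: integrable_real_indicator)
  have Bi: "integrable lborel ?B" by (intro Bochner_Integration.integrable_sum integrable_mult_right J)
  have B0: "0 \<le> ?B r" for r by (intro sum_nonneg) simp
  have rd: "AE r in lborel. r \<in> {0<..<1} \<longrightarrow> sph_int (\<lambda>\<theta>. (rad_deriv chain_fun r \<theta>)\<^sup>2) \<le> ?B r"
  proof -
    have "AE r in lborel. r \<in> {0<..<1} \<longrightarrow> (AE x in lborel. x \<in> ball 0 1 \<longrightarrow>
        rad_deriv (\<lambda>r \<theta>. \<Sum>i<Suc n. chain_weight i r * chain_part i \<theta>) r (x /\<^sub>R norm x) = (\<Sum>i<Suc n. chain_weight' i r * chain_part i (x /\<^sub>R norm x)))"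
      by (rule rad_deriv_profile[OF _ chain_weight_deriv chain_weight'_cont]) (use chain_part_H2S H2S_H1S in auto)
    then show ?thesis
    proof eventually_elim
      case (elim r)
      show ?case
      proof
        assume r: "r \<in> {0<..<1}"
        let ?w = "\<lambda>\<theta>. \<Sum>i<Suc n. chain_weight' i r * chain_part i \<theta>"
        show "sph_int (\<lambda>\<theta>. (rad_deriv chain_fun r \<theta>)\<^sup>2) \<le> ?B r"
        proof (cases "integrable lborel (\<lambda>x. indicator (ball 0 1) x * (rad_deriv chain_fun r (x /\<^sub>R norm x))\<^sup>2)")
          case True
          have w: "L2S ?w" using chain_part_H2S by (intro H1S_L2S H1S_sum H1S_cmult) (auto intro: H2S_H1S)
          have m: "(\<lambda>x. indicator (ball 0 1) x * (?w (x /\<^sub>R norm x))\<^sup>2) \<in> borel_measurable lborel"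
          proof -
            have "integrable lborel (\<lambda>x. (sph_lift ?w x)\<^sup>2)" using w by (simp add: L2S_iff sq_int_def)
            then have "(\<lambda>x. (sph_lift ?w x)\<^sup>2) \<in> borel_measurable lborel" by (rule borel_measurable_integrable)
            then show ?thesis by (simp only: indicator_power2_mult)
          qed
          have "(LBINT x. indicator (ball 0 1) x * (rad_deriv chain_fun r (x /\<^sub>R norm x))\<^sup>2) = (LBINT x. indicator (ball 0 1) x * (?w (x /\<^sub>R norm x))\<^sup>2)"
          proof (rule integral_cong_AE[OF _ m])
            show "(\<lambda>x. indicator (ball 0 1) x * (rad_deriv chain_fun r (x /\<^sub>R norm x))\<^sup>2) \<in> borel_measurable lborel"
              by (rule borel_measurable_integrable[OF True])
            show "AE x in lborel. indicator (ball 0 1) x * (rad_deriv chain_fun r (x /\<^sub>R norm x))\<^sup>2 = indicator (ball 0 1) x * (?w (x /\<^sub>R norm x))\<^sup>2"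
              using mp[OF elim r] by eventually_elim (auto simp: chain_fun_def[abs_def] indicator_def)
          qed
          then have "sph_int (\<lambda>\<theta>. (rad_deriv chain_fun r \<theta>)\<^sup>2) = (L2S_norm ?w)\<^sup>2"
            unfolding sph_int_square[symmetric] sph_int_def set_lebesgue_integral_def by simp
          then show ?thesis using chain_speed[of r] by simp
        next
          \<comment> \<open>The integral of a non-integrable function is 0 by convention, and the
            bound is nonnegative.\<close>
          case False
          then have "sph_int (\<lambda>\<theta>. (rad_deriv chain_fun r \<theta>)\<^sup>2) = 0"
            unfolding sph_int_def set_lebesgue_integral_def by (simp add: not_integrable_integral_eq)
          then show ?thesis using B0 by simp
        qed
      qed
    qed
  qed
  have "set_lebesgue_integral lborel {0..1} (\<lambda>r. sph_int (\<lambda>\<theta>. (rad_deriv chain_fun r \<theta>)\<^sup>2) * r powr e) \<le> (LBINT r. ?B r)"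
    unfolding set_lebesgue_integral_def
  proof (rule integral_mono_AE'[OF Bi])
    show "AE r in lborel. indicator {0..1} r *\<^sub>R (sph_int (\<lambda>\<theta>. (rad_deriv chain_fun r \<theta>)\<^sup>2) * r powr e) \<le> ?B r"
      using rd AE_lborel_singleton[of 0] AE_lborel_singleton[of 1]
    proof eventually_elim
      case (elim r)
      show ?case
      proof (cases "r \<in> {0..1}")
        case True
        with elim have r: "0 < r" "r < 1" and b: "sph_int (\<lambda>\<theta>. (rad_deriv chain_fun r \<theta>)\<^sup>2) \<le> ?B r" by auto
        have "r powr e \<le> 1" using r e by (intro powr_le1) auto
        then have "sph_int (\<lambda>\<theta>. (rad_deriv chain_fun r \<theta>)\<^sup>2) * r powr e \<le> ?B r * 1"
          by (intro mult_mono b B0) auto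
        then show ?thesis using True by simp
      next
        case False
        then show ?thesis using B0 by simp
      qed
    qed
  qed (use B0 in auto)
  also have "(LBINT r. ?B r) = (\<Sum>i<n. 9 * (real n)\<^sup>2 * ?l i * (1 / (2 * real n)))"
    using J by (subst Bochner_Integration.integral_sum) auto
  also have "\<dots> = 9 * real n / 2 * (\<Sum>i<n. ?l i)"
    using n by (simp add: sum_distrib_left power2_eq_square field_simps)
  finally show ?thesis .
qed

text \<open>The energy is at most M on the outer half and equal to that of the end point on the
  inner half. The latter has weight (1/2)^K / K, which is the fraction of the energy drop that is
  gained.\<close>

lemma chain_potential:
  assumes F: "H1_cont F" and K: "K > 0"
    and M: "\<And>i t. i < n \<Longrightarrow> 0 \<le> t \<Longrightarrow> t \<le> 1 \<Longrightarrow> F (\<lambda>\<theta>. P i \<theta> + t * (P (Suc i) \<theta> - P i \<theta>)) \<le> M"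
  shows "set_lebesgue_integral lborel {0..1} (\<lambda>r. F (chain_fun r) * r powr (K - 1)) \<le> M / K - (M - F (P n)) * ((1/2) powr K / K)"
proof -
  let ?f = "\<lambda>r. indicator {0..1} r * F (chain_fun r)"
  let ?R = "\<lambda>r. M * (indicator {0..1} r * r powr (K - 1)) - (M - F (P n)) * (indicator {0..1/2} r * r powr (K - 1))"
  have pi: "integrable lborel (\<lambda>r. indicator {0..c} r * r powr (K - 1))"
     "(LBINT r. indicator {0..c} r * r powr (K - 1)) = c powr K / K" if "0 \<le> c" for c
    using powr_integral[of "K - 1" c] K that by auto
  have Ri: "integrable lborel ?R" by (intro Bochner_Integration.integrable_diff integrable_mult_right pi) auto
  have mf: "?f \<in> borel_measurable lborel"
    using borel_measurable_continuous_on_indicator[OF _ chain_fun_F_cont[OF F]] by simp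
  obtain B where B: "\<And>r. r \<in> {0..1} \<Longrightarrow> \<bar>F (chain_fun r)\<bar> \<le> B"
  proof -
    have "compact ((\<lambda>r. F (chain_fun r)) ` {0..1})" by (intro compact_continuous_image chain_fun_F_cont F) simp
    then have "bounded ((\<lambda>r. F (chain_fun r)) ` {0..1})" by (rule compact_imp_bounded)
    then obtain B where "\<forall>y\<in>(\<lambda>r. F (chain_fun r)) ` {0..1}. norm y \<le> B" unfolding bounded_iff by blast
    then show ?thesis by (intro that[of B]) auto
  qed
  have Li: "integrable lborel (\<lambda>r. indicator {0..1} r * (F (chain_fun r) * r powr (K - 1)))"
  proof (rule Bochner_Integration.integrable_bound)
    show "integrable lborel (\<lambda>r. B * (indicator {0..1} r * r powr (K - 1)))" by (intro integrable_mult_right pi) auto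
    have "(\<lambda>r. ?f r * r powr (K - 1)) \<in> borel_measurable lborel" by (intro borel_measurable_times mf) measurable
    then show "(\<lambda>r. indicator {0..1} r * (F (chain_fun r) * r powr (K - 1))) \<in> borel_measurable lborel" by (simp add: mult.assoc)
    show "AE r in lborel. norm (indicator {0..1} r * (F (chain_fun r) * r powr (K - 1))) \<le> norm (B * (indicator {0..1} r * r powr (K - 1)))"
    proof (intro AE_I2)
      fix r :: real
      show "norm (indicator {0..1} r * (F (chain_fun r) * r powr (K - 1))) \<le> norm (B * (indicator {0..1} r * r powr (K - 1)))"
        using B[of r] by (auto simp: indicator_def abs_mult intro!: mult_right_mono)
    qed
  qed
  have le: "F (chain_fun r) \<le> M" if "r \<in> {1/2..1}" for r
    using chain_fun_outer[of r] M that by (metis atLeastAtMost_iff)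
  have "set_lebesgue_integral lborel {0..1} (\<lambda>r. F (chain_fun r) * r powr (K - 1)) \<le> (LBINT r. ?R r)"
    unfolding set_lebesgue_integral_def real_scaleR_def
  proof (rule integral_mono[OF Li Ri])
    fix r :: real
    show "indicator {0..1} r * (F (chain_fun r) * r powr (K - 1)) \<le> ?R r"
    proof (cases "r \<in> {0..1/2}")
      case True
      then show ?thesis using chain_fun_inner[of r] by (auto simp: left_diff_distrib)
    next
      case False
      then show ?thesis using le[of r] by (auto simp: indicator_def intro!: mult_right_mono)
    qed
  qed
  also have "\<dots> = M * (1 powr K / K) - (M - F (P n)) * ((1/2) powr K / K)"
  proof -
    have "(LBINT r. ?R r) = (LBINT r. M * (indicator {0..1} r * r powr (K - 1))) - (LBINT r. (M - F (P n)) * (indicator {0..1/2} r * r powr (K - 1)))"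
      by (rule Bochner_Integration.integral_diff) (auto intro!: integrable_mult_right pi)
    then show ?thesis by (simp only: integral_mult_right_zero) (simp add: pi)
  qed
  finally show ?thesis by simp
qed

end

lemma chain_competitor:
  fixes P :: "nat \<Rightarrow> 'a::euclidean_space \<Rightarrow> real"
  assumes P: "\<And>i. i \<le> n \<Longrightarrow> H2S (P i)" and n: "n > 0"
    and K: "2 * \<alpha> + real DIM('a) - 2 > 0" and C: "C_SL \<ge> 0"
    and F: "H1_cont F"
    and M: "\<And>i t. i < n \<Longrightarrow> 0 \<le> t \<Longrightarrow> t \<le> 1 \<Longrightarrow> F (\<lambda>\<theta>. P i \<theta> + t * (P (Suc i) \<theta> - P i \<theta>)) \<le> M"
    and G: "\<And>u :: real \<Rightarrow> 'a \<Rightarrow> real. H1_prod u \<Longrightarrow>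
          G (polar_fun \<alpha> u) \<le> set_lebesgue_integral lborel {0..1} (\<lambda>r. F (u r) * r powr (2 * \<alpha> + real DIM('a) - 3))
            + C_SL * set_lebesgue_integral lborel {0..1} (\<lambda>r. sph_int (\<lambda>\<theta>. (rad_deriv u r \<theta>)\<^sup>2) * r powr (2 * \<alpha> + real DIM('a) - 1))"
  shows "\<exists>h. H1B h \<and> trace_eq h (P 0) \<and>
    G h \<le> M / (2 * \<alpha> + real DIM('a) - 2) - (M - F (P n)) * ((1/2) powr (2 * \<alpha> + real DIM('a) - 2) / (2 * \<alpha> + real DIM('a) - 2))
      + C_SL * (9 * real n / 2 * (\<Sum>i<n. (L2S_norm (\<lambda>x. P (Suc i) x - P i x))\<^sup>2))"
proof (intro exI conjI)
  let ?u = "chain_fun P n"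
  show "H1B (polar_fun \<alpha> ?u)" by (rule chain_H1B[OF P n K])
  show "trace_eq (polar_fun \<alpha> ?u) (P 0)" by (rule chain_trace[OF P n])
  have "G (polar_fun \<alpha> ?u) \<le> set_lebesgue_integral lborel {0..1} (\<lambda>r. F (?u r) * r powr (2 * \<alpha> + real DIM('a) - 3))
            + C_SL * set_lebesgue_integral lborel {0..1} (\<lambda>r. sph_int (\<lambda>\<theta>. (rad_deriv ?u r \<theta>)\<^sup>2) * r powr (2 * \<alpha> + real DIM('a) - 1))"
    by (rule G[OF chain_H1_prod[OF P n]])
  moreover have "set_lebesgue_integral lborel {0..1} (\<lambda>r. F (?u r) * r powr (2 * \<alpha> + real DIM('a) - 3)) \<le> M / (2 * \<alpha> + real DIM('a) - 2) - (M - F (P n)) * ((1/2) powr (2 * \<alpha> + real DIM('a) - 2) / (2 * \<alpha> + real DIM('a) - 2))"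
    using chain_potential[where M=M and F=F and P=P and n=n, OF P n F K M] by (simp add: algebra_simps)
  moreover have "C_SL * set_lebesgue_integral lborel {0..1} (\<lambda>r. sph_int (\<lambda>\<theta>. (rad_deriv ?u r \<theta>)\<^sup>2) * r powr (2 * \<alpha> + real DIM('a) - 1)) \<le> C_SL * (9 * real n / 2 * (\<Sum>i<n. (L2S_norm (\<lambda>x. P (Suc i) x - P i x))\<^sup>2))"
    by (intro mult_left_mono chain_cost[OF P n] C) (use K in auto)
  ultimately show "G (polar_fun \<alpha> ?u) \<le> M / (2 * \<alpha> + real DIM('a) - 2) - (M - F (P n)) * ((1/2) powr (2 * \<alpha> + real DIM('a) - 2) / (2 * \<alpha> + real DIM('a) - 2))
      + C_SL * (9 * real n / 2 * (\<Sum>i<n. (L2S_norm (\<lambda>x. P (Suc i) x - P i x))\<^sup>2))" by linarith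
qed

subsection \<open>Competitors from a curve\<close>

definition H1_continuous_curve :: "real \<Rightarrow> (real \<Rightarrow> 'a::euclidean_space \<Rightarrow> real) \<Rightarrow> bool" where
  "H1_continuous_curve T \<psi> \<longleftrightarrow> (\<forall>t\<in>{0..T}. H2S (\<psi> t)) \<and>
     (\<forall>X t. (\<forall>n::nat. X n \<in> {0..T}) \<longrightarrow> X \<longlonglongrightarrow> t \<longrightarrow> t \<in> {0..T} \<longrightarrow> (\<lambda>n. H1S_norm (\<lambda>x. \<psi> (X n) x - \<psi> t x)) \<longlonglongrightarrow> 0)"

lemma F_curve_tendsto:
  assumes F: "H1_cont F" and \<psi>: "H1_continuous_curve T \<psi>"
    and X: "\<And>n. X n \<in> {0..T}" "X \<longlonglongrightarrow> t" "t \<in> {0..T}"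
  shows "(\<lambda>n::nat. F (\<psi> (X n))) \<longlonglongrightarrow> F (\<psi> t)"
proof -
  have "(\<lambda>n. F (\<lambda>x. \<psi> t x + (\<psi> (X n) x - \<psi> t x))) \<longlonglongrightarrow> F (\<psi> t)"
    using \<psi> X by (intro H1_cont_tendsto[OF F] always_eventually allI H1S_diff H2S_H1S) (auto simp: H1_continuous_curve_def)
  then show ?thesis by simp
qed

lemma F_curve_continuous:
  assumes F: "H1_cont F" and \<psi>: "H1_continuous_curve T \<psi>"
  shows "continuous_on {0..T} (\<lambda>t. F (\<psi> t))"
  unfolding continuous_on_sequentially using F_curve_tendsto[OF assms] by (auto simp: o_def)

text \<open>By contradiction: if every mesh contained a bad segment, a subsequence of their end
  points would converge to a common time. Continuity of the curve into H^1 makes the whole segments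
  converge there, and continuity of F at that single point contradicts the excess
  \<open>\<kappa>\<close>.\<close>

lemma fine_chain:
  assumes F: "H1_cont F" and \<psi>: "H1_continuous_curve T \<psi>" and \<tau>: "0 \<le> \<tau>" "\<tau> \<le> T" and \<kappa>: "\<kappa> > 0"
  shows "\<exists>n>0. \<forall>i<n. \<forall>s. 0 \<le> s \<longrightarrow> s \<le> 1 \<longrightarrow>
    F (\<lambda>\<theta>. \<psi> (\<tau> * real i / real n) \<theta> + s * (\<psi> (\<tau> * real (Suc i) / real n) \<theta> - \<psi> (\<tau> * real i / real n) \<theta>)) \<le> F (\<psi> (\<tau> * real i / real n)) + \<kappa>"
proof (rule ccontr)
  assume neg: "\<not> ?thesis"
  define bad where "bad n i s \<longleftrightarrow> i < Suc n \<and> 0 \<le> s \<and> s \<le> 1 \<and>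
     F (\<psi> (\<tau> * real i / real (Suc n))) + \<kappa> < F (\<lambda>\<theta>. \<psi> (\<tau> * real i / real (Suc n)) \<theta> + s * (\<psi> (\<tau> * real (Suc i) / real (Suc n)) \<theta> - \<psi> (\<tau> * real i / real (Suc n)) \<theta>))" for n i s
  have "\<exists>i s. bad n i s" for n
  proof (rule ccontr)
    assume a: "\<nexists>i s. bad n i s"
    have "\<exists>n>0. \<forall>i<n. \<forall>s. 0 \<le> s \<longrightarrow> s \<le> 1 \<longrightarrow>
      F (\<lambda>\<theta>. \<psi> (\<tau> * real i / real n) \<theta> + s * (\<psi> (\<tau> * real (Suc i) / real n) \<theta> - \<psi> (\<tau> * real i / real n) \<theta>)) \<le> F (\<psi> (\<tau> * real i / real n)) + \<kappa>"
      by (rule exI[of _ "Suc n"], intro conjI allI impI leI, simp) (use a in \<open>unfold bad_def, blast\<close>)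
    with neg show False by (rule notE)
  qed
  then obtain i s where bad: "\<And>n. bad n (i n) (s n)" by metis
  have i: "\<And>n. i n < Suc n" and s: "\<And>n. 0 \<le> s n" "\<And>n. s n \<le> 1"
    and gt: "\<And>n. F (\<psi> (\<tau> * real (i n) / real (Suc n))) + \<kappa> < F (\<lambda>\<theta>. \<psi> (\<tau> * real (i n) / real (Suc n)) \<theta> + s n * (\<psi> (\<tau> * real (Suc (i n)) / real (Suc n)) \<theta> - \<psi> (\<tau> * real (i n) / real (Suc n)) \<theta>))"
    using bad unfolding bad_def by blast+
  define X where "X n = \<tau> * real (i n) / real (Suc n)" for n
  define Y where "Y n = \<tau> * real (Suc (i n)) / real (Suc n)" for n
  have frac: "\<tau> * real j / real (Suc n) \<in> {0..\<tau>}" if "j \<le> Suc n" for j n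
  proof -
    have "real j / real (Suc n) \<le> 1" using that by simp
    then have "\<tau> * (real j / real (Suc n)) \<le> \<tau> * 1" using \<tau>(1) by (rule mult_left_mono)
    then show ?thesis using \<tau>(1) by simp
  qed
  have XY: "X n \<in> {0..\<tau>}" "Y n \<in> {0..\<tau>}" for n
    unfolding X_def Y_def using i[of n] by (intro frac; simp)+
  have "compact {0..\<tau>}" by simp
  then obtain l r where l: "l \<in> {0..\<tau>}" and r: "strict_mono r" "(X \<circ> r) \<longlonglongrightarrow> l"
    using XY(1) unfolding compact_def by metis
  have lT: "l \<in> {0..T}" using l \<tau> by auto
  have Xl: "(\<lambda>n. X (r n)) \<longlonglongrightarrow> l" using r(2) by (simp add: o_def)
  have Yl: "(\<lambda>n. Y (r n)) \<longlonglongrightarrow> l"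
  proof -
    have "(\<lambda>n. \<tau> * (1 / real (Suc n))) \<longlonglongrightarrow> \<tau> * 0" by (intro tendsto_intros LIMSEQ_Suc[OF lim_1_over_n])
    then have "((\<lambda>n. \<tau> * (1 / real (Suc n))) \<circ> r) \<longlonglongrightarrow> \<tau> * 0" by (rule LIMSEQ_subseq_LIMSEQ) (rule r(1))
    then have "(\<lambda>n. X (r n) + \<tau> * (1 / real (Suc (r n)))) \<longlonglongrightarrow> l + \<tau> * 0" by (intro tendsto_add Xl) (simp add: o_def)
    moreover have "X (r n) + \<tau> * (1 / real (Suc (r n))) = Y (r n)" for n
      unfolding X_def Y_def by (simp only: of_nat_Suc[of "i (r n)"] add_divide_distrib distrib_left mult_1_right times_divide_eq_right add.commute)
    ultimately show ?thesis by simp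
  qed
  have XT: "X n \<in> {0..T}" "Y n \<in> {0..T}" for n using XY[of n] \<tau> by auto
  have h: "H1S (\<lambda>x. \<psi> t x - \<psi> l x)" if "t \<in> {0..T}" for t
    using \<psi> that lT by (intro H1S_diff H2S_H1S) (auto simp: H1_continuous_curve_def)
  let ?dX = "\<lambda>n x. \<psi> (X (r n)) x - \<psi> l x" and ?dY = "\<lambda>n x. \<psi> (Y (r n)) x - \<psi> l x"
  \<comment> \<open>The segment point is \<psi>(l) plus this convex combination of the two end point
    deviations; it tends to 0 in H^1 for any choice of parameters in [0,1].\<close>
  let ?v = "\<lambda>n x. (1 - s (r n)) * ?dX n x + s (r n) * ?dY n x"
  have lim: "(\<lambda>n. H1S_norm (\<lambda>x. \<psi> (Z n) x - \<psi> l x)) \<longlonglongrightarrow> 0" if "\<And>n. Z n \<in> {0..T}" "Z \<longlonglongrightarrow> l" for Z :: "nat \<Rightarrow> real"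
    using \<psi>[unfolded H1_continuous_curve_def, THEN conjunct2, rule_format, OF that lT] .
  have nX: "(\<lambda>n. H1S_norm (?dX n)) \<longlonglongrightarrow> 0" by (rule lim[OF XT(1) Xl])
  have nY: "(\<lambda>n. H1S_norm (?dY n)) \<longlonglongrightarrow> 0" by (rule lim[OF XT(2) Yl])
  have vb: "H1S_norm (?v n) \<le> sqrt (2 * (H1S_norm (?dX n))\<^sup>2 + 2 * (H1S_norm (?dY n))\<^sup>2)" for n
  proof (rule real_le_rsqrt)
    have sq: "(\<bar>c\<bar> * H1S_norm u)\<^sup>2 \<le> (H1S_norm u)\<^sup>2" if "0 \<le> c" "c \<le> 1" for c and u :: "'a \<Rightarrow> real"
      using that by (intro power_mono mult_left_le_one_le) auto
    have "(H1S_norm (?v n))\<^sup>2 \<le> 2 * (H1S_norm (\<lambda>x. (1 - s (r n)) * ?dX n x))\<^sup>2 + 2 * (H1S_norm (\<lambda>x. s (r n) * ?dY n x))\<^sup>2"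
      by (intro H1S_norm_add_sq H1S_cmult h XT)
    also have "\<dots> = 2 * (\<bar>1 - s (r n)\<bar> * H1S_norm (?dX n))\<^sup>2 + 2 * (\<bar>s (r n)\<bar> * H1S_norm (?dY n))\<^sup>2"
      by (simp only: H1S_norm_cmult[OF h[OF XT(1)]] H1S_norm_cmult[OF h[OF XT(2)]])
    also have "\<dots> \<le> 2 * (H1S_norm (?dX n))\<^sup>2 + 2 * (H1S_norm (?dY n))\<^sup>2"
      using s[of "r n"] by (intro add_mono mult_left_mono sq) auto
    finally show "(H1S_norm (?v n))\<^sup>2 \<le> 2 * (H1S_norm (?dX n))\<^sup>2 + 2 * (H1S_norm (?dY n))\<^sup>2" .
  qed
  have "(\<lambda>n. sqrt (2 * (H1S_norm (?dX n))\<^sup>2 + 2 * (H1S_norm (?dY n))\<^sup>2)) \<longlonglongrightarrow> sqrt (2 * 0\<^sup>2 + 2 * 0\<^sup>2)"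
    by (intro tendsto_intros nX nY)
  then have sl: "(\<lambda>n. sqrt (2 * (H1S_norm (?dX n))\<^sup>2 + 2 * (H1S_norm (?dY n))\<^sup>2)) \<longlonglongrightarrow> 0" by simp
  have vl: "(\<lambda>n. H1S_norm (?v n)) \<longlonglongrightarrow> 0"
    by (rule tendsto_sandwich[OF _ _ tendsto_const sl]; intro always_eventually allI H1S_norm_nonneg vb)
  have "(\<lambda>n. F (\<lambda>x. \<psi> l x + ?v n x)) \<longlonglongrightarrow> F (\<psi> l)"
  proof (rule H1_cont_tendsto[OF F _ _ vl])
    show "H2S (\<psi> l)" using \<psi> lT by (auto simp: H1_continuous_curve_def)
    show "eventually (\<lambda>n. H1S (?v n)) sequentially"
      by (intro always_eventually allI H1S_add H1S_cmult h XT)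
  qed
  moreover have "(\<lambda>n. F (\<psi> (X (r n))) + \<kappa>) \<longlonglongrightarrow> F (\<psi> l) + \<kappa>"
    by (intro tendsto_add tendsto_const F_curve_tendsto[OF F \<psi> _ Xl lT] XT)
  moreover have "F (\<psi> (X (r n))) + \<kappa> \<le> F (\<lambda>x. \<psi> l x + ?v n x)" for n
  proof -
    have "(\<lambda>x. \<psi> l x + ?v n x) = (\<lambda>x. \<psi> (X (r n)) x + s (r n) * (\<psi> (Y (r n)) x - \<psi> (X (r n)) x))"
      by (simp add: algebra_simps)
    then show ?thesis using gt[of "r n"] by (simp add: X_def Y_def)
  qed
  ultimately have "F (\<psi> l) + \<kappa> \<le> F (\<psi> l)" by (intro LIMSEQ_le[of "\<lambda>n. F (\<psi> (X (r n))) + \<kappa>" _ "\<lambda>n. F (\<lambda>x. \<psi> l x + ?v n x)"]) auto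
  with \<kappa> show False by simp
qed

text \<open>A uniform mesh makes the cost independent of n: each squared increment is at most
  \<tau>/n times the integral of the squared speed over its cell, and this factor cancels the n in
  the chain cost.\<close>

lemma curve_competitor:
  fixes \<psi> :: "real \<Rightarrow> 'a::euclidean_space \<Rightarrow> real"
  assumes sc: "sphere_curve T \<psi> d\<psi>" and \<psi>: "H1_continuous_curve T \<psi>" and F: "H1_cont F"
    and \<tau>: "0 \<le> \<tau>" "\<tau> \<le> T" and \<kappa>: "\<kappa> > 0"
    and dec: "\<And>t. 0 \<le> t \<Longrightarrow> t \<le> \<tau> \<Longrightarrow> F (\<psi> t) \<le> F (\<psi> 0)"
    and K: "2 * \<alpha> + real DIM('a) - 2 > 0" and C: "C_SL \<ge> 0"
    and G: "\<And>u :: real \<Rightarrow> 'a \<Rightarrow> real. H1_prod u \<Longrightarrow>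
          G (polar_fun \<alpha> u) \<le> set_lebesgue_integral lborel {0..1} (\<lambda>r. F (u r) * r powr (2 * \<alpha> + real DIM('a) - 3))
            + C_SL * set_lebesgue_integral lborel {0..1} (\<lambda>r. sph_int (\<lambda>\<theta>. (rad_deriv u r \<theta>)\<^sup>2) * r powr (2 * \<alpha> + real DIM('a) - 1))"
  shows "\<exists>h. H1B h \<and> trace_eq h (\<psi> 0) \<and>
    G h \<le> (F (\<psi> 0) + \<kappa>) / (2 * \<alpha> + real DIM('a) - 2)
        - (F (\<psi> 0) + \<kappa> - F (\<psi> \<tau>)) * ((1/2) powr (2 * \<alpha> + real DIM('a) - 2) / (2 * \<alpha> + real DIM('a) - 2))
        + C_SL * (9 / 2 * \<tau> * (LBINT t. indicator {0..\<tau>} t * (L2S_norm (d\<psi> t))\<^sup>2))"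
proof -
  interpret sphere_curve T \<psi> d\<psi> by (rule sc)
  obtain n where n: "n > 0" and fine: "\<And>i s. i < n \<Longrightarrow> 0 \<le> s \<Longrightarrow> s \<le> 1 \<Longrightarrow>
    F (\<lambda>\<theta>. \<psi> (\<tau> * real i / real n) \<theta> + s * (\<psi> (\<tau> * real (Suc i) / real n) \<theta> - \<psi> (\<tau> * real i / real n) \<theta>)) \<le> F (\<psi> (\<tau> * real i / real n)) + \<kappa>"
    using fine_chain[OF F \<psi> \<tau> \<kappa>] by blast
  define y where "y i = \<tau> * real i / real n" for i
  define J where "J a b = (LBINT t. indicator {a..b} t * (L2S_norm (d\<psi> t))\<^sup>2)" for a b
  have y: "0 \<le> y i" "y i \<le> \<tau>" if "i \<le> n" for i
  proof -
    have "real i / real n \<le> 1" using that n by simp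
    then have "\<tau> * (real i / real n) \<le> \<tau> * 1" using \<tau>(1) by (rule mult_left_mono)
    then show "0 \<le> y i" "y i \<le> \<tau>" using \<tau>(1) by (simp_all add: y_def)
  qed
  have y0: "y 0 = 0" and yn: "y n = \<tau>" using n by (auto simp: y_def)
  have yS: "y (Suc i) - y i = \<tau> / real n" for i using n by (simp add: y_def field_simps)
  have ymono: "y i \<le> y (Suc i)" for i using yS[of i] \<tau> n by (smt (verit) divide_nonneg_nonneg of_nat_0_le_iff)
  have "\<exists>h. H1B h \<and> trace_eq h (\<psi> (y 0)) \<and>
    G h \<le> (F (\<psi> 0) + \<kappa>) / (2 * \<alpha> + real DIM('a) - 2)
        - (F (\<psi> 0) + \<kappa> - F (\<psi> (y n))) * ((1/2) powr (2 * \<alpha> + real DIM('a) - 2) / (2 * \<alpha> + real DIM('a) - 2))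
        + C_SL * (9 * real n / 2 * (\<Sum>i<n. (L2S_norm (\<lambda>x. \<psi> (y (Suc i)) x - \<psi> (y i) x))\<^sup>2))"
  proof (rule chain_competitor[where P="\<lambda>i. \<psi> (y i)" and M="F (\<psi> 0) + \<kappa>", OF _ n K C F _ G])
    show "H2S (\<psi> (y i))" if "i \<le> n" for i using y[OF that] \<tau> by (intro H2) auto
    show "F (\<lambda>\<theta>. \<psi> (y i) \<theta> + t * (\<psi> (y (Suc i)) \<theta> - \<psi> (y i) \<theta>)) \<le> F (\<psi> 0) + \<kappa>" if "i < n" "0 \<le> t" "t \<le> 1" for i t
      using fine[OF that] dec[of "y i"] y[of i] that unfolding y_def[symmetric] by linarith
  qed
  moreover have "9 * real n / 2 * (\<Sum>i<n. (L2S_norm (\<lambda>x. \<psi> (y (Suc i)) x - \<psi> (y i) x))\<^sup>2) \<le> 9 / 2 * \<tau> * J 0 \<tau>"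
  proof -
    have "(\<Sum>i<n. (L2S_norm (\<lambda>x. \<psi> (y (Suc i)) x - \<psi> (y i) x))\<^sup>2) \<le> (\<Sum>i<n. \<tau> / real n * J (y i) (y (Suc i)))"
    proof (rule sum_mono)
      fix i assume "i \<in> {..<n}"
      then show "(L2S_norm (\<lambda>x. \<psi> (y (Suc i)) x - \<psi> (y i) x))\<^sup>2 \<le> \<tau> / real n * J (y i) (y (Suc i))"
        using increment_le[of "y i" "y (Suc i)"] y[of i] y[of "Suc i"] ymono[of i] \<tau> by (simp add: yS J_def)
    qed
    also have "\<dots> = \<tau> / real n * (\<Sum>i<n. J (y i) (y (Suc i)))" by (simp add: sum_distrib_left)
    also have "(\<Sum>i<m. J (y i) (y (Suc i))) = J 0 (y m)" if "m \<le> n" for m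
      using that
    proof (induction m)
      case 0
      have "J 0 0 = J 0 0 + J 0 0" unfolding J_def by (rule integral_split_interval[OF dsq]) (use T in auto)
      then show ?case by (simp add: y0)
    next
      case (Suc m)
      have "J 0 (y (Suc m)) = J 0 (y m) + J (y m) (y (Suc m))"
        unfolding J_def by (rule integral_split_interval[OF dsq]) (use y[of m] y[of "Suc m"] ymono[of m] \<tau> Suc.prems in auto)
      then show ?case using Suc by simp
    qed
    from this[of n] have "(\<Sum>i<n. J (y i) (y (Suc i))) = J 0 \<tau>" by (simp add: yn)
    finally have "(\<Sum>i<n. (L2S_norm (\<lambda>x. \<psi> (y (Suc i)) x - \<psi> (y i) x))\<^sup>2) \<le> \<tau> / real n * J 0 \<tau>" .
    then have "9 * real n / 2 * (\<Sum>i<n. (L2S_norm (\<lambda>x. \<psi> (y (Suc i)) x - \<psi> (y i) x))\<^sup>2) \<le> 9 * real n / 2 * (\<tau> / real n * J 0 \<tau>)"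
      by (rule mult_left_mono) simp
    also have "\<dots> = 9 / 2 * \<tau> * J 0 \<tau>" using n by simp
    finally show ?thesis .
  qed
  then have "C_SL * (9 * real n / 2 * (\<Sum>i<n. (L2S_norm (\<lambda>x. \<psi> (y (Suc i)) x - \<psi> (y i) x))\<^sup>2)) \<le> C_SL * (9 / 2 * \<tau> * J 0 \<tau>)"
    using C by (rule mult_left_mono)
  ultimately show ?thesis unfolding y0 yn J_def by (meson add_left_mono order_trans)
qed

text \<open>The homogeneous extension is the competitor of a constant chain with one step.\<close>

lemma homogeneous_extension_H1B:
  fixes c :: "'a::euclidean_space \<Rightarrow> real"
  assumes "H2S c" "2 * \<alpha> + real DIM('a) - 2 > 0"
  shows "H1B (polar_fun \<alpha> (\<lambda>r. c))" and "trace_eq (polar_fun \<alpha> (\<lambda>r. c)) c"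
proof -
  have "chain_fun (\<lambda>_. c) 1 = (\<lambda>r. c)" using chain_fun_eq[of 1 "\<lambda>_. c"] assms(1) by (simp add: fun_eq_iff)
  then show "H1B (polar_fun \<alpha> (\<lambda>r. c))" and "trace_eq (polar_fun \<alpha> (\<lambda>r. c)) c"
    using chain_H1B[of 1 "\<lambda>_. c" \<alpha>] chain_trace[of 1 "\<lambda>_. c" \<alpha>] assms by auto
qed

subsection \<open>Energy decay\<close>

text \<open>The stopping time is short enough for the cost to be small against the energy drop, and
  long enough for the drop to be of order f(0)^(1+\<beta>+\<sigma>). Until then f stays above
  f(0)/2, which makes the dissipation bounded below and the squared speed linear in it.\<close>

lemma energy_decay_time:
  fixes f D v :: "real \<Rightarrow> real"
  assumes T: "T > 0" and par: "C_ED > 0" "C_LS > 0" "p \<ge> 2" "0 \<le> \<beta>" "0 < \<epsilon>1" "\<epsilon>1 \<le> T"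
    and fc: "continuous_on {0..T} f" and Di: "set_integrable lborel {0<..<T} D"
    and vi: "integrable lborel (\<lambda>t. indicator {0..T} t * (v t)\<^sup>2)" and v0: "\<And>t. 0 \<le> v t"
    and fD: "\<And>a b. 0 \<le> a \<Longrightarrow> a \<le> b \<Longrightarrow> b \<le> T \<Longrightarrow> f a - f b = (LBINT t. indicator {a..b} t * D t)"
    and ED: "AE t in lborel. t \<in> {0<..<T} \<longrightarrow> C_ED * min ((v t)\<^sup>2) (v t powr p) \<le> D t"
    and LS: "AE t in lborel. t \<in> {0<..<T} \<longrightarrow> C_LS * (max 0 (f t)) powr (1 + \<beta>) \<le> D t"
    and f0: "0 < f 0" "f 0 \<le> 1"
  defines "\<sigma> \<equiv> (1 + \<beta>) * (1 - 2 / p)"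
  obtains \<tau> where "0 \<le> \<tau>" "\<tau> \<le> T" "\<And>t. 0 \<le> t \<Longrightarrow> t \<le> \<tau> \<Longrightarrow> f t \<le> f 0"
    "min (1/2) (\<epsilon>1 * C_LS * 2 powr (- (1 + \<beta>))) * f 0 powr (1 + \<beta> + \<sigma>) \<le> f 0 - f \<tau>"
    "\<tau> * (LBINT t. indicator {0..\<tau>} t * (v t)\<^sup>2) \<le>
       \<epsilon>1 * (1 / C_ED + C_ED powr (- (2/p)) * (C_LS powr (2/p - 1) * 2 powr \<sigma>)) * (f 0 - f \<tau>)"
proof -
  have \<sigma>0: "0 \<le> \<sigma>" using par by (auto simp: \<sigma>_def)
  have D0: "AE t in lborel. t \<in> {0<..<T} \<longrightarrow> 0 \<le> D t"
    using LS
  proof eventually_elim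
    case (elim t)
    have "0 \<le> C_LS * (max 0 (f t)) powr (1 + \<beta>)" using par by simp
    with elim show ?case by (meson order_trans)
  qed
  have Ii: "integrable lborel (\<lambda>t. indicator {a..b} t * D t)" if "0 \<le> a" "b \<le> T" for a b
  proof (rule integrable_cong_AE_imp)
    have m: "(\<lambda>t. indicator {0<..<T} t * D t) \<in> borel_measurable lborel" and i: "integrable lborel (\<lambda>t. indicator {0<..<T} t * D t)"
      using Di by (auto simp: set_integrable_def)
    have i2: "integrable lborel (\<lambda>t. indicator {a..b} t * (indicator {0<..<T} t * D t))"
      using integrable_mult_indicator[OF _ i, of "{a..b}"] by simp
    show "integrable lborel (\<lambda>t. indicator {a..b} t * (indicator {0<..<T} t * D t))" by (rule i2)
    show "AE t in lborel. indicator {a..b} t * (indicator {0<..<T} t * D t) = indicator {a..b} t * D t"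
      using AE_lborel_singleton[of 0] AE_lborel_singleton[of T] by eventually_elim (use that in \<open>auto simp: indicator_def\<close>)
    have "(\<lambda>t. indicator {a..b} t * (indicator {0<..<T} t * D t) + indicator {0} t * (indicator {a..b} 0 * D 0) + indicator {T} t * (indicator {a..b} T * D T)) \<in> borel_measurable lborel"
      by (intro borel_measurable_add borel_measurable_integrable[OF i2]) auto
    moreover have "(\<lambda>t. indicator {a..b} t * (indicator {0<..<T} t * D t) + indicator {0} t * (indicator {a..b} 0 * D 0) + indicator {T} t * (indicator {a..b} T * D T)) = (\<lambda>t. indicator {a..b} t * D t)"
      using that T by (auto simp: indicator_def fun_eq_iff)
    ultimately show "(\<lambda>t. indicator {a..b} t * D t) \<in> borel_measurable lborel" by simp
  qed
  have dec: "f b \<le> f a" if "0 \<le> a" "a \<le> b" "b \<le> T" for a b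
  proof -
    have "0 \<le> (LBINT t. indicator {a..b} t * D t)"
    proof (rule integral_nonneg_AE)
      show "AE t in lborel. 0 \<le> indicator {a..b} t * D t"
        using D0 AE_lborel_singleton[of 0] AE_lborel_singleton[of T]
        by eventually_elim (use that in \<open>auto simp: indicator_def\<close>)
    qed
    then show ?thesis using fD[OF that] by linarith
  qed
  \<comment> \<open>The longest admissible time; its power of f(0) offsets the factor
    f(0)^(-\<sigma>) lost in the speed estimate.\<close>
  define \<delta> where "\<delta> = \<epsilon>1 * f 0 powr \<sigma>"
  have \<delta>: "0 \<le> \<delta>" "\<delta> \<le> T"
  proof -
    have "f 0 powr \<sigma> \<le> 1" using f0 \<sigma>0 by (intro powr_le1) auto
    then have "\<delta> \<le> \<epsilon>1 * 1" unfolding \<delta>_def using par by (intro mult_left_mono) auto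
    then show "\<delta> \<le> T" using par by simp
  qed (use par in \<open>simp add: \<delta>_def\<close>)
  \<comment> \<open>Stop at \<delta>, or earlier at a time of half energy supplied by the
    intermediate value theorem.\<close>
  obtain \<tau> where \<tau>: "0 \<le> \<tau>" "\<tau> \<le> \<delta>" "f 0 / 2 \<le> f \<tau>" "\<tau> = \<delta> \<or> f \<tau> = f 0 / 2"
  proof (cases "f 0 / 2 \<le> f \<delta>")
    case True
    then show ?thesis using \<delta> that by blast
  next
    case False
    have "\<exists>x\<ge>0. x \<le> \<delta> \<and> f x = f 0 / 2"
      using False f0 \<delta> by (intro IVT2') (auto intro: continuous_on_subset[OF fc])
    then show ?thesis using that by force
  qed
  have \<tau>T: "\<tau> \<le> T" using \<tau> \<delta> by simp
  define m where "m = C_LS * (f 0 / 2) powr (1 + \<beta>)"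
  have m0: "m > 0" using par f0 by (simp add: m_def)
  define B where "B = (1 / C_ED + C_ED powr (- (2/p)) * (C_LS powr (2/p - 1) * 2 powr \<sigma>))"
  have B0: "0 \<le> B" using par by (auto simp: B_def)
  have low: "AE t in lborel. t \<in> {0<..<\<tau>} \<longrightarrow> m \<le> D t"
    using LS
  proof eventually_elim
    case (elim t)
    show ?case
    proof
      assume t: "t \<in> {0<..<\<tau>}"
      have "f 0 / 2 \<le> f t" using dec[of t \<tau>] t \<tau> \<tau>T by auto
      then have "(f 0 / 2) powr (1 + \<beta>) \<le> (max 0 (f t)) powr (1 + \<beta>)" using f0 par by (intro powr_mono2) auto
      then have "m \<le> C_LS * (max 0 (f t)) powr (1 + \<beta>)" unfolding m_def using par by (intro mult_left_mono) auto
      also have "\<dots> \<le> D t" using elim t \<tau>T by simp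
      finally show "m \<le> D t" .
    qed
  qed
  have m_powr: "m powr (2/p - 1) = C_LS powr (2/p - 1) * 2 powr \<sigma> * f 0 powr (- \<sigma>)"
  proof -
    have "m powr (2/p - 1) = C_LS powr (2/p - 1) * (f 0 / 2) powr ((1 + \<beta>) * (2/p - 1))"
      using par f0 by (simp add: m_def powr_mult powr_powr)
    also have "(1 + \<beta>) * (2/p - 1) = - \<sigma>" by (simp add: \<sigma>_def algebra_simps)
    also have "(f 0 / 2) powr (- \<sigma>) = 2 powr \<sigma> * f 0 powr (- \<sigma>)"
      using powr_divide[of "f 0" 2 "- \<sigma>"] f0 by (simp only: powr_minus[of 2 \<sigma>] divide_inverse[of "f 0 powr (- \<sigma>)"] inverse_inverse_eq mult.commute)
    finally show ?thesis by (simp only: mult.assoc)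
  qed
  \<comment> \<open>(ED) only bounds \<open>v\<^sup>2\<close> by a power \<open>2/p \<le> 1\<close> of \<open>D\<close>; the lower bound \<open>m \<le> D\<close> makes this linear in \<open>D\<close>\<close>
  have speed: "(v t)\<^sup>2 \<le> B * f 0 powr (- \<sigma>) * D t" if mD: "m \<le> D t" and ed: "C_ED * min ((v t)\<^sup>2) (v t powr p) \<le> D t" for t
  proof -
    have Dp: "D t > 0" using mD m0 by linarith
    have one: "1 \<le> f 0 powr (- \<sigma>)"
    proof -
      have "f 0 powr 0 \<le> f 0 powr (- \<sigma>)" using f0 \<sigma>0 by (intro powr_mono') auto
      then show ?thesis using f0 by simp
    qed
    have a: "D t / C_ED \<le> 1 / C_ED * f 0 powr (- \<sigma>) * D t"
    proof -
      have "(D t / C_ED) * 1 \<le> (D t / C_ED) * f 0 powr (- \<sigma>)" using one Dp par by (intro mult_left_mono) auto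
      then show ?thesis by (simp add: mult_ac)
    qed
    have b: "(D t / C_ED) powr (2/p) \<le> C_ED powr (- (2/p)) * (C_LS powr (2/p - 1) * 2 powr \<sigma>) * f 0 powr (- \<sigma>) * D t"
    proof -
      have "D t powr (2/p) = D t powr (2/p - 1) * D t" using Dp powr_add[of "D t" "2/p - 1" 1] by simp
      also have "\<dots> \<le> m powr (2/p - 1) * D t"
        using mD m0 par Dp by (intro mult_right_mono powr_mono2') (auto simp: divide_le_eq)
      finally have "C_ED powr (- (2/p)) * D t powr (2/p) \<le> C_ED powr (- (2/p)) * (m powr (2/p - 1) * D t)"
        by (rule mult_left_mono) simp
      moreover have "(D t / C_ED) powr (2/p) = C_ED powr (- (2/p)) * D t powr (2/p)"
        using powr_divide[of "D t" C_ED "2/p"] powr_minus[of C_ED "2/p"] Dp par by (simp only: divide_inverse less_imp_le mult.commute)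
      ultimately show ?thesis by (simp add: m_powr mult_ac)
    qed
    \<comment> \<open>The two cases of the minimum in (ED); in the second, the power 2/p undoes the
      power p.\<close>
    have "(v t)\<^sup>2 \<le> D t / C_ED \<or> (v t)\<^sup>2 \<le> (D t / C_ED) powr (2/p)"
    proof (cases "(v t)\<^sup>2 \<le> v t powr p")
      case True
      then show ?thesis using ed par by (simp add: le_divide_eq mult.commute)
    next
      case False
      then have "v t powr p \<le> D t / C_ED" using ed par by (simp add: le_divide_eq mult.commute)
      then have "(v t powr p) powr (2/p) \<le> (D t / C_ED) powr (2/p)" using par by (intro powr_mono2) auto
      moreover have "(v t powr p) powr (2/p) = (v t)\<^sup>2" using par v0[of t] by (simp add: powr_powr)
      ultimately show ?thesis by simp
    qed
    moreover have "0 \<le> D t / C_ED" "0 \<le> (D t / C_ED) powr (2/p)" using Dp par by auto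
    moreover have "B * f 0 powr (- \<sigma>) * D t = 1 / C_ED * f 0 powr (- \<sigma>) * D t + C_ED powr (- (2/p)) * (C_LS powr (2/p - 1) * 2 powr \<sigma>) * f 0 powr (- \<sigma>) * D t"
      unfolding B_def by (simp only: distrib_right)
    ultimately show ?thesis using a b by linarith
  qed
  have int: "(LBINT t. indicator {0..\<tau>} t * (v t)\<^sup>2) \<le> B * f 0 powr (- \<sigma>) * (f 0 - f \<tau>)"
  proof -
    have "(LBINT t. indicator {0..\<tau>} t * (v t)\<^sup>2) \<le> (LBINT t. B * f 0 powr (- \<sigma>) * (indicator {0..\<tau>} t * D t))"
    proof (rule integral_mono_AE)
      show "integrable lborel (\<lambda>t. indicator {0..\<tau>} t * (v t)\<^sup>2)" by (rule integrable_subinterval[OF vi]) (use \<tau>T in auto)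
      show "integrable lborel (\<lambda>t. B * f 0 powr (- \<sigma>) * (indicator {0..\<tau>} t * D t))" by (intro integrable_mult_right Ii \<tau>T) simp
      show "AE t in lborel. indicator {0..\<tau>} t * (v t)\<^sup>2 \<le> B * f 0 powr (- \<sigma>) * (indicator {0..\<tau>} t * D t)"
        using low ED AE_lborel_singleton[of 0] AE_lborel_singleton[of \<tau>]
      proof eventually_elim
        case (elim t)
        then show ?case using speed[of t] \<tau>T by (cases "t \<in> {0..\<tau>}") auto
      qed
    qed
    then show ?thesis using fD[OF order_refl \<tau>(1) \<tau>T] by simp
  qed
  have A0: "0 \<le> f 0 - f \<tau>" using dec[OF order_refl \<tau>(1) \<tau>T] by simp
  have "\<tau> * (LBINT t. indicator {0..\<tau>} t * (v t)\<^sup>2) \<le> \<delta> * (B * f 0 powr (- \<sigma>) * (f 0 - f \<tau>))"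
    using int \<tau> \<delta> by (intro mult_mono) (auto intro!: integral_nonneg_AE)
  \<comment> \<open>The powers f(0)^\<sigma> and f(0)^(-\<sigma>) cancel.\<close>
  also have "\<dots> = \<epsilon>1 * B * (f 0 - f \<tau>)"
    using f0 by (simp add: \<delta>_def powr_minus field_simps)
  finally have cost: "\<tau> * (LBINT t. indicator {0..\<tau>} t * (v t)\<^sup>2) \<le> \<epsilon>1 * B * (f 0 - f \<tau>)" .
  have gain: "min (1/2) (\<epsilon>1 * C_LS * 2 powr (- (1 + \<beta>))) * f 0 powr (1 + \<beta> + \<sigma>) \<le> f 0 - f \<tau>"
    using \<tau>(4)
  proof
    assume "f \<tau> = f 0 / 2"
    \<comment> \<open>If the energy was halved, the drop is linear in f(0); since f(0) \<le> 1 and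
      the exponent is at least 1, it dominates the claimed power.\<close>
    have "f 0 powr (1 + \<beta> + \<sigma>) \<le> f 0 powr 1" using f0 \<sigma>0 par by (intro powr_mono') auto
    then have "min (1/2) (\<epsilon>1 * C_LS * 2 powr (- (1 + \<beta>))) * f 0 powr (1 + \<beta> + \<sigma>) \<le> 1/2 * f 0 powr 1"
      by (intro mult_mono) auto
    then show ?thesis using \<open>f \<tau> = f 0 / 2\<close> f0 by simp
  next
    assume "\<tau> = \<delta>"
    have ic: "integrable lborel (\<lambda>t. indicator {0..\<tau>} t * m)" by (intro integrable_mult_left integrable_real_indicator) (auto simp: emeasure_lborel_Icc_eq)
    have "(LBINT t. indicator {0..\<tau>} t * m) \<le> (LBINT t. indicator {0..\<tau>} t * D t)"
    proof (rule integral_mono_AE[OF ic Ii[OF order_refl \<tau>T]])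
      show "AE t in lborel. indicator {0..\<tau>} t * m \<le> indicator {0..\<tau>} t * D t"
        using low AE_lborel_singleton[of 0] AE_lborel_singleton[of \<tau>]
        by eventually_elim (auto simp: indicator_def)
    qed
    \<comment> \<open>If the time ran out, the drop is at least the length \<delta> times the lower
      bound of the dissipation.\<close>
    then have "\<delta> * m \<le> f 0 - f \<tau>" using fD[OF order_refl \<tau>(1) \<tau>T] \<tau>(1) \<open>\<tau> = \<delta>\<close> by simp
    moreover have "\<delta> * m = (\<epsilon>1 * C_LS * 2 powr (- (1 + \<beta>))) * f 0 powr (1 + \<beta> + \<sigma>)"
    proof -
      have "(f 0 / 2) powr (1 + \<beta>) = f 0 powr (1 + \<beta>) * 2 powr (- (1 + \<beta>))"
        using powr_divide[of "f 0" 2 "1 + \<beta>"] powr_minus[of 2 "1 + \<beta>"] f0 by (simp only: divide_inverse)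
      then show ?thesis by (simp only: \<delta>_def m_def powr_add[of "f 0" "1 + \<beta>" \<sigma>] mult_ac)
    qed
    moreover have "min (1/2) (\<epsilon>1 * C_LS * 2 powr (- (1 + \<beta>))) * f 0 powr (1 + \<beta> + \<sigma>) \<le> (\<epsilon>1 * C_LS * 2 powr (- (1 + \<beta>))) * f 0 powr (1 + \<beta> + \<sigma>)"
      by (intro mult_right_mono) auto
    ultimately show ?thesis by linarith
  qed
  show ?thesis
    by (rule that[OF \<tau>(1) \<tau>T dec[OF order_refl] gain cost[unfolded B_def]]) (use \<tau>T in auto)
qed

section \<open>Choice of the constants and assembly of the estimate\<close>

theorem theoremA1:
  fixes \<alpha> p \<beta> T C_SL C_LS C_ED :: real
  assumes dim: "DIM('a::euclidean_space) \<ge> 2"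
    and "\<alpha> > 0" and "p \<ge> 2" and "0 \<le> \<beta>" and "\<beta> < 1" and "T > 0"
    and "C_SL > 0" and "C_LS > 0" and "C_ED > 0"
    and "(1 + \<beta>) * (1 - 1 / p) < 1"
  shows "\<exists>(\<delta>0::real) (E::real) (\<gamma>::real) (\<epsilon>::real). \<delta>0 > 0 \<and> E > 0 \<and> \<epsilon> > 0 \<and> 0 \<le> \<gamma> \<and> \<gamma> < 1 \<and>
     \<gamma> = (1 + \<beta>) * (2 - 2 / p) - 1 \<and>
     (\<forall>(G :: ('a \<Rightarrow> real) \<Rightarrow> real) (F :: ('a \<Rightarrow> real) \<Rightarrow> real) gradF S FS \<psi> d\<psi>.
       \<comment> \<open>(1) differentiability of F\<close>
       (\<forall>u. H2S u \<longrightarrow> L2S (gradF u) \<and>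
          (\<forall>e>0. \<exists>\<delta>>0. \<forall>v. H1S v \<longrightarrow> H1S_norm v < \<delta> \<longrightarrow>
             \<bar>F (\<lambda>x. u x + v x) - F u - sph_inner v (gradF u)\<bar> \<le> e * H1S_norm v)) \<longrightarrow>
       \<comment> \<open>(2) slicing\<close>
       (\<forall>u. H1_prod u \<longrightarrow>
          G (polar_fun \<alpha> u) \<le>
            set_lebesgue_integral lborel {0..1}
              (\<lambda>r. F (u r) * r powr (2 * \<alpha> + real DIM('a) - 3))
            + C_SL * set_lebesgue_integral lborel {0..1}
              (\<lambda>r. sph_int (\<lambda>\<theta>. (rad_deriv u r \<theta>)\<^sup>2) * r powr (2 * \<alpha> + real DIM('a) - 1))) \<longrightarrow>
       (\<forall>c. H1S c \<longrightarrow> G (polar_fun \<alpha> (\<lambda>r. c)) = F c / (2 * \<alpha> + real DIM('a) - 2)) \<longrightarrow>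
       \<comment> \<open>(3) the compact critical set S\<close>
       H2S_compact S \<longrightarrow> S \<noteq> {} \<longrightarrow>
       (\<forall>Q\<in>S. L2S_norm (gradF Q) = 0 \<and> F Q = FS) \<longrightarrow>
       \<comment> \<open>the curve psi and its time derivative d psi\<close>
       (\<forall>t\<in>{0..T}. H2S (\<psi> t)) \<longrightarrow>
       (\<forall>t\<in>{0..T}. ((\<lambda>s. L2S_norm (\<lambda>x. \<psi> s x - \<psi> t x)) \<longlongrightarrow> 0) (at t within {0..T})) \<longrightarrow>
       ((L2T T H2S_norm \<psi> \<and> L2T T L2S_norm \<psi> \<and> (\<forall>t\<in>{0..T}. L2S (d\<psi> t)) \<and>
           L2T T L2S_norm d\<psi> \<and> time_deriv T \<psi> d\<psi>)
        \<or> (L2T T H1S_norm \<psi> \<and> (\<forall>t\<in>{0..T}. H1S (d\<psi> t)) \<and>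
           L2T T H1S_norm d\<psi> \<and> time_deriv T \<psi> d\<psi>)) \<longrightarrow>
       scalar_weak_deriv T (\<lambda>t. F (\<psi> t)) (\<lambda>t. sph_inner (d\<psi> t) (gradF (\<psi> t))) \<longrightarrow>
       set_integrable lborel {0<..<T} (\<lambda>t. sph_inner (d\<psi> t) (gradF (\<psi> t))) \<longrightarrow>
       \<comment> \<open>(ED)\<close>
       (AE t in lborel. t \<in> {0<..<T} \<longrightarrow>
          C_ED * min ((L2S_norm (d\<psi> t))\<^sup>2) (L2S_norm (d\<psi> t) powr p)
            \<le> - sph_inner (d\<psi> t) (gradF (\<psi> t))) \<longrightarrow>
       \<comment> \<open>(LS)\<close>
       (AE t in lborel. t \<in> {0<..<T} \<longrightarrow>
          C_LS * (max 0 (F (\<psi> t) - FS)) powr (1 + \<beta>)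
            \<le> - sph_inner (d\<psi> t) (gradF (\<psi> t))) \<longrightarrow>
       (\<forall>c. H1S c \<longrightarrow> c = \<psi> 0 \<longrightarrow> F c - FS \<le> E \<longrightarrow>
          (\<exists>h. H1B h \<and> trace_eq h c \<and>
             (let z = polar_fun \<alpha> (\<lambda>r. c); GS = FS / (2 * \<alpha> + real DIM('a) - 2) in
              G h - GS \<le> (1 - \<epsilon> * \<bar>G z - GS\<bar> powr \<gamma>) * (G z - GS)))))"
proof -
  define K where "K = 2 * \<alpha> + real DIM('a) - 2"
  define \<sigma> where "\<sigma> = (1 + \<beta>) * (1 - 2 / p)"
  define \<gamma> where "\<gamma> = (1 + \<beta>) * (2 - 2 / p) - 1"
  define B where "B = 1 / C_ED + C_ED powr (- (2/p)) * (C_LS powr (2/p - 1) * 2 powr \<sigma>)"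
  \<comment> \<open>The integral of r^(K-1) over [0,1/2]: the weight with which the energy drop
    enters the gain.\<close>
  define w where "w = (1/2) powr K / K"
  \<comment> \<open>Chosen so that the cost (9/2) C_SL \<epsilon>1 B A is at most half of the gain w
    A, where A is the energy drop; the other entry keeps the stopping time in [0,T].\<close>
  define \<epsilon>1 where "\<epsilon>1 = min T (w / (9 * C_SL * B))"
  define c2 where "c2 = min (1/2) (\<epsilon>1 * C_LS * 2 powr (- (1 + \<beta>)))"
  \<comment> \<open>A quarter of the gain survives, and f(0) equals K times the excess of the
    homogeneous extension, whence the power of K.\<close>
  define \<epsilon> where "\<epsilon> = w * c2 * K powr (1 + \<gamma>) / 4"
  have K: "K > 0" using dim \<open>\<alpha> > 0\<close> by (simp add: K_def)
  have B: "B > 0" unfolding B_def using \<open>C_ED > 0\<close> by (intro add_pos_nonneg) auto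
  have w: "w > 0" using K by (simp add: w_def)
  have \<epsilon>1: "0 < \<epsilon>1" "\<epsilon>1 \<le> T" using \<open>T > 0\<close> w B \<open>C_SL > 0\<close> by (auto simp: \<epsilon>1_def)
  have c2: "c2 > 0" using \<epsilon>1 \<open>C_LS > 0\<close> by (simp add: c2_def)
  have \<epsilon>: "\<epsilon> > 0" using w c2 K by (simp add: \<epsilon>_def)
  have p1: "0 \<le> 1 - 2 / p" "0 \<le> 1 / p" using \<open>p \<ge> 2\<close> by auto
  have \<gamma>0: "0 \<le> \<gamma>"
  proof -
    have "1 * 1 \<le> (1 + \<beta>) * (2 - 2 / p)" using \<open>0 \<le> \<beta>\<close> p1 by (intro mult_mono) auto
    then show ?thesis by (simp add: \<gamma>_def)
  qed
  have \<gamma>1: "\<gamma> < 1"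
  proof -
    \<comment> \<open>Shows that \<gamma> < 1 is the assumption on \<beta> and p in another
      form.\<close>
    have "\<gamma> = 2 * ((1 + \<beta>) * (1 - 1 / p)) - 1" by (simp add: \<gamma>_def right_diff_distrib)
    then show ?thesis using \<open>(1 + \<beta>) * (1 - 1 / p) < 1\<close> by linarith
  qed
  have \<gamma>\<sigma>: "1 + \<gamma> = 1 + \<beta> + \<sigma>" by (simp add: \<gamma>_def \<sigma>_def algebra_simps)
  have main: "\<exists>h. H1B h \<and> trace_eq h c \<and>
             (let z = polar_fun \<alpha> (\<lambda>r. c); GS = FS / (2 * \<alpha> + real DIM('a) - 2) in
              G h - GS \<le> (1 - \<epsilon> * \<bar>G z - GS\<bar> powr \<gamma>) * (G z - GS))"
    if F: "\<forall>u. H2S u \<longrightarrow> L2S (gradF u) \<and>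
          (\<forall>e>0. \<exists>\<delta>>0. \<forall>v. H1S v \<longrightarrow> H1S_norm v < \<delta> \<longrightarrow>
             \<bar>F (\<lambda>x. u x + v x) - F u - sph_inner v (gradF u)\<bar> \<le> e * H1S_norm v)"
    and G: "\<forall>u. H1_prod u \<longrightarrow>
          G (polar_fun \<alpha> u) \<le>
            set_lebesgue_integral lborel {0..1}
              (\<lambda>r. F (u r) * r powr (2 * \<alpha> + real DIM('a) - 3))
            + C_SL * set_lebesgue_integral lborel {0..1}
              (\<lambda>r. sph_int (\<lambda>\<theta>. (rad_deriv u r \<theta>)\<^sup>2) * r powr (2 * \<alpha> + real DIM('a) - 1))"
    and Gz: "\<forall>c. H1S c \<longrightarrow> G (polar_fun \<alpha> (\<lambda>r. c)) = F c / (2 * \<alpha> + real DIM('a) - 2)"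
    and H2: "\<forall>t\<in>{0..T}. H2S (\<psi> t)"
    and cont: "\<forall>t\<in>{0..T}. ((\<lambda>s. L2S_norm (\<lambda>x. \<psi> s x - \<psi> t x)) \<longlongrightarrow> 0) (at t within {0..T})"
    and reg: "(L2T T H2S_norm \<psi> \<and> L2T T L2S_norm \<psi> \<and> (\<forall>t\<in>{0..T}. L2S (d\<psi> t)) \<and>
           L2T T L2S_norm d\<psi> \<and> time_deriv T \<psi> d\<psi>)
        \<or> (L2T T H1S_norm \<psi> \<and> (\<forall>t\<in>{0..T}. H1S (d\<psi> t)) \<and>
           L2T T H1S_norm d\<psi> \<and> time_deriv T \<psi> d\<psi>)"
    and wd: "scalar_weak_deriv T (\<lambda>t. F (\<psi> t)) (\<lambda>t. sph_inner (d\<psi> t) (gradF (\<psi> t)))"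
    and wi: "set_integrable lborel {0<..<T} (\<lambda>t. sph_inner (d\<psi> t) (gradF (\<psi> t)))"
    and ED: "AE t in lborel. t \<in> {0<..<T} \<longrightarrow>
          C_ED * min ((L2S_norm (d\<psi> t))\<^sup>2) (L2S_norm (d\<psi> t) powr p)
            \<le> - sph_inner (d\<psi> t) (gradF (\<psi> t))"
    and LS: "AE t in lborel. t \<in> {0<..<T} \<longrightarrow>
          C_LS * (max 0 (F (\<psi> t) - FS)) powr (1 + \<beta>)
            \<le> - sph_inner (d\<psi> t) (gradF (\<psi> t))"
    and c: "c = \<psi> 0" and E: "F c - FS \<le> 1"
    for G F :: "('a \<Rightarrow> real) \<Rightarrow> real" and gradF FS \<psi> d\<psi> c
  proof -
    note sc = sphere_curve_H1_continuous[OF \<open>T > 0\<close> H2 cont reg]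
    interpret sphere_curve T \<psi> d\<psi> by (rule sc(1))
    have curve: "H1_continuous_curve T \<psi>" using H2 sc(2) by (auto simp: H1_continuous_curve_def)
    have F1: "H1_cont F" by (rule H1_cont_if_differentiable[of gradF]) (use F in blast)
    have cH2: "H2S c" using H2 \<open>T > 0\<close> by (simp add: c)
    have Gc: "G (polar_fun \<alpha> (\<lambda>r. c)) = F c / K" using Gz H2S_H1S[OF cH2] by (simp add: K_def)
    have "\<exists>h. H1B h \<and> trace_eq h c \<and> G h - FS / K \<le> (1 - \<epsilon> * \<bar>F c / K - FS / K\<bar> powr \<gamma>) * (F c / K - FS / K)"
    proof (cases "F c \<le> FS")
      case True
      \<comment> \<open>At or below the critical level the homogeneous extension itself serves: its
        excess is nonpositive, so the correction factor can only increase the right-hand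
        side.\<close>
      have "F c / K - FS / K \<le> 0" using True K by (simp add: divide_right_mono)
      moreover have "0 \<le> \<epsilon> * \<bar>F c / K - FS / K\<bar> powr \<gamma>" using \<epsilon> by simp
      ultimately have "F c / K - FS / K \<le> (1 - \<epsilon> * \<bar>F c / K - FS / K\<bar> powr \<gamma>) * (F c / K - FS / K)"
        by (simp add: left_diff_distrib mult_nonneg_nonpos)
      then show ?thesis
        using homogeneous_extension_H1B[OF cH2, of \<alpha>] K Gc by (intro exI[of _ "polar_fun \<alpha> (\<lambda>r. c)"]) (simp add: K_def)
    next
      case False
      define f where "f t = F (\<psi> t) - FS" for t
      define D where "D t = - sph_inner (d\<psi> t) (gradF (\<psi> t))" for t
      have f0: "0 < f 0" "f 0 \<le> 1" using False E by (auto simp: f_def c)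
      have FTC: "f a - f b = (LBINT t. indicator {a..b} t * D t)" if ab: "0 \<le> a" "a \<le> b" "b \<le> T" for a b
      proof -
        have "F (\<psi> b) - F (\<psi> a) = (LBINT t. indicator {a..b} t * sph_inner (d\<psi> t) (gradF (\<psi> t)))"
          by (rule weak_FTC[OF F_curve_continuous[OF F1 curve] wi _ ab]) (use wd in \<open>auto simp: scalar_weak_deriv_def\<close>)
        then show ?thesis by (simp add: f_def D_def)
      qed
      obtain \<tau> where \<tau>: "0 \<le> \<tau>" "\<tau> \<le> T" "\<And>t. 0 \<le> t \<Longrightarrow> t \<le> \<tau> \<Longrightarrow> f t \<le> f 0"
        and gain: "c2 * f 0 powr (1 + \<gamma>) \<le> f 0 - f \<tau>"
        and cost: "\<tau> * (LBINT t. indicator {0..\<tau>} t * (L2S_norm (d\<psi> t))\<^sup>2) \<le> \<epsilon>1 * B * (f 0 - f \<tau>)"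
        unfolding c2_def B_def \<gamma>\<sigma> \<sigma>_def
      proof (rule energy_decay_time[of T C_ED C_LS p \<beta> \<epsilon>1 f D "\<lambda>t. L2S_norm (d\<psi> t)"])
        show "continuous_on {0..T} f" unfolding f_def by (intro continuous_intros F_curve_continuous[OF F1 curve])
        show "set_integrable lborel {0<..<T} D" using wi by (simp add: D_def set_integrable_def)
        show "AE t in lborel. t \<in> {0<..<T} \<longrightarrow> C_ED * min ((L2S_norm (d\<psi> t))\<^sup>2) (L2S_norm (d\<psi> t) powr p) \<le> D t"
          using ED by (simp add: D_def)
        show "AE t in lborel. t \<in> {0<..<T} \<longrightarrow> C_LS * (max 0 (f t)) powr (1 + \<beta>) \<le> D t"
          using LS by (simp add: D_def f_def)
      qed ((assumption | rule assms \<epsilon>1 f0 dsq FTC L2S_norm_nonneg)+, blast)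
      define A where "A = f 0 - f \<tau>"
      have A: "A > 0"
      proof -
        have "0 < c2 * f 0 powr (1 + \<gamma>)" using c2 f0 by simp
        then show ?thesis using gain by (simp add: A_def)
      qed
      \<comment> \<open>The slack for the mesh: divided by K it amounts to a quarter of the
        gain.\<close>
      define \<kappa> where "\<kappa> = K * w * A / 4"
      have \<kappa>: "\<kappa> > 0" using K w A by (simp add: \<kappa>_def)
      obtain h where h: "H1B h" "trace_eq h c"
        and Gh: "G h \<le> (F c + \<kappa>) / K - (F c + \<kappa> - F (\<psi> \<tau>)) * w + C_SL * (9 / 2 * \<tau> * (LBINT t. indicator {0..\<tau>} t * (L2S_norm (d\<psi> t))\<^sup>2))"
      proof -
        have "F (\<psi> t) \<le> F (\<psi> 0)" if "0 \<le> t" "t \<le> \<tau>" for t using \<tau>(3)[OF that] by (simp add: f_def)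
        from curve_competitor[where \<alpha>=\<alpha> and C_SL=C_SL and G=G, OF sc(1) curve F1 \<tau>(1,2) \<kappa> this K[unfolded K_def] less_imp_le[OF \<open>C_SL > 0\<close>]] G
        show ?thesis using that unfolding c w_def K_def by blast
      qed
      have "C_SL * (9 / 2 * \<tau> * (LBINT t. indicator {0..\<tau>} t * (L2S_norm (d\<psi> t))\<^sup>2)) \<le> w * A / 2"
      proof -
        have "C_SL * (9 / 2 * \<tau> * (LBINT t. indicator {0..\<tau>} t * (L2S_norm (d\<psi> t))\<^sup>2)) \<le> 9 / 2 * C_SL * (\<epsilon>1 * B * A)"
          using mult_left_mono[OF cost, of "9 / 2 * C_SL"] \<open>C_SL > 0\<close> by (simp add: A_def mult_ac)
        also have "\<dots> \<le> 9 / 2 * C_SL * (w / (9 * C_SL * B) * B * A)"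
          using \<open>C_SL > 0\<close> B A by (intro mult_left_mono mult_right_mono) (auto simp: \<epsilon>1_def)
        also have "\<dots> = w * A / 2" using \<open>C_SL > 0\<close> B by simp
        finally show ?thesis .
      qed
      moreover have "(F c + \<kappa> - F (\<psi> \<tau>)) * w = w * A + \<kappa> * w" by (simp add: A_def f_def c algebra_simps)
      moreover have "0 \<le> \<kappa> * w" using \<kappa> w by simp
      moreover have "(F c + \<kappa>) / K = F c / K + w * A / 4" using K by (simp add: \<kappa>_def add_divide_distrib)
      \<comment> \<open>Of the gain w A, half pays for the cost and a quarter for the mesh
        slack.\<close>
      ultimately have up: "G h \<le> F c / K - w * A / 4" using Gh by linarith
      have "\<epsilon> * (f 0 / K) powr \<gamma> * (f 0 / K) = \<epsilon> * (f 0 / K) powr (1 + \<gamma>)"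
        using f0 K by (simp add: powr_add)
      also have "\<dots> = w / 4 * (c2 * f 0 powr (1 + \<gamma>))" using f0 K by (simp add: \<epsilon>_def powr_divide)
      also have "\<dots> \<le> w / 4 * A" using gain w by (intro mult_left_mono) (auto simp: A_def)
      finally have "\<epsilon> * (f 0 / K) powr \<gamma> * (f 0 / K) \<le> w * A / 4" by simp
      moreover have e: "F c / K - FS / K = f 0 / K" by (simp add: f_def c diff_divide_distrib)
      moreover have "\<bar>f 0 / K\<bar> = f 0 / K" using f0 K by simp
      then have "(1 - \<epsilon> * \<bar>f 0 / K\<bar> powr \<gamma>) * (f 0 / K) = f 0 / K - \<epsilon> * (f 0 / K) powr \<gamma> * (f 0 / K)"
        by (simp only: left_diff_distrib mult_1)
      ultimately have "G h - FS / K \<le> (1 - \<epsilon> * \<bar>f 0 / K\<bar> powr \<gamma>) * (f 0 / K)" using up by linarith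
      then have "G h - FS / K \<le> (1 - \<epsilon> * \<bar>F c / K - FS / K\<bar> powr \<gamma>) * (F c / K - FS / K)" by (simp only: e)
      with h show ?thesis by blast
    qed
    then show ?thesis unfolding Let_def Gc by (simp add: K_def)
  qed
  show ?thesis
    \<comment> \<open>The first two witnesses are \<delta>0 = E = 1; the bound E = 1 supplies f(0)
      \<le> 1, on which the comparison of powers rests.\<close>
    by (rule exI[of _ 1], rule exI[of _ 1], rule exI[of _ \<gamma>], rule exI[of _ \<epsilon>],
        intro conjI allI impI zero_less_one \<epsilon> \<gamma>0 \<gamma>1 \<gamma>_def, rule main, assumption+)
qed

end
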